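(* Let $O_1,\dots,O_n$ be i.i.d. copies of $O=(A,X,M,Y)$, and let $\psi_0(a,a')$, $\alpha,\lambda,\gamma,\eta$, $K_h$, $m(O;\alpha,\lambda,\gamma,\psi(a,a'))$, and the cross-fitted estimator $\hat\psi^{MR}(a,a')$ with fold-specific nuisance estimators $\hat\alpha=\hat\alpha_\ell$, $\hat\lambda=\hat\lambda_\ell$, $\hat\gamma=\hat\gamma_\ell$ ($\ell=1,\dots,L$) be as defined in the context. Assume the following. (1) Identification. - Consistency: for all $a\in\mathcal A$, $m\in\mathcal M$: $Y^{(a,m)}=Y$ if $A=a$ and $M=m$; and $M^{(a)}=M$ if $A=a$. - Sequential exchangeability: for all $a,a'\in\mathcal A$, $m\in\mathcal M$: $Y^{(a,m)}\perp\{A,M\}\mid X$; $M^{(a)}\perp A\mid X$; $Y^{(a,m)}\perp M^{(a')}\mid X$. - Positivity: for all $a\in\mathcal A,m\in\mathcal M,x\in\mathcal X$: $f_{M|A,X}(m|a,x)>0$ and $f_{A|X}(a|x)>0$. (2) Kernel and bandwidth. $\int k(u)\,du=1$; $\int u\,k(u)\,du=0$; $0<\int u^6k(u)\,du<\infty$; $\int k^2(u)\,du<\infty$; $0<\int u^2k^2(u)\,du<\infty$. The bandwidth $h$ is a function of $n$ with $h\to0$, $nh^{d_A}\to\infty$ and $nh^{d_A+4}\to C_h$ for a constant $C_h$, as $n\to\infty$. (3) Regularity. - For all $Y,M,X$, the functions $f(a\mid Y,M,X)$, $f(a\mid M,X)$, $f(a\mid X)$, $\gamma(X,M,a)$, as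 functions of $a$, are three times continuously differentiable with respect to each dimension of $a$, and these functions and their first, second and third derivatives with respect to $a$ are bounded in each dimension. - $\alpha,\lambda,\gamma$ and $\hat\alpha,\hat\lambda,\hat\gamma$ are bounded, and $\alpha,\lambda,\hat\alpha,\hat\lambda$ are bounded away from zero. - $\mathrm{var}(Y\mid A=a,M=m,X=x)$ and its first and second derivatives with respect to each dimension of $a$ are bounded for any $a\in\mathcal A,m\in\mathcal M,x\in\mathcal X$. (4) Convergence of nuisance estimators. For any $a\in\mathcal A$, as $n\to\infty$, $\int(\hat\lambda(a,x)-\lambda(a,x))^2f_X(x)\,dx\xrightarrow{P}0$, $\int(\hat\alpha(a,m,x)-\alpha(a,m,x))^2f_{M,X}(m,x)\,dm\,dx\xrightarrow{P}0$, and $\int(\hat\gamma(x,m,a)-\gamma(x,m,a))^2f_{M,X}(m,x)\,dm\,dx\xrightarrow{P}0$. (5) Product rates. For any $a,a'\in\mathcal A$, as $n\to\infty$, $$\sqrt{nh^{d_A}}\Big(\int(\hat\alpha(a',m,x)-\alpha(a',m,x))^2f_{M,X}(m,x)\,dm\,dx\Big)^{1/2}\Big(\int(\hat\gamma(x,m,a)-\gamma(x,m,a))^2f_{M,X}(m,x)\,dm\,dx\Big)^{1/2}\xrightarrow{P}0,$$ $$\sqrt{nh^{d_A}}\Big(\int(\hat\lambda(a',x)-\lambda(a',x))^2f_X(x)\,dx\Big)^{1/2}\Big(\int(\hat\gamma(x,m,a)-\gamma(x,m,a))^2f_{M,X}(m,x)\,dm\,dx\Big)^{1/2}\xrightarrow{P}0,$$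 $$\sqrt{nh^{d_A}}\Big(\int(\hat\lambda(a',x)-\lambda(a',x))^2f_X(x)\,dx\Big)^{1/2}\Big(\int(\hat\alpha(a,m,x)-\alpha(a,m,x))^2f_{M,X}(m,x)\,dm\,dx\Big)^{1/2}\xrightarrow{P}0.$$ Then, for any $a,a'\in\mathcal A$, $$\sqrt{nh^{d_A}}\big(\hat\psi^{MR}(a,a')-\psi_0(a,a')\big)=\sqrt{\frac{h^{d_A}}{n}}\sum_{i=1}^n m(O_i;\alpha,\lambda,\gamma,\psi_0(a,a'))+o_p(1).$$ If additionally (6) $\mathbb E\big[|Y-\gamma(X,M,a)|^3\mid A=a',M=m,X=x\big]$ is bounded for any $(a,a',m,x)\in\mathcal A\times\mathcal A\times\mathcal M\times\mathcal X$, and $\int_{-\infty}^{\infty}k(u)^{c_1}k(u+\tilde c)^{c_2}\,du<\infty$ and $\int_{-\infty}^{\infty}u^2k(u)^{c_1}k(u+\tilde c)^{c_2}\,du<\infty$ for $\tilde c\in\mathbb R$ and $c_1,c_2\in\{0,1,2,3\}$ with $c_1+c_2\in\{2,3\}$, then $\sqrt{nh^{d_A}}\big(\hat\psi^{MR}(a,a')-\psi_0(a,a')-h^2B(a,a')\big)$ converges in distribution to $\mathcal N(0,V(a,a'))$, where $$\begin{aligned}B(a,a')=\Big[\int u^2k(u)\,du\Big]\,\mathbb E\Big[&\frac{\alpha(a',M,X)\,\lambda(a,X)}{\alpha(a,M,X)}\Big\{\sum_{j=1}^{d_A}\partial_{a_j}\gamma(X,M,a)\,\partial_{a_j}f(a\mid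 X,M)+\frac12\Big(\sum_{j=1}^{d_A}\partial^2_{a_j}\gamma(X,M,a)\Big)f(a\mid X,M)\Big\}\\&+\{\gamma(X,M,a)-\eta(a,a',X)\}\,\frac12\,\lambda(a',X)\sum_{j=1}^{d_A}\partial^2_{a_j}f(a'\mid X,M)\Big]+O(h)\end{aligned}$$ and $$V(a,a')=\Big[\int k(u)^2\,du\Big]^{d_A}\mathbb E\Big\{\frac{\alpha^2(a',M,X)\,f(a\mid X,M)}{\alpha^2(a,M,X)}\lambda^2(a,X)\,\mathrm{var}(Y\mid X,M,A=a)+\lambda(a',X)\,\mathrm{var}\big[\gamma(X,M,a)\mid X,A=a'\big]\Big\}.$$
   Context: $A\in\mathcal A$ is a continuous treatment of dimension $d_A$ ($\mathcal A\subseteq\mathbb R^{d_A}$), $M\in\mathcal M$ a mediator, $X\in\mathcal X$ pre-treatment covariates, $Y\in\mathcal Y$ a (real) outcome. $Y^{(a,m)}$ is the potential outcome when the treatment is set to $a$ and the mediator to $m$; $M^{(a)}$ is the potential mediator when the treatment is set to $a$. The target is $\psi_0(a,a')=\mathbb E[Y^{(a,M^{(a')})}]$. $U\perp V\mid W$ denotes conditional independence. The symbols $f_X$, $f_{M,X}$, $f_{A|X}$, $f_{M|A,X}$, $f(a\mid X)$, $f(a\mid M,X)=f(a\mid X,M)$, $f(a\mid Y,M,X)$ denote the corresponding (conditional) densities; the last three are densities of $A$ evaluated at $a$. Nuisance functions: $\lambda(a,X)=1/f_{A|X}(a\mid X)$, $\alpha(a,M,X)=f_{M|A,X}(M\mid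 a,X)$, $\gamma(X,M,a)=\mathbb E[Y\mid A=a,M,X]$, and $\eta(a,a',X)=\int_{\mathcal M}\gamma(X,m,a)\,\alpha(a',m,X)\,dm$. $k(\cdot)$ is a univariate kernel function, $h>0$ a bandwidth, and $K_h(a)=h^{-d_A}\prod_{j=1}^{d_A}k(a_j/h)$. The moment function is $$m(O;\alpha,\lambda,\gamma,\psi(a,a'))=K_h(A-a)\lambda(a,X)\frac{\alpha(a',M,X)}{\alpha(a,M,X)}\{Y-\gamma(X,M,a)\}+K_h(A-a')\lambda(a',X)\{\gamma(X,M,a)-\eta(a,a',X)\}+\eta(a,a',X)-\psi(a,a'),$$ where, when estimators $\hat\alpha,\hat\lambda,\hat\gamma$ are plugged in, $\eta$ is replaced by $\hat\eta(a,a',X)=\int_{\mathcal M}\hat\gamma(X,m,a)\hat\alpha(a',m,X)\,dm$. Cross-fitting: the indices $\{1,\dots,n\}$ are partitioned into a fixed number $L$ of folds $I_1,\dots,I_L$ of roughly equal size. For each $\ell$, $\hat\alpha_\ell,\hat\lambda_\ell,\hat\gamma_\ell$ are estimators of $\alpha,\lambda,\gamma$ computed only from the data outside fold $\ell$. $\hat\psi_\ell(a,a')$ is the solution of $\frac1{|I_\ell|}\sum_{i\in I_\ell}m(O_i;\hat\alpha_\ell,\hat\lambda_\ell,\hat\gamma_\ell,\hat\psi_\ell(a,a'))=0$, and $\hat\psi^{MR}(a,a')=\frac1L\sum_{\ell=1}^L\hat\psi_\ell(a,a')$. Assumptions on $\hat\alpha,\hat\lambda,\hat\gamma$ are understood to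 hold for $\hat\alpha_\ell,\hat\lambda_\ell,\hat\gamma_\ell$ for every $\ell$. $o_p(1)$ denotes convergence to zero in probability; all limits are as $n\to\infty$. In $B(a,a')$, the term $O(h)$ denotes a deterministic remainder of order $h$ as $h\to0$; $\partial_{a_j}f(a\mid X,M)$, $\partial^2_{a_j}f(a'\mid X,M)$, etc. are partial derivatives in the $j$-th coordinate of the treatment argument, evaluated at the displayed treatment value.
   Formalization: The treatment range 𝒜 is taken to be open (at boundary points kernel smoothing loses mass and the stated variance is wrong), and conditional independence is read pointwise through regular conditional distributions. *)

theory Defs
  imports "HOL-Probability.Probability" "HOL-Library.Landau_Symbols"
begin

section \<open>Regular conditional distributions and conditional independence\<close>

text \<open>
  A continuous treatment forces conditioning on null events such as \<open>A = a, M = m, X = x\<close>.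
  Conditional laws are therefore given by regular conditional distributions \<open>\<kappa>\<close>, defined at
  every value \<open>z\<close> of the conditioning variable \<open>Z\<close> and concentrated on \<open>Z = z\<close>.
\<close>

definition reg_cond_dist ::
  "'w measure \<Rightarrow> 'c measure \<Rightarrow> ('w \<Rightarrow> 'c) \<Rightarrow> ('c \<Rightarrow> 'w measure) \<Rightarrow> bool" where
  "reg_cond_dist P C Z \<kappa> \<longleftrightarrow>
     Z \<in> measurable P C \<and> \<kappa> \<in> measurable C (prob_algebra P) \<and>
     (\<forall>z\<in>space C. AE \<omega> in \<kappa> z. Z \<omega> = z) \<and>
     distr P C Z \<bind> \<kappa> = P"

text \<open>
  \<open>U \<bottom> V | W\<close>: the law of \<open>U\<close> given \<open>(V, W) = (v, w)\<close> is the law of \<open>U\<close> given \<open>W = w\<close>.  The two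
  laws are compared at every \<open>(v, w)\<close> and not only almost everywhere: for a fixed \<open>(a, m)\<close> the
  event \<open>A = a, M = m\<close> is null, and an almost-everywhere statement about \<open>Y^(a,m)\<close> would carry
  no information about what happens on it.
\<close>

definition cond_indep ::
  "'w measure \<Rightarrow> 'u measure \<Rightarrow> ('w \<Rightarrow> 'u) \<Rightarrow> 'v measure \<Rightarrow> ('w \<Rightarrow> 'v) \<Rightarrow> 'c measure \<Rightarrow> ('w \<Rightarrow> 'c) \<Rightarrow>
   ('v \<times> 'c \<Rightarrow> 'w measure) \<Rightarrow> ('c \<Rightarrow> 'w measure) \<Rightarrow> bool" where
  "cond_indep P NU U NV V NW W \<kappa>VW \<kappa>W \<longleftrightarrow>
     U \<in> measurable P NU \<and>
     reg_cond_dist P (NV \<Otimes>\<^sub>M NW) (\<lambda>\<omega>. (V \<omega>, W \<omega>)) \<kappa>VW \<and>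
     reg_cond_dist P NW W \<kappa>W \<and>
     (\<forall>v\<in>space NV. \<forall>w\<in>space NW. distr (\<kappa>VW (v, w)) NU U = distr (\<kappa>W w) NU U)"

definition cond_density ::
  "'w measure \<Rightarrow> 'u measure \<Rightarrow> ('w \<Rightarrow> 'u) \<Rightarrow> 'c measure \<Rightarrow> ('w \<Rightarrow> 'c) \<Rightarrow> ('u \<Rightarrow> 'c \<Rightarrow> real) \<Rightarrow> bool" where
  "cond_density P NU U NZ Z f \<longleftrightarrow>
     (\<forall>u\<in>space NU. \<forall>z\<in>space NZ. 0 \<le> f u z) \<and>
     Z \<in> measurable P NZ \<and>
     distributed P (NU \<Otimes>\<^sub>M distr P NZ Z) (\<lambda>\<omega>. (U \<omega>, Z \<omega>)) (\<lambda>(u, z). ennreal (f u z))"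

definition var_of :: "'w measure \<Rightarrow> ('w \<Rightarrow> real) \<Rightarrow> real" where
  "var_of N Z = (LINT \<omega>|N. (Z \<omega> - (LINT \<omega>'|N. Z \<omega>'))\<^sup>2)"


section \<open>Modes of convergence\<close>

definition tendsto_prob :: "'s measure \<Rightarrow> (nat \<Rightarrow> 's \<Rightarrow> real) \<Rightarrow> real \<Rightarrow> bool" where
  "tendsto_prob S Z c \<longleftrightarrow>
     (\<forall>n. Z n \<in> borel_measurable S) \<and>
     (\<forall>\<epsilon>>0. (\<lambda>n. measure S {\<omega>\<in>space S. \<epsilon> < \<bar>Z n \<omega> - c\<bar>}) \<longlonglongrightarrow> 0)"

definition tendsto_dist :: "'s measure \<Rightarrow> (nat \<Rightarrow> 's \<Rightarrow> real) \<Rightarrow> real measure \<Rightarrow> bool" where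
  "tendsto_dist S Z N \<longleftrightarrow>
     (\<forall>n. Z n \<in> borel_measurable S) \<and> weak_conv_m (\<lambda>n. distr S borel (Z n)) N"

text \<open>The degenerate case \<open>v = 0\<close> has to be included: \<open>V\<close> vanishes for noiseless outcomes.\<close>

definition normal_law :: "real \<Rightarrow> real \<Rightarrow> real measure" where
  "normal_law \<mu> v =
     (if v = 0 then return borel \<mu> else density lborel (\<lambda>x. ennreal (normal_density \<mu> (sqrt v) x)))"


section \<open>Coordinatewise derivatives\<close>

definition partial :: "'d::finite \<Rightarrow> (real ^ 'd \<Rightarrow> real) \<Rightarrow> real ^ 'd \<Rightarrow> real" where
  "partial j g a = deriv (\<lambda>t. g (a + t *\<^sub>R axis j 1)) 0"

definition coord_differentiable :: "nat \<Rightarrow> (real ^ 'd::finite) set \<Rightarrow> (real ^ 'd \<Rightarrow> real) \<Rightarrow> bool" where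
  "coord_differentiable r S g \<longleftrightarrow>
     (\<forall>j. \<forall>i<r. \<forall>a\<in>S. (\<lambda>t. (partial j ^^ i) g (a + t *\<^sub>R axis j 1)) differentiable (at (0::real)))"

definition coord_continuously_differentiable ::
  "nat \<Rightarrow> (real ^ 'd::finite) set \<Rightarrow> (real ^ 'd \<Rightarrow> real) \<Rightarrow> bool" where
  "coord_continuously_differentiable r S g \<longleftrightarrow>
     coord_differentiable r S g \<and> (\<forall>j. \<forall>i\<le>r. continuous_on S ((partial j ^^ i) g))"

text \<open>The bound is uniform over the remaining arguments \<open>z \<in> Z\<close> (the values of \<open>Y, M, X\<close>).\<close>

definition bounded_partials ::
  "nat \<Rightarrow> (real ^ 'd::finite) set \<Rightarrow> 'z set \<Rightarrow> ('z \<Rightarrow> real ^ 'd \<Rightarrow> real) \<Rightarrow> bool" where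
  "bounded_partials r S Z F \<longleftrightarrow>
     (\<exists>C. \<forall>z\<in>Z. \<forall>j. \<forall>i\<le>r. \<forall>a\<in>S. \<bar>(partial j ^^ i) (F z) a\<bar> \<le> C)"


section \<open>The causal mediation model\<close>

text \<open>
  \<open>refM\<close> and \<open>refX\<close> are the reference measures \<open>dm\<close> and \<open>dx\<close>; their spaces are the ranges of the
  mediator and of the covariates.  \<open>dens\<close> is the joint density of \<open>(A, M, X)\<close>, and \<open>densA_YMX\<close> the
  conditional density \<open>f(a | y, m, x)\<close>.  \<open>givenX\<close>, \<open>givenAX\<close>, \<open>givenAMX\<close> are the regular conditional
  distributions given \<open>X\<close>, \<open>(A, X)\<close>, \<open>((A, M), X)\<close>, and \<open>givenPM a\<close> the one given \<open>(M^(a), X)\<close>.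
\<close>

record ('w, 'd, 'm, 'x) mediation =
  prb :: "'w measure"
  domA :: "(real ^ 'd::finite) set"
  domY :: "real set"
  refM :: "'m measure"
  refX :: "'x measure"
  trt :: "'w \<Rightarrow> real ^ 'd"
  cov :: "'w \<Rightarrow> 'x"
  med :: "'w \<Rightarrow> 'm"
  outc :: "'w \<Rightarrow> real"
  pot_outc :: "real ^ 'd \<Rightarrow> 'm \<Rightarrow> 'w \<Rightarrow> real"
  pot_med :: "real ^ 'd \<Rightarrow> 'w \<Rightarrow> 'm"
  dens :: "real ^ 'd \<Rightarrow> 'm \<Rightarrow> 'x \<Rightarrow> real"
  densA_YMX :: "real ^ 'd \<Rightarrow> real \<Rightarrow> 'm \<Rightarrow> 'x \<Rightarrow> real"
  givenX :: "'x \<Rightarrow> 'w measure"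
  givenAX :: "(real ^ 'd) \<times> 'x \<Rightarrow> 'w measure"
  givenAMX :: "((real ^ 'd) \<times> 'm) \<times> 'x \<Rightarrow> 'w measure"
  givenPM :: "real ^ 'd \<Rightarrow> 'm \<times> 'x \<Rightarrow> 'w measure"

definition refA :: "('w, 'd::finite, 'm, 'x) mediation \<Rightarrow> (real ^ 'd) measure" where
  "refA D = restrict_space lborel (domA D)"

definition domM :: "('w, 'd::finite, 'm, 'x) mediation \<Rightarrow> 'm set" where
  "domM D = space (refM D)"

definition domX :: "('w, 'd::finite, 'm, 'x) mediation \<Rightarrow> 'x set" where
  "domX D = space (refX D)"

text \<open>
  Marginal and conditional densities are all obtained from the one joint density, so that Bayes'
  rule holds at every point, as is implicit in evaluating densities at a fixed treatment value.
\<close>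

definition densAX :: "('w, 'd::finite, 'm, 'x) mediation \<Rightarrow> real ^ 'd \<Rightarrow> 'x \<Rightarrow> real" where
  "densAX D a x = (LINT m|refM D. dens D a m x)"

definition densMX :: "('w, 'd::finite, 'm, 'x) mediation \<Rightarrow> 'm \<Rightarrow> 'x \<Rightarrow> real" where
  "densMX D m x = (LINT a|refA D. dens D a m x)"

definition densX :: "('w, 'd::finite, 'm, 'x) mediation \<Rightarrow> 'x \<Rightarrow> real" where
  "densX D x = (LINT a|refA D. densAX D a x)"

definition densA_X :: "('w, 'd::finite, 'm, 'x) mediation \<Rightarrow> real ^ 'd \<Rightarrow> 'x \<Rightarrow> real" where
  "densA_X D a x = densAX D a x / densX D x"

definition densM_AX :: "('w, 'd::finite, 'm, 'x) mediation \<Rightarrow> 'm \<Rightarrow> real ^ 'd \<Rightarrow> 'x \<Rightarrow> real" where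
  "densM_AX D m a x = dens D a m x / densAX D a x"

definition densA_MX :: "('w, 'd::finite, 'm, 'x) mediation \<Rightarrow> real ^ 'd \<Rightarrow> 'm \<Rightarrow> 'x \<Rightarrow> real" where
  "densA_MX D a m x = dens D a m x / densMX D m x"

definition lam :: "('w, 'd::finite, 'm, 'x) mediation \<Rightarrow> real ^ 'd \<Rightarrow> 'x \<Rightarrow> real" where
  "lam D a x = 1 / densA_X D a x"

definition alp :: "('w, 'd::finite, 'm, 'x) mediation \<Rightarrow> real ^ 'd \<Rightarrow> 'm \<Rightarrow> 'x \<Rightarrow> real" where
  "alp D a m x = densM_AX D m a x"

definition gam :: "('w, 'd::finite, 'm, 'x) mediation \<Rightarrow> 'x \<Rightarrow> 'm \<Rightarrow> real ^ 'd \<Rightarrow> real" where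
  "gam D x m a = (LINT \<omega>|givenAMX D ((a, m), x). outc D \<omega>)"

definition varY :: "('w, 'd::finite, 'm, 'x) mediation \<Rightarrow> 'x \<Rightarrow> 'm \<Rightarrow> real ^ 'd \<Rightarrow> real" where
  "varY D x m a = var_of (givenAMX D ((a, m), x)) (outc D)"

text \<open>The map from \<open>\<gamma>, \<alpha>\<close> to \<open>\<eta>\<close>, also used with estimated nuisance functions.\<close>

definition eta_of ::
  "'m measure \<Rightarrow> (real ^ 'd \<Rightarrow> 'm \<Rightarrow> 'x \<Rightarrow> real) \<Rightarrow> ('x \<Rightarrow> 'm \<Rightarrow> real ^ 'd \<Rightarrow> real) \<Rightarrow>
   real ^ 'd::finite \<Rightarrow> real ^ 'd \<Rightarrow> 'x \<Rightarrow> real" where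
  "eta_of \<mu> al ga a a' x = (LINT m|\<mu>. ga x m a * al a' m x)"

definition eta :: "('w, 'd::finite, 'm, 'x) mediation \<Rightarrow> real ^ 'd \<Rightarrow> real ^ 'd \<Rightarrow> 'x \<Rightarrow> real" where
  "eta D = eta_of (refM D) (alp D) (gam D)"

definition psi0 :: "('w, 'd::finite, 'm, 'x) mediation \<Rightarrow> real ^ 'd \<Rightarrow> real ^ 'd \<Rightarrow> real" where
  "psi0 D a a' = (LINT \<omega>|prb D. pot_outc D a (pot_med D a' \<omega>) \<omega>)"

definition obs_space ::
  "('w, 'd::finite, 'm, 'x) mediation \<Rightarrow> ((real ^ 'd) \<times> 'x \<times> 'm \<times> real) measure" where
  "obs_space D = refA D \<Otimes>\<^sub>M refX D \<Otimes>\<^sub>M refM D \<Otimes>\<^sub>M borel"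

text \<open>
  \<open>domA\<close> is open: derivatives in \<open>a\<close> are evaluated at every \<open>a \<in> domA\<close>, and kernel smoothing
  at a boundary point of the treatment range would lose mass.
\<close>

definition mediation_setup :: "('w, 'd::finite, 'm, 'x) mediation \<Rightarrow> bool" where
  "mediation_setup D \<longleftrightarrow>
     prob_space (prb D) \<and> open (domA D) \<and> domY D \<in> sets borel \<and>
     sigma_finite_measure (refM D) \<and> sigma_finite_measure (refX D) \<and>
     outc D \<in> measurable (prb D) (restrict_space borel (domY D)) \<and>
     (\<forall>a\<in>domA D. pot_med D a \<in> measurable (prb D) (refM D)) \<and>
     (\<forall>a\<in>domA D. (\<lambda>(m, \<omega>). pot_outc D a m \<omega>) \<in> borel_measurable (refM D \<Otimes>\<^sub>M prb D)) \<and>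
     (\<forall>a\<in>domA D. \<forall>m\<in>domM D. \<forall>x\<in>domX D. 0 \<le> dens D a m x) \<and>
     distributed (prb D) (refA D \<Otimes>\<^sub>M refM D \<Otimes>\<^sub>M refX D) (\<lambda>\<omega>. (trt D \<omega>, med D \<omega>, cov D \<omega>))
       (\<lambda>(a, m, x). ennreal (dens D a m x)) \<and>
     cond_density (prb D) (refA D) (trt D) (borel \<Otimes>\<^sub>M refM D \<Otimes>\<^sub>M refX D)
       (\<lambda>\<omega>. (outc D \<omega>, med D \<omega>, cov D \<omega>)) (\<lambda>a (y, m, x). densA_YMX D a y m x) \<and>
     reg_cond_dist (prb D) (refX D) (cov D) (givenX D) \<and>
     reg_cond_dist (prb D) (refA D \<Otimes>\<^sub>M refX D) (\<lambda>\<omega>. (trt D \<omega>, cov D \<omega>)) (givenAX D) \<and>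
     reg_cond_dist (prb D) ((refA D \<Otimes>\<^sub>M refM D) \<Otimes>\<^sub>M refX D)
       (\<lambda>\<omega>. ((trt D \<omega>, med D \<omega>), cov D \<omega>)) (givenAMX D) \<and>
     (\<forall>a\<in>domA D. reg_cond_dist (prb D) (refM D \<Otimes>\<^sub>M refX D)
       (\<lambda>\<omega>. (pot_med D a \<omega>, cov D \<omega>)) (givenPM D a)) \<and>
     (\<forall>a\<in>domA D. \<forall>x\<in>domX D.
       distributed (givenAX D (a, x)) (refM D) (med D) (\<lambda>m. ennreal (densM_AX D m a x)))"


section \<open>Moment function and cross-fitted estimator\<close>

definition Kh :: "(real \<Rightarrow> real) \<Rightarrow> real \<Rightarrow> real ^ 'd::finite \<Rightarrow> real" where
  "Kh k h a = (\<Prod>j\<in>UNIV. k (a $ j / h)) / h ^ CARD('d)"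

definition moment ::
  "'m measure \<Rightarrow> (real \<Rightarrow> real) \<Rightarrow> real \<Rightarrow> real ^ 'd::finite \<Rightarrow> real ^ 'd \<Rightarrow>
   (real ^ 'd \<Rightarrow> 'm \<Rightarrow> 'x \<Rightarrow> real) \<Rightarrow> (real ^ 'd \<Rightarrow> 'x \<Rightarrow> real) \<Rightarrow> ('x \<Rightarrow> 'm \<Rightarrow> real ^ 'd \<Rightarrow> real) \<Rightarrow>
   real \<Rightarrow> (real ^ 'd) \<times> 'x \<times> 'm \<times> real \<Rightarrow> real" where
  "moment \<mu> k h a a' al la ga psi = (\<lambda>(A, X, M, Y).
     Kh k h (A - a) * la a X * (al a' M X / al a M X) * (Y - ga X M a)
     + Kh k h (A - a') * la a' X * (ga X M a - eta_of \<mu> al ga a a' X)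
     + eta_of \<mu> al ga a a' X - psi)"

text \<open>
  The sample lives on its own probability space \<open>smp\<close>.  The estimators of fold \<open>l\<close> at sample
  size \<open>n\<close> are functions of a data set indexed by the observations outside that fold.
\<close>

record ('s, 'd, 'm, 'x) crossfit =
  smp :: "'s measure"
  obs :: "nat \<Rightarrow> 's \<Rightarrow> (real ^ 'd::finite) \<times> 'x \<times> 'm \<times> real"
  nfolds :: nat
  folds :: "nat \<Rightarrow> nat \<Rightarrow> nat set"
  est_alp :: "nat \<Rightarrow> nat \<Rightarrow> (nat \<Rightarrow> (real ^ 'd) \<times> 'x \<times> 'm \<times> real) \<Rightarrow> real ^ 'd \<Rightarrow> 'm \<Rightarrow> 'x \<Rightarrow> real"
  est_lam :: "nat \<Rightarrow> nat \<Rightarrow> (nat \<Rightarrow> (real ^ 'd) \<times> 'x \<times> 'm \<times> real) \<Rightarrow> real ^ 'd \<Rightarrow> 'x \<Rightarrow> real"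
  est_gam :: "nat \<Rightarrow> nat \<Rightarrow> (nat \<Rightarrow> (real ^ 'd) \<times> 'x \<times> 'm \<times> real) \<Rightarrow> 'x \<Rightarrow> 'm \<Rightarrow> real ^ 'd \<Rightarrow> real"

definition train_idx :: "('s, 'd::finite, 'm, 'x) crossfit \<Rightarrow> nat \<Rightarrow> nat \<Rightarrow> nat set" where
  "train_idx E n l = {1..n} - folds E n l"

definition train ::
  "('s, 'd::finite, 'm, 'x) crossfit \<Rightarrow> nat \<Rightarrow> nat \<Rightarrow> 's \<Rightarrow> nat \<Rightarrow> (real ^ 'd) \<times> 'x \<times> 'm \<times> real" where
  "train E n l \<omega> = restrict (\<lambda>i. obs E i \<omega>) (train_idx E n l)"

definition alp_hat ::
  "('s, 'd::finite, 'm, 'x) crossfit \<Rightarrow> nat \<Rightarrow> nat \<Rightarrow> 's \<Rightarrow> real ^ 'd \<Rightarrow> 'm \<Rightarrow> 'x \<Rightarrow> real" where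
  "alp_hat E n l \<omega> = est_alp E n l (train E n l \<omega>)"

definition lam_hat ::
  "('s, 'd::finite, 'm, 'x) crossfit \<Rightarrow> nat \<Rightarrow> nat \<Rightarrow> 's \<Rightarrow> real ^ 'd \<Rightarrow> 'x \<Rightarrow> real" where
  "lam_hat E n l \<omega> = est_lam E n l (train E n l \<omega>)"

definition gam_hat ::
  "('s, 'd::finite, 'm, 'x) crossfit \<Rightarrow> nat \<Rightarrow> nat \<Rightarrow> 's \<Rightarrow> 'x \<Rightarrow> 'm \<Rightarrow> real ^ 'd \<Rightarrow> real" where
  "gam_hat E n l \<omega> = est_gam E n l (train E n l \<omega>)"

definition iid_sample ::
  "('w, 'd::finite, 'm, 'x) mediation \<Rightarrow> ('s, 'd, 'm, 'x) crossfit \<Rightarrow> bool" where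
  "iid_sample D E \<longleftrightarrow>
     prob_space (smp E) \<and>
     prob_space.indep_vars (smp E) (\<lambda>_. obs_space D) (obs E) {1..} \<and>
     (\<forall>i\<ge>1. distr (smp E) (obs_space D) (obs E i) =
       distr (prb D) (obs_space D) (\<lambda>\<omega>. (trt D \<omega>, cov D \<omega>, med D \<omega>, outc D \<omega>)))"

text \<open>Folds of roughly equal size: \<open>|I\<^sub>l| / n \<longlonglongrightarrow> 1 / L\<close>.\<close>

definition crossfit_setup ::
  "('w, 'd::finite, 'm, 'x) mediation \<Rightarrow> ('s, 'd, 'm, 'x) crossfit \<Rightarrow> bool" where
  "crossfit_setup D E \<longleftrightarrow>
     1 \<le> nfolds E \<and>
     (\<forall>n. (\<Union>l\<in>{1..nfolds E}. folds E n l) = {1..n}) \<and>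
     (\<forall>n. disjoint_family_on (folds E n) {1..nfolds E}) \<and>
     (\<forall>l\<in>{1..nfolds E}. (\<lambda>n. real (card (folds E n l)) / real n) \<longlonglongrightarrow> 1 / real (nfolds E)) \<and>
     (\<forall>n. \<forall>l\<in>{1..nfolds E}. \<forall>a\<in>domA D.
       (\<lambda>(d, m, x). est_alp E n l d a m x) \<in>
         borel_measurable (PiM (train_idx E n l) (\<lambda>_. obs_space D) \<Otimes>\<^sub>M refM D \<Otimes>\<^sub>M refX D) \<and>
       (\<lambda>(d, x). est_lam E n l d a x) \<in>
         borel_measurable (PiM (train_idx E n l) (\<lambda>_. obs_space D) \<Otimes>\<^sub>M refX D) \<and>
       (\<lambda>(d, m, x). est_gam E n l d x m a) \<in>
         borel_measurable (PiM (train_idx E n l) (\<lambda>_. obs_space D) \<Otimes>\<^sub>M refM D \<Otimes>\<^sub>M refX D))"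

definition psi_fold ::
  "('w, 'd::finite, 'm, 'x) mediation \<Rightarrow> ('s, 'd, 'm, 'x) crossfit \<Rightarrow> (real \<Rightarrow> real) \<Rightarrow> (nat \<Rightarrow> real) \<Rightarrow>
   real ^ 'd \<Rightarrow> real ^ 'd \<Rightarrow> nat \<Rightarrow> nat \<Rightarrow> 's \<Rightarrow> real" where
  "psi_fold D E k h a a' n l \<omega> =
     (THE psi. (1 / real (card (folds E n l))) *
        (\<Sum>i\<in>folds E n l. moment (refM D) k (h n) a a'
           (alp_hat E n l \<omega>) (lam_hat E n l \<omega>) (gam_hat E n l \<omega>) psi (obs E i \<omega>)) = 0)"

definition psi_MR ::
  "('w, 'd::finite, 'm, 'x) mediation \<Rightarrow> ('s, 'd, 'm, 'x) crossfit \<Rightarrow> (real \<Rightarrow> real) \<Rightarrow> (nat \<Rightarrow> real) \<Rightarrow>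
   real ^ 'd \<Rightarrow> real ^ 'd \<Rightarrow> nat \<Rightarrow> 's \<Rightarrow> real" where
  "psi_MR D E k h a a' n \<omega> =
     (1 / real (nfolds E)) * (\<Sum>l\<in>{1..nfolds E}. psi_fold D E k h a a' n l \<omega>)"


section \<open>Assumptions\<close>

definition consistency :: "('w, 'd::finite, 'm, 'x) mediation \<Rightarrow> bool" where
  "consistency D \<longleftrightarrow>
     (\<forall>a\<in>domA D. \<forall>m\<in>domM D. \<forall>\<omega>\<in>space (prb D).
        trt D \<omega> = a \<and> med D \<omega> = m \<longrightarrow> pot_outc D a m \<omega> = outc D \<omega>) \<and>
     (\<forall>a\<in>domA D. \<forall>\<omega>\<in>space (prb D). trt D \<omega> = a \<longrightarrow> pot_med D a \<omega> = med D \<omega>)"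

definition sequential_exchangeability :: "('w, 'd::finite, 'm, 'x) mediation \<Rightarrow> bool" where
  "sequential_exchangeability D \<longleftrightarrow>
     (\<forall>a\<in>domA D. \<forall>a'\<in>domA D. \<forall>m\<in>domM D.
        cond_indep (prb D) borel (pot_outc D a m) (refA D \<Otimes>\<^sub>M refM D) (\<lambda>\<omega>. (trt D \<omega>, med D \<omega>))
          (refX D) (cov D) (givenAMX D) (givenX D) \<and>
        cond_indep (prb D) (refM D) (pot_med D a) (refA D) (trt D)
          (refX D) (cov D) (givenAX D) (givenX D) \<and>
        cond_indep (prb D) borel (pot_outc D a m) (refM D) (pot_med D a')
          (refX D) (cov D) (givenPM D a') (givenX D))"

definition positivity :: "('w, 'd::finite, 'm, 'x) mediation \<Rightarrow> bool" where
  "positivity D \<longleftrightarrow>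
     (\<forall>a\<in>domA D. \<forall>m\<in>domM D. \<forall>x\<in>domX D. 0 < densM_AX D m a x \<and> 0 < densA_X D a x)"

text \<open>The kernel may be signed; a finite integral is read as absolute integrability.\<close>

definition kernel_conditions :: "(real \<Rightarrow> real) \<Rightarrow> bool" where
  "kernel_conditions k \<longleftrightarrow>
     has_bochner_integral lborel k 1 \<and>
     has_bochner_integral lborel (\<lambda>u. u * k u) 0 \<and>
     integrable lborel (\<lambda>u. u ^ 6 * k u) \<and> 0 < (LINT u|lborel. u ^ 6 * k u) \<and>
     integrable lborel (\<lambda>u. (k u)\<^sup>2) \<and>
     integrable lborel (\<lambda>u. u\<^sup>2 * (k u)\<^sup>2) \<and> 0 < (LINT u|lborel. u\<^sup>2 * (k u)\<^sup>2)"

definition bandwidth_conditions :: "nat \<Rightarrow> (nat \<Rightarrow> real) \<Rightarrow> real \<Rightarrow> bool" where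
  "bandwidth_conditions d h C \<longleftrightarrow>
     (\<forall>n. 0 < h n) \<and> h \<longlonglongrightarrow> 0 \<and>
     filterlim (\<lambda>n. real n * h n ^ d) at_top sequentially \<and>
     (\<lambda>n. real n * h n ^ (d + 4)) \<longlonglongrightarrow> C"

definition smoothness :: "('w, 'd::finite, 'm, 'x) mediation \<Rightarrow> bool" where
  "smoothness D \<longleftrightarrow>
     (\<forall>y\<in>domY D. \<forall>m\<in>domM D. \<forall>x\<in>domX D.
        coord_continuously_differentiable 3 (domA D) (\<lambda>a. densA_YMX D a y m x) \<and>
        coord_continuously_differentiable 3 (domA D) (\<lambda>a. densA_MX D a m x) \<and>
        coord_continuously_differentiable 3 (domA D) (\<lambda>a. densA_X D a x) \<and>
        coord_continuously_differentiable 3 (domA D) (\<lambda>a. gam D x m a)) \<and>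
     bounded_partials 3 (domA D) (domY D \<times> domM D \<times> domX D) (\<lambda>(y, m, x) a. densA_YMX D a y m x) \<and>
     bounded_partials 3 (domA D) (domM D \<times> domX D) (\<lambda>(m, x) a. densA_MX D a m x) \<and>
     bounded_partials 3 (domA D) (domX D) (\<lambda>x a. densA_X D a x) \<and>
     bounded_partials 3 (domA D) (domM D \<times> domX D) (\<lambda>(m, x) a. gam D x m a)"

definition nuisance_bounds ::
  "('w, 'd::finite, 'm, 'x) mediation \<Rightarrow> ('s, 'd, 'm, 'x) crossfit \<Rightarrow> bool" where
  "nuisance_bounds D E \<longleftrightarrow>
     (\<exists>c C. 0 < c \<and>
       (\<forall>a\<in>domA D. \<forall>m\<in>domM D. \<forall>x\<in>domX D.
          c \<le> \<bar>alp D a m x\<bar> \<and> \<bar>alp D a m x\<bar> \<le> C \<and>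
          c \<le> \<bar>lam D a x\<bar> \<and> \<bar>lam D a x\<bar> \<le> C \<and>
          \<bar>gam D x m a\<bar> \<le> C) \<and>
       (\<forall>n. \<forall>l\<in>{1..nfolds E}. \<forall>\<omega>\<in>space (smp E). \<forall>a\<in>domA D. \<forall>m\<in>domM D. \<forall>x\<in>domX D.
          c \<le> \<bar>alp_hat E n l \<omega> a m x\<bar> \<and> \<bar>alp_hat E n l \<omega> a m x\<bar> \<le> C \<and>
          c \<le> \<bar>lam_hat E n l \<omega> a x\<bar> \<and> \<bar>lam_hat E n l \<omega> a x\<bar> \<le> C \<and>
          \<bar>gam_hat E n l \<omega> x m a\<bar> \<le> C))"

text \<open>
  Integrability of \<open>Y\<^sup>2\<close> is what makes the variance finite: the Bochner integral
  of a non-integrable function is 0.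
\<close>

definition variance_regularity :: "('w, 'd::finite, 'm, 'x) mediation \<Rightarrow> bool" where
  "variance_regularity D \<longleftrightarrow>
     (\<forall>a\<in>domA D. \<forall>m\<in>domM D. \<forall>x\<in>domX D. integrable (givenAMX D ((a, m), x)) (\<lambda>\<omega>. (outc D \<omega>)\<^sup>2)) \<and>
     (\<forall>m\<in>domM D. \<forall>x\<in>domX D. coord_differentiable 2 (domA D) (\<lambda>a. varY D x m a)) \<and>
     bounded_partials 2 (domA D) (domM D \<times> domX D) (\<lambda>(m, x) a. varY D x m a)"

definition err_alp ::
  "('w, 'd::finite, 'm, 'x) mediation \<Rightarrow> ('s, 'd, 'm, 'x) crossfit \<Rightarrow> nat \<Rightarrow> nat \<Rightarrow> 's \<Rightarrow> real ^ 'd \<Rightarrow> real" where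
  "err_alp D E n l \<omega> a =
     (LINT (m, x)|(refM D \<Otimes>\<^sub>M refX D). (alp_hat E n l \<omega> a m x - alp D a m x)\<^sup>2 * densMX D m x)"

definition err_lam ::
  "('w, 'd::finite, 'm, 'x) mediation \<Rightarrow> ('s, 'd, 'm, 'x) crossfit \<Rightarrow> nat \<Rightarrow> nat \<Rightarrow> 's \<Rightarrow> real ^ 'd \<Rightarrow> real" where
  "err_lam D E n l \<omega> a =
     (LINT x|refX D. (lam_hat E n l \<omega> a x - lam D a x)\<^sup>2 * densX D x)"

definition err_gam ::
  "('w, 'd::finite, 'm, 'x) mediation \<Rightarrow> ('s, 'd, 'm, 'x) crossfit \<Rightarrow> nat \<Rightarrow> nat \<Rightarrow> 's \<Rightarrow> real ^ 'd \<Rightarrow> real" where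
  "err_gam D E n l \<omega> a =
     (LINT (m, x)|(refM D \<Otimes>\<^sub>M refX D). (gam_hat E n l \<omega> x m a - gam D x m a)\<^sup>2 * densMX D m x)"

definition nuisance_consistency ::
  "('w, 'd::finite, 'm, 'x) mediation \<Rightarrow> ('s, 'd, 'm, 'x) crossfit \<Rightarrow> bool" where
  "nuisance_consistency D E \<longleftrightarrow>
     (\<forall>l\<in>{1..nfolds E}. \<forall>a\<in>domA D.
        tendsto_prob (smp E) (\<lambda>n \<omega>. err_lam D E n l \<omega> a) 0 \<and>
        tendsto_prob (smp E) (\<lambda>n \<omega>. err_alp D E n l \<omega> a) 0 \<and>
        tendsto_prob (smp E) (\<lambda>n \<omega>. err_gam D E n l \<omega> a) 0)"

definition product_rates ::
  "('w, 'd::finite, 'm, 'x) mediation \<Rightarrow> ('s, 'd, 'm, 'x) crossfit \<Rightarrow> (nat \<Rightarrow> real) \<Rightarrow> bool" where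
  "product_rates D E h \<longleftrightarrow>
     (\<forall>l\<in>{1..nfolds E}. \<forall>a\<in>domA D. \<forall>a'\<in>domA D.
        tendsto_prob (smp E) (\<lambda>n \<omega>. sqrt (real n * h n ^ CARD('d)) *
          sqrt (err_alp D E n l \<omega> a') * sqrt (err_gam D E n l \<omega> a)) 0 \<and>
        tendsto_prob (smp E) (\<lambda>n \<omega>. sqrt (real n * h n ^ CARD('d)) *
          sqrt (err_lam D E n l \<omega> a') * sqrt (err_gam D E n l \<omega> a)) 0 \<and>
        tendsto_prob (smp E) (\<lambda>n \<omega>. sqrt (real n * h n ^ CARD('d)) *
          sqrt (err_lam D E n l \<omega> a') * sqrt (err_alp D E n l \<omega> a)) 0)"

definition third_moments :: "('w, 'd::finite, 'm, 'x) mediation \<Rightarrow> bool" where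
  "third_moments D \<longleftrightarrow>
     (\<exists>C::real. \<forall>a\<in>domA D. \<forall>a'\<in>domA D. \<forall>m\<in>domM D. \<forall>x\<in>domX D.
        (\<integral>\<^sup>+\<omega>. ennreal (\<bar>outc D \<omega> - gam D (cov D \<omega>) (med D \<omega>) a\<bar> ^ 3) \<partial>givenAMX D ((a', m), x))
          \<le> ennreal C)"

definition kernel_products :: "(real \<Rightarrow> real) \<Rightarrow> bool" where
  "kernel_products k \<longleftrightarrow>
     (\<forall>c::real. \<forall>c1\<in>{0..3::nat}. \<forall>c2\<in>{0..3::nat}. c1 + c2 \<in> {2, 3} \<longrightarrow>
        integrable lborel (\<lambda>u. k u ^ c1 * k (u + c) ^ c2) \<and>
        integrable lborel (\<lambda>u. u\<^sup>2 * k u ^ c1 * k (u + c) ^ c2))"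


section \<open>Asymptotic bias and variance\<close>

text \<open>The bias without its \<open>O(h)\<close> remainder.\<close>

definition B_main ::
  "('w, 'd::finite, 'm, 'x) mediation \<Rightarrow> (real \<Rightarrow> real) \<Rightarrow> real ^ 'd \<Rightarrow> real ^ 'd \<Rightarrow> real" where
  "B_main D k a a' =
     (LINT u|lborel. u\<^sup>2 * k u) *
     (LINT \<omega>|prb D. (let M = med D \<omega>; X = cov D \<omega> in
        alp D a' M X * lam D a X / alp D a M X *
          ((\<Sum>j\<in>UNIV. partial j (\<lambda>s. gam D X M s) a * partial j (\<lambda>s. densA_MX D s M X) a)
           + 1 / 2 * (\<Sum>j\<in>UNIV. (partial j ^^ 2) (\<lambda>s. gam D X M s) a) * densA_MX D a M X)
        + (gam D X M a - eta D a a' X) * (1 / 2) * lam D a' X *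
            (\<Sum>j\<in>UNIV. (partial j ^^ 2) (\<lambda>s. densA_MX D s M X) a')))"

definition V_asym ::
  "('w, 'd::finite, 'm, 'x) mediation \<Rightarrow> (real \<Rightarrow> real) \<Rightarrow> real ^ 'd \<Rightarrow> real ^ 'd \<Rightarrow> real" where
  "V_asym D k a a' =
     (LINT u|lborel. (k u)\<^sup>2) ^ CARD('d) *
     (LINT \<omega>|prb D. (let M = med D \<omega>; X = cov D \<omega> in
        (alp D a' M X)\<^sup>2 * densA_MX D a M X / (alp D a M X)\<^sup>2 * (lam D a X)\<^sup>2 * varY D X M a
        + lam D a' X *
            var_of (givenAX D (a', X)) (\<lambda>\<omega>'. gam D (cov D \<omega>') (med D \<omega>') a)))"

end

theory Submission imports Defs begin

text \<open>
  Given the data outside a fold, the fold average of the difference between the estimated and the true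
  moment function is a sum of i.i.d. terms.  Its conditional variance is of order \<open>1 / (n h^d)\<close> times the
  squared nuisance errors.  In its conditional mean the first-order terms in the nuisance errors cancel
  (Bayes' rule and Fubini), up to the smoothing error \<open>O(h\<^sup>2)\<close> times the errors, and what remains is
  bounded by the products of errors in the rate conditions.  Chebyshev's inequality conditional on the
  training data gives the linearisation.  The linear term is a triangular array with Lyapunov's condition
  of order three; its centred part is treated by characteristic functions, its mean by a second-order
  expansion of the kernel smoother, and the limiting variance by rescaling the squared kernel.
\<close>

section \<open>Product kernels and smoothing\<close>

text \<open>Several features of the setting shape the proof. Smoothness is coordinatewise and
  controls pure derivatives only, so a multivariate Taylor expansion, which brings in mixed
  derivatives, is replaced by moving one coordinate at a time; the product form of the kernel makes
  every linear term integrate to zero. The treatment range is an arbitrary open set, and the kernel,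
  possibly signed, may have unbounded support, so the rescaled argument can leave the range; the
  second moment of the kernel pays for this at order \<open>h^2\<close>. Conditioning on null events
  is confined to integral identities: the analytic part sees the outcome only through moments
  integrated against functions of treatment, mediator and covariates. Lower bounds on the nuisance
  functions force finite reference measures, and this is what turns an error in \<open>eta\<close>,
  an integral against \<open>dm\<close>, into mean squared errors under the law of the data.
  Finally, \<open>h^2\<close> times a root mean squared error stays negligible after scaling by
  \<open>sqrt (n h^d)\<close> because \<open>n h^(d+4)\<close> converges and hence is
  bounded.\<close>

definition kprod :: "(real \<Rightarrow> real) \<Rightarrow> real ^ 'd::finite \<Rightarrow> real" where
  "kprod k u = (\<Prod>j\<in>UNIV. k (u $ j))"

lemma Kh_eq_kprod: "Kh k h (s - a) = kprod k ((1 / h) *\<^sub>R (s - a)) / h ^ CARD('d)"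
  for s :: "real ^ 'd::finite"
  by (simp add: Kh_def kprod_def)

lemma lborel_integral_affine:
  fixes f :: "'a::euclidean_space \<Rightarrow> real"
  assumes [measurable]: "f \<in> borel_measurable borel" and "0 < h"
  shows "integral\<^sup>L lborel f = h ^ DIM('a) * (LINT u|lborel. f (a + h *\<^sub>R u))"
proof -
  have "integral\<^sup>L lborel f = integral\<^sup>L (density (distr lborel borel (\<lambda>x. a + h *\<^sub>R x)) (\<lambda>_. ennreal (\<bar>h\<bar> ^ DIM('a)))) f"
    using lborel_affine[of h a] assms(2) by (simp add: ennreal_power)
  also have "\<dots> = (LINT x|distr lborel borel (\<lambda>x. a + h *\<^sub>R x). \<bar>h\<bar> ^ DIM('a) * f x)"
    by (subst integral_density) auto
  also have "\<dots> = h ^ DIM('a) * (LINT u|lborel. f (a + h *\<^sub>R u))"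
    using assms(2) by (subst integral_distr) auto
  finally show ?thesis .
qed

lemma lborel_integrable_affine:
  fixes f :: "'a::euclidean_space \<Rightarrow> real"
  assumes "f \<in> borel_measurable borel" and h: "0 < h" and i: "integrable lborel (\<lambda>u. f (a + h *\<^sub>R u))"
  shows "integrable lborel f"
proof -
  note [measurable] = assms(1)
  have "integrable (density (distr lborel borel (\<lambda>x. a + h *\<^sub>R x)) (\<lambda>_. ennreal (\<bar>h\<bar> ^ DIM('a)))) f"
    using i h by (subst integrable_density) (auto simp: integrable_distr_eq)
  moreover have "lborel = density (distr lborel borel (\<lambda>x. a + h *\<^sub>R x)) (\<lambda>_. ennreal (\<bar>h\<bar> ^ DIM('a)))"
    using lborel_affine[of h a] h by (simp add: ennreal_power)
  ultimately show ?thesis by simp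
qed

section \<open>Fubini over the coordinates of a vector\<close>

lemma sum_Basis_nth: "(\<Sum>b\<in>Basis. f b *\<^sub>R b) $ j = f (axis j 1)" for j :: "'d::finite"
proof -
  have "(\<Sum>b\<in>Basis. f b *\<^sub>R (b :: real ^ 'd)) $ j = (\<Sum>b\<in>Basis. f b *\<^sub>R b) \<bullet> axis j 1"
    by (simp add: inner_axis)
  also have "\<dots> = f (axis j 1)"
    by (rule inner_sum_left_Basis) (auto simp: Basis_vec_def)
  finally show ?thesis .
qed

lemma bij_betw_axis_Basis: "bij_betw (\<lambda>j. axis j 1) UNIV (Basis :: (real ^ 'd::finite) set)"
  by (auto simp: bij_betw_def Basis_vec_def inj_on_def axis_eq_axis)

text \<open>Lebesgue measure on \<open>real ^ 'd\<close> is the image of a product measure indexed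
  by basis vectors, so products over coordinates have to be reindexed along \<open>axis j 1\<close>
  before the theorems on product measures apply.\<close>

lemma prod_coord_eq_prod_Basis:
  "(\<Prod>j\<in>UNIV. g j (f (axis j 1 :: real ^ 'd::finite))) = (\<Prod>b\<in>Basis. g (inv_into UNIV (\<lambda>j. axis j 1) b) (f b))"
proof -
  have "inj (\<lambda>j. axis j 1 :: real ^ 'd)"
    by (auto simp: inj_on_def axis_eq_axis)
  then show ?thesis
    by (subst prod.reindex_bij_betw[OF bij_betw_axis_Basis, symmetric]) (simp add: inv_f_f[of "\<lambda>j. axis j 1 :: real ^ 'd"])
qed

lemma lborel_prod_coord:
  fixes g :: "'d::finite \<Rightarrow> real \<Rightarrow> real"
  assumes g: "\<And>j. integrable lborel (g j)"
  shows "integrable lborel (\<lambda>u::real ^ 'd. \<Prod>j\<in>UNIV. g j (u $ j))"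
    and "(LINT u|(lborel :: (real ^ 'd) measure). (\<Prod>j\<in>UNIV. g j (u $ j))) = (\<Prod>j\<in>UNIV. integral\<^sup>L lborel (g j))"
proof -
  interpret product_sigma_finite "\<lambda>_::real ^ 'd. lborel :: real measure" by standard
  have [measurable]: "g j \<in> borel_measurable borel" for j
    using g[of j] by simp
  let ?G = "\<lambda>f. \<Prod>b\<in>(Basis::(real ^ 'd) set). g (inv_into UNIV (\<lambda>j. axis j 1) b) (f b)"
  have eq: "(\<Prod>j\<in>UNIV. g j ((\<Sum>b\<in>Basis. f b *\<^sub>R (b :: real ^ 'd)) $ j)) = ?G f" for f
    unfolding sum_Basis_nth by (rule prod_coord_eq_prod_Basis)
  have i: "integrable (\<Pi>\<^sub>M b\<in>Basis. lborel) ?G"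
    by (intro product_integrable_prod g) auto
  show "integrable lborel (\<lambda>u::real ^ 'd. \<Prod>j\<in>UNIV. g j (u $ j))"
    by (subst lborel_eq, subst integrable_distr_eq) (use i in \<open>simp_all add: eq del: sum_component\<close>)
  have "(LINT u|(lborel :: (real ^ 'd) measure). (\<Prod>j\<in>UNIV. g j (u $ j))) = integral\<^sup>L (\<Pi>\<^sub>M b\<in>Basis. lborel) ?G"
    by (subst lborel_eq, subst integral_distr) (simp_all add: eq del: sum_component)
  also have "\<dots> = (\<Prod>b\<in>(Basis::(real ^ 'd) set). integral\<^sup>L lborel (g (inv_into UNIV (\<lambda>j. axis j 1) b)))"
    by (intro product_integral_prod g) auto
  also have "\<dots> = (\<Prod>j\<in>UNIV. integral\<^sup>L lborel (g j))"
    by (rule prod_coord_eq_prod_Basis[of "\<lambda>j _. integral\<^sup>L lborel (g j)", symmetric])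
  finally show "(LINT u|(lborel :: (real ^ 'd) measure). (\<Prod>j\<in>UNIV. g j (u $ j))) = (\<Prod>j\<in>UNIV. integral\<^sup>L lborel (g j))" .
qed

text \<open>\<open>inv\<close> says that \<open>H\<close> does not depend on coordinate
  \<open>j\<close>. Integrating that coordinate first pulls \<open>H\<close> out and leaves the
  integral of \<open>q\<close>, which is zero.\<close>

lemma lborel_integral_coord_zero:
  fixes H :: "real ^ 'd::finite \<Rightarrow> real" and q :: "real \<Rightarrow> real"
  assumes H: "integrable lborel (\<lambda>u. q (u $ j) * H u)"
    and inv: "\<And>u t. H (u + t *\<^sub>R axis j 1) = H u" and q: "has_bochner_integral lborel q 0"
  shows "(LINT u|lborel. q (u $ j) * H u) = 0"
proof -
  interpret product_sigma_finite "\<lambda>_::real ^ 'd. lborel :: real measure" by standard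
  let ?b = "axis j 1 :: real ^ 'd"
  let ?T = "\<lambda>f. \<Sum>b\<in>Basis. f b *\<^sub>R (b :: real ^ 'd)"
  let ?I = "Basis - {?b}"
  have b: "?b \<in> Basis" by (auto simp: Basis_vec_def)
  have B: "insert ?b ?I = Basis" using b by auto
  have m: "(\<lambda>u. q (u $ j) * H u) \<in> borel_measurable borel"
    using H by simp
  have i: "integrable (\<Pi>\<^sub>M b\<in>Basis. lborel) (\<lambda>f. q (?T f $ j) * H (?T f))"
    using H by (subst (asm) lborel_eq, subst (asm) integrable_distr_eq) (use m in simp_all)
  have "(LINT u|lborel. q (u $ j) * H u) = (LINT f|(\<Pi>\<^sub>M b\<in>Basis. lborel). q (?T f $ j) * H (?T f))"
    by (subst lborel_eq, subst integral_distr) (use m in simp_all)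
  \<comment> \<open>Splits off the factor that belongs to coordinate \<open>j\<close> as the inner
    integral.\<close>
  also have "\<dots> = (LINT x|(\<Pi>\<^sub>M b\<in>?I. lborel). (LINT y|lborel. q (?T (x(?b := y)) $ j) * H (?T (x(?b := y)))))"
    using product_integral_insert[of ?I ?b "\<lambda>f. q (?T f $ j) * H (?T f)", unfolded B, OF _ _ i] by simp
  also have "\<dots> = (LINT x|(\<Pi>\<^sub>M b\<in>?I. lborel). (LINT y|lborel. q y * H (?T (x(?b := 0)))))"
  proof (intro Bochner_Integration.integral_cong refl)
    fix x :: "real ^ 'd \<Rightarrow> real" and y :: real
    have 1: "?T (x(?b := y)) $ j = y"
      by (subst sum_Basis_nth) simp
    have 2: "?T (x(?b := y)) = ?T (x(?b := 0)) + y *\<^sub>R ?b"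
      by (subst (1 2) sum.remove[OF _ b]) (auto intro!: sum.cong simp: add.commute)
    show "q (?T (x(?b := y)) $ j) * H (?T (x(?b := y))) = q y * H (?T (x(?b := 0)))"
      unfolding 1 unfolding 2 by (simp only: inv)
  qed
  also have "\<dots> = 0"
    using q by (simp add: has_bochner_integral_iff)
  finally show ?thesis .
qed

section \<open>Moments of the product kernel\<close>

locale kernel =
  fixes k :: "real \<Rightarrow> real"
  assumes kernel: "kernel_conditions k"
begin

lemma k_int: "integrable lborel k" "integral\<^sup>L lborel k = 1"
  and uk: "has_bochner_integral lborel (\<lambda>u. u * k u) 0"
  and k2_int: "integrable lborel (\<lambda>u. (k u)\<^sup>2)"
  using kernel by (auto simp: kernel_conditions_def has_bochner_integral_iff)

lemma k_meas [measurable]: "k \<in> borel_measurable borel"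
  using k_int(1) by simp

text \<open>The second moment is not among the kernel conditions; it is interpolated between the
  orders zero and six by \<open>u^2 \<le> 1 + u ^ 6\<close>.\<close>

lemma u2k_int: "integrable lborel (\<lambda>u. u\<^sup>2 * k u)"
proof (rule Bochner_Integration.integrable_bound)
  show "integrable lborel (\<lambda>u. \<bar>k u\<bar> + \<bar>u ^ 6 * k u\<bar>)"
    using kernel by (intro Bochner_Integration.integrable_add integrable_abs k_int) (auto simp: kernel_conditions_def)
  have "u\<^sup>2 \<le> 1 + u ^ 6" for u :: real
  proof (cases "\<bar>u\<bar> \<le> 1")
    case True
    then have "u\<^sup>2 \<le> 1" by (simp add: abs_square_le_1)
    then show ?thesis by (smt (verit) zero_le_power_eq_numeral even_numeral)
  next
    case False
    then have "\<bar>u\<bar> ^ 2 \<le> \<bar>u\<bar> ^ 6" by (intro power_increasing) auto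
    then show ?thesis by simp
  qed
  then have "u\<^sup>2 * \<bar>k u\<bar> \<le> (1 + u ^ 6) * \<bar>k u\<bar>" for u
    by (intro mult_right_mono) auto
  then show "AE u in lborel. norm (u\<^sup>2 * k u) \<le> norm (\<bar>k u\<bar> + \<bar>u ^ 6 * k u\<bar>)"
    by (intro AE_I2) (simp add: abs_mult algebra_simps)
qed simp

lemma kprod_meas [measurable]: "kprod k \<in> borel_measurable (borel :: (real ^ 'd::finite) measure)"
  unfolding kprod_def by measurable

lemma kprod_int: "integrable lborel (kprod k :: real ^ 'd::finite \<Rightarrow> real)"
  and kprod_integral: "integral\<^sup>L lborel (kprod k :: real ^ 'd::finite \<Rightarrow> real) = 1"
  using lborel_prod_coord[of "\<lambda>_::'d. k"] k_int by (simp_all add: kprod_def[abs_def])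

lemma kprod2_int: "integrable lborel (\<lambda>u::real ^ 'd::finite. (kprod k u)\<^sup>2)"
  and kprod2_integral: "(LINT u|(lborel :: (real ^ 'd::finite) measure). (kprod k u)\<^sup>2) = (LINT u|lborel. (k u)\<^sup>2) ^ CARD('d)"
  using lborel_prod_coord[of "\<lambda>_::'d. \<lambda>u. (k u)\<^sup>2"] k2_int by (simp_all add: kprod_def[abs_def] prod_power_distrib)

text \<open>A weight in one coordinate keeps the product form, so moments of \<open>kprod k\<close>
  in one coordinate reduce to \<open>lborel_prod_coord\<close> with a single modified
  factor.\<close>

lemma kprod_fun_upd: "(\<Prod>i\<in>UNIV. (if i = j then p (u $ i) * k (u $ i) else k (u $ i))) = p (u $ j) * kprod k u"
  for u :: "real ^ 'd::finite"
  unfolding kprod_def by (subst (1 2) prod.remove[of _ j]) (auto intro!: prod.cong)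

lemma kprod_u2:
  shows kprod_u2_int: "integrable lborel (\<lambda>u::real ^ 'd::finite. (u $ j)\<^sup>2 * kprod k u)"
    and kprod_u2_integral: "(LINT u|(lborel :: (real ^ 'd::finite) measure). (u $ j)\<^sup>2 * kprod k u) = (LINT u|lborel. u\<^sup>2 * k u)"
proof -
  let ?g = "\<lambda>i u. if i = j then u\<^sup>2 * k u else k u"
  have g: "integrable lborel (?g i)" for i using u2k_int k_int by (cases "i = j") auto
  have "(\<Prod>i\<in>UNIV. integral\<^sup>L lborel (?g i)) = (\<Prod>i\<in>UNIV. if i = j then (LINT u|lborel. u\<^sup>2 * k u) else 1)"
    by (intro prod.cong) (auto simp: k_int)
  then show "integrable lborel (\<lambda>u::real ^ 'd::finite. (u $ j)\<^sup>2 * kprod k u)"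
    "(LINT u|(lborel :: (real ^ 'd::finite) measure). (u $ j)\<^sup>2 * kprod k u) = (LINT u|lborel. u\<^sup>2 * k u)"
    using lborel_prod_coord[of ?g, OF g] kprod_fun_upd[of j "\<lambda>t. t\<^sup>2"] by simp_all
qed

lemma kprod_u_int: "integrable lborel (\<lambda>u::real ^ 'd::finite. (u $ j) * kprod k u)"
proof -
  let ?g = "\<lambda>i u. if i = j then u * k u else k u"
  have g: "integrable lborel (?g i)" for i using uk k_int by (cases "i = j") (auto simp: has_bochner_integral_iff)
  then show ?thesis
    using lborel_prod_coord[of ?g, OF g] kprod_fun_upd[of j "\<lambda>t. t"] by simp_all
qed

text \<open>The factor \<open>u $ j * k (u $ j)\<close> integrates to zero by the first-moment
  condition, and the remaining factors are constant in coordinate \<open>j\<close>. In the Taylor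
  step \<open>H\<close> is a derivative evaluated at a point where coordinate \<open>j\<close> has
  not yet been moved.\<close>

lemma kprod_u_zero:
  fixes H :: "real ^ 'd::finite \<Rightarrow> real"
  assumes [measurable]: "H \<in> borel_measurable borel" and bd: "\<And>u. \<bar>H u\<bar> \<le> C"
    and inv: "\<And>u t. H (u + t *\<^sub>R axis j 1) = H u"
  shows "integrable lborel (\<lambda>u. u $ j * kprod k u * H u)" "(LINT u|lborel. u $ j * kprod k u * H u) = 0"
proof -
  show i: "integrable lborel (\<lambda>u. u $ j * kprod k u * H u)"
    using order_trans[OF bd abs_ge_self] by (intro Bochner_Integration.integrable_bound[OF integrable_mult_right[OF integrable_abs[OF kprod_u_int[of j]], of C]])
      (auto intro!: AE_I2 mult_right_mono simp: abs_mult mult.commute[of _ "\<bar>H _\<bar>"])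
  let ?r = "\<lambda>u. \<Prod>i\<in>UNIV - {j}. k (u $ i)"
  have e: "u $ j * kprod k u * H u = (u $ j * k (u $ j)) * (?r u * H u)" for u
    unfolding kprod_def by (subst prod.remove[of _ j]) auto
  have "?r (u + t *\<^sub>R axis j 1) = ?r u" for u t
    by (intro prod.cong) (auto simp: axis_def)
  then have "?r (u + t *\<^sub>R axis j 1) * H (u + t *\<^sub>R axis j 1) = ?r u * H u" for u t
    by (simp add: inv)
  then show "(LINT u|lborel. u $ j * kprod k u * H u) = 0"
    unfolding e by (intro lborel_integral_coord_zero uk) (use i in \<open>auto simp: e\<close>)
qed

end

section \<open>Coordinatewise Taylor expansion on a cube\<close>

definition cube :: "real \<Rightarrow> real ^ 'd::finite \<Rightarrow> (real ^ 'd) set" where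
  "cube \<delta> a = {p. \<forall>j. \<bar>p $ j - a $ j\<bar> \<le> \<delta>}"

text \<open>A coordinate that leaves the cube is reset to the centre.  This keeps the argument in the region where the
  function is smooth, and by the second moment of the kernel it changes the smoothed value only by \<open>O(h\<^sup>2)\<close>.\<close>

definition clip :: "real \<Rightarrow> real \<Rightarrow> real" where
  "clip \<delta> t = (if \<bar>t\<bar> \<le> \<delta> then t else 0)"

text \<open>\<open>J\<close> is the set of coordinates already moved away from \<open>a\<close>.
  Running \<open>J\<close> from the empty set to \<open>UNIV\<close> replaces a multivariate
  expansion by univariate ones, in which only pure derivatives occur.\<close>

definition cpt :: "real \<Rightarrow> real ^ 'd::finite \<Rightarrow> real \<Rightarrow> 'd set \<Rightarrow> real ^ 'd \<Rightarrow> real ^ 'd" where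
  "cpt \<delta> a h J u = a + (\<chi> i. if i \<in> J then clip \<delta> (h * u $ i) else 0)"

lemma clip_meas [measurable]: "clip \<delta> \<in> borel_measurable borel"
  unfolding clip_def by measurable

lemma open_contains_cube:
  fixes a :: "real ^ 'd::finite"
  assumes "open S" "a \<in> S"
  obtains \<delta> where "0 < \<delta>" "cube \<delta> a \<subseteq> S"
proof -
  from assms obtain e where e: "0 < e" "ball a e \<subseteq> S" by (auto simp: open_contains_ball)
  \<comment> \<open>The norm is at most the sum of \<open>CARD('d)\<close> coordinates, each at most
    \<open>\<delta>\<close>, that is \<open>e / 2\<close>.\<close>
  define \<delta> where "\<delta> = e / (2 * real CARD('d))"
  have "p \<in> ball a e" if "p \<in> cube \<delta> a" for p
  proof -
    have "norm (p - a) \<le> (\<Sum>j\<in>UNIV. \<bar>(p - a) $ j\<bar>)" by (rule norm_le_l1_cart)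
    also have "\<dots> \<le> (\<Sum>j\<in>(UNIV::'d set). \<delta>)" using that by (intro sum_mono) (auto simp: cube_def)
    also have "\<dots> < e" using e by (simp add: \<delta>_def)
    finally show ?thesis by (simp add: dist_norm norm_minus_commute)
  qed
  then have "cube \<delta> a \<subseteq> S" using e by blast
  moreover have "0 < \<delta>" using e by (simp add: \<delta>_def)
  ultimately show ?thesis by (rule that[rotated])
qed

lemma cpt_in_cube: "0 \<le> \<delta> \<Longrightarrow> cpt \<delta> a h J u \<in> cube \<delta> a"
  by (auto simp: cube_def cpt_def clip_def)

lemma cpt_empty [simp]: "cpt \<delta> a h {} u = a"
  by (simp add: cpt_def vec_eq_iff)

lemma cpt_insert: "j \<notin> J \<Longrightarrow> cpt \<delta> a h (insert j J) u = cpt \<delta> a h J u + clip \<delta> (h * u $ j) *\<^sub>R axis j 1"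
  by (auto simp: cpt_def vec_eq_iff axis_def)

lemma cpt_meas [measurable]: "cpt \<delta> a h J \<in> borel_measurable (borel :: (real ^ 'd::finite) measure)"
proof -
  have [measurable]: "(\<lambda>u. \<chi> i. if i \<in> J then clip \<delta> (h * u $ i) else 0) \<in> borel_measurable (borel :: (real ^ 'd) measure)"
  proof -
    have [measurable]: "(\<lambda>u. if i \<in> J then clip \<delta> (h * u $ i) else 0) \<in> borel_measurable (borel :: (real ^ 'd) measure)" for i
      by (cases "i \<in> J") simp_all
    have "(\<lambda>u. (\<Sum>i\<in>UNIV. (if i \<in> J then clip \<delta> (h * u $ i) else 0) *\<^sub>R (axis i 1 :: real ^ 'd)))
        \<in> borel_measurable (borel :: (real ^ 'd) measure)"
      by measurable
    moreover have "(\<Sum>i\<in>UNIV. f i *\<^sub>R axis i 1) = (\<chi> i. f i)" for f :: "'d \<Rightarrow> real"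
      by (simp add: vec_eq_iff axis_def if_distrib[of "\<lambda>x. _ * x"] cong: if_cong)
    ultimately show ?thesis by simp
  qed
  show ?thesis unfolding cpt_def by measurable
qed

lemma cpt_tendsto:
  assumes "h \<longlonglongrightarrow> 0"
  shows "(\<lambda>n. cpt \<delta> a (h n) J u) \<longlonglongrightarrow> a"
proof -
  have "(\<lambda>n. cpt \<delta> a (h n) J u $ i) \<longlonglongrightarrow> a $ i" for i
  proof (cases "i \<in> J")
    case True
    have "(\<lambda>n. clip \<delta> (h n * u $ i)) \<longlonglongrightarrow> 0"
    proof (rule Lim_null_comparison)
      show "\<forall>\<^sub>F n in sequentially. norm (clip \<delta> (h n * u $ i)) \<le> \<bar>h n\<bar> * \<bar>u $ i\<bar>"
        by (auto simp: clip_def abs_mult)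
      show "(\<lambda>n. \<bar>h n\<bar> * \<bar>u $ i\<bar>) \<longlonglongrightarrow> 0"
        using assms by (auto intro!: tendsto_mult_left_zero tendsto_rabs_zero)
    qed
    then have "(\<lambda>n. a $ i + clip \<delta> (h n * u $ i)) \<longlonglongrightarrow> a $ i + 0"
      by (intro tendsto_intros)
    then show ?thesis using True by (simp add: cpt_def)
  qed (simp add: cpt_def)
  then show ?thesis by (rule vec_tendstoI)
qed

text \<open>The derivatives are carried as explicit functions \<open>F1\<close>, \<open>F2\<close>,
  so that a product is handled by stating its derivatives. Differentiability is stated at parameter
  zero; \<open>DERIV_along_axis\<close> transports it along the axis.\<close>

definition C2_on_cube ::
  "real \<Rightarrow> real ^ 'd::finite \<Rightarrow> real \<Rightarrow> (real ^ 'd \<Rightarrow> real) \<Rightarrow> ('d \<Rightarrow> real ^ 'd \<Rightarrow> real) \<Rightarrow> ('d \<Rightarrow> real ^ 'd \<Rightarrow> real) \<Rightarrow> bool" where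
  "C2_on_cube \<delta> a C F F1 F2 \<longleftrightarrow>
     0 < \<delta> \<and> continuous_on (cube \<delta> a) F \<and>
     (\<forall>j. continuous_on (cube \<delta> a) (F1 j) \<and> continuous_on (cube \<delta> a) (F2 j)) \<and>
     (\<forall>p\<in>cube \<delta> a. \<bar>F p\<bar> \<le> C \<and> (\<forall>j. \<bar>F1 j p\<bar> \<le> C \<and> \<bar>F2 j p\<bar> \<le> C \<and>
       ((\<lambda>t. F (p + t *\<^sub>R axis j 1)) has_real_derivative F1 j p) (at 0) \<and>
       ((\<lambda>t. F1 j (p + t *\<^sub>R axis j 1)) has_real_derivative F2 j p) (at 0)))"

lemma C2_on_cubeD:
  assumes "C2_on_cube \<delta> a C F F1 F2"
  shows "0 < \<delta>" "continuous_on (cube \<delta> a) F" "continuous_on (cube \<delta> a) (F1 j)" "continuous_on (cube \<delta> a) (F2 j)"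
    "p \<in> cube \<delta> a \<Longrightarrow> \<bar>F p\<bar> \<le> C" "p \<in> cube \<delta> a \<Longrightarrow> \<bar>F1 j p\<bar> \<le> C" "p \<in> cube \<delta> a \<Longrightarrow> \<bar>F2 j p\<bar> \<le> C"
    "p \<in> cube \<delta> a \<Longrightarrow> ((\<lambda>t. F (p + t *\<^sub>R axis j 1)) has_real_derivative F1 j p) (at 0)"
    "p \<in> cube \<delta> a \<Longrightarrow> ((\<lambda>t. F1 j (p + t *\<^sub>R axis j 1)) has_real_derivative F2 j p) (at 0)"
  using assms unfolding C2_on_cube_def by auto

text \<open>A cube is convex in each coordinate. The sign condition \<open>0 \<le> s * t\<close>
  lets one lemma serve steps in both directions.\<close>

lemma cube_segment:
  assumes "p \<in> cube \<delta> a" "p + t *\<^sub>R axis j 1 \<in> cube \<delta> a" "\<bar>s\<bar> \<le> \<bar>t\<bar>" "0 \<le> s * t"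
  shows "p + s *\<^sub>R axis j 1 \<in> cube \<delta> a"
  unfolding cube_def
proof safe
  fix i
  have 1: "\<bar>p $ i - a $ i\<bar> \<le> \<delta>" "\<bar>p $ i + t * axis j 1 $ i - a $ i\<bar> \<le> \<delta>"
    using assms by (auto simp: cube_def)
  have "0 \<le> t \<and> 0 \<le> s \<and> s \<le> t \<or> t \<le> 0 \<and> s \<le> 0 \<and> t \<le> s"
    using assms(3,4) by (auto simp: zero_le_mult_iff)
  then show "\<bar>(p + s *\<^sub>R axis j 1) $ i - a $ i\<bar> \<le> \<delta>"
    using 1 by (auto simp: axis_def)
qed

lemma DERIV_along_axis:
  assumes "((\<lambda>t. F (p + s *\<^sub>R axis j 1 + t *\<^sub>R axis j 1)) has_real_derivative D) (at 0)"
  shows "((\<lambda>t. F (p + t *\<^sub>R axis j 1)) has_real_derivative D) (at s)"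
  using assms DERIV_shift[of "\<lambda>t. F (p + t *\<^sub>R axis j 1)" D 0 s]
  by (simp add: scaleR_add_left ac_simps)

lemma C2_Taylor:
  fixes F :: "real ^ 'd::finite \<Rightarrow> real"
  assumes C2: "C2_on_cube \<delta> a C F F1 F2" and p: "p \<in> cube \<delta> a" "p + t *\<^sub>R axis j 1 \<in> cube \<delta> a"
  shows "\<exists>\<theta>. \<bar>\<theta>\<bar> \<le> \<bar>t\<bar> \<and> p + \<theta> *\<^sub>R axis j 1 \<in> cube \<delta> a \<and>
    F (p + t *\<^sub>R axis j 1) - F p - t * F1 j p = t\<^sup>2 / 2 * F2 j (p + \<theta> *\<^sub>R axis j 1)"
proof (cases "t = 0")
  case True
  then show ?thesis using p by auto
next
  case False
  \<comment> \<open>The derivative sequence along the axis in the format of \<open>Taylor\<close>;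
    the interval from \<open>min 0 t\<close> to \<open>max 0 t\<close> covers both signs of
    \<open>t\<close>.\<close>
  define diff :: "nat \<Rightarrow> real \<Rightarrow> real" where "diff = (\<lambda>m s. if m = 0 then F (p + s *\<^sub>R axis j 1) else if m = 1 then F1 j (p + s *\<^sub>R axis j 1)
    else F2 j (p + s *\<^sub>R axis j 1))"
  have seg: "p + s *\<^sub>R axis j 1 \<in> cube \<delta> a" if "min 0 t \<le> s" "s \<le> max 0 t" for s
    using p that by (intro cube_segment[OF p]) (auto simp: zero_le_mult_iff)
  have D: "\<forall>m s. m < 2 \<and> min 0 t \<le> s \<and> s \<le> max 0 t \<longrightarrow> DERIV (diff m) s :> diff (Suc m) s"
  proof safe
    fix m :: nat and s assume m: "m < 2" and s: "min 0 t \<le> s" "s \<le> max 0 t"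
    consider "m = 0" | "m = 1" using m by linarith
    then show "DERIV (diff m) s :> diff (Suc m) s"
      using seg[OF s] by cases (auto simp: diff_def intro!: DERIV_along_axis C2_on_cubeD[OF C2])
  qed
  obtain \<theta> where th: "if t < 0 then t < \<theta> \<and> \<theta> < 0 else 0 < \<theta> \<and> \<theta> < t"
    and eq: "diff 0 t = (\<Sum>m<2. diff m 0 / fact m * (t - 0) ^ m) + diff 2 \<theta> / fact 2 * (t - 0) ^ 2"
    using Taylor[of 2 diff "diff 0" "min 0 t" "max 0 t" 0 t] D False by auto
  have "p + \<theta> *\<^sub>R axis j 1 \<in> cube \<delta> a"
    by (rule seg) (use th in \<open>auto split: if_splits\<close>)
  moreover have "F (p + t *\<^sub>R axis j 1) - F p - t * F1 j p = t\<^sup>2 / 2 * F2 j (p + \<theta> *\<^sub>R axis j 1)"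
    using eq by (simp add: diff_def numeral_2_eq_2 lessThan_Suc)
  ultimately show ?thesis using th by (intro exI[of _ \<theta>]) (auto split: if_splits)
qed

text \<open>\<open>F\<close> is known to be continuous on the cube only, hence measurable there, and
  \<open>cpt\<close> never leaves the cube.\<close>

lemma comp_cpt_meas:
  assumes "continuous_on (cube \<delta> a) F" "0 \<le> \<delta>"
  shows "(\<lambda>u. F (cpt \<delta> a h J u)) \<in> borel_measurable (borel :: (real ^ 'd::finite) measure)"
proof (rule measurable_compose[where N = "restrict_space borel (cube \<delta> a)"])
  show "cpt \<delta> a h J \<in> measurable borel (restrict_space borel (cube \<delta> a))"
    by (intro measurable_restrict_space2) (auto simp: cpt_in_cube assms)
  show "F \<in> borel_measurable (restrict_space borel (cube \<delta> a))"
    using assms(1) by (rule borel_measurable_continuous_on_restrict)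
qed

text \<open>Remainder of one coordinate step. The linear term carries the unclipped increment
  \<open>h * u $ j\<close>: against the kernel its integral is then exactly zero
  (\<open>kprod_u_zero\<close>), and the effect of clipping is charged to the remainder.\<close>

definition clip_err :: "real \<Rightarrow> real ^ 'd::finite \<Rightarrow> (real ^ 'd \<Rightarrow> real) \<Rightarrow> ('d \<Rightarrow> real ^ 'd \<Rightarrow> real) \<Rightarrow> 'd \<Rightarrow> 'd set \<Rightarrow> real \<Rightarrow> real ^ 'd \<Rightarrow> real" where
  "clip_err \<delta> a F F1 j J h u =
     F (cpt \<delta> a h (insert j J) u) - F (cpt \<delta> a h J u) - h * u $ j * F1 j (cpt \<delta> a h J u)"

text \<open>With \<open>t = h * u $ j\<close>: inside the clipping range Taylor gives
  \<open>t^2 / 2 * C\<close>. Outside it the step is zero and only \<open>t * F1\<close> is left,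
  where \<open>\<bar>t\<bar> > \<delta>\<close> yields
  \<open>\<bar>t\<bar> \<le> t^2 / \<delta>\<close>. The factor \<open>1 + 1 / \<delta>\<close>
  covers both cases.\<close>

lemma clip_err_bound:
  assumes C2: "C2_on_cube \<delta> a C F F1 F2" and j: "j \<notin> J"
  shows "\<bar>clip_err \<delta> a F F1 j J h u\<bar> \<le> C * (1 + 1 / \<delta>) * (h\<^sup>2 * (u $ j)\<^sup>2)"
proof -
  note C2D = C2_on_cubeD[OF C2]
  let ?p = "cpt \<delta> a h J u" and ?t = "h * u $ j"
  have d: "0 < \<delta>" by (rule C2D)
  have p: "?p \<in> cube \<delta> a" "?p + clip \<delta> ?t *\<^sub>R axis j 1 \<in> cube \<delta> a"
    using cpt_in_cube[of \<delta> a h J u] cpt_in_cube[of \<delta> a h "insert j J" u] d by (auto simp: cpt_insert[OF j])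
  have C: "0 \<le> C" using C2D(5)[OF p(1)] by linarith
  show ?thesis
  proof (cases "\<bar>?t\<bar> \<le> \<delta>")
    case True
    then obtain \<theta> where th: "?p + \<theta> *\<^sub>R axis j 1 \<in> cube \<delta> a"
      "clip_err \<delta> a F F1 j J h u = ?t\<^sup>2 / 2 * F2 j (?p + \<theta> *\<^sub>R axis j 1)"
      using C2_Taylor[OF C2 p] by (auto simp: clip_err_def cpt_insert[OF j] clip_def)
    have "\<bar>clip_err \<delta> a F F1 j J h u\<bar> = ?t\<^sup>2 / 2 * \<bar>F2 j (?p + \<theta> *\<^sub>R axis j 1)\<bar>"
      unfolding th(2) by (simp add: abs_mult)
    also have "\<dots> \<le> ?t\<^sup>2 / 2 * C"
      using C2D(7)[OF th(1)] by (intro mult_left_mono) auto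
    also have "\<dots> \<le> C * (1 + 1 / \<delta>) * ?t\<^sup>2"
      using C d by (simp add: algebra_simps)
    finally show ?thesis by (simp add: power_mult_distrib)
  next
    case False
    then have "clip_err \<delta> a F F1 j J h u = - (?t * F1 j ?p)"
      by (simp add: clip_err_def cpt_insert[OF j] clip_def)
    then have "\<bar>clip_err \<delta> a F F1 j J h u\<bar> = \<bar>?t\<bar> * \<bar>F1 j ?p\<bar>"
      by (simp add: abs_mult)
    also have "\<dots> \<le> \<bar>?t\<bar> * C"
      using C2D(6)[OF p(1)] by (intro mult_left_mono) auto
    also have "\<bar>?t\<bar> \<le> \<bar>?t\<bar> * (\<bar>?t\<bar> / \<delta>)"
      using mult_left_mono[of 1 "\<bar>?t\<bar> / \<delta>" "\<bar>?t\<bar>"] False d by simp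
    then have "\<bar>?t\<bar> * C \<le> \<bar>?t\<bar> * (\<bar>?t\<bar> / \<delta>) * C"
      using C by (intro mult_right_mono) auto
    also have "\<bar>?t\<bar> * (\<bar>?t\<bar> / \<delta>) * C = C * (1 / \<delta>) * ?t\<^sup>2"
      by (simp add: power2_eq_square abs_mult_self_eq algebra_simps flip: abs_mult)
    also have "\<dots> \<le> C * (1 + 1 / \<delta>) * ?t\<^sup>2"
      using C d by (intro mult_right_mono mult_left_mono) auto
    finally show ?thesis by (simp add: power_mult_distrib)
  qed
qed

text \<open>For fixed \<open>u\<close> no clipping takes place once \<open>h\<close> is small, and
  the intermediate point of the Taylor remainder converges to \<open>a\<close>.\<close>

lemma clip_err_tendsto:
  assumes C2: "C2_on_cube \<delta> a C F F1 F2" and j: "j \<notin> J" and h: "h \<longlonglongrightarrow> 0" "\<And>n. 0 < h n"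
  shows "(\<lambda>n. clip_err \<delta> a F F1 j J (h n) u / (h n)\<^sup>2) \<longlonglongrightarrow> (u $ j)\<^sup>2 / 2 * F2 j a"
proof -
  note C2D = C2_on_cubeD[OF C2]
  have d: "0 < \<delta>" by (rule C2D)
  let ?p = "\<lambda>n. cpt \<delta> a (h n) J u"
  have p: "?p n \<in> cube \<delta> a" "?p n + clip \<delta> (h n * u $ j) *\<^sub>R axis j 1 \<in> cube \<delta> a" for n
    using cpt_in_cube[of \<delta> a "h n" J u] cpt_in_cube[of \<delta> a "h n" "insert j J" u] d by (auto simp: cpt_insert[OF j])
  obtain \<theta> where th: "\<And>n. \<bar>\<theta> n\<bar> \<le> \<bar>clip \<delta> (h n * u $ j)\<bar>" "\<And>n. ?p n + \<theta> n *\<^sub>R axis j 1 \<in> cube \<delta> a"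
     "\<And>n. F (?p n + clip \<delta> (h n * u $ j) *\<^sub>R axis j 1) - F (?p n) - clip \<delta> (h n * u $ j) * F1 j (?p n)
       = (clip \<delta> (h n * u $ j))\<^sup>2 / 2 * F2 j (?p n + \<theta> n *\<^sub>R axis j 1)"
    using C2_Taylor[OF C2 p] by metis
  have hu: "(\<lambda>n. \<bar>h n * u $ j\<bar>) \<longlonglongrightarrow> 0"
    using h by (intro tendsto_rabs_zero tendsto_mult_left_zero)
  have "\<theta> \<longlonglongrightarrow> 0"
    by (rule Lim_null_comparison[OF always_eventually hu]) (auto intro!: order_trans[OF th(1)] simp: clip_def)
  then have "(\<lambda>n. ?p n + \<theta> n *\<^sub>R axis j 1) \<longlonglongrightarrow> a + 0 *\<^sub>R axis j 1"
    by (intro tendsto_intros cpt_tendsto h)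
  then have "(\<lambda>n. F2 j (?p n + \<theta> n *\<^sub>R axis j 1)) \<longlonglongrightarrow> F2 j a"
    using C2D(4)[of j] th(2) d unfolding continuous_on_sequentially
    by (auto simp: comp_def cube_def)
  then have "(\<lambda>n. (u $ j)\<^sup>2 / 2 * F2 j (?p n + \<theta> n *\<^sub>R axis j 1)) \<longlonglongrightarrow> (u $ j)\<^sup>2 / 2 * F2 j a"
    by (intro tendsto_intros)
  moreover have "\<forall>\<^sub>F n in sequentially. (u $ j)\<^sup>2 / 2 * F2 j (?p n + \<theta> n *\<^sub>R axis j 1) = clip_err \<delta> a F F1 j J (h n) u / (h n)\<^sup>2"
    using order_tendstoD(2)[OF hu d]
  proof eventually_elim
    case (elim n)
    then show ?case using th(3)[of n] h(2)[of n]
      by (simp add: clip_err_def cpt_insert[OF j] clip_def power_mult_distrib)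
  qed
  ultimately show ?thesis by (rule Lim_transform_eventually)
qed

section \<open>Second-order expansion under the product kernel\<close>

context kernel begin

definition clip_int :: "real \<Rightarrow> real ^ 'd::finite \<Rightarrow> (real ^ 'd \<Rightarrow> real) \<Rightarrow> real \<Rightarrow> 'd set \<Rightarrow> real" where
  "clip_int \<delta> a F h J = (LINT u|lborel. kprod k u * (F (cpt \<delta> a h J u) - F a))"

lemma kprod_times_bounded_int:
  fixes H :: "real ^ 'd::finite \<Rightarrow> real"
  assumes [measurable]: "H \<in> borel_measurable borel" and bd: "\<And>u. \<bar>H u\<bar> \<le> C"
  shows "integrable lborel (\<lambda>u. kprod k u * H u)"
proof (rule Bochner_Integration.integrable_bound)
  show "integrable lborel (\<lambda>u::real ^ 'd. C * \<bar>kprod k u\<bar>)"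
    by (intro integrable_mult_right integrable_abs kprod_int)
  have "\<bar>kprod k u\<bar> * \<bar>H u\<bar> \<le> \<bar>kprod k u\<bar> * \<bar>C\<bar>" for u
    using bd[of u] by (intro mult_left_mono) auto
  then show "AE u in lborel. norm (kprod k u * H u) \<le> norm (C * \<bar>kprod k u\<bar>)"
    by (intro AE_I2) (simp add: abs_mult mult.commute)
qed simp

text \<open>Since \<open>j \<notin> J\<close>, the derivative \<open>F1 j\<close> is evaluated at a
  point that is constant in coordinate \<open>j\<close>, so the linear term of the step vanishes
  under the kernel.\<close>

lemma clip_int_step:
  assumes C2: "C2_on_cube \<delta> a C F F1 F2" and j: "j \<notin> J"
  shows "clip_int \<delta> a F h (insert j J) - clip_int \<delta> a F h J = (LINT u|lborel. kprod k u * clip_err \<delta> a F F1 j J h u)"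
    (is "_ = integral\<^sup>L lborel ?E")
    and "integrable lborel (\<lambda>u. kprod k u * clip_err \<delta> a F F1 j J h u)"
proof -
  note C2D = C2_on_cubeD[OF C2]
  have d: "0 < \<delta>" by (rule C2D)
  have a: "a \<in> cube \<delta> a" using d by (simp add: cube_def)
  have [measurable]: "(\<lambda>u. F (cpt \<delta> a h J u)) \<in> borel_measurable borel" "(\<lambda>u. F1 j (cpt \<delta> a h J u)) \<in> borel_measurable borel" for J
    using comp_cpt_meas[OF C2D(2)] comp_cpt_meas[OF C2D(3)] d by auto
  have i: "integrable lborel (\<lambda>u. kprod k u * (F (cpt \<delta> a h J u) - F a))" for J
  proof (rule kprod_times_bounded_int)
    fix u
    show "\<bar>F (cpt \<delta> a h J u) - F a\<bar> \<le> C + C"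
      using C2D(5)[OF cpt_in_cube[of \<delta> a h J u]] C2D(5)[OF a] d by linarith
  qed measurable
  have inv: "F1 j (cpt \<delta> a h J (u + t *\<^sub>R axis j 1)) = F1 j (cpt \<delta> a h J u)" for u t
  proof -
    have "cpt \<delta> a h J (u + t *\<^sub>R axis j 1) = cpt \<delta> a h J u"
      using j by (auto simp: cpt_def vec_eq_iff axis_def)
    then show ?thesis by simp
  qed
  have bd: "\<bar>F1 j (cpt \<delta> a h J u)\<bar> \<le> C" for u
    using C2D(6)[OF cpt_in_cube] d by auto
  note z = kprod_u_zero[of "\<lambda>u. F1 j (cpt \<delta> a h J u)" C j, OF _ bd inv]
  have E: "?E = (\<lambda>u. kprod k u * (F (cpt \<delta> a h (insert j J) u) - F a) - kprod k u * (F (cpt \<delta> a h J u) - F a)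
       - h * (u $ j * kprod k u * F1 j (cpt \<delta> a h J u)))"
    by (simp add: clip_err_def algebra_simps)
  show "integrable lborel ?E"
    unfolding E using z by (intro Bochner_Integration.integrable_diff i integrable_mult_right) auto
  show "clip_int \<delta> a F h (insert j J) - clip_int \<delta> a F h J = integral\<^sup>L lborel ?E"
    unfolding E clip_int_def using z i by simp
qed

lemma kprod_abs_u2_int: "integrable lborel (\<lambda>u::real ^ 'd::finite. \<bar>kprod k u\<bar> * (u $ j)\<^sup>2)"
  using integrable_abs[OF kprod_u2_int[of j]] by (simp add: abs_mult mult.commute)

text \<open>Induction over the moved coordinates telescopes
  \<open>F (cpt \<delta> a h J u) - F a\<close>; each step costs \<open>clip_err_bound\<close>
  integrated against \<open>\<bar>kprod k u\<bar>\<close>.\<close>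

lemma clip_int_bound:
  fixes a :: "real ^ 'd::finite"
  assumes C2: "C2_on_cube \<delta> a C F F1 F2"
  shows "\<bar>clip_int \<delta> a F h J\<bar> \<le> C * (1 + 1 / \<delta>) * h\<^sup>2 * (\<Sum>j\<in>J. LINT u|lborel. \<bar>kprod k u\<bar> * (u $ j)\<^sup>2)"
  using finite[of J]
proof (induction J rule: finite_induct)
  case empty
  then show ?case by (simp add: clip_int_def)
next
  case (insert j J)
  have "\<bar>LINT u|lborel. kprod k u * clip_err \<delta> a F F1 j J h u\<bar> \<le> (LINT u|lborel. \<bar>kprod k u * clip_err \<delta> a F F1 j J h u\<bar>)"
    by (rule integral_abs_bound)
  also have "\<dots> \<le> (LINT u|lborel. C * (1 + 1 / \<delta>) * h\<^sup>2 * (\<bar>kprod k u\<bar> * (u $ j)\<^sup>2))"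
  proof (intro integral_mono integrable_abs clip_int_step(2)[OF C2 insert(2)] integrable_mult_right kprod_abs_u2_int)
    fix u :: "real ^ 'd"
    show "\<bar>kprod k u * clip_err \<delta> a F F1 j J h u\<bar> \<le> C * (1 + 1 / \<delta>) * h\<^sup>2 * (\<bar>kprod k u\<bar> * (u $ j)\<^sup>2)"
      using mult_left_mono[OF clip_err_bound[OF C2 insert(2), of h u], of "\<bar>kprod k u\<bar>"]
      by (simp add: abs_mult algebra_simps)
  qed
  also have "\<dots> = C * (1 + 1 / \<delta>) * h\<^sup>2 * (LINT u|lborel. \<bar>kprod k u\<bar> * (u $ j)\<^sup>2)"
    by simp
  finally have "\<bar>clip_int \<delta> a F h (insert j J)\<bar> \<le> \<bar>clip_int \<delta> a F h J\<bar> + C * (1 + 1 / \<delta>) * h\<^sup>2 * (LINT u|lborel. \<bar>kprod k u\<bar> * (u $ j)\<^sup>2)"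
    using clip_int_step(1)[OF C2 insert(2), of h] by linarith
  also have "\<dots> \<le> C * (1 + 1 / \<delta>) * h\<^sup>2 * (\<Sum>j\<in>J. LINT u|lborel. \<bar>kprod k u\<bar> * (u $ j)\<^sup>2) + C * (1 + 1 / \<delta>) * h\<^sup>2 * (LINT u|lborel. \<bar>kprod k u\<bar> * (u $ j)\<^sup>2)"
    using insert.IH by simp
  finally show ?case using insert by (simp add: algebra_simps)
qed

text \<open>The same telescoping in the limit: \<open>clip_err_bound\<close> divided by
  \<open>h^2\<close> is an integrable majorant free of \<open>h\<close>, and
  \<open>clip_err_tendsto\<close> gives the pointwise limit of each step.\<close>

lemma clip_int_tendsto:
  fixes a :: "real ^ 'd::finite"
  assumes C2: "C2_on_cube \<delta> a C F F1 F2" and h: "h \<longlonglongrightarrow> 0" "\<And>n. 0 < h n"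
  shows "(\<lambda>n. clip_int \<delta> a F (h n) J / (h n)\<^sup>2) \<longlonglongrightarrow> (LINT u|lborel. u\<^sup>2 * k u) / 2 * (\<Sum>j\<in>J. F2 j a)"
  using finite[of J]
proof (induction J rule: finite_induct)
  case empty
  then show ?case by (simp add: clip_int_def)
next
  case (insert j J)
  note C2D = C2_on_cubeD[OF C2]
  have "(\<lambda>n. LINT u|lborel. kprod k u * clip_err \<delta> a F F1 j J (h n) u / (h n)\<^sup>2) \<longlonglongrightarrow> (LINT u|lborel. kprod k u * ((u $ j)\<^sup>2 / 2 * F2 j a))"
  proof (rule integral_dominated_convergence[where w = "\<lambda>u. C * (1 + 1 / \<delta>) * (\<bar>kprod k u\<bar> * (u $ j)\<^sup>2)"])
    show "AE u in lborel. (\<lambda>n. kprod k u * clip_err \<delta> a F F1 j J (h n) u / (h n)\<^sup>2) \<longlonglongrightarrow> kprod k u * ((u $ j)\<^sup>2 / 2 * F2 j a)"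
      unfolding times_divide_eq_right[symmetric]
      by (intro AE_I2 tendsto_mult_left clip_err_tendsto[OF C2 insert(2) h])
    show "AE u in lborel. norm (kprod k u * clip_err \<delta> a F F1 j J (h n) u / (h n)\<^sup>2) \<le> C * (1 + 1 / \<delta>) * (\<bar>kprod k u\<bar> * (u $ j)\<^sup>2)" for n
    proof (intro AE_I2)
      fix u :: "real ^ 'd"
      show "norm (kprod k u * clip_err \<delta> a F F1 j J (h n) u / (h n)\<^sup>2) \<le> C * (1 + 1 / \<delta>) * (\<bar>kprod k u\<bar> * (u $ j)\<^sup>2)"
        using mult_left_mono[OF clip_err_bound[OF C2 insert(2), of "h n" u], of "\<bar>kprod k u\<bar>"] h(2)[of n]
        by (simp add: abs_mult divide_le_eq algebra_simps)
    qed
    show "(\<lambda>u. kprod k u * clip_err \<delta> a F F1 j J (h n) u / (h n)\<^sup>2) \<in> borel_measurable lborel" for n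
      using clip_int_step(2)[OF C2 insert(2), of "h n"] by (intro borel_measurable_divide) auto
  qed (auto intro!: integrable_mult_right kprod_abs_u2_int)
  also have "(LINT u|lborel. kprod k u * ((u $ j)\<^sup>2 / 2 * F2 j a)) = (LINT u|lborel. (u $ j)\<^sup>2 * kprod k u * (F2 j a / 2))"
    by (simp add: mult_ac)
  also have "\<dots> = (LINT u|lborel. u\<^sup>2 * k u) / 2 * F2 j a"
    by (subst integral_mult_left_zero) (simp add: kprod_u2_integral)
  finally have "(\<lambda>n. (clip_int \<delta> a F (h n) (insert j J) - clip_int \<delta> a F (h n) J) / (h n)\<^sup>2) \<longlonglongrightarrow> (LINT u|lborel. u\<^sup>2 * k u) / 2 * F2 j a"
    by (simp add: clip_int_step[OF C2 insert(2)])
  from tendsto_add[OF insert.IH this] show ?case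
    using insert by (simp add: add_divide_distrib[symmetric] algebra_simps)
qed

end

section \<open>Rescaling around a point of an open set\<close>

lemma indicator_times_meas:
  fixes F :: "'a::euclidean_space \<Rightarrow> real"
  assumes "open S" "F \<in> borel_measurable (restrict_space lborel S)"
  shows "(\<lambda>s. indicator S s * F s) \<in> borel_measurable borel"
  using assms by (subst (asm) borel_measurable_restrict_space_iff) (auto simp: scaleR_conv_of_real)

text \<open>Substitution \<open>s = a + h u\<close>, with \<open>F\<close> extended by zero outside
  \<open>S\<close>. The last bound does not involve \<open>h\<close>: it makes all later moment
  bounds uniform in the bandwidth.\<close>

lemma rescaled_integral:
  fixes F :: "real ^ 'd::finite \<Rightarrow> real"
  assumes S: "open S" and F: "F \<in> borel_measurable (restrict_space lborel S)" and bd: "\<And>s. s \<in> S \<Longrightarrow> \<bar>F s\<bar> \<le> C"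
    and g: "integrable lborel g" and h: "0 < h"
  shows "integrable lborel (\<lambda>u. g u * (indicator S (a + h *\<^sub>R u) * F (a + h *\<^sub>R u)))" (is ?i1)
    and "integrable (restrict_space lborel S) (\<lambda>s. g ((1 / h) *\<^sub>R (s - a)) * F s)" (is ?i2)
    and "(LINT s|restrict_space lborel S. g ((1 / h) *\<^sub>R (s - a)) * F s) =
      h ^ CARD('d) * (LINT u|lborel. g u * (indicator S (a + h *\<^sub>R u) * F (a + h *\<^sub>R u)))" (is ?e)
    and "\<bar>LINT u|lborel. g u * (indicator S (a + h *\<^sub>R u) * F (a + h *\<^sub>R u))\<bar> \<le> \<bar>C\<bar> * (LINT u|lborel. \<bar>g u\<bar>)" (is ?b)
proof -
  have Sb: "S \<in> sets borel" using S by simp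
  note [measurable] = indicator_times_meas[OF S F]
  have [measurable]: "g \<in> borel_measurable borel" using g by simp
  have bd': "\<bar>g u * (indicator S (a + h *\<^sub>R u) * F (a + h *\<^sub>R u))\<bar> \<le> \<bar>C\<bar> * \<bar>g u\<bar>" for u
    using bd[of "a + h *\<^sub>R u"] by (auto simp: abs_mult mult.commute[of _ "\<bar>g u\<bar>"] indicator_def intro!: mult_left_mono)
  show i1: ?i1
    by (rule Bochner_Integration.integrable_bound[of _ "\<lambda>u. \<bar>C\<bar> * \<bar>g u\<bar>"]) (use bd' g in \<open>auto intro!: AE_I2\<close>)
  let ?f = "\<lambda>s. indicator S s * (g ((1 / h) *\<^sub>R (s - a)) * F s)"
  have f: "?f s = g ((1 / h) *\<^sub>R (s - a)) * (indicator S s * F s)" for s by simp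
  have m: "?f \<in> borel_measurable borel" unfolding f by measurable
  have fa: "?f (a + h *\<^sub>R u) = g u * (indicator S (a + h *\<^sub>R u) * F (a + h *\<^sub>R u))" for u
    using h by simp
  have "integrable lborel ?f"
    by (rule lborel_integrable_affine[OF m h, of a]) (unfold fa, rule i1)
  then show ?i2
    using Sb by (subst integrable_restrict_space) auto
  have "(LINT s|restrict_space lborel S. g ((1 / h) *\<^sub>R (s - a)) * F s) = integral\<^sup>L lborel ?f"
    using Sb by (subst integral_restrict_space) auto
  also have "\<dots> = h ^ CARD('d) * (LINT u|lborel. ?f (a + h *\<^sub>R u))"
    using lborel_integral_affine[OF m h, of a] by simp
  finally show ?e unfolding fa .
  have "\<bar>LINT u|lborel. g u * (indicator S (a + h *\<^sub>R u) * F (a + h *\<^sub>R u))\<bar> \<le> (LINT u|lborel. \<bar>g u * (indicator S (a + h *\<^sub>R u) * F (a + h *\<^sub>R u))\<bar>)"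
    by (rule integral_abs_bound)
  also have "\<dots> \<le> (LINT u|lborel. \<bar>C\<bar> * \<bar>g u\<bar>)"
    using i1 g bd' by (intro integral_mono) auto
  finally show ?b by simp
qed

text \<open>An approximate identity: \<open>a\<close> is an interior point, so for fixed
  \<open>u\<close> the indicator is eventually 1 and continuity at \<open>a\<close> decides the
  limit.\<close>

lemma rescaled_integral_tendsto:
  fixes F :: "real ^ 'd::finite \<Rightarrow> real"
  assumes S: "open S" "a \<in> S" and F: "F \<in> borel_measurable (restrict_space lborel S)" and bd: "\<And>s. s \<in> S \<Longrightarrow> \<bar>F s\<bar> \<le> C"
    and cont: "isCont F a" and g: "integrable lborel g" and h: "h \<longlonglongrightarrow> 0" "\<And>n. 0 < h n"
  shows "(\<lambda>n. LINT u|lborel. g u * (indicator S (a + h n *\<^sub>R u) * F (a + h n *\<^sub>R u))) \<longlonglongrightarrow> F a * integral\<^sup>L lborel g"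
proof -
  note [measurable] = indicator_times_meas[OF S(1) F]
  have [measurable]: "g \<in> borel_measurable borel" using g by simp
  have "(\<lambda>n. LINT u|lborel. g u * (indicator S (a + h n *\<^sub>R u) * F (a + h n *\<^sub>R u))) \<longlonglongrightarrow> (LINT u|lborel. g u * F a)"
  proof (rule integral_dominated_convergence[where w = "\<lambda>u. \<bar>C\<bar> * \<bar>g u\<bar>"])
    show "AE u in lborel. (\<lambda>n. g u * (indicator S (a + h n *\<^sub>R u) * F (a + h n *\<^sub>R u))) \<longlonglongrightarrow> g u * F a"
    proof (intro AE_I2 tendsto_mult_left)
      fix u
      have "(\<lambda>n. a + h n *\<^sub>R u) \<longlonglongrightarrow> a + 0 *\<^sub>R u"
        by (intro tendsto_intros h)
      then have t: "(\<lambda>n. a + h n *\<^sub>R u) \<longlonglongrightarrow> a" by simp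
      have "(\<lambda>n. F (a + h n *\<^sub>R u)) \<longlonglongrightarrow> F a"
        using cont t by (rule isCont_tendsto_compose)
      moreover have "\<forall>\<^sub>F n in sequentially. F (a + h n *\<^sub>R u) = indicator S (a + h n *\<^sub>R u) * F (a + h n *\<^sub>R u)"
        using topological_tendstoD[OF t S] by eventually_elim simp
      ultimately show "(\<lambda>n. indicator S (a + h n *\<^sub>R u) * F (a + h n *\<^sub>R u)) \<longlonglongrightarrow> F a"
        by (rule Lim_transform_eventually)
    qed
    show "AE u in lborel. norm (g u * (indicator S (a + h n *\<^sub>R u) * F (a + h n *\<^sub>R u))) \<le> \<bar>C\<bar> * \<bar>g u\<bar>" for n
    proof (intro AE_I2)
      fix u
      show "norm (g u * (indicator S (a + h n *\<^sub>R u) * F (a + h n *\<^sub>R u))) \<le> \<bar>C\<bar> * \<bar>g u\<bar>"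
        using bd[of "a + h n *\<^sub>R u"] by (auto simp: abs_mult mult.commute[of _ "\<bar>g u\<bar>"] indicator_def intro!: mult_left_mono)
    qed
  qed (use g in auto)
  then show ?thesis by (simp add: mult.commute)
qed

context kernel begin

text \<open>\<open>1 + 1 / \<delta>\<close> comes from \<open>clip_err_bound\<close>,
  \<open>2 / \<delta>^2\<close> from the error \<open>G\<close> of replacing the true argument by
  the clipped one in \<open>smoothing\<close>. The type argument carries the dimension in which the
  kernel moments are taken.\<close>

definition smooth_const :: "real \<Rightarrow> 'd::finite itself \<Rightarrow> real" where
  "smooth_const \<delta> (_ :: 'd::finite itself) = (1 + 1 / \<delta> + 2 / \<delta>\<^sup>2) *
     (\<Sum>j\<in>UNIV. LINT u|(lborel :: (real ^ 'd::finite) measure). \<bar>kprod k u\<bar> * (u $ j)\<^sup>2)"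

lemma smooth_const_nonneg: "0 < \<delta> \<Longrightarrow> 0 \<le> smooth_const \<delta> TYPE('d::finite)"
  unfolding smooth_const_def by (intro mult_nonneg_nonneg sum_nonneg integral_nonneg_AE AE_I2) auto

lemma Kh_integral_rescale:
  fixes F :: "real ^ 'd::finite \<Rightarrow> real"
  assumes "open S" "F \<in> borel_measurable (restrict_space lborel S)" "\<And>s. s \<in> S \<Longrightarrow> \<bar>F s\<bar> \<le> C" "0 < h"
  shows "(LINT s|restrict_space lborel S. Kh k h (s - a) * F s) =
      (LINT u|lborel. kprod k u * (indicator S (a + h *\<^sub>R u) * F (a + h *\<^sub>R u)))"
    and "h ^ CARD('d) * (LINT s|restrict_space lborel S. (Kh k h (s - a))\<^sup>2 * F s) =
      (LINT u|lborel. (kprod k u)\<^sup>2 * (indicator S (a + h *\<^sub>R u) * F (a + h *\<^sub>R u)))"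
    and "integrable (restrict_space lborel S) (\<lambda>s. Kh k h (s - a) * F s)"
    and "integrable (restrict_space lborel S) (\<lambda>s. (Kh k h (s - a))\<^sup>2 * F s)"
  using rescaled_integral[OF assms(1-3) kprod_int assms(4)] rescaled_integral[OF assms(1-3) kprod2_int assms(4)] assms(4)
  by (simp_all add: Kh_eq_kprod power_divide power2_eq_square)

text \<open>The smoothed value minus \<open>F a\<close> is \<open>clip_int\<close> over all
  coordinates plus the contribution of \<open>G\<close>, the difference between the values at the
  true and at the clipped argument. \<open>G\<close> vanishes unless some coordinate of
  \<open>h u\<close> exceeds \<open>\<delta>\<close>, so after division by \<open>h^2\<close> it is
  dominated and tends to zero for every fixed \<open>u\<close>.\<close>

lemma smoothing:
  fixes F :: "real ^ 'd::finite \<Rightarrow> real"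
  assumes C2: "C2_on_cube \<delta> a C F F1 F2" and S: "open S" "cube \<delta> a \<subseteq> S"
    and F: "F \<in> borel_measurable (restrict_space lborel S)" and bd: "\<And>s. s \<in> S \<Longrightarrow> \<bar>F s\<bar> \<le> C"
  shows smoothing_bound: "0 < h \<Longrightarrow> \<bar>(LINT s|restrict_space lborel S. Kh k h (s - a) * F s) - F a\<bar> \<le> C * smooth_const \<delta> TYPE('d) * h\<^sup>2"
    and smoothing_tendsto: "H \<longlonglongrightarrow> 0 \<Longrightarrow> (\<And>n. 0 < H n) \<Longrightarrow>
      (\<lambda>n. ((LINT s|restrict_space lborel S. Kh k (H n) (s - a) * F s) - F a) / (H n)\<^sup>2) \<longlonglongrightarrow>
        (LINT u|lborel. u\<^sup>2 * k u) / 2 * (\<Sum>j\<in>UNIV. F2 j a)"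
proof -
  note C2D = C2_on_cubeD[OF C2]
  have d: "0 < \<delta>" by (rule C2D)
  have a: "a \<in> cube \<delta> a" using d by (simp add: cube_def)
  have C: "0 \<le> C" using C2D(5)[OF a] by linarith
  note [measurable] = indicator_times_meas[OF S(1) F]
  have [measurable]: "(\<lambda>u. F (cpt \<delta> a h J u)) \<in> borel_measurable borel" for h J
    using comp_cpt_meas[OF C2D(2)] d by auto
  define G where "G h u = indicator S (a + h *\<^sub>R u) * F (a + h *\<^sub>R u) - F (cpt \<delta> a h UNIV u)" for h and u :: "real ^ 'd"
  have [measurable]: "G h \<in> borel_measurable borel" for h unfolding G_def by measurable
  have cpt: "cpt \<delta> a h UNIV u = a + h *\<^sub>R u" if "\<And>j. \<bar>h * u $ j\<bar> \<le> \<delta>" for h u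
    using that by (simp add: cpt_def clip_def vec_eq_iff)
  have G0: "G h u = 0" if "\<And>j. \<bar>h * u $ j\<bar> \<le> \<delta>" for h u
  proof -
    have "a + h *\<^sub>R u \<in> cube \<delta> a" using that by (simp add: cube_def)
    then show ?thesis using S cpt[OF that] by (auto simp: G_def)
  qed
  have G2: "\<bar>G h u\<bar> \<le> 2 * C" for h u
    using bd[of "a + h *\<^sub>R u"] C2D(5)[OF cpt_in_cube[of \<delta> a h UNIV u]] d C by (auto simp: G_def indicator_def)
  \<comment> \<open>Where \<open>G\<close> can be nonzero, some coordinate has
    \<open>\<bar>h * u $ j\<bar> > \<delta>\<close>, so the crude bound \<open>2 * C\<close> may be
    multiplied by \<open>(h * u $ j)^2 / \<delta>^2\<close>, which is at least 1.\<close>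
  have Gb: "\<bar>G h u\<bar> \<le> C * (2 / \<delta>\<^sup>2) * h\<^sup>2 * (\<Sum>j\<in>UNIV. (u $ j)\<^sup>2)" for h u
  proof (cases "\<forall>j. \<bar>h * u $ j\<bar> \<le> \<delta>")
    case True
    then show ?thesis using C by (simp add: G0 sum_nonneg)
  next
    case False
    then obtain j where j: "\<delta> < \<bar>h * u $ j\<bar>" by (auto simp: not_le)
    then have "\<delta>\<^sup>2 \<le> \<bar>h * u $ j\<bar>\<^sup>2" using d by (intro power_mono) auto
    then have "1 \<le> (h * u $ j)\<^sup>2 / \<delta>\<^sup>2" using d by simp
    also have "\<dots> \<le> h\<^sup>2 * (\<Sum>j\<in>UNIV. (u $ j)\<^sup>2) / \<delta>\<^sup>2"
      using member_le_sum[of j UNIV "\<lambda>j. (u $ j)\<^sup>2"]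
      by (intro divide_right_mono) (auto simp: power_mult_distrib intro!: mult_left_mono)
    finally have "2 * C * 1 \<le> 2 * C * (h\<^sup>2 * (\<Sum>j\<in>UNIV. (u $ j)\<^sup>2) / \<delta>\<^sup>2)"
      using C by (intro mult_left_mono) auto
    then show ?thesis using G2[of h u] by (simp add: mult_ac)
  qed
  let ?w = "\<lambda>u::real ^ 'd. C * (2 / \<delta>\<^sup>2) * (\<Sum>j\<in>UNIV. \<bar>kprod k u\<bar> * (u $ j)\<^sup>2)"
  have wi: "integrable lborel ?w"
    by (intro integrable_mult_right Bochner_Integration.integrable_sum kprod_abs_u2_int)
  have kG: "\<bar>kprod k u * G h u\<bar> \<le> h\<^sup>2 * ?w u" for h u
    using mult_left_mono[OF Gb[of h u], of "\<bar>kprod k u\<bar>"] by (simp add: abs_mult algebra_simps flip: sum_distrib_left)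
  have Gi: "integrable lborel (\<lambda>u. kprod k u * G h u)" for h
    by (rule Bochner_Integration.integrable_bound[OF integrable_mult_right[OF wi, of "h\<^sup>2"]])
      (use order_trans[OF kG abs_ge_self] in \<open>auto intro!: AE_I2\<close>)
  have split: "(LINT s|restrict_space lborel S. Kh k h (s - a) * F s) - F a
      = clip_int \<delta> a F h UNIV + (LINT u|lborel. kprod k u * G h u)" if h: "0 < h" for h
  proof -
    have ci: "integrable lborel (\<lambda>u. kprod k u * (F (cpt \<delta> a h UNIV u) - F a))"
    proof (rule kprod_times_bounded_int)
      fix u
      show "\<bar>F (cpt \<delta> a h UNIV u) - F a\<bar> \<le> C + C"
        using C2D(5)[OF cpt_in_cube[of \<delta> a h UNIV u]] C2D(5)[OF a] d by linarith
    qed measurable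
    have "clip_int \<delta> a F h UNIV + (LINT u|lborel. kprod k u * G h u) =
        (LINT u|lborel. kprod k u * (F (cpt \<delta> a h UNIV u) - F a) + kprod k u * G h u)"
      unfolding clip_int_def using ci Gi by (subst Bochner_Integration.integral_add) auto
    also have "\<dots> = (LINT u|lborel. kprod k u * (indicator S (a + h *\<^sub>R u) * F (a + h *\<^sub>R u)) - kprod k u * F a)"
      by (simp add: G_def algebra_simps)
    also have "\<dots> = (LINT u|lborel. kprod k u * (indicator S (a + h *\<^sub>R u) * F (a + h *\<^sub>R u))) - F a"
      using rescaled_integral(1)[OF S(1) F bd kprod_int h, of a] kprod_int
      by (subst Bochner_Integration.integral_diff) (auto simp: kprod_integral)
    finally show ?thesis using Kh_integral_rescale(1)[OF S(1) F bd h] by simp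
  qed
  show "\<bar>(LINT s|restrict_space lborel S. Kh k h (s - a) * F s) - F a\<bar> \<le> C * smooth_const \<delta> TYPE('d) * h\<^sup>2" if h: "0 < h"
  proof -
    have "\<bar>LINT u|lborel. kprod k u * G h u\<bar> \<le> (LINT u|lborel. \<bar>kprod k u * G h u\<bar>)"
      by (rule integral_abs_bound)
    also have "\<dots> \<le> (LINT u|lborel. h\<^sup>2 * ?w u)"
      by (intro integral_mono integrable_abs Gi integrable_mult_right wi kG)
    also have "\<dots> = C * (2 / \<delta>\<^sup>2) * h\<^sup>2 * (\<Sum>j\<in>UNIV. LINT u|(lborel::(real^'d) measure). \<bar>kprod k u\<bar> * (u $ j)\<^sup>2)"
    proof -
      have "(LINT u|(lborel::(real^'d) measure). (\<Sum>j\<in>UNIV. \<bar>kprod k u\<bar> * (u $ j)\<^sup>2)) = (\<Sum>j\<in>UNIV. LINT u|(lborel::(real^'d) measure). \<bar>kprod k u\<bar> * (u $ j)\<^sup>2)"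
        by (rule Bochner_Integration.integral_sum) (rule kprod_abs_u2_int)
      then show ?thesis by simp
    qed
    finally show ?thesis
      using clip_int_bound[OF C2, of h UNIV] split[OF h] unfolding smooth_const_def
      by (simp add: algebra_simps)
  qed
  show "(\<lambda>n. ((LINT s|restrict_space lborel S. Kh k (H n) (s - a) * F s) - F a) / (H n)\<^sup>2) \<longlonglongrightarrow>
        (LINT u|lborel. u\<^sup>2 * k u) / 2 * (\<Sum>j\<in>UNIV. F2 j a)" if H: "H \<longlonglongrightarrow> 0" "\<And>n. 0 < H n"
  proof -
    have "(\<lambda>n. LINT u|lborel. kprod k u * G (H n) u / (H n)\<^sup>2) \<longlonglongrightarrow> (LINT u|(lborel::(real^'d) measure). 0)"
    proof (rule integral_dominated_convergence[OF _ _ wi])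
      show "AE u in lborel. (\<lambda>n. kprod k u * G (H n) u / (H n)\<^sup>2) \<longlonglongrightarrow> 0"
      proof (intro AE_I2 tendsto_eventually)
        fix u :: "real ^ 'd"
        have "(\<lambda>n. \<bar>H n * u $ j\<bar>) \<longlonglongrightarrow> 0" for j
          using H by (intro tendsto_rabs_zero tendsto_mult_left_zero)
        then have "\<forall>\<^sub>F n in sequentially. \<forall>j. \<bar>H n * u $ j\<bar> < \<delta>"
          using d by (intro eventually_all_finite order_tendstoD(2))
        then show "\<forall>\<^sub>F n in sequentially. kprod k u * G (H n) u / (H n)\<^sup>2 = 0"
          by eventually_elim (simp add: G0 less_imp_le)
      qed
      show "AE u in lborel. norm (kprod k u * G (H n) u / (H n)\<^sup>2) \<le> ?w u" for n
        using kG[of _ "H n"] H(2)[of n] by (intro AE_I2) (simp add: divide_le_eq mult.commute)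
    qed simp_all
    then have "(\<lambda>n. clip_int \<delta> a F (H n) UNIV / (H n)\<^sup>2 + (LINT u|lborel. kprod k u * G (H n) u / (H n)\<^sup>2)) \<longlonglongrightarrow>
        (LINT u|lborel. u\<^sup>2 * k u) / 2 * (\<Sum>j\<in>UNIV. F2 j a) + 0"
      by (intro tendsto_add clip_int_tendsto[OF C2 H]) simp
    then show ?thesis using H(2) by (simp add: split add_divide_distrib)
  qed
qed

end

section \<open>Moments of the kernel-localised moment function\<close>

lemma Cauchy_Schwarz_integral:
  fixes x y :: "'a \<Rightarrow> real"
  assumes [measurable]: "x \<in> borel_measurable M" "y \<in> borel_measurable M"
    and x: "integrable M (\<lambda>w. (x w)\<^sup>2)" and y: "integrable M (\<lambda>w. (y w)\<^sup>2)"
  shows "integrable M (\<lambda>w. x w * y w)"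
    and "(LINT w|M. \<bar>x w * y w\<bar>) \<le> sqrt (LINT w|M. (x w)\<^sup>2) * sqrt (LINT w|M. (y w)\<^sup>2)"
    and "\<bar>LINT w|M. x w * y w\<bar> \<le> sqrt (LINT w|M. (x w)\<^sup>2) * sqrt (LINT w|M. (y w)\<^sup>2)"
proof -
  have amgm: "2 * \<bar>x w * y w\<bar> \<le> t * (x w)\<^sup>2 + (1 / t) * (y w)\<^sup>2" if "0 < t" for t w
  proof -
    have "0 \<le> (sqrt t * \<bar>x w\<bar> - sqrt (1 / t) * \<bar>y w\<bar>)\<^sup>2" by simp
    also have "\<dots> = t * (x w)\<^sup>2 + (1 / t) * (y w)\<^sup>2 - 2 * (sqrt t * sqrt (1 / t)) * \<bar>x w * y w\<bar>"
      using that by (simp add: power2_diff power_mult_distrib abs_mult)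
    also have "sqrt t * sqrt (1 / t) = 1" using that by (simp flip: real_sqrt_mult)
    finally show ?thesis by simp
  qed
  have "\<bar>x w * y w\<bar> \<le> (x w)\<^sup>2 + (y w)\<^sup>2" for w
    using amgm[of 1 w] by simp
  then show i: "integrable M (\<lambda>w. x w * y w)"
    by (intro Bochner_Integration.integrable_bound[OF Bochner_Integration.integrable_add[OF x y]])
      (auto intro!: AE_I2)
  define p q r where "p = (LINT w|M. (x w)\<^sup>2)" and "q = (LINT w|M. (y w)\<^sup>2)" and "r = (LINT w|M. \<bar>x w * y w\<bar>)"
  have nn: "0 \<le> p" "0 \<le> q" "0 \<le> r" by (simp_all add: p_def q_def r_def)
  \<comment> \<open>The integrated arithmetic-geometric mean inequality with a free weight
    \<open>t\<close>; the claim follows by a good choice of \<open>t\<close>.\<close>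
  have *: "2 * r \<le> t * p + (1 / t) * q" if t: "0 < t" for t
  proof -
    have "2 * r = (LINT w|M. 2 * \<bar>x w * y w\<bar>)" by (simp add: r_def)
    also have "\<dots> \<le> (LINT w|M. t * (x w)\<^sup>2 + (1 / t) * (y w)\<^sup>2)"
      using i x y amgm[OF t] by (intro integral_mono) auto
    also have "\<dots> = t * p + (1 / t) * q" using x y by (simp add: p_def q_def)
    finally show ?thesis .
  qed
  have "r \<le> sqrt p * sqrt q"
  proof (cases "0 < p \<and> 0 < q")
    case True
    \<comment> \<open>Minimises \<open>t * p + q / t\<close>, with minimum
      \<open>2 * sqrt (p * q)\<close>.\<close>
    define t where "t = sqrt q / sqrt p"
    have "t * p = sqrt q * (p / sqrt p)" by (simp add: t_def)
    moreover have "(1 / t) * q = sqrt p * (q / sqrt q)" by (simp add: t_def)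
    ultimately have "t * p + (1 / t) * q = 2 * (sqrt p * sqrt q)"
      using nn by (simp add: real_div_sqrt)
    moreover have "0 < t" using True by (simp add: t_def)
    ultimately show ?thesis using *[of t] by simp
  next
    case False
    have "r \<le> 0"
    proof (rule ccontr)
      assume "\<not> r \<le> 0"
      then have r: "0 < r" by simp
      consider "p = 0" | "q = 0" using False nn by linarith
      then show False
      proof cases
        case 1
        \<comment> \<open>With one of the two integrals zero there is no minimiser; this weight
          makes the right-hand side at most \<open>r\<close>, against \<open>2 * r\<close> on the
          left.\<close>
        have "0 < (q + 1) / r" using r nn by simp
        from *[OF this] have "2 * r \<le> r * q / (q + 1)" using 1 nn by simp
        also have "\<dots> \<le> r" using nn r by (simp add: divide_le_eq algebra_simps)
        finally show False using r by simp
      next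
        case 2
        have "0 < r / (p + 1)" using r nn by simp
        from *[OF this] have "2 * r \<le> r * p / (p + 1)" using 2 nn by simp
        also have "\<dots> \<le> r" using nn r by (simp add: divide_le_eq algebra_simps)
        finally show False using r by simp
      qed
    qed
    then show ?thesis using nn by (smt (verit) mult_nonneg_nonneg real_sqrt_ge_zero)
  qed
  then show "(LINT w|M. \<bar>x w * y w\<bar>) \<le> sqrt (LINT w|M. (x w)\<^sup>2) * sqrt (LINT w|M. (y w)\<^sup>2)"
    by (simp add: p_def q_def r_def)
  then show "\<bar>LINT w|M. x w * y w\<bar> \<le> sqrt (LINT w|M. (x w)\<^sup>2) * sqrt (LINT w|M. (y w)\<^sup>2)"
    using integral_abs_bound[of M "\<lambda>w. x w * y w"] by linarith
qed

lemma integrable_sum_sq: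
  fixes x y :: "'a \<Rightarrow> real"
  assumes [measurable]: "x \<in> borel_measurable M" "y \<in> borel_measurable M"
    and x: "integrable M (\<lambda>w. (x w)\<^sup>2)" and y: "integrable M (\<lambda>w. (y w)\<^sup>2)"
  shows "integrable M (\<lambda>w. (x w + y w)\<^sup>2)"
    and "(LINT w|M. (x w + y w)\<^sup>2) \<le> 2 * (LINT w|M. (x w)\<^sup>2) + 2 * (LINT w|M. (y w)\<^sup>2)"
proof -
  have b: "(x w + y w)\<^sup>2 \<le> 2 * (x w)\<^sup>2 + 2 * (y w)\<^sup>2" for w
    using sum_squares_bound[of "x w" "y w"] by (simp add: power2_sum)
  show i: "integrable M (\<lambda>w. (x w + y w)\<^sup>2)"
    by (rule Bochner_Integration.integrable_bound[of _ "\<lambda>w. 2 * (x w)\<^sup>2 + 2 * (y w)\<^sup>2"]) (use x y b in \<open>auto intro!: AE_I2\<close>)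
  have "(LINT w|M. (x w + y w)\<^sup>2) \<le> (LINT w|M. 2 * (x w)\<^sup>2 + 2 * (y w)\<^sup>2)"
    using i x y b by (intro integral_mono) auto
  then show "(LINT w|M. (x w + y w)\<^sup>2) \<le> 2 * (LINT w|M. (x w)\<^sup>2) + 2 * (LINT w|M. (y w)\<^sup>2)"
    using x y by simp
qed

text \<open>\<open>c n\<close> will be the scale \<open>h^d\<close>. A summand that vanishes at this
  scale does not change the limit: its cross term is bounded by Cauchy-Schwarz, where the other
  factor converges.\<close>

lemma tendsto_integral_sum_sq:
  fixes x y :: "nat \<Rightarrow> 'a \<Rightarrow> real"
  assumes m: "\<And>n. x n \<in> borel_measurable M" "\<And>n. y n \<in> borel_measurable M"
    and i: "\<And>n. integrable M (\<lambda>w. (x n w)\<^sup>2)" "\<And>n. integrable M (\<lambda>w. (y n w)\<^sup>2)"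
    and x: "(\<lambda>n. c n * (LINT w|M. (x n w)\<^sup>2)) \<longlonglongrightarrow> 0" and y: "(\<lambda>n. c n * (LINT w|M. (y n w)\<^sup>2)) \<longlonglongrightarrow> V"
    and c: "\<And>n. 0 \<le> c n"
  shows "(\<lambda>n. c n * (LINT w|M. (x n w + y n w)\<^sup>2)) \<longlonglongrightarrow> V"
proof -
  note CS = Cauchy_Schwarz_integral[OF m i]
  have "(\<lambda>n. c n * (LINT w|M. x n w * y n w)) \<longlonglongrightarrow> 0"
  proof (rule Lim_null_comparison)
    show "\<forall>\<^sub>F n in sequentially. norm (c n * (LINT w|M. x n w * y n w)) \<le>
       sqrt (c n * (LINT w|M. (x n w)\<^sup>2)) * sqrt (c n * (LINT w|M. (y n w)\<^sup>2))"
    proof (intro always_eventually allI)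
      fix n
      have "sqrt (c n * (LINT w|M. (x n w)\<^sup>2)) * sqrt (c n * (LINT w|M. (y n w)\<^sup>2)) =
        c n * (sqrt (LINT w|M. (x n w)\<^sup>2) * sqrt (LINT w|M. (y n w)\<^sup>2))"
        using c[of n] by (simp add: real_sqrt_mult algebra_simps flip: power2_eq_square)
      then show "norm (c n * (LINT w|M. x n w * y n w)) \<le> sqrt (c n * (LINT w|M. (x n w)\<^sup>2)) * sqrt (c n * (LINT w|M. (y n w)\<^sup>2))"
        using CS(3)[of n] c[of n] by (auto simp: abs_mult intro!: mult_left_mono)
    qed
    show "(\<lambda>n. sqrt (c n * (LINT w|M. (x n w)\<^sup>2)) * sqrt (c n * (LINT w|M. (y n w)\<^sup>2))) \<longlonglongrightarrow> 0"
      using tendsto_mult[OF tendsto_real_sqrt[OF x] tendsto_real_sqrt[OF y]] by simp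
  qed
  from tendsto_add[OF tendsto_add[OF x tendsto_mult_left[OF this, of 2]] y]
  have "(\<lambda>n. c n * (LINT w|M. (x n w)\<^sup>2) + 2 * (c n * (LINT w|M. x n w * y n w)) + c n * (LINT w|M. (y n w)\<^sup>2)) \<longlonglongrightarrow> V"
    by simp
  moreover have "c n * (LINT w|M. (x n w + y n w)\<^sup>2) =
      c n * (LINT w|M. (x n w)\<^sup>2) + 2 * (c n * (LINT w|M. x n w * y n w)) + c n * (LINT w|M. (y n w)\<^sup>2)" for n
  proof -
    have "(LINT w|M. (x n w + y n w)\<^sup>2) = (LINT w|M. (x n w)\<^sup>2 + 2 * (x n w * y n w) + (y n w)\<^sup>2)"
      by (simp add: power2_sum algebra_simps)
    also have "\<dots> = (LINT w|M. (x n w)\<^sup>2) + 2 * (LINT w|M. x n w * y n w) + (LINT w|M. (y n w)\<^sup>2)"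
      using i[of n] CS(1)[of n] by simp
    finally show ?thesis by (simp add: algebra_simps)
  qed
  ultimately show ?thesis by simp
qed

text \<open>\<open>f\<close> is the density of \<open>A\<close> given \<open>Z\<close> with respect to Lebesgue measure on \<open>S\<close>; \<open>g\<close> and \<open>v\<close> are the
  conditional mean and variance of \<open>Y\<close> given \<open>(A, Z)\<close>.\<close>

locale kernel_model = kernel k + prob_space P for k and P :: "'w measure" +
  fixes S :: "(real ^ 'd::finite) set" and NZ :: "'z measure"
    and A :: "'w \<Rightarrow> real ^ 'd" and Z :: "'w \<Rightarrow> 'z" and Y :: "'w \<Rightarrow> real"
    and f g v :: "real ^ 'd \<Rightarrow> 'z \<Rightarrow> real" and f1 f2 g1 g2 :: "'d \<Rightarrow> real ^ 'd \<Rightarrow> 'z \<Rightarrow> real" and C :: real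
  assumes S: "open S" and C1: "1 \<le> C"
    and Z_meas [measurable]: "Z \<in> measurable P NZ" and Y_meas [measurable]: "Y \<in> borel_measurable P"
    and A_meas [measurable]: "A \<in> measurable P (restrict_space lborel S)"
    and f_meas [measurable]: "(\<lambda>p. f (fst p) (snd p)) \<in> borel_measurable (restrict_space lborel S \<Otimes>\<^sub>M NZ)"
    and g_meas [measurable]: "(\<lambda>p. g (fst p) (snd p)) \<in> borel_measurable (restrict_space lborel S \<Otimes>\<^sub>M NZ)"
    and v_meas [measurable]: "(\<lambda>p. v (fst p) (snd p)) \<in> borel_measurable (restrict_space lborel S \<Otimes>\<^sub>M NZ)"
    and f_nonneg: "\<And>s z. s \<in> S \<Longrightarrow> z \<in> space NZ \<Longrightarrow> 0 \<le> f s z"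
    and v_nonneg: "\<And>s z. s \<in> S \<Longrightarrow> z \<in> space NZ \<Longrightarrow> 0 \<le> v s z"
    and bounds: "\<And>s z. s \<in> S \<Longrightarrow> z \<in> space NZ \<Longrightarrow> \<bar>f s z\<bar> \<le> C \<and> \<bar>g s z\<bar> \<le> C \<and> \<bar>v s z\<bar> \<le> C"
    and bounds_deriv: "\<And>s z j. s \<in> S \<Longrightarrow> z \<in> space NZ \<Longrightarrow> \<bar>f1 j s z\<bar> \<le> C \<and> \<bar>f2 j s z\<bar> \<le> C \<and> \<bar>g1 j s z\<bar> \<le> C \<and> \<bar>g2 j s z\<bar> \<le> C"
    and cont: "\<And>z. z \<in> space NZ \<Longrightarrow> continuous_on S (\<lambda>s. f s z) \<and> continuous_on S (\<lambda>s. g s z) \<and> continuous_on S (\<lambda>s. v s z)"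
    and cont_deriv: "\<And>z j. z \<in> space NZ \<Longrightarrow> continuous_on S (\<lambda>s. f1 j s z) \<and> continuous_on S (\<lambda>s. f2 j s z) \<and>
        continuous_on S (\<lambda>s. g1 j s z) \<and> continuous_on S (\<lambda>s. g2 j s z)"
    and deriv: "\<And>s z j. s \<in> S \<Longrightarrow> z \<in> space NZ \<Longrightarrow>
        ((\<lambda>t. f (s + t *\<^sub>R axis j 1) z) has_real_derivative f1 j s z) (at 0) \<and>
        ((\<lambda>t. f1 j (s + t *\<^sub>R axis j 1) z) has_real_derivative f2 j s z) (at 0) \<and>
        ((\<lambda>t. g (s + t *\<^sub>R axis j 1) z) has_real_derivative g1 j s z) (at 0) \<and>
        ((\<lambda>t. g1 j (s + t *\<^sub>R axis j 1) z) has_real_derivative g2 j s z) (at 0)"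
    and law: "distributed P (restrict_space lborel S \<Otimes>\<^sub>M distr P NZ Z) (\<lambda>w. (A w, Z w)) (\<lambda>p. ennreal (f (fst p) (snd p)))"
    and Y1: "\<And>b. (\<lambda>p. b (fst p) (snd p)) \<in> borel_measurable (restrict_space lborel S \<Otimes>\<^sub>M NZ) \<Longrightarrow>
        integrable P (\<lambda>w. b (A w) (Z w)) \<Longrightarrow>
        has_bochner_integral P (\<lambda>w. b (A w) (Z w) * Y w) (LINT w|P. b (A w) (Z w) * g (A w) (Z w))"
    and Y2: "\<And>b. (\<lambda>p. b (fst p) (snd p)) \<in> borel_measurable (restrict_space lborel S \<Otimes>\<^sub>M NZ) \<Longrightarrow>
        integrable P (\<lambda>w. b (A w) (Z w)) \<Longrightarrow>
        has_bochner_integral P (\<lambda>w. b (A w) (Z w) * (Y w)\<^sup>2) (LINT w|P. b (A w) (Z w) * (v (A w) (Z w) + (g (A w) (Z w))\<^sup>2))"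
begin

abbreviation "RA \<equiv> restrict_space lborel S"

lemma C0: "0 \<le> C" using C1 by simp

lemma A_in: "w \<in> space P \<Longrightarrow> A w \<in> S" and Z_in: "w \<in> space P \<Longrightarrow> Z w \<in> space NZ"
  using measurable_space[OF A_meas] measurable_space[OF Z_meas] by (auto simp: space_restrict_space)

lemma AZ_meas [measurable]: "(\<lambda>w. (A w, Z w)) \<in> measurable P (RA \<Otimes>\<^sub>M NZ)"
  by measurable

lemma comp_AZ_meas:
  assumes "(\<lambda>p. G (fst p) (snd p)) \<in> borel_measurable (RA \<Otimes>\<^sub>M NZ)"
  shows "(\<lambda>w. G (A w) (Z w) :: real) \<in> borel_measurable P"
  using measurable_compose[OF AZ_meas assms] by simp

lemma section_meas:
  assumes "(\<lambda>p. G (fst p) (snd p)) \<in> borel_measurable (RA \<Otimes>\<^sub>M NZ)"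
  shows "z \<in> space NZ \<Longrightarrow> (\<lambda>s. G s z :: real) \<in> borel_measurable RA"
    and "s \<in> S \<Longrightarrow> (\<lambda>z. G s z) \<in> borel_measurable NZ"
  using measurable_compose[OF measurable_Pair2' assms] measurable_compose[OF measurable_Pair1' assms]
  by (auto simp: space_restrict_space)

lemma RA_sigma_finite: "sigma_finite_measure RA"
  using S by (intro sigma_finite_measure_restrict_space) (auto simp: sigma_finite_lborel)

lemma pair_sf: "pair_sigma_finite RA (distr P NZ Z)"
proof -
  interpret PZ: prob_space "distr P NZ Z" by (rule prob_space_distr) simp
  show ?thesis
    by (intro pair_sigma_finite.intro RA_sigma_finite PZ.sigma_finite_measure_axioms)
qed

text \<open>Fubini for the law of \<open>(A, Z)\<close>, which has density \<open>f\<close> relative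
  to Lebesgue measure times the law of \<open>Z\<close>. The latter is a probability measure, so a
  bound on the inner integrals that is uniform in \<open>z\<close> gives joint
  integrability.\<close>

lemma E_AZ:
  fixes G :: "real ^ 'd \<Rightarrow> 'z \<Rightarrow> real"
  assumes G: "(\<lambda>p. G (fst p) (snd p)) \<in> borel_measurable (RA \<Otimes>\<^sub>M NZ)"
    and i: "\<And>z. z \<in> space NZ \<Longrightarrow> integrable RA (\<lambda>s. G s z * f s z)"
    and bd: "\<And>z. z \<in> space NZ \<Longrightarrow> (LINT s|RA. \<bar>G s z * f s z\<bar>) \<le> M"
  shows "integrable P (\<lambda>w. G (A w) (Z w))"
    and "integrable P (\<lambda>w. LINT s|RA. G s (Z w) * f s (Z w))"
    and "(LINT w|P. G (A w) (Z w)) = (LINT w|P. LINT s|RA. G s (Z w) * f s (Z w))"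
proof -
  interpret PZ: prob_space "distr P NZ Z" by (rule prob_space_distr) simp
  interpret pair_sigma_finite RA "distr P NZ Z" by (rule pair_sf)
  have sets_eq: "sets (RA \<Otimes>\<^sub>M distr P NZ Z) = sets (RA \<Otimes>\<^sub>M NZ)" by (intro sets_pair_measure_cong) auto
  have [measurable]: "(\<lambda>p. G (fst p) (snd p)) \<in> borel_measurable (RA \<Otimes>\<^sub>M distr P NZ Z)"
    "(\<lambda>p. f (fst p) (snd p)) \<in> borel_measurable (RA \<Otimes>\<^sub>M distr P NZ Z)"
    using G f_meas by (simp_all cong: measurable_cong_sets add: measurable_cong_sets[OF sets_eq refl])
  let ?H = "\<lambda>p. G (fst p) (snd p) * f (fst p) (snd p)"
  have nn: "0 \<le> f (fst p) (snd p)" if "p \<in> space (RA \<Otimes>\<^sub>M distr P NZ Z)" for p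
    using that by (auto simp: space_pair_measure space_restrict_space intro!: f_nonneg)
  have int: "integrable (RA \<Otimes>\<^sub>M distr P NZ Z) ?H"
  proof (rule integrableI_bounded)
    have "(\<integral>\<^sup>+ p. ennreal (norm (?H p)) \<partial>(RA \<Otimes>\<^sub>M distr P NZ Z)) =
        (\<integral>\<^sup>+ z. \<integral>\<^sup>+ s. ennreal (norm (G s z * f s z)) \<partial>RA \<partial>distr P NZ Z)"
      by (subst nn_integral_snd[symmetric]) (auto simp: split_beta')
    also have "\<dots> \<le> (\<integral>\<^sup>+ z. ennreal M \<partial>distr P NZ Z)"
    proof (rule nn_integral_mono)
      fix z assume "z \<in> space (distr P NZ Z)"
      then have z: "z \<in> space NZ" by simp
      have "(\<integral>\<^sup>+ s. ennreal (norm (G s z * f s z)) \<partial>RA) = ennreal (LINT s|RA. \<bar>G s z * f s z\<bar>)"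
        using i[OF z] by (subst nn_integral_eq_integral) auto
      also have "\<dots> \<le> ennreal M" by (intro ennreal_leI bd z)
      finally show "(\<integral>\<^sup>+ s. ennreal (norm (G s z * f s z)) \<partial>RA) \<le> ennreal M" .
    qed
    also have "\<dots> < \<infinity>" by (simp add: PZ.emeasure_space_1 del: space_distr)
    finally show "(\<integral>\<^sup>+ p. ennreal (norm (?H p)) \<partial>(RA \<Otimes>\<^sub>M distr P NZ Z)) < \<infinity>" .
  qed measurable
  have "integrable (RA \<Otimes>\<^sub>M distr P NZ Z) (\<lambda>p. f (fst p) (snd p) * G (fst p) (snd p)) \<longleftrightarrow> integrable P (\<lambda>w. G (fst (A w, Z w)) (snd (A w, Z w)))"
    by (rule distributed_integrable[OF law]) (use nn in auto)
  then show "integrable P (\<lambda>w. G (A w) (Z w))"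
    using int by (simp add: mult.commute)
  have iz: "integrable (distr P NZ Z) (\<lambda>z. LINT s|RA. G s z * f s z)"
    using integrable_snd[of "\<lambda>s z. G s z * f s z"] int by (simp add: split_beta')
  have m: "(\<lambda>z. LINT s|RA. G s z * f s z) \<in> borel_measurable NZ"
    using borel_measurable_integrable[OF iz] by simp
  show "integrable P (\<lambda>w. LINT s|RA. G s (Z w) * f s (Z w))"
    by (rule integrable_distr[OF Z_meas iz])
  have "(LINT w|P. G (A w) (Z w)) = (LINT p|(RA \<Otimes>\<^sub>M distr P NZ Z). f (fst p) (snd p) * G (fst p) (snd p))"
    using distributed_integral[OF law, of "\<lambda>p. G (fst p) (snd p)"] nn by simp
  also have "\<dots> = (LINT z|distr P NZ Z. LINT s|RA. G s z * f s z)"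
    using integral_snd[of "\<lambda>s z. G s z * f s z"] int by (simp add: split_beta' mult.commute)
  also have "\<dots> = (LINT w|P. LINT s|RA. G s (Z w) * f s (Z w))"
    using m by (simp add: integral_distr)
  finally show "(LINT w|P. G (A w) (Z w)) = (LINT w|P. LINT s|RA. G s (Z w) * f s (Z w))" .
qed

end

section \<open>Localised conditional expectations\<close>

context kernel_model begin

text \<open>\<open>h^(-d)\<close> times the conditional expectation of
  \<open>q ((A - a) / h) * c A Z\<close> given \<open>Z = z\<close>, written in the rescaled
  variable, where its limit as \<open>h\<close> tends to 0 and a bound free of \<open>h\<close> are
  visible.\<close>

definition locint :: "(real ^ 'd \<Rightarrow> real) \<Rightarrow> real \<Rightarrow> real ^ 'd \<Rightarrow> (real ^ 'd \<Rightarrow> 'z \<Rightarrow> real) \<Rightarrow> 'z \<Rightarrow> real" where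
  "locint q h a c z = (LINT t|lborel. q t * (indicator S (a + h *\<^sub>R t) * (c (a + h *\<^sub>R t) z * f (a + h *\<^sub>R t) z)))"

text \<open>Bounded measurable weights, with the bound kept as an argument: integrability under
  \<open>P\<close> becomes automatic and constants can be propagated through products.\<close>

definition adm :: "(real ^ 'd \<Rightarrow> 'z \<Rightarrow> real) \<Rightarrow> real \<Rightarrow> bool" where
  "adm c M \<longleftrightarrow> 0 \<le> M \<and> (\<lambda>p. c (fst p) (snd p)) \<in> borel_measurable (RA \<Otimes>\<^sub>M NZ) \<and> (\<forall>s\<in>S. \<forall>z\<in>space NZ. \<bar>c s z\<bar> \<le> M)"

definition admZ :: "('z \<Rightarrow> real) \<Rightarrow> real \<Rightarrow> bool" where
  "admZ u B \<longleftrightarrow> u \<in> borel_measurable NZ \<and> (\<forall>z\<in>space NZ. \<bar>u z\<bar> \<le> B)"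

lemma admZ_meas: "admZ u B \<Longrightarrow> u \<in> borel_measurable NZ"
  and admZ_bd: "admZ u B \<Longrightarrow> z \<in> space NZ \<Longrightarrow> \<bar>u z\<bar> \<le> B"
  and adm_meas: "adm c M \<Longrightarrow> (\<lambda>p. c (fst p) (snd p)) \<in> borel_measurable (RA \<Otimes>\<^sub>M NZ)"
  and adm_bd: "adm c M \<Longrightarrow> s \<in> S \<Longrightarrow> z \<in> space NZ \<Longrightarrow> \<bar>c s z\<bar> \<le> M"
  and adm_nonneg: "adm c M \<Longrightarrow> 0 \<le> M"
  by (auto simp: admZ_def adm_def)

lemma admZ_nonneg: "admZ u B \<Longrightarrow> 0 \<le> B"
proof -
  assume u: "admZ u B"
  obtain w where "w \<in> space P" using not_empty by auto
  then show ?thesis using admZ_bd[OF u Z_in] abs_ge_zero order_trans by blast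
qed

lemma admZ_int:
  assumes "admZ u B"
  shows "(\<lambda>w. u (Z w)) \<in> borel_measurable P" "integrable P (\<lambda>w. u (Z w))"
proof -
  show m: "(\<lambda>w. u (Z w)) \<in> borel_measurable P"
    by (rule measurable_compose[OF Z_meas admZ_meas[OF assms]])
  show "integrable P (\<lambda>w. u (Z w))"
    by (rule integrable_const_bound[of _ B]) (use admZ_bd[OF assms Z_in] m in \<open>auto intro!: AE_I2\<close>)
qed

lemma admZ_sq: "admZ u B \<Longrightarrow> admZ (\<lambda>z. (u z)\<^sup>2) (B\<^sup>2)"
  using admZ_nonneg[of u B] by (auto simp: admZ_def abs_le_square_iff power2_abs intro!: power_mono[of "\<bar>u _\<bar>" B 2, unfolded power2_abs])

lemma admZ_abs: "admZ u B \<Longrightarrow> admZ (\<lambda>z. \<bar>u z\<bar>) B"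
  by (auto simp: admZ_def)

lemma admZ_sq_int: "admZ u B \<Longrightarrow> integrable P (\<lambda>w. (u (Z w))\<^sup>2)"
  using admZ_int(2)[OF admZ_sq] .

lemma admZ_mult: "admZ u B \<Longrightarrow> admZ u' B' \<Longrightarrow> admZ (\<lambda>z. u z * u' z) (B * B')"
  using admZ_nonneg[of u B] by (auto simp: admZ_def abs_mult intro!: mult_mono)

lemma adm_mult: "adm c M \<Longrightarrow> adm c' M' \<Longrightarrow> adm (\<lambda>s z. c s z * c' s z) (M * M')"
  by (auto simp: adm_def abs_mult intro!: mult_mono)

lemma adm_sq: "adm c M \<Longrightarrow> adm (\<lambda>s z. (c s z)\<^sup>2) (M\<^sup>2)"
  unfolding power2_eq_square by (rule adm_mult)

lemma adm_one: "adm (\<lambda>_ _. 1) 1"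
  by (auto simp: adm_def)

lemma adm_f: "adm f C" and adm_g: "adm g C" and adm_v: "adm v C"
  using bounds C0 by (auto simp: adm_def)

lemma admZ_f: "a \<in> S \<Longrightarrow> admZ (f a) C" and admZ_g: "a \<in> S \<Longrightarrow> admZ (g a) C" and admZ_v: "a \<in> S \<Longrightarrow> admZ (v a) C"
  using bounds section_meas(2)[OF f_meas] section_meas(2)[OF g_meas] section_meas(2)[OF v_meas] by (auto simp: admZ_def)

text \<open>The square root turns the conditional variance into a squared weight, so that
  \<open>Kh_square\<close> applies to it. Since \<open>1 \<le> C\<close>, the bound
  \<open>v \<le> C\<close> implies \<open>sqrt v \<le> C\<close>.\<close>

lemma adm_sqrt_v: "adm (\<lambda>s z. sqrt (v s z)) C"
proof -
  have "\<bar>sqrt (v s z)\<bar> \<le> C" if "s \<in> S" "z \<in> space NZ" for s z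
  proof -
    have "sqrt (v s z) \<le> sqrt (C\<^sup>2)"
      using bounds[OF that] C1 by (intro real_sqrt_le_mono) (auto simp: power2_eq_square intro: order_trans[of _ C])
    then show ?thesis using v_nonneg[OF that] C0 by simp
  qed
  then show ?thesis using C0 v_meas by (auto simp: adm_def)
qed

lemma adm_gdiff: "a \<in> S \<Longrightarrow> adm (\<lambda>s z. g s z - g a z) (2 * C)"
proof -
  assume a: "a \<in> S"
  have "(\<lambda>p. g a (snd p)) \<in> borel_measurable (RA \<Otimes>\<^sub>M NZ)"
    by (rule measurable_compose[OF measurable_snd admZ_meas[OF admZ_g[OF a]]])
  moreover have "\<bar>g s z - g a z\<bar> \<le> 2 * C" if "s \<in> S" "z \<in> space NZ" for s z
    using bounds[OF that] bounds[OF a that(2)] by linarith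
  ultimately show ?thesis using C0 g_meas by (auto simp: adm_def)
qed

lemma shift_meas [measurable]: "(\<lambda>p. (1 / h) *\<^sub>R (fst p - a)) \<in> measurable (RA \<Otimes>\<^sub>M NZ) borel"
proof -
  have "fst \<in> measurable (RA \<Otimes>\<^sub>M NZ) borel"
    by (rule measurable_compose[OF measurable_fst]) (auto intro: measurable_restrict_space1)
  then show ?thesis by measurable
qed

lemma Kh_meas [measurable]: "(\<lambda>p. Kh k h (fst p - a)) \<in> borel_measurable (RA \<Otimes>\<^sub>M NZ)"
  unfolding Kh_eq_kprod using measurable_compose[OF shift_meas kprod_meas] by measurable

text \<open>Fubini (\<open>E_AZ\<close>) followed by the substitution of
  \<open>rescaled_integral\<close>: localising at bandwidth \<open>h\<close> costs the volume factor
  \<open>h ^ CARD('d)\<close>.\<close>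

lemma local_integral:
  assumes q: "integrable lborel q" and c: "adm c M" and u: "admZ u B" and h: "0 < h"
  shows "integrable P (\<lambda>w. q ((1 / h) *\<^sub>R (A w - a)) * (u (Z w) * c (A w) (Z w)))"
    and "integrable P (\<lambda>w. u (Z w) * locint q h a c (Z w))"
    and "(LINT w|P. q ((1 / h) *\<^sub>R (A w - a)) * (u (Z w) * c (A w) (Z w))) =
      h ^ CARD('d) * (LINT w|P. u (Z w) * locint q h a c (Z w))"
    and "z \<in> space NZ \<Longrightarrow> \<bar>locint q h a c z\<bar> \<le> M * C * (LINT t|lborel. \<bar>q t\<bar>)"
proof -
  have [measurable]: "q \<in> borel_measurable borel" using q by simp
  have [measurable]: "(\<lambda>p. c (fst p) (snd p)) \<in> borel_measurable (RA \<Otimes>\<^sub>M NZ)" by (rule adm_meas[OF c])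
  have [measurable]: "u \<in> borel_measurable NZ" by (rule admZ_meas[OF u])
  have cf: "adm (\<lambda>s z. c s z * f s z) (M * C)" by (rule adm_mult[OF c adm_f])
  have M: "0 \<le> M * C" using adm_nonneg[OF cf] .
  have sec: "(\<lambda>s. c s z * f s z) \<in> borel_measurable RA" if "z \<in> space NZ" for z
    by (rule section_meas(1)[OF adm_meas[OF cf] that])
  have bd: "\<bar>c s z * f s z\<bar> \<le> M * C" if "s \<in> S" "z \<in> space NZ" for s z
    using adm_bd[OF cf] that by auto
  have R: "integrable RA (\<lambda>s. q ((1 / h) *\<^sub>R (s - a)) * (c s z * f s z))"
    "(LINT s|RA. q ((1 / h) *\<^sub>R (s - a)) * (c s z * f s z)) = h ^ CARD('d) * locint q h a c z"
    "\<bar>locint q h a c z\<bar> \<le> M * C * (LINT t|lborel. \<bar>q t\<bar>)" if z: "z \<in> space NZ" for z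
    using rescaled_integral(2-4)[OF S sec[OF z] bd[OF _ z] q h, where a = a] M by (simp_all add: locint_def)
  show "\<bar>locint q h a c z\<bar> \<le> M * C * (LINT t|lborel. \<bar>q t\<bar>)" if "z \<in> space NZ" for z
    by (rule R(3)[OF that])
  define G where "G s z = q ((1 / h) *\<^sub>R (s - a)) * (u z * c s z)" for s z
  have Gm: "(\<lambda>p. G (fst p) (snd p)) \<in> borel_measurable (RA \<Otimes>\<^sub>M NZ)"
    unfolding G_def by measurable
  have Gf: "G s z * f s z = u z * (q ((1 / h) *\<^sub>R (s - a)) * (c s z * f s z))" for s z
    by (simp add: G_def mult_ac)
  have Gi: "integrable RA (\<lambda>s. G s z * f s z)" if "z \<in> space NZ" for z
    unfolding Gf using R(1)[OF that] by (intro integrable_mult_right)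
  \<comment> \<open>\<open>E_AZ\<close> asks for inner integrals of absolute values, so the
    rescaling is applied to the absolute values of \<open>q\<close> and of the weight.\<close>
  have Gb: "(LINT s|RA. \<bar>G s z * f s z\<bar>) \<le> B * (h ^ CARD('d) * (M * C * (LINT t|lborel. \<bar>q t\<bar>)))" if z: "z \<in> space NZ" for z
  proof -
    have bd': "\<And>s. s \<in> S \<Longrightarrow> \<bar>\<bar>c s z * f s z\<bar>\<bar> \<le> M * C" using bd z by auto
    have am: "(\<lambda>s. \<bar>c s z * f s z\<bar>) \<in> borel_measurable RA" using sec[OF z] by measurable
    have R': "(LINT s|RA. \<bar>q ((1 / h) *\<^sub>R (s - a))\<bar> * \<bar>c s z * f s z\<bar>) \<le> h ^ CARD('d) * (M * C * (LINT t|lborel. \<bar>q t\<bar>))"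
    proof (subst rescaled_integral(3)[OF S am bd' integrable_abs[OF q] h, where a = a])
      show "h ^ CARD('d) * (LINT u|lborel. \<bar>q u\<bar> * (indicator S (a + h *\<^sub>R u) * \<bar>c (a + h *\<^sub>R u) z * f (a + h *\<^sub>R u) z\<bar>))
          \<le> h ^ CARD('d) * (M * C * (LINT t|lborel. \<bar>q t\<bar>))"
        using rescaled_integral(4)[OF S am bd' integrable_abs[OF q] h, where a = a] h M by (intro mult_left_mono) simp_all
    qed
    have "(LINT s|RA. \<bar>G s z * f s z\<bar>) = \<bar>u z\<bar> * (LINT s|RA. \<bar>q ((1 / h) *\<^sub>R (s - a))\<bar> * \<bar>c s z * f s z\<bar>)"
      unfolding Gf by (simp add: abs_mult)
    also have "\<dots> \<le> \<bar>u z\<bar> * (h ^ CARD('d) * (M * C * (LINT t|lborel. \<bar>q t\<bar>)))"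
      by (intro mult_left_mono R') simp
    also have "\<dots> \<le> B * (h ^ CARD('d) * (M * C * (LINT t|lborel. \<bar>q t\<bar>)))"
      using admZ_bd[OF u z] h adm_nonneg[OF c] C0 by (intro mult_right_mono mult_nonneg_nonneg) auto
    finally show ?thesis .
  qed
  note E = E_AZ[OF Gm Gi Gb]
  show "integrable P (\<lambda>w. q ((1 / h) *\<^sub>R (A w - a)) * (u (Z w) * c (A w) (Z w)))"
    using E(1) by (simp add: G_def)
  have inner: "(LINT s|RA. G s z * f s z) = h ^ CARD('d) * (u z * locint q h a c z)" if "z \<in> space NZ" for z
    unfolding Gf using R(2)[OF that] by (simp add: mult_ac)
  have "integrable P (\<lambda>w. h ^ CARD('d) * (u (Z w) * locint q h a c (Z w)))"
  proof -
    have "integrable P (\<lambda>w. LINT s|RA. G s (Z w) * f s (Z w)) \<longleftrightarrow> integrable P (\<lambda>w. h ^ CARD('d) * (u (Z w) * locint q h a c (Z w)))"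
      by (intro Bochner_Integration.integrable_cong refl inner Z_in)
    moreover have "integrable P (\<lambda>w. LINT s|RA. G s (Z w) * f s (Z w))" by (rule E(2))
    ultimately show ?thesis by (rule iffD1)
  qed
  then show "integrable P (\<lambda>w. u (Z w) * locint q h a c (Z w))" using h by simp
  show "(LINT w|P. q ((1 / h) *\<^sub>R (A w - a)) * (u (Z w) * c (A w) (Z w))) =
      h ^ CARD('d) * (LINT w|P. u (Z w) * locint q h a c (Z w))"
  proof -
    have "(LINT w|P. G (A w) (Z w)) = (LINT w|P. LINT s|RA. G s (Z w) * f s (Z w))"
      by (rule E(3))
    also have "\<dots> = (LINT w|P. h ^ CARD('d) * (u (Z w) * locint q h a c (Z w)))"
      by (intro Bochner_Integration.integral_cong refl inner Z_in)
    finally show ?thesis by (simp add: G_def)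
  qed
qed

text \<open>Two dominated limits: in the rescaled treatment for each \<open>z\<close>, then in
  \<open>z\<close> with the constant majorant from \<open>local_integral\<close>.\<close>

lemma local_integral_tendsto:
  assumes q: "integrable lborel q" and c: "adm c M" and u: "admZ u B" and h: "H \<longlonglongrightarrow> 0" "\<And>n. 0 < H n"
    and a: "a \<in> S" and cc: "\<And>z. z \<in> space NZ \<Longrightarrow> continuous_on S (\<lambda>s. c s z)"
  shows "(\<lambda>n. LINT w|P. u (Z w) * locint q (H n) a c (Z w)) \<longlonglongrightarrow> (LINT w|P. u (Z w) * (c a (Z w) * f a (Z w))) * integral\<^sup>L lborel q"
proof -
  have cf: "adm (\<lambda>s z. c s z * f s z) (M * C)" by (rule adm_mult[OF c adm_f])
  have "(\<lambda>n. LINT w|P. u (Z w) * locint q (H n) a c (Z w)) \<longlonglongrightarrow> (LINT w|P. u (Z w) * (c a (Z w) * f a (Z w) * integral\<^sup>L lborel q))"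
  proof (rule integral_dominated_convergence[where w = "\<lambda>w. B * (M * C * (LINT t|lborel. \<bar>q t\<bar>))"])
    show "(\<lambda>w. u (Z w) * (c a (Z w) * f a (Z w) * integral\<^sup>L lborel q)) \<in> borel_measurable P"
      using admZ_int(1)[OF u] measurable_compose[OF Z_meas section_meas(2)[OF adm_meas[OF cf] a]] by measurable
    show "(\<lambda>w. u (Z w) * locint q (H n) a c (Z w)) \<in> borel_measurable P" for n
      using local_integral(2)[OF q c u h(2)] by auto
    show "AE w in P. (\<lambda>n. u (Z w) * locint q (H n) a c (Z w)) \<longlonglongrightarrow> u (Z w) * (c a (Z w) * f a (Z w) * integral\<^sup>L lborel q)"
    proof (intro AE_I2 tendsto_mult_left)
      fix w assume "w \<in> space P"
      then have z: "Z w \<in> space NZ" by (rule Z_in)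
      show "(\<lambda>n. locint q (H n) a c (Z w)) \<longlonglongrightarrow> c a (Z w) * f a (Z w) * integral\<^sup>L lborel q"
        unfolding locint_def
      proof (rule rescaled_integral_tendsto[OF S a section_meas(1)[OF adm_meas[OF cf] z] _ _ q h])
        show "s \<in> S \<Longrightarrow> \<bar>c s (Z w) * f s (Z w)\<bar> \<le> M * C" for s using adm_bd[OF cf _ z] by simp
        have "continuous_on S (\<lambda>s. c s (Z w) * f s (Z w))"
          using cc[OF z] cont[OF z] by (intro continuous_on_mult) auto
        then show "isCont (\<lambda>s. c s (Z w) * f s (Z w)) a"
          using S a by (simp add: continuous_on_eq_continuous_at)
      qed
    qed
    show "AE w in P. norm (u (Z w) * locint q (H n) a c (Z w)) \<le> B * (M * C * (LINT t|lborel. \<bar>q t\<bar>))" for n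
      using local_integral(4)[OF q c u h(2)] admZ_bd[OF u] admZ_nonneg[OF u] Z_in
      by (intro AE_I2) (auto simp: abs_mult intro!: mult_mono)
  qed simp
  also have "(LINT w|P. u (Z w) * (c a (Z w) * f a (Z w) * integral\<^sup>L lborel q)) = (LINT w|P. u (Z w) * (c a (Z w) * f a (Z w))) * integral\<^sup>L lborel q"
    by (simp add: mult.assoc[symmetric])
  finally show ?thesis .
qed

lemma Kh_first:
  assumes c: "adm c M" and u: "admZ u B" and h: "0 < h"
  shows "integrable P (\<lambda>w. Kh k h (A w - a) * (u (Z w) * c (A w) (Z w)))"
    and "(LINT w|P. Kh k h (A w - a) * (u (Z w) * c (A w) (Z w))) = (LINT w|P. u (Z w) * locint (kprod k) h a c (Z w))"
  using local_integral[OF kprod_int c u h, where a = a] h by (simp_all add: Kh_eq_kprod)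

text \<open>The square of \<open>Kh\<close> carries \<open>h^(-2d)\<close> and the substitution
  returns \<open>h^d\<close>, so second moments are of order \<open>h^(-d)\<close>; the factor
  \<open>h ^ CARD('d)\<close> normalises them.\<close>

lemma Kh_square:
  assumes c: "adm c M" and u: "admZ u B" and h: "0 < h"
  shows "integrable P (\<lambda>w. (Kh k h (A w - a) * (u (Z w) * c (A w) (Z w)))\<^sup>2)"
    and "h ^ CARD('d) * (LINT w|P. (Kh k h (A w - a) * (u (Z w) * c (A w) (Z w)))\<^sup>2) =
      (LINT w|P. (u (Z w))\<^sup>2 * locint (\<lambda>t. (kprod k t)\<^sup>2) h a (\<lambda>s z. (c s z)\<^sup>2) (Z w))"
    and "h ^ CARD('d) * (LINT w|P. (Kh k h (A w - a) * (u (Z w) * c (A w) (Z w)))\<^sup>2) \<le>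
      M\<^sup>2 * C * (LINT u|lborel. (k u)\<^sup>2) ^ CARD('d) * (LINT w|P. (u (Z w))\<^sup>2)"
proof -
  note L = local_integral[OF kprod2_int adm_sq[OF c] admZ_sq[OF u] h, where a = a]
  have eq: "(Kh k h (A w - a) * (u (Z w) * c (A w) (Z w)))\<^sup>2 =
      (kprod k ((1 / h) *\<^sub>R (A w - a)))\<^sup>2 * ((u (Z w))\<^sup>2 * (c (A w) (Z w))\<^sup>2) / (h ^ CARD('d))\<^sup>2" for w
    by (simp add: Kh_eq_kprod power_mult_distrib power_divide)
  show "integrable P (\<lambda>w. (Kh k h (A w - a) * (u (Z w) * c (A w) (Z w)))\<^sup>2)"
    unfolding eq using L(1) by simp
  show e: "h ^ CARD('d) * (LINT w|P. (Kh k h (A w - a) * (u (Z w) * c (A w) (Z w)))\<^sup>2) =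
      (LINT w|P. (u (Z w))\<^sup>2 * locint (\<lambda>t. (kprod k t)\<^sup>2) h a (\<lambda>s z. (c s z)\<^sup>2) (Z w))"
    unfolding eq using L(3) h by (simp add: power2_eq_square)
  have "(LINT w|P. (u (Z w))\<^sup>2 * locint (\<lambda>t. (kprod k t)\<^sup>2) h a (\<lambda>s z. (c s z)\<^sup>2) (Z w))
      \<le> (LINT w|P. (u (Z w))\<^sup>2 * (M\<^sup>2 * C * (LINT t|lborel. \<bar>(kprod k (t :: real ^ 'd))\<^sup>2\<bar>)))"
  proof (intro integral_mono L(2) integrable_mult_left admZ_sq_int[OF u] mult_left_mono)
    fix w assume "w \<in> space P"
    from L(4)[OF Z_in[OF this]] show "locint (\<lambda>t. (kprod k t)\<^sup>2) h a (\<lambda>s z. (c s z)\<^sup>2) (Z w) \<le> M\<^sup>2 * C * (LINT t|lborel. \<bar>(kprod k (t :: real ^ 'd))\<^sup>2\<bar>)"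
      by simp
  qed simp
  then show "h ^ CARD('d) * (LINT w|P. (Kh k h (A w - a) * (u (Z w) * c (A w) (Z w)))\<^sup>2) \<le>
      M\<^sup>2 * C * (LINT u|lborel. (k u)\<^sup>2) ^ CARD('d) * (LINT w|P. (u (Z w))\<^sup>2)"
    unfolding e by (simp add: kprod2_integral mult_ac)
qed

text \<open>Both the true moment function and its difference to an estimated one have this form; only the
  difference has a nonzero \<open>u2\<close>.\<close>

definition mom :: "real \<Rightarrow> real ^ 'd \<Rightarrow> real ^ 'd \<Rightarrow> ('z \<Rightarrow> real) \<Rightarrow> ('z \<Rightarrow> real) \<Rightarrow> ('z \<Rightarrow> real) \<Rightarrow> ('z \<Rightarrow> real) \<Rightarrow> 'w \<Rightarrow> real" where
  "mom h a a' u1 u2 u3 u4 w = Kh k h (A w - a) * (u1 (Z w) * (Y w - g a (Z w)) + u2 (Z w))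
     + Kh k h (A w - a') * u3 (Z w) + u4 (Z w)"

text \<open>The conditional mean of \<open>mom\<close> given \<open>(A, Z)\<close>: the outcome is
  replaced by \<open>g A Z\<close>. The factors \<open>1\<close> match the shape
  \<open>u z * c s z\<close> of \<open>Kh_first\<close> and \<open>Kh_square\<close>.\<close>

definition momr :: "real \<Rightarrow> real ^ 'd \<Rightarrow> real ^ 'd \<Rightarrow> ('z \<Rightarrow> real) \<Rightarrow> ('z \<Rightarrow> real) \<Rightarrow> ('z \<Rightarrow> real) \<Rightarrow> ('z \<Rightarrow> real) \<Rightarrow> real ^ 'd \<Rightarrow> 'z \<Rightarrow> real" where
  "momr h a a' u1 u2 u3 u4 s z = Kh k h (s - a) * (u1 z * (g s z - g a z)) + (Kh k h (s - a) * (u2 z * 1) +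
     (Kh k h (s - a') * (u3 z * 1) + u4 z))"

context
  fixes a a' :: "real ^ 'd" and u1 u2 u3 u4 :: "'z \<Rightarrow> real" and B h :: real
  assumes a: "a \<in> S" "a' \<in> S" and u: "admZ u1 B" "admZ u2 B" "admZ u3 B" "admZ u4 B" and h: "0 < h"
begin

lemma u_meas [measurable]: "u1 \<in> borel_measurable NZ" "u2 \<in> borel_measurable NZ" "u3 \<in> borel_measurable NZ" "u4 \<in> borel_measurable NZ"
  using u admZ_meas by auto

lemma ga_meas [measurable]: "g a \<in> borel_measurable NZ" using admZ_meas[OF admZ_g[OF a(1)]] .

text \<open>Four summands are split off one at a time, at the cost of a factor of at most 8. The
  weight \<open>g s z - g a z\<close> is at most \<open>2 * C\<close> and the density at most
  \<open>C\<close>, so \<open>Kh_square\<close> gives \<open>4 * C ^ 3\<close> for the first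
  summand; the two with weight one are raised to the same constant by
  \<open>1 \<le> C\<close>.\<close>

lemma momr_sq:
  shows "integrable P (\<lambda>w. (momr h a a' u1 u2 u3 u4 (A w) (Z w))\<^sup>2)"
    and "h ^ CARD('d) * (LINT w|P. (momr h a a' u1 u2 u3 u4 (A w) (Z w))\<^sup>2) \<le>
      32 * C ^ 3 * (LINT u|lborel. (k u)\<^sup>2) ^ CARD('d) * ((LINT w|P. (u1 (Z w))\<^sup>2) + (LINT w|P. (u2 (Z w))\<^sup>2) + (LINT w|P. (u3 (Z w))\<^sup>2))
       + 8 * h ^ CARD('d) * (LINT w|P. (u4 (Z w))\<^sup>2)"
proof -
  define r1 r2 r3 r4 where "r1 = (\<lambda>w. Kh k h (A w - a) * (u1 (Z w) * (g (A w) (Z w) - g a (Z w))))"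
    and "r2 = (\<lambda>w. Kh k h (A w - a) * (u2 (Z w) * 1))" and "r3 = (\<lambda>w. Kh k h (A w - a') * (u3 (Z w) * 1))"
    and "r4 = (\<lambda>w. u4 (Z w))"
  note rdef = r1_def r2_def r3_def r4_def
  have r: "momr h a a' u1 u2 u3 u4 (A w) (Z w) = r1 w + (r2 w + (r3 w + r4 w))" for w
    by (simp add: momr_def rdef)
  have Km: "(\<lambda>w. Kh k h (A w - b)) \<in> borel_measurable P" for b
    using comp_AZ_meas[of "\<lambda>s z. Kh k h (s - b)"] by simp
  have gm: "(\<lambda>w. g (A w) (Z w)) \<in> borel_measurable P" by (rule comp_AZ_meas) measurable
  have m[measurable]: "r1 \<in> borel_measurable P" "r2 \<in> borel_measurable P" "r3 \<in> borel_measurable P" "r4 \<in> borel_measurable P"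
    unfolding rdef using Km gm by measurable
  note K1 = Kh_square[OF adm_gdiff[OF a(1)] u(1) h, where a = a] and K2 = Kh_square[OF adm_one u(2) h, where a = a]
    and K3 = Kh_square[OF adm_one u(3) h, where a = a']
  have i: "integrable P (\<lambda>w. (r1 w)\<^sup>2)" "integrable P (\<lambda>w. (r2 w)\<^sup>2)" "integrable P (\<lambda>w. (r3 w)\<^sup>2)" "integrable P (\<lambda>w. (r4 w)\<^sup>2)"
    unfolding rdef using K1(1) K2(1) K3(1) admZ_sq_int[OF u(4)] by auto
  note i34 = integrable_sum_sq[OF m(3,4) i(3,4)]
  note i234 = integrable_sum_sq[OF m(2) borel_measurable_add[OF m(3,4)] i(2) i34(1)]
  note i1234 = integrable_sum_sq[OF m(1) borel_measurable_add[OF m(2) borel_measurable_add[OF m(3,4)]] i(1) i234(1)]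
  show "integrable P (\<lambda>w. (momr h a a' u1 u2 u3 u4 (A w) (Z w))\<^sup>2)"
    unfolding r using i1234(1) .
  define x1 x2 x3 x4 where "x1 = (LINT w|P. (r1 w)\<^sup>2)" and "x2 = (LINT w|P. (r2 w)\<^sup>2)" and "x3 = (LINT w|P. (r3 w)\<^sup>2)" and "x4 = (LINT w|P. (r4 w)\<^sup>2)"
  have xnn: "0 \<le> x1" "0 \<le> x2" "0 \<le> x3" "0 \<le> x4" by (simp_all add: x1_def x2_def x3_def x4_def)
  have "(LINT w|P. (momr h a a' u1 u2 u3 u4 (A w) (Z w))\<^sup>2) \<le> 2 * x1 + 4 * x2 + 8 * x3 + 8 * x4"
  proof -
    define y1 y2 y3 where "y1 = (LINT w|P. (momr h a a' u1 u2 u3 u4 (A w) (Z w))\<^sup>2)"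
      and "y2 = (LINT w|P. (r2 w + (r3 w + r4 w))\<^sup>2)" and "y3 = (LINT w|P. (r3 w + r4 w)\<^sup>2)"
    have "y1 \<le> 2 * x1 + 2 * y2" unfolding y1_def y2_def x1_def r by (rule i1234(2))
    moreover have "y2 \<le> 2 * x2 + 2 * y3" unfolding y2_def y3_def x2_def by (rule i234(2))
    moreover have "y3 \<le> 2 * x3 + 2 * x4" unfolding y3_def x3_def x4_def by (rule i34(2))
    ultimately show ?thesis unfolding y1_def[symmetric] by linarith
  qed
  also have "\<dots> \<le> 8 * (x1 + x2 + x3 + x4)" using xnn by simp
  finally have "h ^ CARD('d) * (LINT w|P. (momr h a a' u1 u2 u3 u4 (A w) (Z w))\<^sup>2) \<le> h ^ CARD('d) * (8 * (x1 + x2 + x3 + x4))"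
    using h by (intro mult_left_mono) auto
  also have "\<dots> = 8 * (h ^ CARD('d) * x1 + h ^ CARD('d) * x2 + h ^ CARD('d) * x3) + 8 * h ^ CARD('d) * x4"
    by (simp add: algebra_simps)
  also have "\<dots> \<le> 8 * (4 * C ^ 3 * (LINT u|lborel. (k u)\<^sup>2) ^ CARD('d) * (LINT w|P. (u1 (Z w))\<^sup>2) +
     4 * C ^ 3 * (LINT u|lborel. (k u)\<^sup>2) ^ CARD('d) * (LINT w|P. (u2 (Z w))\<^sup>2) +
     4 * C ^ 3 * (LINT u|lborel. (k u)\<^sup>2) ^ CARD('d) * (LINT w|P. (u3 (Z w))\<^sup>2)) + 8 * h ^ CARD('d) * x4"
  proof (intro add_mono mult_left_mono order_refl)
    have C3: "C \<le> 4 * C ^ 3"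
    proof -
      have "C * 1 \<le> C * C\<^sup>2" using C1 by (intro mult_left_mono one_le_power) auto
      also have "\<dots> = C ^ 3" by (simp add: power2_eq_square power3_eq_cube)
      also have "\<dots> \<le> 4 * C ^ 3" using C0 by simp
      finally show ?thesis by simp
    qed
    show "h ^ CARD('d) * x1 \<le> 4 * C ^ 3 * (LINT u|lborel. (k u)\<^sup>2) ^ CARD('d) * (LINT w|P. (u1 (Z w))\<^sup>2)"
      using K1(3) by (simp add: x1_def r1_def power2_eq_square[of C] power3_eq_cube power_mult_distrib)
    have "C * (LINT u|lborel. (k u)\<^sup>2) ^ CARD('d) * (LINT w|P. (u2 (Z w))\<^sup>2) \<le> 4 * C ^ 3 * (LINT u|lborel. (k u)\<^sup>2) ^ CARD('d) * (LINT w|P. (u2 (Z w))\<^sup>2)"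
      by (intro mult_right_mono C3) auto
    with K2(3) show "h ^ CARD('d) * x2 \<le> 4 * C ^ 3 * (LINT u|lborel. (k u)\<^sup>2) ^ CARD('d) * (LINT w|P. (u2 (Z w))\<^sup>2)"
      by (simp add: x2_def r2_def)
    have "C * (LINT u|lborel. (k u)\<^sup>2) ^ CARD('d) * (LINT w|P. (u3 (Z w))\<^sup>2) \<le> 4 * C ^ 3 * (LINT u|lborel. (k u)\<^sup>2) ^ CARD('d) * (LINT w|P. (u3 (Z w))\<^sup>2)"
      by (intro mult_right_mono C3) auto
    with K3(3) show "h ^ CARD('d) * x3 \<le> 4 * C ^ 3 * (LINT u|lborel. (k u)\<^sup>2) ^ CARD('d) * (LINT w|P. (u3 (Z w))\<^sup>2)"
      by (simp add: x3_def r3_def)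
  qed (use h in simp_all)
  finally show "h ^ CARD('d) * (LINT w|P. (momr h a a' u1 u2 u3 u4 (A w) (Z w))\<^sup>2) \<le>
      32 * C ^ 3 * (LINT u|lborel. (k u)\<^sup>2) ^ CARD('d) * ((LINT w|P. (u1 (Z w))\<^sup>2) + (LINT w|P. (u2 (Z w))\<^sup>2) + (LINT w|P. (u3 (Z w))\<^sup>2))
       + 8 * h ^ CARD('d) * (LINT w|P. (u4 (Z w))\<^sup>2)"
    by (simp add: x4_def r4_def algebra_simps)
qed

lemma momr_meas [measurable]: "(\<lambda>p. momr h a a' u1 u2 u3 u4 (fst p) (snd p)) \<in> borel_measurable (RA \<Otimes>\<^sub>M NZ)"
  unfolding momr_def by measurable

text \<open>\<open>mom\<close> is affine in the outcome, \<open>b * Y + D\<close> with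
  \<open>b\<close> and \<open>D\<close> functions of \<open>(A, Z)\<close>. \<open>Y1\<close>
  replaces \<open>Y\<close> by \<open>g\<close>. In the square, \<open>Y1\<close> and
  \<open>Y2\<close> separate the conditional variance from the squared conditional mean, so the
  residual has no cross term with the rest.\<close>

lemma mom_expectation:
  shows mom_int: "integrable P (mom h a a' u1 u2 u3 u4)"
    and "(LINT w|P. mom h a a' u1 u2 u3 u4 w) = (LINT w|P. u1 (Z w) * locint (kprod k) h a (\<lambda>s z. g s z - g a z) (Z w)
      + u2 (Z w) * locint (kprod k) h a (\<lambda>_ _. 1) (Z w) + u3 (Z w) * locint (kprod k) h a' (\<lambda>_ _. 1) (Z w) + u4 (Z w))"
    and mom_sq_int: "integrable P (\<lambda>w. (mom h a a' u1 u2 u3 u4 w)\<^sup>2)"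
    and mom_sq: "(LINT w|P. (mom h a a' u1 u2 u3 u4 w)\<^sup>2) =
      (LINT w|P. (Kh k h (A w - a) * (u1 (Z w) * sqrt (v (A w) (Z w))))\<^sup>2) + (LINT w|P. (momr h a a' u1 u2 u3 u4 (A w) (Z w))\<^sup>2)"
proof -
  define b where "b s z = Kh k h (s - a) * (u1 z * 1)" for s z
  let ?r = "momr h a a' u1 u2 u3 u4"
  define D where "D s z = ?r s z - b s z * g s z" for s z
  have bm[measurable]: "(\<lambda>p. b (fst p) (snd p)) \<in> borel_measurable (RA \<Otimes>\<^sub>M NZ)" unfolding b_def by measurable
  have Dm[measurable]: "(\<lambda>p. D (fst p) (snd p)) \<in> borel_measurable (RA \<Otimes>\<^sub>M NZ)" unfolding D_def by measurable
  note bmP[measurable] = comp_AZ_meas[OF bm] and gmP[measurable] = comp_AZ_meas[OF g_meas]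
    and rmP[measurable] = comp_AZ_meas[OF momr_meas] and DmP[measurable] = comp_AZ_meas[OF Dm]
    and vmP[measurable] = comp_AZ_meas[OF v_meas]
  have mom: "mom h a a' u1 u2 u3 u4 w = b (A w) (Z w) * Y w + D (A w) (Z w)" for w
    by (simp add: mom_def D_def momr_def b_def algebra_simps)
  note F = Kh_first[OF adm_gdiff[OF a(1)] u(1) h, where a = a] Kh_first[OF adm_one u(2) h, where a = a] Kh_first[OF adm_one u(3) h, where a = a']
  have r_int: "integrable P (\<lambda>w. ?r (A w) (Z w))"
    unfolding momr_def using F(1,3,5) admZ_int(2)[OF u(4)] by (intro Bochner_Integration.integrable_add)
  have b_int: "integrable P (\<lambda>w. b (A w) (Z w))" unfolding b_def by (rule Kh_first(1)[OF adm_one u(1) h])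
  have bg_int: "integrable P (\<lambda>w. b (A w) (Z w) * g (A w) (Z w))"
    using Kh_first(1)[OF adm_g u(1) h, where a = a] by (simp add: b_def mult_ac)
  have D_int: "integrable P (\<lambda>w. D (A w) (Z w))" unfolding D_def using r_int bg_int by simp
  have bY: "integrable P (\<lambda>w. b (A w) (Z w) * Y w)" "(LINT w|P. b (A w) (Z w) * Y w) = (LINT w|P. b (A w) (Z w) * g (A w) (Z w))"
    using Y1[OF bm b_int] by (auto simp: has_bochner_integral_iff)
  show "integrable P (mom h a a' u1 u2 u3 u4)"
    unfolding mom[abs_def] using bY D_int by simp
  have "(LINT w|P. mom h a a' u1 u2 u3 u4 w) = (LINT w|P. b (A w) (Z w) * g (A w) (Z w)) + (LINT w|P. D (A w) (Z w))"
    unfolding mom using bY D_int by simp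
  also have "\<dots> = (LINT w|P. ?r (A w) (Z w))"
    unfolding D_def using bg_int r_int by simp
  also have "\<dots> = (LINT w|P. u1 (Z w) * locint (kprod k) h a (\<lambda>s z. g s z - g a z) (Z w)) +
     ((LINT w|P. u2 (Z w) * locint (kprod k) h a (\<lambda>_ _. 1) (Z w)) + ((LINT w|P. u3 (Z w) * locint (kprod k) h a' (\<lambda>_ _. 1) (Z w)) + (LINT w|P. u4 (Z w))))"
    unfolding momr_def using F(1,3,5) admZ_int(2)[OF u(4)] by (simp add: F(2,4,6)[simplified])
  also have "\<dots> = (LINT w|P. u1 (Z w) * locint (kprod k) h a (\<lambda>s z. g s z - g a z) (Z w)
      + u2 (Z w) * locint (kprod k) h a (\<lambda>_ _. 1) (Z w) + u3 (Z w) * locint (kprod k) h a' (\<lambda>_ _. 1) (Z w) + u4 (Z w))"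
    using local_integral(2)[OF kprod_int adm_gdiff[OF a(1)] u(1) h, where a = a] local_integral(2)[OF kprod_int adm_one u(2) h, where a = a]
      local_integral(2)[OF kprod_int adm_one u(3) h, where a = a'] admZ_int(2)[OF u(4)] by simp
  finally show "(LINT w|P. mom h a a' u1 u2 u3 u4 w) = (LINT w|P. u1 (Z w) * locint (kprod k) h a (\<lambda>s z. g s z - g a z) (Z w)
      + u2 (Z w) * locint (kprod k) h a (\<lambda>_ _. 1) (Z w) + u3 (Z w) * locint (kprod k) h a' (\<lambda>_ _. 1) (Z w) + u4 (Z w))" .
  have b2: "integrable P (\<lambda>w. (b (A w) (Z w))\<^sup>2)" unfolding b_def by (rule Kh_square(1)[OF adm_one u(1) h])
  have bg2: "integrable P (\<lambda>w. (b (A w) (Z w) * g (A w) (Z w))\<^sup>2)"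
    using Kh_square(1)[OF adm_g u(1) h, where a = a] by (simp add: b_def mult_ac)
  have bv2: "integrable P (\<lambda>w. (b (A w) (Z w))\<^sup>2 * v (A w) (Z w))" and bv2e:
    "(LINT w|P. (b (A w) (Z w))\<^sup>2 * v (A w) (Z w)) = (LINT w|P. (Kh k h (A w - a) * (u1 (Z w) * sqrt (v (A w) (Z w))))\<^sup>2)"
  proof -
    have e: "(Kh k h (A w - a) * (u1 (Z w) * sqrt (v (A w) (Z w))))\<^sup>2 = (b (A w) (Z w))\<^sup>2 * v (A w) (Z w)" if "w \<in> space P" for w
      using v_nonneg[OF A_in[OF that] Z_in[OF that]] by (simp add: b_def power_mult_distrib)
    show "integrable P (\<lambda>w. (b (A w) (Z w))\<^sup>2 * v (A w) (Z w))"
      using Kh_square(1)[OF adm_sqrt_v u(1) h, where a = a] by (subst Bochner_Integration.integrable_cong[OF refl e[symmetric]])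
    show "(LINT w|P. (b (A w) (Z w))\<^sup>2 * v (A w) (Z w)) = (LINT w|P. (Kh k h (A w - a) * (u1 (Z w) * sqrt (v (A w) (Z w))))\<^sup>2)"
      by (intro Bochner_Integration.integral_cong refl e[symmetric])
  qed
  have D2: "integrable P (\<lambda>w. (D (A w) (Z w))\<^sup>2)"
    using integrable_sum_sq(1)[OF rmP borel_measurable_uminus[OF borel_measurable_times[OF bmP gmP]] momr_sq(1)] bg2 by (simp add: D_def)
  have bD: "integrable P (\<lambda>w. b (A w) (Z w) * D (A w) (Z w))"
    by (rule Cauchy_Schwarz_integral(1)[OF bmP DmP b2 D2])
  have bDg: "integrable P (\<lambda>w. b (A w) (Z w) * D (A w) (Z w) * g (A w) (Z w))"
    using Cauchy_Schwarz_integral(1)[OF borel_measurable_times[OF bmP gmP] DmP bg2 D2] by (simp add: mult_ac)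
  have y1: "integrable P (\<lambda>w. b (A w) (Z w) * D (A w) (Z w) * Y w)"
     "(LINT w|P. b (A w) (Z w) * D (A w) (Z w) * Y w) = (LINT w|P. b (A w) (Z w) * D (A w) (Z w) * g (A w) (Z w))"
    using Y1[of "\<lambda>s z. b s z * D s z"] bD by (auto simp: has_bochner_integral_iff)
  have y2: "integrable P (\<lambda>w. (b (A w) (Z w))\<^sup>2 * (Y w)\<^sup>2)"
     "(LINT w|P. (b (A w) (Z w))\<^sup>2 * (Y w)\<^sup>2) = (LINT w|P. (b (A w) (Z w))\<^sup>2 * (v (A w) (Z w) + (g (A w) (Z w))\<^sup>2))"
    using Y2[of "\<lambda>s z. (b s z)\<^sup>2"] b2 by (auto simp: has_bochner_integral_iff)
  have momsq: "(mom h a a' u1 u2 u3 u4 w)\<^sup>2 = (b (A w) (Z w))\<^sup>2 * (Y w)\<^sup>2 + 2 * (b (A w) (Z w) * D (A w) (Z w) * Y w) + (D (A w) (Z w))\<^sup>2" for w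
    unfolding mom by (simp add: power2_sum power_mult_distrib algebra_simps)
  show "integrable P (\<lambda>w. (mom h a a' u1 u2 u3 u4 w)\<^sup>2)"
    unfolding momsq using y1 y2 D2 by simp
  have "(LINT w|P. (mom h a a' u1 u2 u3 u4 w)\<^sup>2) = (LINT w|P. (b (A w) (Z w))\<^sup>2 * v (A w) (Z w) + (b (A w) (Z w) * g (A w) (Z w))\<^sup>2)
     + 2 * (LINT w|P. b (A w) (Z w) * D (A w) (Z w) * g (A w) (Z w)) + (LINT w|P. (D (A w) (Z w))\<^sup>2)"
  proof -
    have "(LINT w|P. (mom h a a' u1 u2 u3 u4 w)\<^sup>2) = (LINT w|P. (b (A w) (Z w))\<^sup>2 * (Y w)\<^sup>2) +
        2 * (LINT w|P. b (A w) (Z w) * D (A w) (Z w) * Y w) + (LINT w|P. (D (A w) (Z w))\<^sup>2)"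
      unfolding momsq using y1(1) y2(1) D2 by simp
    then show ?thesis unfolding y1(2) y2(2) by (simp add: distrib_left power_mult_distrib)
  qed
  also have "\<dots> = (LINT w|P. (b (A w) (Z w))\<^sup>2 * v (A w) (Z w)) + (LINT w|P. (b (A w) (Z w) * g (A w) (Z w))\<^sup>2 + 2 * (b (A w) (Z w) * D (A w) (Z w) * g (A w) (Z w)) + (D (A w) (Z w))\<^sup>2)"
    using bv2 bg2 bDg D2 by simp
  also have "(LINT w|P. (b (A w) (Z w) * g (A w) (Z w))\<^sup>2 + 2 * (b (A w) (Z w) * D (A w) (Z w) * g (A w) (Z w)) + (D (A w) (Z w))\<^sup>2)
    = (LINT w|P. (?r (A w) (Z w))\<^sup>2)"
    by (intro Bochner_Integration.integral_cong refl) (simp add: D_def power2_eq_square algebra_simps)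
  finally show "(LINT w|P. (mom h a a' u1 u2 u3 u4 w)\<^sup>2) =
      (LINT w|P. (Kh k h (A w - a) * (u1 (Z w) * sqrt (v (A w) (Z w))))\<^sup>2) + (LINT w|P. (?r (A w) (Z w))\<^sup>2)"
    by (simp add: bv2e)
qed

text \<open>The variance term adds one \<open>C ^ 3\<close> to the 32 of \<open>momr_sq\<close>: the
  squared weight \<open>sqrt v\<close> contributes \<open>C^2\<close> and the density another
  \<open>C\<close>.\<close>

lemma mom_sq_bound:
  "h ^ CARD('d) * (LINT w|P. (mom h a a' u1 u2 u3 u4 w)\<^sup>2) \<le>
      33 * C ^ 3 * (LINT u|lborel. (k u)\<^sup>2) ^ CARD('d) * ((LINT w|P. (u1 (Z w))\<^sup>2) + (LINT w|P. (u2 (Z w))\<^sup>2) + (LINT w|P. (u3 (Z w))\<^sup>2))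
       + 8 * h ^ CARD('d) * (LINT w|P. (u4 (Z w))\<^sup>2)"
proof -
  let ?x = "\<lambda>u. LINT w|P. (u (Z w))\<^sup>2"
  let ?K = "(LINT u|lborel. (k u)\<^sup>2) ^ CARD('d)"
  have "C ^ 3 * ?K * ?x u1 \<le> C ^ 3 * ?K * (?x u1 + ?x u2 + ?x u3)"
    using C0 by (intro mult_left_mono) auto
  then show ?thesis
    using momr_sq(2) Kh_square(3)[OF adm_sqrt_v u(1) h, where a = a]
    by (simp add: mom_sq power2_eq_square[of C] power3_eq_cube[of C] distrib_left)
qed

end

end

section \<open>Bias, variance and third moment for small bandwidth\<close>

lemma sum3_cubed_le:
  fixes x y z :: real
  assumes "0 \<le> x" "0 \<le> y" "0 \<le> z"
  shows "(x + y + z) ^ 3 \<le> 27 * (x ^ 3 + y ^ 3 + z ^ 3)"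
proof -
  define m where "m = max x (max y z)"
  have "(x + y + z) ^ 3 \<le> (3 * m) ^ 3"
    using assms by (intro power_mono) (auto simp: m_def)
  also have "\<dots> = 27 * m ^ 3" by (simp add: power_mult_distrib)
  also have "m ^ 3 \<le> x ^ 3 + y ^ 3 + z ^ 3"
    using assms by (auto simp: m_def max_def)
  finally show ?thesis by simp
qed

context kernel_model begin

lemma f_C2:
  assumes "0 < \<delta>" "cube \<delta> a \<subseteq> S" "z \<in> space NZ"
  shows "C2_on_cube \<delta> a C (\<lambda>s. f s z) (\<lambda>j s. f1 j s z) (\<lambda>j s. f2 j s z)"
proof -
  have "continuous_on (cube \<delta> a) (\<lambda>s. f s z)" "continuous_on (cube \<delta> a) (\<lambda>s. f1 j s z)" "continuous_on (cube \<delta> a) (\<lambda>s. f2 j s z)" for j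
    using cont[OF assms(3)] cont_deriv[OF assms(3)] assms(2) by (auto intro: continuous_on_subset)
  then show ?thesis
    using assms bounds[of _ z] bounds_deriv[of _ z] deriv[of _ z]
    unfolding C2_on_cube_def by (auto simp: subset_iff)
qed

text \<open>The constant is that of the second derivative, \<open>C^2 + 2 * C^2 + 2 * C^2\<close>:
  the factor \<open>g s z - g a z\<close> is at most \<open>2 * C\<close>, every other factor at
  most \<open>C\<close>.\<close>

lemma gf_C2:
  assumes d: "0 < \<delta>" and a: "cube \<delta> a \<subseteq> S" "a \<in> S" and z: "z \<in> space NZ"
  shows "C2_on_cube \<delta> a (5 * C\<^sup>2) (\<lambda>s. (g s z - g a z) * f s z) (\<lambda>j s. g1 j s z * f s z + (g s z - g a z) * f1 j s z)
    (\<lambda>j s. g2 j s z * f s z + 2 * (g1 j s z * f1 j s z) + (g s z - g a z) * f2 j s z)"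
  unfolding C2_on_cube_def
proof (intro conjI allI ballI)
  have c: "continuous_on (cube \<delta> a) (\<lambda>s. f s z)" "continuous_on (cube \<delta> a) (\<lambda>s. g s z)"
    "continuous_on (cube \<delta> a) (\<lambda>s. f1 j s z)" "continuous_on (cube \<delta> a) (\<lambda>s. f2 j s z)"
    "continuous_on (cube \<delta> a) (\<lambda>s. g1 j s z)" "continuous_on (cube \<delta> a) (\<lambda>s. g2 j s z)" for j
    using cont[OF z] cont_deriv[OF z] a by (auto intro: continuous_on_subset)
  show "0 < \<delta>" by fact
  show "continuous_on (cube \<delta> a) (\<lambda>s. (g s z - g a z) * f s z)"
    "continuous_on (cube \<delta> a) (\<lambda>s. g1 j s z * f s z + (g s z - g a z) * f1 j s z)"
    "continuous_on (cube \<delta> a) (\<lambda>s. g2 j s z * f s z + 2 * (g1 j s z * f1 j s z) + (g s z - g a z) * f2 j s z)" for j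
    by (intro continuous_intros c)+
  fix p j assume "p \<in> cube \<delta> a"
  then have p: "p \<in> S" using a by auto
  have b: "\<bar>x * y\<bar> \<le> C\<^sup>2" if "\<bar>x\<bar> \<le> C" "\<bar>y\<bar> \<le> C" for x y
    using mult_mono[OF that C0] by (simp add: abs_mult power2_eq_square)
  have b2: "\<bar>x * y\<bar> \<le> 2 * C\<^sup>2" if "\<bar>x\<bar> \<le> 2 * C" "\<bar>y\<bar> \<le> C" for x y
    using mult_mono[OF that] C0 by (simp add: abs_mult power2_eq_square)
  have gd: "\<bar>g p z - g a z\<bar> \<le> 2 * C" using bounds[OF p z] bounds[OF a(2) z] by linarith
  note B = bounds[OF p z] bounds_deriv[OF p z, of j] gd
  have "\<bar>(g p z - g a z) * f p z\<bar> \<le> 2 * C\<^sup>2" "\<bar>g1 j p z * f p z\<bar> \<le> C\<^sup>2" "\<bar>(g p z - g a z) * f1 j p z\<bar> \<le> 2 * C\<^sup>2"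
    "\<bar>g2 j p z * f p z\<bar> \<le> C\<^sup>2" "\<bar>g1 j p z * f1 j p z\<bar> \<le> C\<^sup>2" "\<bar>(g p z - g a z) * f2 j p z\<bar> \<le> 2 * C\<^sup>2"
    using B by (auto intro!: b b2)
  then show "\<bar>(g p z - g a z) * f p z\<bar> \<le> 5 * C\<^sup>2"
    "\<bar>g1 j p z * f p z + (g p z - g a z) * f1 j p z\<bar> \<le> 5 * C\<^sup>2"
    "\<bar>g2 j p z * f p z + 2 * (g1 j p z * f1 j p z) + (g p z - g a z) * f2 j p z\<bar> \<le> 5 * C\<^sup>2"
    by linarith+
  note D = deriv[OF p z, of j]
  show "((\<lambda>t. (g (p + t *\<^sub>R axis j 1) z - g a z) * f (p + t *\<^sub>R axis j 1) z) has_real_derivative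
        g1 j p z * f p z + (g p z - g a z) * f1 j p z) (at 0)"
    using D by (auto intro!: derivative_eq_intros)
  show "((\<lambda>t. g1 j (p + t *\<^sub>R axis j 1) z * f (p + t *\<^sub>R axis j 1) z +
         (g (p + t *\<^sub>R axis j 1) z - g a z) * f1 j (p + t *\<^sub>R axis j 1) z) has_real_derivative
        g2 j p z * f p z + 2 * (g1 j p z * f1 j p z) + (g p z - g a z) * f2 j p z) (at 0)"
    using D by (auto intro!: derivative_eq_intros)
qed

lemma locint_Kh:
  assumes c: "adm c M" and z: "z \<in> space NZ" and h: "0 < h"
  shows "locint (kprod k) h a c z = (LINT s|RA. Kh k h (s - a) * (c s z * f s z))"
proof -
  have cf: "adm (\<lambda>s z. c s z * f s z) (M * C)" by (rule adm_mult[OF c adm_f])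
  have "\<And>s. s \<in> S \<Longrightarrow> \<bar>c s z * f s z\<bar> \<le> M * C" using adm_bd[OF cf _ z] by simp
  from Kh_integral_rescale(1)[OF S section_meas(1)[OF adm_meas[OF cf] z] this h, of a]
  show ?thesis by (simp add: locint_def)
qed

lemma C_le_5C2: "C \<le> 5 * C\<^sup>2"
  using mult_mono[of 1 C C C] C1 by (simp add: power2_eq_square)

text \<open>At \<open>s = a\<close> the factor \<open>g s z - g a z\<close> vanishes. Hence the
  residual term has no part of order zero, and of the second derivative of the product only
  \<open>g2 * f + 2 * (g1 * f1)\<close> survives at \<open>a\<close>.\<close>

lemma locint_smoothing:
  assumes d: "0 < \<delta>" and a: "cube \<delta> a \<subseteq> S" "a \<in> S" and z: "z \<in> space NZ"
  shows "0 < h \<Longrightarrow> \<bar>locint (kprod k) h a (\<lambda>_ _. 1) z - f a z\<bar> \<le> 5 * C\<^sup>2 * smooth_const \<delta> TYPE('d) * h\<^sup>2"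
    and "0 < h \<Longrightarrow> \<bar>locint (kprod k) h a (\<lambda>s z. g s z - g a z) z\<bar> \<le> 5 * C\<^sup>2 * smooth_const \<delta> TYPE('d) * h\<^sup>2"
    and "H \<longlonglongrightarrow> 0 \<Longrightarrow> (\<And>n. 0 < H n) \<Longrightarrow> (\<lambda>n. (locint (kprod k) (H n) a (\<lambda>_ _. 1) z - f a z) / (H n)\<^sup>2) \<longlonglongrightarrow>
        (LINT u|lborel. u\<^sup>2 * k u) / 2 * (\<Sum>j\<in>UNIV. f2 j a z)"
    and "H \<longlonglongrightarrow> 0 \<Longrightarrow> (\<And>n. 0 < H n) \<Longrightarrow> (\<lambda>n. locint (kprod k) (H n) a (\<lambda>s z. g s z - g a z) z / (H n)\<^sup>2) \<longlonglongrightarrow>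
        (LINT u|lborel. u\<^sup>2 * k u) / 2 * (\<Sum>j\<in>UNIV. g2 j a z * f a z + 2 * (g1 j a z * f1 j a z))"
proof -
  have fm: "(\<lambda>s. f s z) \<in> borel_measurable RA" by (rule section_meas(1)[OF f_meas z])
  have fb: "\<And>s. s \<in> S \<Longrightarrow> \<bar>f s z\<bar> \<le> C" using bounds z by auto
  have gf: "adm (\<lambda>s z. (g s z - g a z) * f s z) (2 * C * C)" by (rule adm_mult[OF adm_gdiff[OF a(2)] adm_f])
  have gfm: "(\<lambda>s. (g s z - g a z) * f s z) \<in> borel_measurable RA" by (rule section_meas(1)[OF adm_meas[OF gf] z])
  have gfb: "\<And>s. s \<in> S \<Longrightarrow> \<bar>(g s z - g a z) * f s z\<bar> \<le> 5 * C\<^sup>2"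
  proof -
    fix s assume "s \<in> S"
    from adm_bd[OF gf this z] have "\<bar>(g s z - g a z) * f s z\<bar> \<le> 2 * C\<^sup>2" by (simp add: power2_eq_square)
    then show "\<bar>(g s z - g a z) * f s z\<bar> \<le> 5 * C\<^sup>2" by (rule order_trans) simp
  qed
  note 1 = smoothing[OF f_C2[OF d a(1) z] S a(1) fm fb]
  note 2 = smoothing[OF gf_C2[OF d a z] S a(1) gfm gfb]
  note L1 = locint_Kh[OF adm_one z, where a = a] and L2 = locint_Kh[OF adm_gdiff[OF a(2)] z, where a = a]
  show "\<bar>locint (kprod k) h a (\<lambda>_ _. 1) z - f a z\<bar> \<le> 5 * C\<^sup>2 * smooth_const \<delta> TYPE('d) * h\<^sup>2" if h: "0 < h"
  proof -
    have "\<bar>locint (kprod k) h a (\<lambda>_ _. 1) z - f a z\<bar> \<le> C * smooth_const \<delta> TYPE('d) * h\<^sup>2"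
      using 1(1) h L1[OF h] by simp
    also have "\<dots> \<le> 5 * C\<^sup>2 * smooth_const \<delta> TYPE('d) * h\<^sup>2"
      using smooth_const_nonneg[OF d, where 'd = 'd] C_le_5C2 by (intro mult_right_mono) auto
    finally show ?thesis .
  qed
  show "\<bar>locint (kprod k) h a (\<lambda>s z. g s z - g a z) z\<bar> \<le> 5 * C\<^sup>2 * smooth_const \<delta> TYPE('d) * h\<^sup>2" if h: "0 < h"
    using 2(1) h L2[OF h] by simp
  show "(\<lambda>n. (locint (kprod k) (H n) a (\<lambda>_ _. 1) z - f a z) / (H n)\<^sup>2) \<longlonglongrightarrow>
        (LINT u|lborel. u\<^sup>2 * k u) / 2 * (\<Sum>j\<in>UNIV. f2 j a z)" if H: "H \<longlonglongrightarrow> 0" "\<And>n. 0 < H n"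
    using 1(2) H L1[OF H(2)] by simp
  show "(\<lambda>n. locint (kprod k) (H n) a (\<lambda>s z. g s z - g a z) z / (H n)\<^sup>2) \<longlonglongrightarrow>
        (LINT u|lborel. u\<^sup>2 * k u) / 2 * (\<Sum>j\<in>UNIV. g2 j a z * f a z + 2 * (g1 j a z * f1 j a z))" if H: "H \<longlonglongrightarrow> 0" "\<And>n. 0 < H n"
    using 2(2) H L2[OF H(2)] by simp
qed

text \<open>The subtracted expectation is the value at bandwidth zero: a kernel at \<open>a\<close>
  becomes multiplication by \<open>f a\<close>, and the residual term drops out because its smoothed
  value starts at order \<open>h^2\<close>. The bound is linear in the absolute means of the
  weights, so small nuisance errors make it small.\<close>

lemma mom_expectation_bound:
  assumes d: "0 < \<delta>" and a: "cube \<delta> a \<subseteq> S" "a \<in> S" "cube \<delta> a' \<subseteq> S" "a' \<in> S"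
    and u: "admZ u1 B" "admZ u2 B" "admZ u3 B" "admZ u4 B" and h: "0 < h"
  shows "\<bar>(LINT w|P. mom h a a' u1 u2 u3 u4 w) - (LINT w|P. u2 (Z w) * f a (Z w) + u3 (Z w) * f a' (Z w) + u4 (Z w))\<bar>
    \<le> 5 * C\<^sup>2 * smooth_const \<delta> TYPE('d) * h\<^sup>2 *
      ((LINT w|P. \<bar>u1 (Z w)\<bar>) + (LINT w|P. \<bar>u2 (Z w)\<bar>) + (LINT w|P. \<bar>u3 (Z w)\<bar>))"
proof -
  let ?c = "5 * C\<^sup>2 * smooth_const \<delta> TYPE('d) * h\<^sup>2"
  have c0: "0 \<le> ?c" using smooth_const_nonneg[OF d, where 'd = 'd] by simp
  note li = local_integral(2)[OF kprod_int adm_gdiff[OF a(2)] u(1) h, where a = a] local_integral(2)[OF kprod_int adm_one u(2) h, where a = a]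
      local_integral(2)[OF kprod_int adm_one u(3) h, where a = a']
  note lj = admZ_int(2)[OF admZ_mult[OF u(2) admZ_f[OF a(2)]]] admZ_int(2)[OF admZ_mult[OF u(3) admZ_f[OF a(4)]]] admZ_int(2)[OF u(4)]
  note ui = admZ_int(2)[OF admZ_abs[OF u(1)]] admZ_int(2)[OF admZ_abs[OF u(2)]] admZ_int(2)[OF admZ_abs[OF u(3)]]
  let ?d = "\<lambda>w. u1 (Z w) * locint (kprod k) h a (\<lambda>s z. g s z - g a z) (Z w)
      + u2 (Z w) * (locint (kprod k) h a (\<lambda>_ _. 1) (Z w) - f a (Z w)) + u3 (Z w) * (locint (kprod k) h a' (\<lambda>_ _. 1) (Z w) - f a' (Z w))"
  have eq: "(LINT w|P. mom h a a' u1 u2 u3 u4 w) - (LINT w|P. u2 (Z w) * f a (Z w) + u3 (Z w) * f a' (Z w) + u4 (Z w)) = (LINT w|P. ?d w)"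
    unfolding mom_expectation(2)[OF a(2,4) u h]
    using li lj by (simp add: right_diff_distrib)
  have "\<bar>LINT w|P. ?d w\<bar> \<le> (LINT w|P. \<bar>?d w\<bar>)" by (rule integral_abs_bound)
  also have "\<dots> \<le> (LINT w|P. ?c * (\<bar>u1 (Z w)\<bar> + \<bar>u2 (Z w)\<bar> + \<bar>u3 (Z w)\<bar>))"
  proof (rule integral_mono)
    show "integrable P (\<lambda>w. \<bar>?d w\<bar>)"
      unfolding right_diff_distrib
      by (intro integrable_abs Bochner_Integration.integrable_add Bochner_Integration.integrable_diff li lj)
    show "integrable P (\<lambda>w. ?c * (\<bar>u1 (Z w)\<bar> + \<bar>u2 (Z w)\<bar> + \<bar>u3 (Z w)\<bar>))" using ui by simp
    fix w assume "w \<in> space P"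
    then have z: "Z w \<in> space NZ" by (rule Z_in)
    note s1 = locint_smoothing(1,2)[OF d a(1,2) z h] and s2 = locint_smoothing(1)[OF d a(3,4) z h]
    have "\<bar>?d w\<bar> \<le> \<bar>u1 (Z w)\<bar> * \<bar>locint (kprod k) h a (\<lambda>s z. g s z - g a z) (Z w)\<bar>
      + \<bar>u2 (Z w)\<bar> * \<bar>locint (kprod k) h a (\<lambda>_ _. 1) (Z w) - f a (Z w)\<bar> + \<bar>u3 (Z w)\<bar> * \<bar>locint (kprod k) h a' (\<lambda>_ _. 1) (Z w) - f a' (Z w)\<bar>"
      unfolding abs_mult[symmetric] by linarith
    also have "\<dots> \<le> \<bar>u1 (Z w)\<bar> * ?c + \<bar>u2 (Z w)\<bar> * ?c + \<bar>u3 (Z w)\<bar> * ?c"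
      using s1 s2 by (intro add_mono mult_left_mono) auto
    finally show "\<bar>?d w\<bar> \<le> ?c * (\<bar>u1 (Z w)\<bar> + \<bar>u2 (Z w)\<bar> + \<bar>u3 (Z w)\<bar>)" by (simp add: algebra_simps)
  qed
  also have "\<dots> = ?c * ((LINT w|P. \<bar>u1 (Z w)\<bar>) + (LINT w|P. \<bar>u2 (Z w)\<bar>) + (LINT w|P. \<bar>u3 (Z w)\<bar>))"
    using ui by simp
  finally show ?thesis unfolding eq .
qed

lemma admZ_zero: "0 \<le> B \<Longrightarrow> admZ (\<lambda>_. 0) B"
  by (simp add: admZ_def)

lemma mom_expectation_tendsto:
  assumes a: "a \<in> S" "a' \<in> S" and u: "admZ u1 B" "admZ u3 B" "admZ u4 B" and H: "H \<longlonglongrightarrow> 0" "\<And>n. 0 < H n"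
  shows "(\<lambda>n. ((LINT w|P. mom (H n) a a' u1 (\<lambda>_. 0) u3 u4 w) - (LINT w|P. u3 (Z w) * f a' (Z w) + u4 (Z w))) / (H n)\<^sup>2) \<longlonglongrightarrow>
     (LINT u|lborel. u\<^sup>2 * k u) * (LINT w|P. u1 (Z w) * ((\<Sum>j\<in>UNIV. g1 j a (Z w) * f1 j a (Z w)) + 1 / 2 * (\<Sum>j\<in>UNIV. g2 j a (Z w)) * f a (Z w))
        + u3 (Z w) * (1 / 2) * (\<Sum>j\<in>UNIV. f2 j a' (Z w)))"
proof -
  obtain d1 where d1: "0 < d1" "cube d1 a \<subseteq> S" using open_contains_cube[OF S a(1)] .
  obtain d2 where d2: "0 < d2" "cube d2 a' \<subseteq> S" using open_contains_cube[OF S a(2)] .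
  let ?c1 = "5 * C\<^sup>2 * smooth_const d1 TYPE('d)" and ?c2 = "5 * C\<^sup>2 * smooth_const d2 TYPE('d)"
  have cnn: "0 \<le> ?c1" "0 \<le> ?c2" using smooth_const_nonneg[OF d1(1), where 'd = 'd] smooth_const_nonneg[OF d2(1), where 'd = 'd] by auto
  have B: "0 \<le> B" by (rule admZ_nonneg[OF u(1)])
  let ?\<kappa> = "LINT u|lborel. u\<^sup>2 * k u"
  let ?d = "\<lambda>n w. u1 (Z w) * (locint (kprod k) (H n) a (\<lambda>s z. g s z - g a z) (Z w) / (H n)\<^sup>2)
      + u3 (Z w) * ((locint (kprod k) (H n) a' (\<lambda>_ _. 1) (Z w) - f a' (Z w)) / (H n)\<^sup>2)"
  let ?l = "\<lambda>w. u1 (Z w) * (?\<kappa> / 2 * (\<Sum>j\<in>UNIV. g2 j a (Z w) * f a (Z w) + 2 * (g1 j a (Z w) * f1 j a (Z w))))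
      + u3 (Z w) * (?\<kappa> / 2 * (\<Sum>j\<in>UNIV. f2 j a' (Z w)))"
  have li: "integrable P (\<lambda>w. u1 (Z w) * locint (kprod k) (H n) a (\<lambda>s z. g s z - g a z) (Z w))"
      "integrable P (\<lambda>w. u3 (Z w) * locint (kprod k) (H n) a' (\<lambda>_ _. 1) (Z w))" for n
    using local_integral(2)[OF kprod_int adm_gdiff[OF a(1)] u(1) H(2), where a = a]
      local_integral(2)[OF kprod_int adm_one u(2) H(2), where a = a'] by auto
  note lj = admZ_int(2)[OF admZ_mult[OF u(2) admZ_f[OF a(2)]]] admZ_int(2)[OF u(3)]
  have di: "integrable P (?d n)" for n
    unfolding right_diff_distrib diff_divide_distrib times_divide_eq_right
    by (intro Bochner_Integration.integrable_add Bochner_Integration.integrable_diff integrable_divide li lj)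
  have eq: "((LINT w|P. mom (H n) a a' u1 (\<lambda>_. 0) u3 u4 w) - (LINT w|P. u3 (Z w) * f a' (Z w) + u4 (Z w))) / (H n)\<^sup>2 = (LINT w|P. ?d n w)" for n
    unfolding mom_expectation(2)[OF a u(1) admZ_zero[OF B] u(2,3) H(2)]
    using li lj by (simp add: right_diff_distrib add_divide_distrib diff_divide_distrib)
  have lim: "(\<lambda>n. ?d n w) \<longlonglongrightarrow> ?l w" if "w \<in> space P" for w
    using locint_smoothing(4)[OF d1 a(1) Z_in[OF that] H] locint_smoothing(3)[OF d2 a(2) Z_in[OF that] H]
    by (intro tendsto_add tendsto_mult_left)
  have "(\<lambda>n. LINT w|P. ?d n w) \<longlonglongrightarrow> (LINT w|P. ?l w)"
  proof (rule integral_dominated_convergence[where w = "\<lambda>_. B * ?c1 + B * ?c2"])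
    show "?d n \<in> borel_measurable P" for n using di[of n] by (rule borel_measurable_integrable)
    \<comment> \<open>The derivatives \<open>f1\<close>, \<open>f2\<close>, \<open>g1\<close>,
      \<open>g2\<close> come without measurability in \<open>z\<close>; the limit is measurable as a
      pointwise limit of measurable functions.\<close>
    show "?l \<in> borel_measurable P" by (rule borel_measurable_LIMSEQ_real[OF lim borel_measurable_integrable[OF di]])
    show "AE w in P. norm (?d n w) \<le> B * ?c1 + B * ?c2" for n
    proof (intro AE_I2)
      fix w assume w: "w \<in> space P"
      have "\<bar>locint (kprod k) (H n) a (\<lambda>s z. g s z - g a z) (Z w) / (H n)\<^sup>2\<bar> \<le> ?c1"
        using locint_smoothing(2)[OF d1 a(1) Z_in[OF w] H(2)[of n]] H(2)[of n] by (simp add: divide_le_eq)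
      moreover have "\<bar>(locint (kprod k) (H n) a' (\<lambda>_ _. 1) (Z w) - f a' (Z w)) / (H n)\<^sup>2\<bar> \<le> ?c2"
        using locint_smoothing(1)[OF d2 a(2) Z_in[OF w] H(2)[of n]] H(2)[of n] by (simp add: divide_le_eq)
      ultimately have "\<bar>u1 (Z w)\<bar> * \<bar>locint (kprod k) (H n) a (\<lambda>s z. g s z - g a z) (Z w) / (H n)\<^sup>2\<bar>
        + \<bar>u3 (Z w)\<bar> * \<bar>(locint (kprod k) (H n) a' (\<lambda>_ _. 1) (Z w) - f a' (Z w)) / (H n)\<^sup>2\<bar> \<le> B * ?c1 + B * ?c2"
        using admZ_bd[OF u(1) Z_in[OF w]] admZ_bd[OF u(2) Z_in[OF w]] B by (intro add_mono mult_mono) auto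
      then show "norm (?d n w) \<le> B * ?c1 + B * ?c2"
        unfolding abs_mult[symmetric] real_norm_def by linarith
    qed
  qed (use lim in auto)
  also have "(LINT w|P. ?l w) = (LINT w|P. ?\<kappa> * (u1 (Z w) * ((\<Sum>j\<in>UNIV. g1 j a (Z w) * f1 j a (Z w)) + 1 / 2 * (\<Sum>j\<in>UNIV. g2 j a (Z w)) * f a (Z w))
        + u3 (Z w) * (1 / 2) * (\<Sum>j\<in>UNIV. f2 j a' (Z w))))"
    by (intro Bochner_Integration.integral_cong refl)
      (simp add: sum.distrib sum_distrib_left[symmetric] sum_distrib_right[symmetric] field_simps)
  finally show ?thesis unfolding eq by simp
qed

text \<open>At scale \<open>h^d\<close> two squares survive. The term with weight
  \<open>g s z - g a z\<close> vanishes because the weight is zero at \<open>a\<close>, the term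
  without a kernel because of \<open>h^d\<close>. By \<open>mom_sq\<close> the variance term is
  already orthogonal to the rest, so the two kernels produce no cross term, even for
  \<open>a = a'\<close>.\<close>

lemma mom_sq_tendsto:
  assumes a: "a \<in> S" "a' \<in> S" and u: "admZ u1 B" "admZ u3 B" "admZ u4 B" and H: "H \<longlonglongrightarrow> 0" "\<And>n. 0 < H n"
  shows "(\<lambda>n. H n ^ CARD('d) * (LINT w|P. (mom (H n) a a' u1 (\<lambda>_. 0) u3 u4 w)\<^sup>2)) \<longlonglongrightarrow>
     (LINT u|lborel. (k u)\<^sup>2) ^ CARD('d) * (LINT w|P. (u1 (Z w))\<^sup>2 * (v a (Z w) * f a (Z w)) + (u3 (Z w))\<^sup>2 * f a' (Z w))"
proof -
  let ?K = "(LINT u|lborel. (k u)\<^sup>2) ^ CARD('d)"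
  have B: "0 \<le> B" by (rule admZ_nonneg[OF u(1)])
  have conts: "continuous_on S (\<lambda>s. (sqrt (v s z))\<^sup>2)" "continuous_on S (\<lambda>s. (g s z - g a z)\<^sup>2)" if "z \<in> space NZ" for z
    using cont[OF that] by (auto intro!: continuous_intros)
  define x1 x2 x3 x4 where "x1 n w = Kh k (H n) (A w - a) * (u1 (Z w) * sqrt (v (A w) (Z w)))"
    and "x2 n w = Kh k (H n) (A w - a) * (u1 (Z w) * (g (A w) (Z w) - g a (Z w)))"
    and "x3 n w = Kh k (H n) (A w - a') * (u3 (Z w) * 1)" and "x4 n w = u4 (Z w)" for n :: nat and w
  note K1 = Kh_square(1,2)[OF adm_sqrt_v u(1) H(2), where a = a] and K2 = Kh_square(1,2)[OF adm_gdiff[OF a(1)] u(1) H(2), where a = a]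
    and K3 = Kh_square(1,2)[OF adm_one u(2) H(2), where a = a']
  have l1: "(\<lambda>n. H n ^ CARD('d) * (LINT w|P. (x1 n w)\<^sup>2)) \<longlonglongrightarrow> (LINT w|P. (u1 (Z w))\<^sup>2 * (v a (Z w) * f a (Z w))) * ?K"
  proof -
    have "(LINT w|P. (u1 (Z w))\<^sup>2 * ((sqrt (v a (Z w)))\<^sup>2 * f a (Z w))) = (LINT w|P. (u1 (Z w))\<^sup>2 * (v a (Z w) * f a (Z w)))"
      using v_nonneg[OF a(1) Z_in] by (intro Bochner_Integration.integral_cong) auto
    then show ?thesis
      using local_integral_tendsto[OF kprod2_int adm_sq[OF adm_sqrt_v] admZ_sq[OF u(1)] H a(1) conts(1)]
      unfolding x1_def K1(2) by (simp add: kprod2_integral)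
  qed
  have l2: "(\<lambda>n. H n ^ CARD('d) * (LINT w|P. (x2 n w)\<^sup>2)) \<longlonglongrightarrow> 0"
    using local_integral_tendsto[OF kprod2_int adm_sq[OF adm_gdiff[OF a(1)]] admZ_sq[OF u(1)] H a(1) conts(2)]
    unfolding x2_def K2(2) by simp
  have l3: "(\<lambda>n. H n ^ CARD('d) * (LINT w|P. (x3 n w)\<^sup>2)) \<longlonglongrightarrow> (LINT w|P. (u3 (Z w))\<^sup>2 * f a' (Z w)) * ?K"
    using local_integral_tendsto[OF kprod2_int adm_sq[OF adm_one] admZ_sq[OF u(2)] H a(2)]
    unfolding x3_def K3(2) by (simp add: kprod2_integral)
  have l4: "(\<lambda>n. H n ^ CARD('d) * (LINT w|P. (x4 n w)\<^sup>2)) \<longlonglongrightarrow> 0"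
    unfolding x4_def using H(1) by (intro tendsto_mult_left_zero) (auto intro!: tendsto_null_power)
  have Km: "(\<lambda>w. Kh k h (A w - b)) \<in> borel_measurable P" for b h
    using comp_AZ_meas[of "\<lambda>s z. Kh k h (s - b)"] by simp
  have gm: "(\<lambda>w. g (A w) (Z w)) \<in> borel_measurable P" by (rule comp_AZ_meas) measurable
  have gaP: "(\<lambda>w. g a (Z w)) \<in> borel_measurable P" using admZ_int(1)[OF admZ_g[OF a(1)]] .
  have m: "x2 n \<in> borel_measurable P" "x3 n \<in> borel_measurable P" "x4 n \<in> borel_measurable P" for n
    unfolding x2_def x3_def x4_def using Km gm gaP admZ_int(1)[OF u(1)] admZ_int(1)[OF u(2)] admZ_int(1)[OF u(3)] by measurable
  have i: "integrable P (\<lambda>w. (x2 n w)\<^sup>2)" "integrable P (\<lambda>w. (x3 n w)\<^sup>2)" "integrable P (\<lambda>w. (x4 n w)\<^sup>2)" for n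
    unfolding x2_def x3_def x4_def using K2(1) K3(1) admZ_sq_int[OF u(3)] by auto
  have c: "0 \<le> H n ^ CARD('d)" for n using H(2)[of n] by simp
  have l43: "(\<lambda>n. H n ^ CARD('d) * (LINT w|P. (x4 n w + x3 n w)\<^sup>2)) \<longlonglongrightarrow> (LINT w|P. (u3 (Z w))\<^sup>2 * f a' (Z w)) * ?K"
    by (rule tendsto_integral_sum_sq[OF m(3,2) i(3,2) l4 l3 c])
  have "(\<lambda>n. H n ^ CARD('d) * (LINT w|P. (x2 n w + (x4 n w + x3 n w))\<^sup>2)) \<longlonglongrightarrow> (LINT w|P. (u3 (Z w))\<^sup>2 * f a' (Z w)) * ?K"
    by (rule tendsto_integral_sum_sq[OF m(1) borel_measurable_add[OF m(3,2)] i(1) integrable_sum_sq(1)[OF m(3,2) i(3,2)] l2 l43 c])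
  from tendsto_add[OF l1 this]
  have "(\<lambda>n. H n ^ CARD('d) * ((LINT w|P. (x1 n w)\<^sup>2) + (LINT w|P. (x2 n w + (x4 n w + x3 n w))\<^sup>2))) \<longlonglongrightarrow>
      ?K * ((LINT w|P. (u1 (Z w))\<^sup>2 * (v a (Z w) * f a (Z w))) + (LINT w|P. (u3 (Z w))\<^sup>2 * f a' (Z w)))"
    by (simp add: algebra_simps)
  moreover have "(LINT w|P. (mom (H n) a a' u1 (\<lambda>_. 0) u3 u4 w)\<^sup>2) = (LINT w|P. (x1 n w)\<^sup>2) + (LINT w|P. (x2 n w + (x4 n w + x3 n w))\<^sup>2)" for n
    unfolding mom_sq[OF a u(1) admZ_zero[OF B] u(2,3) H(2)] by (simp add: x1_def x2_def x3_def x4_def momr_def add_ac)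
  ultimately show ?thesis
    using admZ_int(2)[OF admZ_mult[OF admZ_sq[OF u(1)] admZ_mult[OF admZ_v[OF a(1)] admZ_f[OF a(1)]]]]
      admZ_int(2)[OF admZ_mult[OF admZ_sq[OF u(2)] admZ_f[OF a(2)]]] by simp
qed

text \<open>The cube of \<open>Kh\<close> carries \<open>h^(-3d)\<close> and the substitution
  returns \<open>h^d\<close>, hence the scale \<open>h^(2d)\<close>. \<open>Y3\<close> compares
  nonnegative integrals because finiteness of the third moment is part of what is to be
  shown.\<close>

lemma mom_third:
  assumes a: "a \<in> S" "a' \<in> S" and u: "admZ u1 B" "admZ u3 B" "admZ u4 B"
    and k3: "integrable lborel (\<lambda>u. \<bar>k u\<bar> ^ 3)" and C3: "0 \<le> C3"
    and Y3: "\<And>b. (\<lambda>p. b (fst p) (snd p)) \<in> borel_measurable (RA \<Otimes>\<^sub>M NZ) \<Longrightarrow>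
      (\<integral>\<^sup>+w. ennreal (b (A w) (Z w)) * ennreal (\<bar>Y w - g a (Z w)\<bar> ^ 3) \<partial>P) \<le> ennreal C3 * (\<integral>\<^sup>+w. ennreal (b (A w) (Z w)) \<partial>P)"
  shows "\<exists>K. \<forall>h. 0 < h \<and> h \<le> 1 \<longrightarrow> integrable P (\<lambda>w. \<bar>mom h a a' u1 (\<lambda>_. 0) u3 u4 w\<bar> ^ 3) \<and>
      h ^ (2 * CARD('d)) * (LINT w|P. \<bar>mom h a a' u1 (\<lambda>_. 0) u3 u4 w\<bar> ^ 3) \<le> K"
proof -
  have B: "0 \<le> B" by (rule admZ_nonneg[OF u(1)])
  have k3i: "integrable lborel (\<lambda>u::real ^ 'd. \<bar>kprod k u\<bar> ^ 3)"
    using lborel_prod_coord(1)[of "\<lambda>_. \<lambda>u. \<bar>k u\<bar> ^ 3", OF k3] by (simp add: kprod_def abs_prod prod_power_distrib)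
  define I where "I = (LINT u|(lborel :: (real ^ 'd) measure). \<bar>kprod k u\<bar> ^ 3)"
  have I0: "0 \<le> I" by (simp add: I_def)
  define q where "q h b s = \<bar>Kh k h (s - b)\<bar> ^ 3" for h b and s :: "real ^ 'd"
  have qe: "q h b s = \<bar>kprod k ((1 / h) *\<^sub>R (s - b))\<bar> ^ 3 / (h ^ CARD('d)) ^ 3" if "0 < h" for h b s
    using that by (simp add: q_def Kh_eq_kprod power_divide)
  have Q: "integrable P (\<lambda>w. q h b (A w))" "h ^ (2 * CARD('d)) * (LINT w|P. q h b (A w)) \<le> C * I" if h: "0 < h" for h b
  proof -
    have u1': "admZ (\<lambda>_. 1) 1" by (simp add: admZ_def)
    note L = local_integral[OF k3i adm_one u1' h, where a = b]
    show "integrable P (\<lambda>w. q h b (A w))" unfolding qe[OF h] using L(1) by simp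
    have "(LINT w|P. q h b (A w)) = h ^ CARD('d) * (LINT w|P. locint (\<lambda>u. \<bar>kprod k u\<bar> ^ 3) h b (\<lambda>_ _. 1) (Z w)) / (h ^ CARD('d)) ^ 3"
      unfolding qe[OF h] using L(3) by simp
    then have "h ^ (2 * CARD('d)) * (LINT w|P. q h b (A w)) = (LINT w|P. locint (\<lambda>u. \<bar>kprod k u\<bar> ^ 3) h b (\<lambda>_ _. 1) (Z w))"
      using h by (simp add: power_mult power2_eq_square power3_eq_cube mult_2 power_add)
    also have "\<dots> \<le> (LINT w|P. C * I)"
    proof (intro integral_mono)
      show "integrable P (\<lambda>w. locint (\<lambda>u. \<bar>kprod k u\<bar> ^ 3) h b (\<lambda>_ _. 1) (Z w))" using L(2) by simp
      fix w assume "w \<in> space P"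
      from L(4)[OF Z_in[OF this]] show "locint (\<lambda>u. \<bar>kprod k u\<bar> ^ 3) h b (\<lambda>_ _. 1) (Z w) \<le> C * I"
        by (simp add: I_def)
    qed simp
    finally show "h ^ (2 * CARD('d)) * (LINT w|P. q h b (A w)) \<le> C * I" by (simp add: prob_space)
  qed
  have qm: "(\<lambda>p. q h b (fst p)) \<in> borel_measurable (RA \<Otimes>\<^sub>M NZ)" for h b
    unfolding q_def by measurable
  \<comment> \<open>\<open>27 * B ^ 3\<close> comes from \<open>sum3_cubed_le\<close> and the bound
    on the weights, \<open>C * I\<close> bounds the scaled third moment of each kernel, and 1 stands
    for the term without a kernel, where \<open>h \<le> 1\<close> enters.\<close>
  define K where "K = 27 * B ^ 3 * (C3 * (C * I) + C * I + 1)"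
  show ?thesis
  proof (intro exI[of _ K] allI impI)
    fix h :: real assume "0 < h \<and> h \<le> 1"
    then have h: "0 < h" "h \<le> 1" by auto
    let ?m = "mom h a a' u1 (\<lambda>_. 0) u3 u4"
    have bd: "\<bar>?m w\<bar> ^ 3 \<le> 27 * B ^ 3 * (q h a (A w) * \<bar>Y w - g a (Z w)\<bar> ^ 3 + q h a' (A w) + 1)" if w: "w \<in> space P" for w
    proof -
      note ub = admZ_bd[OF u(1) Z_in[OF w]] admZ_bd[OF u(2) Z_in[OF w]] admZ_bd[OF u(3) Z_in[OF w]]
      define x y where "x = \<bar>Kh k h (A w - a)\<bar> * \<bar>Y w - g a (Z w)\<bar>" and "y = \<bar>Kh k h (A w - a')\<bar>"
      have "\<bar>?m w\<bar> \<le> \<bar>Kh k h (A w - a)\<bar> * (\<bar>u1 (Z w)\<bar> * \<bar>Y w - g a (Z w)\<bar>) + \<bar>Kh k h (A w - a')\<bar> * \<bar>u3 (Z w)\<bar> + \<bar>u4 (Z w)\<bar>"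
        unfolding mom_def abs_mult[symmetric] by simp
      also have "\<dots> \<le> \<bar>Kh k h (A w - a)\<bar> * (B * \<bar>Y w - g a (Z w)\<bar>) + \<bar>Kh k h (A w - a')\<bar> * B + B"
        using ub by (intro add_mono mult_left_mono mult_right_mono) auto
      also have "\<dots> = B * (x + y + 1)" by (simp add: x_def y_def algebra_simps)
      finally have "\<bar>?m w\<bar> ^ 3 \<le> (B * (x + y + 1)) ^ 3" by (intro power_mono) auto
      also have "\<dots> = B ^ 3 * (x + y + 1) ^ 3" by (simp add: power_mult_distrib)
      also have "\<dots> \<le> B ^ 3 * (27 * (x ^ 3 + y ^ 3 + 1 ^ 3))"
        using B by (intro mult_left_mono sum3_cubed_le) (auto simp: x_def y_def)
      finally show ?thesis by (simp add: x_def y_def q_def power_mult_distrib algebra_simps)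
    qed
    have m: "?m \<in> borel_measurable P"
      using mom_int[OF a u(1) admZ_zero[OF B] u(2,3) h(1)] by simp
    have qP: "(\<lambda>w. q h b (A w)) \<in> borel_measurable P" for b using comp_AZ_meas[OF qm] .
    have gaP: "(\<lambda>w. g a (Z w)) \<in> borel_measurable P" using admZ_int(1)[OF admZ_g[OF a(1)]] .
    have q0: "0 \<le> q h b s" for b s by (simp add: q_def)
    have "(\<integral>\<^sup>+w. ennreal (\<bar>?m w\<bar> ^ 3) \<partial>P) \<le>
       (\<integral>\<^sup>+w. ennreal (27 * B ^ 3) * (ennreal (q h a (A w)) * ennreal (\<bar>Y w - g a (Z w)\<bar> ^ 3) + ennreal (q h a' (A w)) + 1) \<partial>P)"
    proof (rule nn_integral_mono)
      fix w assume "w \<in> space P"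
      then have "ennreal (\<bar>?m w\<bar> ^ 3) \<le> ennreal (27 * B ^ 3 * (q h a (A w) * \<bar>Y w - g a (Z w)\<bar> ^ 3 + q h a' (A w) + 1))"
        by (intro ennreal_leI bd)
      also have "\<dots> = ennreal (27 * B ^ 3) * (ennreal (q h a (A w)) * ennreal (\<bar>Y w - g a (Z w)\<bar> ^ 3) + ennreal (q h a' (A w)) + 1)"
        using B q0 by (simp add: ennreal_mult ennreal_plus)
      finally show "ennreal (\<bar>?m w\<bar> ^ 3) \<le> ennreal (27 * B ^ 3) * (ennreal (q h a (A w)) * ennreal (\<bar>Y w - g a (Z w)\<bar> ^ 3) + ennreal (q h a' (A w)) + 1)" .
    qed
    also have "\<dots> = ennreal (27 * B ^ 3) * ((\<integral>\<^sup>+w. ennreal (q h a (A w)) * ennreal (\<bar>Y w - g a (Z w)\<bar> ^ 3) \<partial>P) + (\<integral>\<^sup>+w. ennreal (q h a' (A w)) \<partial>P) + 1)"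
    proof -
      have e1: "(\<lambda>w. ennreal (q h a (A w)) * ennreal (\<bar>Y w - g a (Z w)\<bar> ^ 3)) \<in> borel_measurable P" and e2: "(\<lambda>w. ennreal (q h a' (A w))) \<in> borel_measurable P"
        using qP gaP by measurable
      show ?thesis using e1 e2
        by (simp add: nn_integral_cmult nn_integral_add emeasure_space_1)
    qed
    also have "\<dots> \<le> ennreal (27 * B ^ 3) * (ennreal C3 * ennreal (LINT w|P. q h a (A w)) + ennreal (LINT w|P. q h a' (A w)) + 1)"
    proof -
      have n: "(\<integral>\<^sup>+w. ennreal (q h b (A w)) \<partial>P) = ennreal (LINT w|P. q h b (A w))" for b
        by (rule nn_integral_eq_integral[OF Q(1)[OF h(1)]]) (simp add: q0)
      show ?thesis
        using Y3[OF qm, of h a] unfolding n by (intro mult_left_mono add_right_mono) auto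
    qed
    also have "\<dots> = ennreal (27 * B ^ 3 * (C3 * (LINT w|P. q h a (A w)) + (LINT w|P. q h a' (A w)) + 1))"
      using B C3 q0 by (simp add: ennreal_mult ennreal_plus integral_nonneg_AE)
    finally have nn: "(\<integral>\<^sup>+w. ennreal (\<bar>?m w\<bar> ^ 3) \<partial>P) \<le> ennreal (27 * B ^ 3 * (C3 * (LINT w|P. q h a (A w)) + (LINT w|P. q h a' (A w)) + 1))" .
    have int: "integrable P (\<lambda>w. \<bar>?m w\<bar> ^ 3)"
      using m nn by (intro integrableI_bounded) (auto intro: le_less_trans)
    have rb: "0 \<le> 27 * B ^ 3 * (C3 * (LINT w|P. q h a (A w)) + (LINT w|P. q h a' (A w)) + 1)"
      using B C3 q0 by (intro mult_nonneg_nonneg add_nonneg_nonneg integral_nonneg_AE) auto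
    have le: "(LINT w|P. \<bar>?m w\<bar> ^ 3) \<le> 27 * B ^ 3 * (C3 * (LINT w|P. q h a (A w)) + (LINT w|P. q h a' (A w)) + 1)"
      using nn nn_integral_eq_integral[OF int] rb by simp
    let ?h = "h ^ (2 * CARD('d))"
    have "?h * (LINT w|P. \<bar>?m w\<bar> ^ 3) \<le> ?h * (27 * B ^ 3 * (C3 * (LINT w|P. q h a (A w)) + (LINT w|P. q h a' (A w)) + 1))"
      using h by (intro mult_left_mono le) auto
    also have "\<dots> = 27 * B ^ 3 * (C3 * (?h * (LINT w|P. q h a (A w))) + ?h * (LINT w|P. q h a' (A w)) + ?h)"
      by (simp add: algebra_simps)
    also have "\<dots> \<le> K" unfolding K_def
      using B C3 h Q(2)[OF h(1)] by (intro mult_left_mono add_mono) (auto intro: power_le_one)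
    finally show "integrable P (\<lambda>w. \<bar>?m w\<bar> ^ 3) \<and> ?h * (LINT w|P. \<bar>?m w\<bar> ^ 3) \<le> K" using int by simp
  qed
qed

end

section \<open>Convergence in probability and in distribution\<close>

lemma tendsto_prob_0_iff:
  "tendsto_prob S Z 0 \<longleftrightarrow> (\<forall>n. Z n \<in> borel_measurable S) \<and>
     (\<forall>\<epsilon>>0. (\<lambda>n. measure S {\<omega>\<in>space S. \<epsilon> < \<bar>Z n \<omega>\<bar>}) \<longlonglongrightarrow> 0)"
  by (simp add: tendsto_prob_def)

context prob_space begin

lemma exceed_sets [measurable]:
  "Z \<in> borel_measurable M \<Longrightarrow> {\<omega>\<in>space M. \<epsilon> < \<bar>Z \<omega> :: real\<bar>} \<in> sets M"
  by measurable

lemma tendsto_prob_boundI: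
  assumes Z: "\<And>n. Z n \<in> borel_measurable M" and W: "tendsto_prob M W 0" and "0 \<le> c"
    and le: "\<forall>\<^sub>F n in sequentially. \<forall>\<omega>\<in>space M. \<bar>Z n \<omega>\<bar> \<le> c * \<bar>W n \<omega>\<bar>"
  shows "tendsto_prob M Z 0"
  unfolding tendsto_prob_0_iff
proof (intro conjI allI impI Z)
  fix \<epsilon> :: real assume e: "0 < \<epsilon>"
  have Wm: "W n \<in> borel_measurable M" for n using W by (simp add: tendsto_prob_0_iff)
  \<comment> \<open>\<open>c + 1\<close> in place of \<open>c\<close> keeps the threshold meaningful
    for \<open>c = 0\<close>.\<close>
  have e': "0 < \<epsilon> / (c + 1)" using e assms(3) by simp
  show "(\<lambda>n. prob {\<omega>\<in>space M. \<epsilon> < \<bar>Z n \<omega>\<bar>}) \<longlonglongrightarrow> 0"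
  proof (rule Lim_null_comparison)
    show "(\<lambda>n. prob {\<omega>\<in>space M. \<epsilon> / (c + 1) < \<bar>W n \<omega>\<bar>}) \<longlonglongrightarrow> 0"
      using W e' unfolding tendsto_prob_0_iff by blast
    show "\<forall>\<^sub>F n in sequentially. norm (prob {\<omega>\<in>space M. \<epsilon> < \<bar>Z n \<omega>\<bar>}) \<le> prob {\<omega>\<in>space M. \<epsilon> / (c + 1) < \<bar>W n \<omega>\<bar>}"
      using le
    proof eventually_elim
      case (elim n)
      have "\<epsilon> / (c + 1) < \<bar>W n \<omega>\<bar>" if w: "\<omega> \<in> space M" "\<epsilon> < \<bar>Z n \<omega>\<bar>" for \<omega>
      proof -
        have "\<epsilon> < c * \<bar>W n \<omega>\<bar>" using elim w by fastforce
        also have "\<dots> \<le> (c + 1) * \<bar>W n \<omega>\<bar>" by (simp add: distrib_right)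
        finally show ?thesis using assms(3) by (simp add: divide_less_eq mult.commute)
      qed
      then show ?case using Wm by (auto intro!: finite_measure_mono)
    qed
  qed
qed

lemma tendsto_prob_add:
  assumes Z: "tendsto_prob M Z 0" and W: "tendsto_prob M W 0"
  shows "tendsto_prob M (\<lambda>n \<omega>. Z n \<omega> + W n \<omega>) 0"
  unfolding tendsto_prob_0_iff
proof (intro conjI allI impI)
  have m: "Z n \<in> borel_measurable M" "W n \<in> borel_measurable M" for n
    using Z W by (auto simp: tendsto_prob_0_iff)
  note [measurable] = m
  show "(\<lambda>\<omega>. Z n \<omega> + W n \<omega>) \<in> borel_measurable M" for n by measurable
  fix \<epsilon> :: real assume e: "0 < \<epsilon>"
  show "(\<lambda>n. prob {\<omega>\<in>space M. \<epsilon> < \<bar>Z n \<omega> + W n \<omega>\<bar>}) \<longlonglongrightarrow> 0"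
  proof (rule Lim_null_comparison)
    have "0 < \<epsilon> / 2" using e by simp
    then have "(\<lambda>n. prob {\<omega>\<in>space M. \<epsilon> / 2 < \<bar>Z n \<omega>\<bar>}) \<longlonglongrightarrow> 0" "(\<lambda>n. prob {\<omega>\<in>space M. \<epsilon> / 2 < \<bar>W n \<omega>\<bar>}) \<longlonglongrightarrow> 0"
      using Z W unfolding tendsto_prob_0_iff by blast+
    from tendsto_add[OF this]
    show "(\<lambda>n. prob {\<omega>\<in>space M. \<epsilon> / 2 < \<bar>Z n \<omega>\<bar>} + prob {\<omega>\<in>space M. \<epsilon> / 2 < \<bar>W n \<omega>\<bar>}) \<longlonglongrightarrow> 0" by simp
    show "\<forall>\<^sub>F n in sequentially. norm (prob {\<omega>\<in>space M. \<epsilon> < \<bar>Z n \<omega> + W n \<omega>\<bar>}) \<le>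
        prob {\<omega>\<in>space M. \<epsilon> / 2 < \<bar>Z n \<omega>\<bar>} + prob {\<omega>\<in>space M. \<epsilon> / 2 < \<bar>W n \<omega>\<bar>}"
    proof (intro always_eventually allI)
      fix n
      have "prob {\<omega>\<in>space M. \<epsilon> < \<bar>Z n \<omega> + W n \<omega>\<bar>} \<le>
          prob ({\<omega>\<in>space M. \<epsilon> / 2 < \<bar>Z n \<omega>\<bar>} \<union> {\<omega>\<in>space M. \<epsilon> / 2 < \<bar>W n \<omega>\<bar>})"
        by (intro finite_measure_mono) auto
      also have "\<dots> \<le> prob {\<omega>\<in>space M. \<epsilon> / 2 < \<bar>Z n \<omega>\<bar>} + prob {\<omega>\<in>space M. \<epsilon> / 2 < \<bar>W n \<omega>\<bar>}"
        by (intro measure_Un_le) measurable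
      finally show "norm (prob {\<omega>\<in>space M. \<epsilon> < \<bar>Z n \<omega> + W n \<omega>\<bar>}) \<le>
        prob {\<omega>\<in>space M. \<epsilon> / 2 < \<bar>Z n \<omega>\<bar>} + prob {\<omega>\<in>space M. \<epsilon> / 2 < \<bar>W n \<omega>\<bar>}" by simp
    qed
  qed
qed

lemma tendsto_prob_zero: "tendsto_prob M (\<lambda>_ _. 0) 0"
  by (simp add: tendsto_prob_0_iff)

lemma tendsto_prob_sum:
  assumes "finite I" "\<And>i. i \<in> I \<Longrightarrow> tendsto_prob M (Z i) 0"
  shows "tendsto_prob M (\<lambda>n \<omega>. \<Sum>i\<in>I. Z i n \<omega>) 0"
  using assms by (induction I rule: finite_induct) (auto intro: tendsto_prob_add tendsto_prob_zero)

lemma tendsto_prob_cmult: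
  assumes Z: "tendsto_prob M Z 0" and c: "\<forall>\<^sub>F n in sequentially. \<bar>c n\<bar> \<le> C"
  shows "tendsto_prob M (\<lambda>n \<omega>. c n * Z n \<omega>) 0"
proof (rule tendsto_prob_boundI[OF _ Z, of _ "\<bar>C\<bar>"])
  have [measurable]: "Z n \<in> borel_measurable M" for n using Z by (simp add: tendsto_prob_0_iff)
  show "(\<lambda>\<omega>. c n * Z n \<omega>) \<in> borel_measurable M" for n by measurable
  show "\<forall>\<^sub>F n in sequentially. \<forall>\<omega>\<in>space M. \<bar>c n * Z n \<omega>\<bar> \<le> \<bar>C\<bar> * \<bar>Z n \<omega>\<bar>"
    using c by eventually_elim (auto simp: abs_mult intro!: mult_right_mono)
qed simp

lemma tendsto_prob_square:
  assumes Z: "tendsto_prob M Z 0"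
  shows "tendsto_prob M (\<lambda>n \<omega>. (Z n \<omega>)\<^sup>2) 0"
  unfolding tendsto_prob_0_iff
proof (intro conjI allI impI)
  have [measurable]: "Z n \<in> borel_measurable M" for n using Z by (simp add: tendsto_prob_0_iff)
  show "(\<lambda>\<omega>. (Z n \<omega>)\<^sup>2) \<in> borel_measurable M" for n by measurable
  fix \<epsilon> :: real assume e: "0 < \<epsilon>"
  have "\<epsilon> < \<bar>x\<^sup>2\<bar> \<longleftrightarrow> sqrt \<epsilon> < \<bar>x\<bar>" for x :: real
    using real_sqrt_less_iff[of \<epsilon> "x\<^sup>2"] by simp
  moreover have "0 < sqrt \<epsilon>" using e by simp
  ultimately show "(\<lambda>n. prob {\<omega>\<in>space M. \<epsilon> < \<bar>(Z n \<omega>)\<^sup>2\<bar>}) \<longlonglongrightarrow> 0"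
    using Z unfolding tendsto_prob_0_iff by simp
qed

lemma Markov_square:
  assumes [measurable]: "Z \<in> borel_measurable M" and b: "(\<integral>\<^sup>+\<omega>. ennreal ((Z \<omega>)\<^sup>2) \<partial>M) \<le> ennreal b" and e: "0 < \<epsilon>" and b0: "0 \<le> b"
  shows "prob {\<omega>\<in>space M. \<epsilon> < \<bar>Z \<omega>\<bar>} \<le> b / \<epsilon>\<^sup>2"
proof -
  have "emeasure M {\<omega>\<in>space M. \<epsilon> < \<bar>Z \<omega>\<bar>} \<le> emeasure M {\<omega>\<in>space M. 1 \<le> ennreal (1 / \<epsilon>\<^sup>2) * ennreal ((Z \<omega>)\<^sup>2)}"
  proof (intro emeasure_mono subsetI)
    fix \<omega> assume "\<omega> \<in> {\<omega>\<in>space M. \<epsilon> < \<bar>Z \<omega>\<bar>}"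
    then have w: "\<omega> \<in> space M" "\<epsilon> < \<bar>Z \<omega>\<bar>" by auto
    then have "\<epsilon>\<^sup>2 \<le> \<bar>Z \<omega>\<bar>\<^sup>2" using e by (intro power_mono) auto
    then have "1 \<le> 1 / \<epsilon>\<^sup>2 * (Z \<omega>)\<^sup>2" using e by simp
    then have "ennreal 1 \<le> ennreal (1 / \<epsilon>\<^sup>2 * (Z \<omega>)\<^sup>2)" by (rule ennreal_leI)
    also have "\<dots> = ennreal (1 / \<epsilon>\<^sup>2) * ennreal ((Z \<omega>)\<^sup>2)" by (rule ennreal_mult) auto
    finally show "\<omega> \<in> {\<omega>\<in>space M. 1 \<le> ennreal (1 / \<epsilon>\<^sup>2) * ennreal ((Z \<omega>)\<^sup>2)}"
      using w by simp
  qed measurable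
  also have "\<dots> \<le> ennreal (1 / \<epsilon>\<^sup>2) * (\<integral>\<^sup>+\<omega>. ennreal ((Z \<omega>)\<^sup>2) * indicator (space M) \<omega> \<partial>M)"
    by (rule nn_integral_Markov_inequality) measurable
  also have "(\<integral>\<^sup>+\<omega>. ennreal ((Z \<omega>)\<^sup>2) * indicator (space M) \<omega> \<partial>M) = (\<integral>\<^sup>+\<omega>. ennreal ((Z \<omega>)\<^sup>2) \<partial>M)"
    by (intro nn_integral_cong) simp
  also have "ennreal (1 / \<epsilon>\<^sup>2) * (\<integral>\<^sup>+\<omega>. ennreal ((Z \<omega>)\<^sup>2) \<partial>M) \<le> ennreal (1 / \<epsilon>\<^sup>2) * ennreal b"
    by (intro mult_left_mono b) simp
  also have "\<dots> = ennreal (b / \<epsilon>\<^sup>2)" using b0 e by (simp add: ennreal_mult[symmetric])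
  finally show ?thesis using b0 by (simp add: emeasure_eq_measure)
qed

lemma tendsto_prob_L2:
  assumes Z: "\<And>n. Z n \<in> borel_measurable M"
    and b: "\<forall>\<^sub>F n in sequentially. 0 \<le> b n \<and> (\<integral>\<^sup>+\<omega>. ennreal ((Z n \<omega>)\<^sup>2) \<partial>M) \<le> ennreal (b n)" and b0: "b \<longlonglongrightarrow> 0"
  shows "tendsto_prob M Z 0"
  unfolding tendsto_prob_0_iff
proof (intro conjI allI impI Z)
  fix \<epsilon> :: real assume e: "0 < \<epsilon>"
  show "(\<lambda>n. prob {\<omega>\<in>space M. \<epsilon> < \<bar>Z n \<omega>\<bar>}) \<longlonglongrightarrow> 0"
  proof (rule Lim_null_comparison)
    show "\<forall>\<^sub>F n in sequentially. norm (prob {\<omega>\<in>space M. \<epsilon> < \<bar>Z n \<omega>\<bar>}) \<le> b n / \<epsilon>\<^sup>2"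
      using b by eventually_elim (use Markov_square[OF Z _ e] in auto)
    show "(\<lambda>n. b n / \<epsilon>\<^sup>2) \<longlonglongrightarrow> 0" using tendsto_divide_zero[OF b0] .
  qed
qed

text \<open>Conditioning on \<open>T\<close> is replaced by Fubini for the product law of the independent pair \<open>(T, W)\<close>;
  the conditional second moment needs to be controlled only at points in the range of \<open>T\<close>.\<close>

lemma conditional_Chebyshev:
  fixes F :: "'t \<times> 't \<Rightarrow> real"
  assumes ind: "indep_var MT T MW W" and F [measurable]: "F \<in> borel_measurable (MT \<Otimes>\<^sub>M MW)"
    and b [measurable]: "b \<in> borel_measurable M"
    and le: "\<And>\<omega>. \<omega> \<in> space M \<Longrightarrow> (\<integral>\<^sup>+\<omega>'. ennreal ((F (T \<omega>, W \<omega>'))\<^sup>2) \<partial>M) \<le> ennreal (b \<omega>)"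
    and e: "0 < \<epsilon>" and eta: "0 < \<eta>"
  shows "prob {\<omega>\<in>space M. \<epsilon> < \<bar>F (T \<omega>, W \<omega>)\<bar>} \<le> prob {\<omega>\<in>space M. \<eta> < \<bar>b \<omega>\<bar>} + \<eta> / \<epsilon>\<^sup>2"
proof -
  have T [measurable]: "T \<in> measurable M MT" and W [measurable]: "W \<in> measurable M MW"
    using indep_var_rv1[OF ind] indep_var_rv2[OF ind] by auto
  interpret DT: prob_space "distr M MT T" by (rule prob_space_distr) simp
  interpret DW: prob_space "distr M MW W" by (rule prob_space_distr) simp
  interpret DP: pair_sigma_finite "distr M MT T" "distr M MW W" ..
  have joint: "distr M MT T \<Otimes>\<^sub>M distr M MW W = distr M (MT \<Otimes>\<^sub>M MW) (\<lambda>x. (T x, W x))"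
    using ind indep_var_distribution_eq by auto
  define \<beta> where "\<beta> t = (\<integral>\<^sup>+w. ennreal ((F (t, w))\<^sup>2) \<partial>distr M MW W)" for t
  have [measurable]: "\<beta> \<in> borel_measurable MT"
    unfolding \<beta>_def by measurable
  have \<beta>: "\<beta> (T \<omega>) = (\<integral>\<^sup>+\<omega>'. ennreal ((F (T \<omega>, W \<omega>'))\<^sup>2) \<partial>M)" if "\<omega> \<in> space M" for \<omega>
  proof -
    have "T \<omega> \<in> space MT" using measurable_space[OF T that] .
    then show ?thesis unfolding \<beta>_def by (subst nn_integral_distr) auto
  qed
  \<comment> \<open>\<open>F\<close> truncated to the points where its conditional second moment is
    at most \<open>\<eta>\<close>. By Fubini the truncated variable has second moment at most
    \<open>\<eta>\<close>, and wherever the truncation acts, \<open>b\<close> exceeds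
    \<open>\<eta>\<close>.\<close>
  define Q where "Q \<omega> = (if \<beta> (T \<omega>) \<le> ennreal \<eta> then F (T \<omega>, W \<omega>) else 0)" for \<omega>
  have Qm [measurable]: "Q \<in> borel_measurable M" unfolding Q_def by measurable
  have "(\<integral>\<^sup>+\<omega>. ennreal ((Q \<omega>)\<^sup>2) \<partial>M) = (\<integral>\<^sup>+p. (if \<beta> (fst p) \<le> ennreal \<eta> then ennreal ((F p)\<^sup>2) else 0) \<partial>distr M (MT \<Otimes>\<^sub>M MW) (\<lambda>x. (T x, W x)))"
    by (subst nn_integral_distr) (auto simp: Q_def intro!: nn_integral_cong)
  also have "\<dots> = (\<integral>\<^sup>+t. \<integral>\<^sup>+w. (if \<beta> t \<le> ennreal \<eta> then ennreal ((F (t, w))\<^sup>2) else 0) \<partial>distr M MW W \<partial>distr M MT T)"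
    unfolding joint[symmetric] by (subst DW.nn_integral_fst[symmetric]) (simp_all add: measurable_cong_sets[OF sets_pair_measure_cong[OF sets_distr sets_distr] refl])
  also have "\<dots> \<le> (\<integral>\<^sup>+t. ennreal \<eta> \<partial>distr M MT T)"
  proof (rule nn_integral_mono)
    fix t
    show "(\<integral>\<^sup>+w. (if \<beta> t \<le> ennreal \<eta> then ennreal ((F (t, w))\<^sup>2) else 0) \<partial>distr M MW W) \<le> ennreal \<eta>"
      by (cases "\<beta> t \<le> ennreal \<eta>") (simp_all flip: \<beta>_def)
  qed
  also have "\<dots> = ennreal \<eta>" using DT.emeasure_space_1 by simp
  finally have Q: "prob {\<omega>\<in>space M. \<epsilon> < \<bar>Q \<omega>\<bar>} \<le> \<eta> / \<epsilon>\<^sup>2"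
    using Markov_square[OF Qm _ e] eta by simp
  have "prob {\<omega>\<in>space M. \<epsilon> < \<bar>F (T \<omega>, W \<omega>)\<bar>} \<le> prob ({\<omega>\<in>space M. \<eta> < \<bar>b \<omega>\<bar>} \<union> {\<omega>\<in>space M. \<epsilon> < \<bar>Q \<omega>\<bar>})"
  proof (intro finite_measure_mono subsetI)
    fix \<omega> assume "\<omega> \<in> {\<omega>\<in>space M. \<epsilon> < \<bar>F (T \<omega>, W \<omega>)\<bar>}"
    then have w: "\<omega> \<in> space M" "\<epsilon> < \<bar>F (T \<omega>, W \<omega>)\<bar>" by auto
    show "\<omega> \<in> {\<omega>\<in>space M. \<eta> < \<bar>b \<omega>\<bar>} \<union> {\<omega>\<in>space M. \<epsilon> < \<bar>Q \<omega>\<bar>}"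
    proof (cases "\<beta> (T \<omega>) \<le> ennreal \<eta>")
      case True
      then show ?thesis using w by (simp add: Q_def)
    next
      case False
      have "\<not> b \<omega> \<le> \<eta>"
      proof
        assume "b \<omega> \<le> \<eta>"
        then have "\<beta> (T \<omega>) \<le> ennreal \<eta>"
          using order_trans[OF le[OF w(1)] ennreal_leI] \<beta>[OF w(1)] by simp
        with False show False ..
      qed
      then show ?thesis using w by auto
    qed
  qed measurable
  also have "\<dots> \<le> prob {\<omega>\<in>space M. \<eta> < \<bar>b \<omega>\<bar>} + prob {\<omega>\<in>space M. \<epsilon> < \<bar>Q \<omega>\<bar>}"
    by (intro measure_Un_le) measurable
  finally show ?thesis using Q by linarith
qed

lemma tendsto_prob_conditional:
  fixes F :: "nat \<Rightarrow> 't \<times> 't \<Rightarrow> real"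
  assumes ind: "\<And>n. indep_var (MT n) (T n) (MW n) (W n)" and F: "\<And>n. F n \<in> borel_measurable (MT n \<Otimes>\<^sub>M MW n)"
    and b: "tendsto_prob M b 0"
    and le: "\<forall>\<^sub>F n in sequentially. \<forall>\<omega>\<in>space M. (\<integral>\<^sup>+\<omega>'. ennreal ((F n (T n \<omega>, W n \<omega>'))\<^sup>2) \<partial>M) \<le> ennreal (b n \<omega>)"
  shows "tendsto_prob M (\<lambda>n \<omega>. F n (T n \<omega>, W n \<omega>)) 0"
  unfolding tendsto_prob_0_iff
proof (intro conjI allI impI)
  have [measurable]: "T n \<in> measurable M (MT n)" "W n \<in> measurable M (MW n)" for n
    using indep_var_rv1[OF ind] indep_var_rv2[OF ind] by auto
  show "(\<lambda>\<omega>. F n (T n \<omega>, W n \<omega>)) \<in> borel_measurable M" for n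
    by (rule measurable_compose[OF _ F]) measurable
  fix \<epsilon> :: real assume e: "0 < \<epsilon>"
  have bm: "b n \<in> borel_measurable M" for n using b by (simp add: tendsto_prob_0_iff)
  show "(\<lambda>n. prob {\<omega>\<in>space M. \<epsilon> < \<bar>F n (T n \<omega>, W n \<omega>)\<bar>}) \<longlonglongrightarrow> 0"
  proof (rule LIMSEQ_I)
    fix r :: real assume r: "0 < r"
    \<comment> \<open>Chosen so that the Chebyshev term \<open>\<eta> / \<epsilon>\<^sup>2\<close>
      equals \<open>r / 2\<close>; for this fixed level the event that \<open>b n\<close> exceeds it
      becomes improbable.\<close>
    define \<eta> where "\<eta> = \<epsilon>\<^sup>2 * r / 2"
    have eta: "0 < \<eta>" using e r by (simp add: \<eta>_def)
    have "(\<lambda>n. prob {\<omega>\<in>space M. \<eta> < \<bar>b n \<omega>\<bar>}) \<longlonglongrightarrow> 0"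
      using b eta unfolding tendsto_prob_0_iff by blast
    then have "\<forall>\<^sub>F n in sequentially. prob {\<omega>\<in>space M. \<eta> < \<bar>b n \<omega>\<bar>} < r / 2"
      using r by (intro order_tendstoD(2)) auto
    with le have "\<forall>\<^sub>F n in sequentially. norm (prob {\<omega>\<in>space M. \<epsilon> < \<bar>F n (T n \<omega>, W n \<omega>)\<bar>} - 0) < r"
    proof eventually_elim
      case (elim n)
      have "prob {\<omega>\<in>space M. \<epsilon> < \<bar>F n (T n \<omega>, W n \<omega>)\<bar>} \<le> prob {\<omega>\<in>space M. \<eta> < \<bar>b n \<omega>\<bar>} + \<eta> / \<epsilon>\<^sup>2"
        using elim(1) by (intro conditional_Chebyshev[OF ind F bm _ e eta]) auto
      also have "\<eta> / \<epsilon>\<^sup>2 = r / 2" using e by (simp add: \<eta>_def)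
      finally show ?case using elim(2) by simp
    qed
    then show "\<exists>no. \<forall>n\<ge>no. norm (prob {\<omega>\<in>space M. \<epsilon> < \<bar>F n (T n \<omega>, W n \<omega>)\<bar>} - 0) < r"
      by (simp add: eventually_sequentially)
  qed
qed

section \<open>Sums of independent variables and characteristic functions\<close>

lemma iid_sum_second_moment:
  fixes X :: "'i \<Rightarrow> 'a \<Rightarrow> real"
  assumes fin: "finite I" and ind: "indep_vars (\<lambda>_. borel) X I"
    and sq: "\<And>i. i \<in> I \<Longrightarrow> integrable M (\<lambda>\<omega>. (X i \<omega>)\<^sup>2)"
    and m: "\<And>i. i \<in> I \<Longrightarrow> expectation (X i) = m" and s: "\<And>i. i \<in> I \<Longrightarrow> expectation (\<lambda>\<omega>. (X i \<omega>)\<^sup>2) = s"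
  shows "(\<integral>\<^sup>+\<omega>. ennreal ((\<Sum>i\<in>I. X i \<omega>)\<^sup>2) \<partial>M) \<le> ennreal (real (card I) * s + (real (card I))\<^sup>2 * m\<^sup>2)"
proof -
  have Xm: "X i \<in> borel_measurable M" if "i \<in> I" for i
    using ind that by (auto simp: indep_vars_def)
  have Xi: "integrable M (X i)" if "i \<in> I" for i
    by (rule square_integrable_imp_integrable[OF Xm[OF that] sq[OF that]])
  have pr: "integrable M (\<lambda>\<omega>. X i \<omega> * X j \<omega>)" "expectation (\<lambda>\<omega>. X i \<omega> * X j \<omega>) = (if i = j then s else m\<^sup>2)"
    if ij: "i \<in> I" "j \<in> I" for i j
  proof -
    show "integrable M (\<lambda>\<omega>. X i \<omega> * X j \<omega>)"
      by (rule Cauchy_Schwarz_integral(1)[OF Xm[OF ij(1)] Xm[OF ij(2)] sq[OF ij(1)] sq[OF ij(2)]])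
    show "expectation (\<lambda>\<omega>. X i \<omega> * X j \<omega>) = (if i = j then s else m\<^sup>2)"
    proof (cases "i = j")
      case True
      then show ?thesis using s[OF ij(1)] by (simp add: power2_eq_square)
    next
      case False
      have "indep_vars (\<lambda>_. borel) X {i, j}" by (rule indep_vars_subset[OF ind]) (use ij in auto)
      from indep_vars_lebesgue_integral[OF _ this] have "expectation (\<lambda>\<omega>. \<Prod>i\<in>{i, j}. X i \<omega>) = (\<Prod>i\<in>{i, j}. expectation (X i))"
        using Xi ij by auto
      then show ?thesis using False m ij by (simp add: power2_eq_square)
    qed
  qed
  have sqe: "(\<Sum>i\<in>I. X i \<omega>)\<^sup>2 = (\<Sum>i\<in>I. \<Sum>j\<in>I. X i \<omega> * X j \<omega>)" for \<omega>
    by (simp add: power2_eq_square sum_product)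
  have int: "integrable M (\<lambda>\<omega>. (\<Sum>i\<in>I. X i \<omega>)\<^sup>2)"
    unfolding sqe by (intro Bochner_Integration.integrable_sum pr)
  have "expectation (\<lambda>\<omega>. (\<Sum>i\<in>I. X i \<omega>)\<^sup>2) = (\<Sum>i\<in>I. \<Sum>j\<in>I. if i = j then s else m\<^sup>2)"
    unfolding sqe using pr by (simp add: Bochner_Integration.integral_sum Bochner_Integration.integrable_sum)
  \<comment> \<open>The square of the mean is charged to the diagonal pairs as well, which gives the
    closed form.\<close>
  also have "\<dots> \<le> (\<Sum>i\<in>I. \<Sum>j\<in>I. (if i = j then s else 0) + m\<^sup>2)"
    by (intro sum_mono) auto
  also have "\<dots> = real (card I) * s + (real (card I))\<^sup>2 * m\<^sup>2"
    using fin by (simp add: sum.distrib power2_eq_square algebra_simps)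
  finally show ?thesis
    using nn_integral_eq_integral[OF int] by (simp add: ennreal_leI)
qed

text \<open>From \<open>1 - y \<le> exp (- y) \<le> 1 / (1 + y) \<le> 1 - y + y^2\<close>; the last
  inequality is \<open>(1 - y + y^2) * (1 + y) = 1 + y ^ 3\<close>.\<close>

lemma cmod_exp_minus_bound: "0 \<le> y \<Longrightarrow> \<bar>1 - y - exp (- y)\<bar> \<le> y\<^sup>2" for y :: real
proof -
  assume y: "0 \<le> y"
  have 1: "1 - y \<le> exp (- y)" using exp_ge_add_one_self[of "- y"] by simp
  have "exp (- y) * (1 + y) \<le> exp (- y) * exp y" using exp_ge_add_one_self[of y] by (intro mult_left_mono) auto
  then have "exp (- y) * (1 + y) \<le> 1" by (simp flip: exp_add)
  moreover have "1 \<le> (1 - y + y\<^sup>2) * (1 + y)"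
  proof -
    have "(1 - y + y\<^sup>2) * (1 + y) = 1 + y ^ 3" by (simp add: power2_eq_square power3_eq_cube algebra_simps)
    then show ?thesis using y by simp
  qed
  ultimately have "exp (- y) * (1 + y) \<le> (1 - y + y\<^sup>2) * (1 + y)" by linarith
  then have "exp (- y) \<le> 1 - y + y\<^sup>2" using y by (simp add: mult_le_cancel_right)
  then show ?thesis using 1 by linarith
qed

text \<open>Each factor is compared with \<open>exp (- y n)\<close>, where
  \<open>y n = t^2 * s n / 2\<close>. Products of numbers in the unit disc differ by at most the sum
  of the differences of their factors. The third moments sum to a multiple of
  \<open>n * r n\<close>, the quadratic errors to \<open>(n * y n)^2 / n\<close>, and both vanish.
  The variance is never divided by, which admits \<open>V = 0\<close>.\<close>

lemma triangular_array_char_tendsto: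
  fixes X :: "nat \<Rightarrow> nat \<Rightarrow> 'a \<Rightarrow> real"
  assumes ind: "\<And>n. indep_vars (\<lambda>_. borel) (X n) {1..n}"
    and sq: "\<And>n i. i \<in> {1..n} \<Longrightarrow> integrable M (\<lambda>\<omega>. (X n i \<omega>)\<^sup>2)"
    and m: "\<And>n i. i \<in> {1..n} \<Longrightarrow> expectation (X n i) = 0"
    and s: "\<And>n i. i \<in> {1..n} \<Longrightarrow> expectation (\<lambda>\<omega>. (X n i \<omega>)\<^sup>2) = s n"
    and r: "\<forall>\<^sub>F n in sequentially. \<forall>i\<in>{1..n}. integrable M (\<lambda>\<omega>. \<bar>X n i \<omega>\<bar> ^ 3) \<and> expectation (\<lambda>\<omega>. \<bar>X n i \<omega>\<bar> ^ 3) \<le> r n"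
    and s_lim: "(\<lambda>n. real n * s n) \<longlonglongrightarrow> V" and r_lim: "(\<lambda>n. real n * r n) \<longlonglongrightarrow> 0"
    and s0: "\<And>n. 0 \<le> s n"
  shows "(\<lambda>n. char (distr M borel (\<lambda>\<omega>. \<Sum>i\<in>{1..n}. X n i \<omega>)) t) \<longlonglongrightarrow> of_real (exp (- (t\<^sup>2 * V / 2)))"
proof -
  have Xm: "X n i \<in> borel_measurable M" if "i \<in> {1..n}" for n i
    using ind[of n] that by (auto simp: indep_vars_def)
  define y where "y n = t\<^sup>2 * s n / 2" for n
  have y0: "0 \<le> y n" for n using s0 by (simp add: y_def)
  have ny: "(\<lambda>n. real n * y n) \<longlonglongrightarrow> t\<^sup>2 * V / 2"
    using tendsto_mult_left[OF s_lim, of "t\<^sup>2 / 2"] by (simp add: y_def mult_ac)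
  have ny2: "(\<lambda>n. real n * (y n)\<^sup>2) \<longlonglongrightarrow> 0"
  proof (rule Lim_transform_eventually)
    show "(\<lambda>n. (real n * y n) * (real n * y n) * (1 / real n)) \<longlonglongrightarrow> 0"
      using tendsto_mult[OF tendsto_mult[OF ny ny] lim_1_over_n] by simp
    show "\<forall>\<^sub>F n in sequentially. (real n * y n) * (real n * y n) * (1 / real n) = real n * (y n)\<^sup>2"
      using eventually_gt_at_top[of 0] by eventually_elim (simp add: power2_eq_square)
  qed
  have "(\<lambda>n. char (distr M borel (\<lambda>\<omega>. \<Sum>i\<in>{1..n}. X n i \<omega>)) t - of_real (exp (- (real n * y n)))) \<longlonglongrightarrow> 0"
  proof (rule Lim_null_comparison)
    show "(\<lambda>n. \<bar>t\<bar> ^ 3 / 6 * (real n * r n) + real n * (y n)\<^sup>2) \<longlonglongrightarrow> 0"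
      using tendsto_add[OF tendsto_mult_left[OF r_lim, of "\<bar>t\<bar> ^ 3 / 6"] ny2] by simp
    show "\<forall>\<^sub>F n in sequentially. norm (char (distr M borel (\<lambda>\<omega>. \<Sum>i\<in>{1..n}. X n i \<omega>)) t - of_real (exp (- (real n * y n))))
      \<le> \<bar>t\<bar> ^ 3 / 6 * (real n * r n) + real n * (y n)\<^sup>2"
      using r
    proof eventually_elim
      case (elim n)
      let ?\<phi> = "\<lambda>i. char (distr M borel (X n i)) t"
      let ?e = "complex_of_real (exp (- y n))"
      have "char (distr M borel (\<lambda>\<omega>. \<Sum>i\<in>{1..n}. X n i \<omega>)) t = (\<Prod>i\<in>{1..n}. ?\<phi> i)"
        by (rule char_distr_sum[OF ind])
      moreover have "of_real (exp (- (real n * y n))) = (\<Prod>i\<in>{1..n}. ?e)"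
        by (simp flip: exp_of_nat_mult of_real_power)
      ultimately have "norm (char (distr M borel (\<lambda>\<omega>. \<Sum>i\<in>{1..n}. X n i \<omega>)) t - of_real (exp (- (real n * y n))))
          = norm ((\<Prod>i\<in>{1..n}. ?\<phi> i) - (\<Prod>i\<in>{1..n}. ?e))" by simp
      also have "\<dots> \<le> (\<Sum>i\<in>{1..n}. norm (?\<phi> i - ?e))"
      proof (rule norm_prod_diff)
        fix i assume i: "i \<in> {1..n}"
        interpret R: real_distribution "distr M borel (X n i)"
          by (rule real_distribution_distr) (rule Xm[OF i])
        show "norm (?\<phi> i) \<le> 1" by (rule R.cmod_char_le_1)
        show "norm ?e \<le> 1" using y0 by simp
      qed
      also have "\<dots> \<le> (\<Sum>i\<in>{1..n}. \<bar>t\<bar> ^ 3 / 6 * r n + (y n)\<^sup>2)"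
      proof (rule sum_mono)
        fix i assume i: "i \<in> {1..n}"
        have Xi: "integrable M (X n i)" by (rule square_integrable_imp_integrable[OF Xm[OF i] sq[OF i]])
        have i3: "integrable M (\<lambda>\<omega>. \<bar>X n i \<omega>\<bar> ^ 3)" "expectation (\<lambda>\<omega>. \<bar>X n i \<omega>\<bar> ^ 3) \<le> r n" using elim i by auto
        have "norm (?\<phi> i - (1 - t^2 * s n / 2)) \<le> (t^2 / 6) * expectation (\<lambda>x. min (6 * (X n i x)^2) (\<bar>t\<bar> * \<bar>X n i x\<bar>^3))"
          by (rule char_approx3'[OF Xm[OF i] Xi sq[OF i] m[OF i] _ refl]) (use m[OF i] s[OF i] in simp)
        also have "\<dots> \<le> (t^2 / 6) * expectation (\<lambda>x. \<bar>t\<bar> * \<bar>X n i x\<bar>^3)"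
          using i3 Xm[OF i] sq[OF i] by (intro mult_left_mono integral_mono integrable_min) auto
        also have "\<dots> = \<bar>t\<bar> ^ 3 / 6 * expectation (\<lambda>x. \<bar>X n i x\<bar>^3)"
          by (simp add: power3_eq_cube power2_eq_square abs_mult_self_eq flip: abs_mult)
        also have "\<dots> \<le> \<bar>t\<bar> ^ 3 / 6 * r n" using i3 by (intro mult_left_mono) auto
        finally have a: "norm (?\<phi> i - (1 - of_real (y n))) \<le> \<bar>t\<bar> ^ 3 / 6 * r n" by (simp add: y_def)
        have "norm ((1 - of_real (y n)) - ?e) = \<bar>1 - y n - exp (- y n)\<bar>"
        proof -
          have "(1 - complex_of_real (y n)) - ?e = of_real (1 - y n - exp (- y n))" by (simp add: exp_of_real)
          then show ?thesis by (simp only: norm_of_real)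
        qed
        also have "\<dots> \<le> (y n)\<^sup>2" by (rule cmod_exp_minus_bound[OF y0])
        finally have b: "norm ((1 - of_real (y n)) - ?e) \<le> (y n)\<^sup>2" .
        show "norm (?\<phi> i - ?e) \<le> \<bar>t\<bar> ^ 3 / 6 * r n + (y n)\<^sup>2"
          using norm_triangle_ineq[of "?\<phi> i - (1 - of_real (y n))" "(1 - of_real (y n)) - ?e"] a b by simp
      qed
      also have "\<dots> = \<bar>t\<bar> ^ 3 / 6 * (real n * r n) + real n * (y n)\<^sup>2" by (simp add: algebra_simps)
      finally show ?case .
    qed
  qed
  moreover have "(\<lambda>n. complex_of_real (exp (- (real n * y n)))) \<longlonglongrightarrow> of_real (exp (- (t\<^sup>2 * V / 2)))"
    using ny by (intro tendsto_of_real tendsto_exp tendsto_minus)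
  ultimately show ?thesis by (rule Lim_transform[rotated])
qed

text \<open>\<open>iexp\<close> is bounded and Lipschitz: the integrand is at most
  \<open>\<bar>t\<bar> * \<epsilon>\<close> where \<open>Z n\<close> and \<open>W n\<close> are
  close, and at most 2 on the rare event where they are not.\<close>

lemma char_Slutsky:
  assumes Z: "\<And>n. Z n \<in> borel_measurable M" and W: "\<And>n. W n \<in> borel_measurable M"
    and d: "tendsto_prob M (\<lambda>n \<omega>. Z n \<omega> - W n \<omega>) 0"
    and c: "(\<lambda>n. char (distr M borel (W n)) t) \<longlonglongrightarrow> l"
  shows "(\<lambda>n. char (distr M borel (Z n)) t) \<longlonglongrightarrow> l"
proof -
  note [measurable] = Z W
  have "(\<lambda>n. char (distr M borel (Z n)) t - char (distr M borel (W n)) t) \<longlonglongrightarrow> 0"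
  proof (rule LIMSEQ_I)
    fix r :: real assume r: "0 < r"
    \<comment> \<open>Gives \<open>\<bar>t\<bar> * \<epsilon> \<le> r / 2\<close>, with
      \<open>+ 1\<close> for the case \<open>t = 0\<close>. An event of probability below
      \<open>r / 4\<close> then contributes less than the other \<open>r / 2\<close>.\<close>
    define \<epsilon> where "\<epsilon> = r / (2 * (\<bar>t\<bar> + 1))"
    have e: "0 < \<epsilon>" using r by (simp add: \<epsilon>_def add_nonneg_pos)
    have te: "\<bar>t\<bar> * \<epsilon> \<le> r / 2"
    proof -
      have "\<bar>t\<bar> * \<epsilon> = r / 2 * (\<bar>t\<bar> / (\<bar>t\<bar> + 1))" by (simp add: \<epsilon>_def)
      also have "\<dots> \<le> r / 2 * 1" using r by (intro mult_left_mono) (auto simp: divide_le_eq)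
      finally show ?thesis by simp
    qed
    let ?A = "\<lambda>n. {\<omega>\<in>space M. \<epsilon> < \<bar>Z n \<omega> - W n \<omega>\<bar>}"
    have "(\<lambda>n. prob (?A n)) \<longlonglongrightarrow> 0"
      using d e unfolding tendsto_prob_0_iff by blast
    then have "\<forall>\<^sub>F n in sequentially. prob (?A n) < r / 4"
      using r by (intro order_tendstoD(2)) auto
    then have "\<forall>\<^sub>F n in sequentially. norm (char (distr M borel (Z n)) t - char (distr M borel (W n)) t - 0) < r"
    proof eventually_elim
      case (elim n)
      have ii: "integrable M (indicat_real (?A n))" "(LINT \<omega>|M. indicat_real (?A n) \<omega>) = prob (?A n)"
        by (auto intro!: integrable_real_indicator simp: emeasure_eq_measure)
      have i: "integrable M (\<lambda>\<omega>. iexp (t * Z n \<omega>))" "integrable M (\<lambda>\<omega>. iexp (t * W n \<omega>))"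
        by (auto intro!: integrable_const_bound[of _ 1])
      have "char (distr M borel (Z n)) t - char (distr M borel (W n)) t = (CLINT \<omega>|M. iexp (t * Z n \<omega>) - iexp (t * W n \<omega>))"
        using i by (simp add: char_def integral_distr)
      also have "norm \<dots> \<le> (LINT \<omega>|M. norm (iexp (t * Z n \<omega>) - iexp (t * W n \<omega>)))"
        by (rule integral_norm_bound)
      also have "\<dots> \<le> (LINT \<omega>|M. r / 2 + 2 * indicat_real (?A n) \<omega>)"
      proof (rule integral_mono)
        show "integrable M (\<lambda>\<omega>. norm (iexp (t * Z n \<omega>) - iexp (t * W n \<omega>)))" using i by auto
        show "integrable M (\<lambda>\<omega>. r / 2 + 2 * indicat_real (?A n) \<omega>)" using ii by simp
        fix \<omega> assume w: "\<omega> \<in> space M"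
        have "norm (iexp (t * Z n \<omega>) - iexp (t * W n \<omega>)) = norm (iexp (t * W n \<omega>) * (iexp (t * Z n \<omega> - t * W n \<omega>) - 1))"
          by (simp add: right_diff_distrib flip: exp_add)
        also have "\<dots> = norm (iexp (t * Z n \<omega> - t * W n \<omega>) - 1)" by (simp only: norm_mult norm_exp_i_times mult_1_left)
        also have "\<dots> \<le> \<bar>t * Z n \<omega> - t * W n \<omega>\<bar>" using iexp_approx1[of "t * Z n \<omega> - t * W n \<omega>" 0] by simp
        also have "\<dots> = \<bar>t\<bar> * \<bar>Z n \<omega> - W n \<omega>\<bar>" by (simp flip: abs_mult right_diff_distrib)
        finally have 1: "norm (iexp (t * Z n \<omega>) - iexp (t * W n \<omega>)) \<le> \<bar>t\<bar> * \<bar>Z n \<omega> - W n \<omega>\<bar>" .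
        have 2: "norm (iexp (t * Z n \<omega>) - iexp (t * W n \<omega>)) \<le> 2"
          using norm_triangle_ineq4[of "iexp (t * Z n \<omega>)" "iexp (t * W n \<omega>)"] by (simp only: norm_exp_i_times)
        show "norm (iexp (t * Z n \<omega>) - iexp (t * W n \<omega>)) \<le> r / 2 + 2 * indicator (?A n) \<omega>"
        proof (cases "\<omega> \<in> ?A n")
          case True
          then show ?thesis using 2 r by simp
        next
          case False
          then have "\<bar>t\<bar> * \<bar>Z n \<omega> - W n \<omega>\<bar> \<le> \<bar>t\<bar> * \<epsilon>" using w by (intro mult_left_mono) auto
          then show ?thesis using 1 te False by simp
        qed
      qed
      also have "\<dots> = (LINT \<omega>|M. r / 2) + (LINT \<omega>|M. 2 * indicat_real (?A n) \<omega>)"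
        using ii(1) by (intro Bochner_Integration.integral_add) auto
      also have "\<dots> = r / 2 + 2 * prob (?A n)" using ii(2) by (simp add: prob_space)
      finally show ?case using elim by simp
    qed
    then show "\<exists>no. \<forall>n\<ge>no. norm (char (distr M borel (Z n)) t - char (distr M borel (W n)) t - 0) < r"
      by (simp add: eventually_sequentially)
  qed
  from Lim_transform[OF c this] show ?thesis .
qed

end

lemma char_normal_law:
  assumes "0 \<le> V"
  shows "real_distribution (normal_law 0 V)" "char (normal_law 0 V) t = of_real (exp (- (t\<^sup>2 * V / 2)))"
proof -
  have "real_distribution (normal_law 0 V) \<and> char (normal_law 0 V) t = of_real (exp (- (t\<^sup>2 * V / 2)))"
  proof (cases "V = 0")
    case True
    have "prob_space (return borel (0 :: real))" by (rule prob_space_return) simp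
    then have "real_distribution (return borel (0 :: real))"
      by (simp add: real_distribution_def real_distribution_axioms_def)
    then show ?thesis using True by (simp add: normal_law_def char_def integral_return)
  next
    case False
    then have V: "0 < sqrt V" using assms by simp
    interpret N: real_distribution std_normal_distribution by (rule real_dist_normal_dist)
    have id: "distributed std_normal_distribution lborel (\<lambda>x. x) (\<lambda>x. ennreal (normal_density 0 1 x))"
      by (auto simp: distributed_def distr_id2[of lborel std_normal_distribution])
    \<comment> \<open>The law with variance \<open>V\<close> is the standard normal law scaled by
      \<open>sqrt V\<close>, so its characteristic function is obtained from the standard
      one.\<close>
    from N.normal_density_affine[OF id _ less_imp_neq[OF V, symmetric], of 0]
    have d: "distributed std_normal_distribution lborel (\<lambda>x. sqrt V * x) (normal_density 0 (sqrt V))"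
      using V by simp
    have "distr std_normal_distribution lborel (\<lambda>x. sqrt V * x) = density lborel (\<lambda>x. ennreal (normal_density 0 (sqrt V) x))"
      using d by (simp add: distributed_def)
    then have law: "normal_law 0 V = distr std_normal_distribution borel (\<lambda>x. sqrt V * x)"
      using False by (simp add: normal_law_def cong: distr_cong)
    have "real_distribution (normal_law 0 V)" unfolding law by (rule N.real_distribution_distr) simp
    moreover have "char (normal_law 0 V) t = char std_normal_distribution (t * sqrt V)"
      unfolding law char_def by (subst integral_distr) (simp_all add: mult.assoc)
    ultimately show ?thesis
      using assms by (simp add: char_std_normal_distribution power_mult_distrib)
  qed
  then show "real_distribution (normal_law 0 V)" "char (normal_law 0 V) t = of_real (exp (- (t\<^sup>2 * V / 2)))" by auto
qed

section \<open>The mediation model as a kernel model\<close>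

lemma reg_cond_distD:
  assumes "reg_cond_dist P C Z \<kappa>"
  shows "Z \<in> measurable P C" "\<kappa> \<in> measurable C (prob_algebra P)" "\<And>z. z \<in> space C \<Longrightarrow> AE \<omega> in \<kappa> z. Z \<omega> = z"
    "distr P C Z \<bind> \<kappa> = P" "\<And>z. z \<in> space C \<Longrightarrow> prob_space (\<kappa> z)" "\<And>z. z \<in> space C \<Longrightarrow> sets (\<kappa> z) = sets P"
    "\<kappa> \<in> measurable C (subprob_algebra P)"
  using assms measurable_space[of \<kappa> C "prob_algebra P"] measurable_prob_algebraD[of \<kappa> C P]
  by (auto simp: reg_cond_dist_def space_prob_algebra)

lemma reg_cond_dist_nn_integral:
  assumes R: "reg_cond_dist P C Z \<kappa>" and g: "g \<in> borel_measurable P"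
  shows "(\<integral>\<^sup>+\<omega>. g \<omega> \<partial>P) = (\<integral>\<^sup>+\<omega>. \<integral>\<^sup>+\<omega>'. g \<omega>' \<partial>\<kappa> (Z \<omega>) \<partial>P)"
proof -
  note D = reg_cond_distD[OF R]
  have [measurable]: "(\<lambda>z. \<integral>\<^sup>+\<omega>'. g \<omega>' \<partial>\<kappa> z) \<in> borel_measurable C"
    by (rule measurable_compose[OF D(7) nn_integral_measurable_subprob_algebra[OF g]])
  have k: "\<kappa> \<in> measurable (distr P C Z) (subprob_algebra P)" using D(7) by simp
  have "(\<integral>\<^sup>+\<omega>. g \<omega> \<partial>P) = (\<integral>\<^sup>+\<omega>. g \<omega> \<partial>(distr P C Z \<bind> \<kappa>))" by (simp add: D(4))
  also have "\<dots> = (\<integral>\<^sup>+z. \<integral>\<^sup>+\<omega>'. g \<omega>' \<partial>\<kappa> z \<partial>distr P C Z)" by (rule nn_integral_bind[OF g k])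
  also have "\<dots> = (\<integral>\<^sup>+\<omega>. \<integral>\<^sup>+\<omega>'. g \<omega>' \<partial>\<kappa> (Z \<omega>) \<partial>P)" using D(1) by (subst nn_integral_distr) auto
  finally show ?thesis .
qed

lemma reg_cond_dist_integral_meas:
  fixes g :: "'w \<Rightarrow> real"
  assumes R: "reg_cond_dist P C Z \<kappa>" and g: "g \<in> borel_measurable P"
  shows "(\<lambda>z. LINT \<omega>'|\<kappa> z. g \<omega>') \<in> borel_measurable C"
  by (rule measurable_compose[OF reg_cond_distD(7)[OF R] integral_measurable_subprob_algebra[OF g]])

text \<open>The nonnegative case follows from \<open>reg_cond_dist_nn_integral\<close>; the general
  one is the difference of positive and negative parts. The inner integral splits only almost
  everywhere, because \<open>g\<close> may fail to be integrable under \<open>\<kappa>\<close> for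
  conditions in a null set.\<close>

lemma reg_cond_dist_integral:
  fixes g :: "'w \<Rightarrow> real"
  assumes R: "reg_cond_dist P C Z \<kappa>" and i: "integrable P g"
  shows "integrable P (\<lambda>\<omega>. LINT \<omega>'|\<kappa> (Z \<omega>). g \<omega>')"
    and "integral\<^sup>L P g = (LINT \<omega>|P. LINT \<omega>'|\<kappa> (Z \<omega>). g \<omega>')"
proof -
  note D = reg_cond_distD[OF R]
  have nn: "(AE \<omega> in P. integrable (\<kappa> (Z \<omega>)) g) \<and> integrable P (\<lambda>\<omega>. LINT \<omega>'|\<kappa> (Z \<omega>). g \<omega>') \<and>
      integral\<^sup>L P g = (LINT \<omega>|P. LINT \<omega>'|\<kappa> (Z \<omega>). g \<omega>')" if i: "integrable P g" and g0: "\<And>\<omega>. 0 \<le> g \<omega>" for g :: "'w \<Rightarrow> real"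
  proof -
    have g: "g \<in> borel_measurable P" using i by simp
    have gk: "g \<in> borel_measurable (\<kappa> (Z \<omega>))" if "\<omega> \<in> space P" for \<omega>
      using g D(6)[OF measurable_space[OF D(1) that]] by (simp cong: measurable_cong_sets)
    have m: "(\<lambda>\<omega>. LINT \<omega>'|\<kappa> (Z \<omega>). g \<omega>') \<in> borel_measurable P"
      by (rule measurable_compose[OF D(1) reg_cond_dist_integral_meas[OF R g]])
    have mn: "(\<lambda>\<omega>. \<integral>\<^sup>+\<omega>'. ennreal (g \<omega>') \<partial>\<kappa> (Z \<omega>)) \<in> borel_measurable P"
      by (rule measurable_compose[OF D(1) measurable_compose[OF D(7) nn_integral_measurable_subprob_algebra]]) (use g in measurable)
    have eq: "(\<integral>\<^sup>+\<omega>. \<integral>\<^sup>+\<omega>'. ennreal (g \<omega>') \<partial>\<kappa> (Z \<omega>) \<partial>P) = ennreal (integral\<^sup>L P g)"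
      using reg_cond_dist_nn_integral[OF R, of "\<lambda>\<omega>. ennreal (g \<omega>)"] g nn_integral_eq_integral[OF i] g0 by simp
    have fin: "AE \<omega> in P. (\<integral>\<^sup>+\<omega>'. ennreal (g \<omega>') \<partial>\<kappa> (Z \<omega>)) \<noteq> \<infinity>"
      by (rule nn_integral_PInf_AE[OF mn]) (simp add: eq)
    have int: "AE \<omega> in P. integrable (\<kappa> (Z \<omega>)) g"
      using fin AE_space by eventually_elim (use gk g0 in \<open>auto simp: integrable_iff_bounded less_top\<close>)
    moreover have "(\<integral>\<^sup>+\<omega>. ennreal (LINT \<omega>'|\<kappa> (Z \<omega>). g \<omega>') \<partial>P) = (\<integral>\<^sup>+\<omega>. \<integral>\<^sup>+\<omega>'. ennreal (g \<omega>') \<partial>\<kappa> (Z \<omega>) \<partial>P)"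
      by (intro nn_integral_cong_AE, use int in eventually_elim) (use g0 in \<open>simp add: nn_integral_eq_integral\<close>)
    then have e2: "(\<integral>\<^sup>+\<omega>. ennreal (LINT \<omega>'|\<kappa> (Z \<omega>). g \<omega>') \<partial>P) = ennreal (integral\<^sup>L P g)" using eq by simp
    moreover have "integrable P (\<lambda>\<omega>. LINT \<omega>'|\<kappa> (Z \<omega>). g \<omega>')"
      by (rule integrableI_nn_integral_finite[OF m _ e2]) (use g0 in simp)
    moreover have "(LINT \<omega>|P. LINT \<omega>'|\<kappa> (Z \<omega>). g \<omega>') = integral\<^sup>L P g"
      using integral_eq_nn_integral[OF m] e2 g0 by simp
    ultimately show ?thesis by simp
  qed
  let ?p = "\<lambda>\<omega>. max 0 (g \<omega>)" and ?n = "\<lambda>\<omega>. max 0 (- g \<omega>)"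
  have ip: "integrable P ?p" "integrable P ?n" using i by auto
  note P = nn[OF ip(1) max.cobounded1] and N = nn[OF ip(2) max.cobounded1]
  have gd: "g \<omega> = ?p \<omega> - ?n \<omega>" for \<omega> by (simp add: max_def)
  have AEe: "AE \<omega> in P. (LINT \<omega>'|\<kappa> (Z \<omega>). g \<omega>') = (LINT \<omega>'|\<kappa> (Z \<omega>). ?p \<omega>') - (LINT \<omega>'|\<kappa> (Z \<omega>). ?n \<omega>')"
    using P[THEN conjunct1] N[THEN conjunct1]
    by eventually_elim (subst gd, simp)
  have m: "(\<lambda>\<omega>. LINT \<omega>'|\<kappa> (Z \<omega>). g \<omega>') \<in> borel_measurable P"
    by (rule measurable_compose[OF D(1) reg_cond_dist_integral_meas[OF R]]) (use i in simp)
  have id: "integrable P (\<lambda>\<omega>. (LINT \<omega>'|\<kappa> (Z \<omega>). ?p \<omega>') - (LINT \<omega>'|\<kappa> (Z \<omega>). ?n \<omega>'))"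
    using P N by simp
  show "integrable P (\<lambda>\<omega>. LINT \<omega>'|\<kappa> (Z \<omega>). g \<omega>')"
    using integrable_cong_AE[THEN iffD2, OF m borel_measurable_integrable[OF id] AEe id] .
  have "(LINT \<omega>|P. LINT \<omega>'|\<kappa> (Z \<omega>). g \<omega>') = (LINT \<omega>|P. (LINT \<omega>'|\<kappa> (Z \<omega>). ?p \<omega>') - (LINT \<omega>'|\<kappa> (Z \<omega>). ?n \<omega>'))"
    by (rule integral_cong_AE[OF m borel_measurable_integrable[OF id] AEe])
  also have "\<dots> = integral\<^sup>L P ?p - integral\<^sup>L P ?n" using P N by simp
  also have "\<dots> = (LINT \<omega>|P. ?p \<omega> - ?n \<omega>)" using ip by simp
  also have "\<dots> = integral\<^sup>L P g" by (simp only: gd[symmetric])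
  finally show "integral\<^sup>L P g = (LINT \<omega>|P. LINT \<omega>'|\<kappa> (Z \<omega>). g \<omega>')" ..
qed

text \<open>Bounded axis derivatives make \<open>F\<close> Lipschitz along axis-parallel paths, and
  a nearby point is reached by changing one coordinate at a time. This yields continuity of the
  conditional variance, for which differentiability and bounded derivatives are assumed, but not
  continuity of these derivatives.\<close>

lemma coordinatewise_Lipschitz_continuous:
  fixes F :: "real ^ 'd::finite \<Rightarrow> real"
  assumes S: "open S" and d: "\<And>s j. s \<in> S \<Longrightarrow> (\<lambda>t. F (s + t *\<^sub>R axis j 1)) differentiable (at 0)"
    and b: "\<And>s j. s \<in> S \<Longrightarrow> \<bar>partial j F s\<bar> \<le> C"
  shows "continuous_on S F"
  unfolding continuous_on_eq_continuous_at[OF S] isCont_def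
proof
  fix a assume a: "a \<in> S"
  obtain \<delta> where dl: "0 < \<delta>" "cube \<delta> a \<subseteq> S" using open_contains_cube[OF S a] .
  define pt where "pt J s = (\<chi> i. if i \<in> J then s $ i else a $ i)" for J and s :: "real ^ 'd"
  have ptc: "pt J s \<in> cube \<delta> a" if "s \<in> cube \<delta> a" for J s
    using that dl by (auto simp: pt_def cube_def)
  have step: "\<bar>F (pt J s) - F a\<bar> \<le> C * (\<Sum>j\<in>J. \<bar>s $ j - a $ j\<bar>)" if s: "s \<in> cube \<delta> a" for J s
    using finite[of J]
  proof (induction J rule: finite_induct)
    case empty
    have "pt {} s = a" by (simp add: pt_def vec_eq_iff)
    then show ?case by simp
  next
    case (insert j J)
    define t where "t = s $ j - a $ j"
    have pe: "pt (insert j J) s = pt J s + t *\<^sub>R axis j 1"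
      using insert(2) by (auto simp: pt_def vec_eq_iff axis_def t_def)
    have seg: "pt J s + r *\<^sub>R axis j 1 \<in> S" if "\<bar>r\<bar> \<le> \<bar>t\<bar>" "0 \<le> r * t" for r
      using cube_segment[OF ptc[OF s, of J] _ that] ptc[OF s, of "insert j J"] dl unfolding pe by auto
    have D: "((\<lambda>r. F (pt J s + r *\<^sub>R axis j 1)) has_real_derivative partial j F (pt J s + r *\<^sub>R axis j 1)) (at r)"
      if "\<bar>r\<bar> \<le> \<bar>t\<bar>" "0 \<le> r * t" for r
      by (rule DERIV_along_axis) (use d[OF seg[OF that], of j] in \<open>simp add: partial_def DERIV_deriv_iff_real_differentiable\<close>)
    have "\<bar>F (pt J s + t *\<^sub>R axis j 1) - F (pt J s)\<bar> \<le> C * \<bar>t\<bar>"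
    proof (cases "t = 0")
      case False
      have conv: "\<bar>r\<bar> \<le> \<bar>t\<bar> \<and> 0 \<le> r * t" if "r \<in> closed_segment 0 t" for r
        using that by (auto simp: closed_segment_eq_real_ivl zero_le_mult_iff split: if_splits)
      have "norm (F (pt J s + t *\<^sub>R axis j 1) - F (pt J s + 0 *\<^sub>R axis j 1)) \<le> C * norm (t - 0)"
      proof (rule field_differentiable_bound[where S = "closed_segment 0 t" and f = "\<lambda>r. F (pt J s + r *\<^sub>R axis j 1)"
            and f' = "\<lambda>r. partial j F (pt J s + r *\<^sub>R axis j 1)"])
        fix r assume r: "r \<in> closed_segment 0 t"
        show "((\<lambda>r. F (pt J s + r *\<^sub>R axis j 1)) has_field_derivative partial j F (pt J s + r *\<^sub>R axis j 1)) (at r within closed_segment 0 t)"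
          using D conv[OF r] by (blast intro: has_field_derivative_at_within)
        show "norm (partial j F (pt J s + r *\<^sub>R axis j 1)) \<le> C" using b[OF seg] conv[OF r] by simp
      qed auto
      then show ?thesis by simp
    qed simp
    then have "\<bar>F (pt (insert j J) s) - F a\<bar> \<le> C * \<bar>t\<bar> + C * (\<Sum>j\<in>J. \<bar>s $ j - a $ j\<bar>)"
      unfolding pe using insert.IH by linarith
    then show ?case using insert by (simp add: t_def distrib_left)
  qed
  have "\<forall>\<^sub>F s in at a. norm (F s - F a) \<le> C * (\<Sum>j\<in>UNIV. \<bar>s $ j - a $ j\<bar>)"
  proof -
    have "\<forall>\<^sub>F s in at a. s \<in> ball a \<delta>" using dl by (intro eventually_at_in_open') auto
    then show ?thesis
    proof eventually_elim
      case (elim s)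
      have "s \<in> cube \<delta> a"
        unfolding cube_def
      proof safe
        fix j
        have "\<bar>(s - a) $ j\<bar> \<le> norm (s - a)" by (rule component_le_norm_cart)
        then show "\<bar>s $ j - a $ j\<bar> \<le> \<delta>" using elim by (simp add: dist_norm norm_minus_commute)
      qed
      from step[OF this, of UNIV] show ?case by (simp add: pt_def)
    qed
  qed
  moreover have "((\<lambda>s. C * (\<Sum>j\<in>UNIV. \<bar>s $ j - a $ j\<bar>)) \<longlongrightarrow> 0) (at a)"
    by (rule tendsto_eq_intros refl | simp)+
  ultimately have "((\<lambda>s. F s - F a) \<longlongrightarrow> 0) (at a)" by (rule Lim_null_comparison)
  then show "(F \<longlongrightarrow> F a) (at a)" by (rule LIM_zero_cancel)
qed

section \<open>Densities and reference measures\<close>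

locale mediation_model = kernel k for k +
  fixes D :: "('w, 'd::finite, 'm, 'x) mediation" and cl cu :: real
  assumes med_setup: "mediation_setup D" and pos: "positivity D" and smooth: "smoothness D" and varreg: "variance_regularity D"
    and cl: "0 < cl"
    and nb: "\<And>a m x. a \<in> domA D \<Longrightarrow> m \<in> domM D \<Longrightarrow> x \<in> domX D \<Longrightarrow>
      cl \<le> \<bar>alp D a m x\<bar> \<and> \<bar>alp D a m x\<bar> \<le> cu \<and> cl \<le> \<bar>lam D a x\<bar> \<and> \<bar>lam D a x\<bar> \<le> cu \<and> \<bar>gam D x m a\<bar> \<le> cu"
begin

abbreviation "PP \<equiv> prb D"
abbreviation "SS \<equiv> domA D"
abbreviation "RA \<equiv> restrict_space lborel (domA D)"
abbreviation "RM \<equiv> refM D"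
abbreviation "RX \<equiv> refX D"
abbreviation "NZ \<equiv> refM D \<Otimes>\<^sub>M refX D"

definition "ZZ \<omega> = (med D \<omega>, cov D \<omega>)"

lemma setupD:
  "prob_space PP" "open SS" "sigma_finite_measure RM" "sigma_finite_measure RX"
  "domY D \<in> sets borel" "outc D \<in> measurable PP (restrict_space borel (domY D))"
  "\<And>a m x. a \<in> SS \<Longrightarrow> m \<in> domM D \<Longrightarrow> x \<in> domX D \<Longrightarrow> 0 \<le> dens D a m x"
  "distributed PP (RA \<Otimes>\<^sub>M NZ) (\<lambda>\<omega>. (trt D \<omega>, ZZ \<omega>)) (\<lambda>(a, m, x). ennreal (dens D a m x))"
  "reg_cond_dist PP RX (cov D) (givenX D)"
  "reg_cond_dist PP (RA \<Otimes>\<^sub>M RX) (\<lambda>\<omega>. (trt D \<omega>, cov D \<omega>)) (givenAX D)"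
  "reg_cond_dist PP ((RA \<Otimes>\<^sub>M RM) \<Otimes>\<^sub>M RX) (\<lambda>\<omega>. ((trt D \<omega>, med D \<omega>), cov D \<omega>)) (givenAMX D)"
  "\<And>a. a \<in> SS \<Longrightarrow> reg_cond_dist PP NZ (\<lambda>\<omega>. (pot_med D a \<omega>, cov D \<omega>)) (givenPM D a)"
  "\<And>a x. a \<in> SS \<Longrightarrow> x \<in> domX D \<Longrightarrow> distributed (givenAX D (a, x)) RM (med D) (\<lambda>m. ennreal (densM_AX D m a x))"
  "\<And>a. a \<in> SS \<Longrightarrow> pot_med D a \<in> measurable PP RM"
  "\<And>a. a \<in> SS \<Longrightarrow> (\<lambda>(m, \<omega>). pot_outc D a m \<omega>) \<in> borel_measurable (RM \<Otimes>\<^sub>M PP)"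
  using med_setup unfolding mediation_setup_def refA_def ZZ_def by blast+

sublocale PS: prob_space PP by (rule setupD)

lemma space_RA [simp]: "space RA = SS" by (simp add: space_restrict_space)

lemma space_RM [simp]: "space RM = domM D" and space_RX [simp]: "space RX = domX D"
  by (simp_all add: domM_def domX_def)

lemma ZZ_meas [measurable]: "ZZ \<in> measurable PP NZ" and trt_meas [measurable]: "trt D \<in> measurable PP RA"
  and med_meas [measurable]: "med D \<in> measurable PP RM" and cov_meas [measurable]: "cov D \<in> measurable PP RX"
  and outc_meas [measurable]: "outc D \<in> borel_measurable PP"
proof -
  have m: "(\<lambda>\<omega>. (trt D \<omega>, med D \<omega>, cov D \<omega>)) \<in> measurable PP (RA \<Otimes>\<^sub>M NZ)"
    using setupD(8) by (simp add: distributed_def ZZ_def)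
  show 1: "trt D \<in> measurable PP RA" using measurable_compose[OF m measurable_fst] by simp
  show 2: "ZZ \<in> measurable PP NZ" using measurable_compose[OF m measurable_snd] by (simp add: ZZ_def[abs_def])
  show "med D \<in> measurable PP RM" "cov D \<in> measurable PP RX"
    using measurable_compose[OF 2 measurable_fst] measurable_compose[OF 2 measurable_snd] by (simp_all add: ZZ_def)
  show "outc D \<in> borel_measurable PP" using setupD(6) by (rule measurable_restrict_space2_iff[THEN iffD1, THEN conjunct1])
qed

lemma in_dom: "\<omega> \<in> space PP \<Longrightarrow> trt D \<omega> \<in> SS" "\<omega> \<in> space PP \<Longrightarrow> med D \<omega> \<in> domM D" "\<omega> \<in> space PP \<Longrightarrow> cov D \<omega> \<in> domX D"
  "\<omega> \<in> space PP \<Longrightarrow> outc D \<omega> \<in> domY D"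
  using measurable_space[OF trt_meas] measurable_space[OF med_meas] measurable_space[OF cov_meas] measurable_space[OF setupD(6)]
  by (auto simp: space_restrict_space)

lemma nonempty: obtains s m x y where "s \<in> SS" "m \<in> domM D" "x \<in> domX D" "y \<in> domY D"
proof -
  obtain \<omega> where "\<omega> \<in> space PP" using PS.not_empty by auto
  then show ?thesis using in_dom that by blast
qed

lemma cu_pos: "0 < cu" and cl_le_cu: "cl \<le> cu"
proof -
  obtain s m x y where "s \<in> SS" "m \<in> domM D" "x \<in> domX D" "y \<in> domY D" by (rule nonempty)
  then show "0 < cu" "cl \<le> cu" using nb[of s m x] cl by linarith+
qed

context
  fixes a m x assumes amx: "a \<in> SS" "m \<in> domM D" "x \<in> domX D"
begin

text \<open>A quotient by zero is 0, so a positive quotient with nonnegative numerator has positive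
  numerator and denominator. Positivity of the conditional densities thus reaches the joint and the
  marginal ones.\<close>

lemma dens_pos: "0 < densAX D a x" "0 < dens D a m x" "0 < densX D x"
proof -
  have 1: "0 \<le> dens D a m x" by (rule setupD(7)[OF amx])
  have 2: "0 \<le> densAX D b x" if "b \<in> SS" for b
    unfolding densAX_def using setupD(7) that amx by (intro integral_nonneg_AE AE_I2) auto
  have 3: "0 \<le> densX D x"
    unfolding densX_def refA_def using 2 by (intro integral_nonneg_AE AE_I2) auto
  have p: "0 < dens D a m x / densAX D a x" "0 < densAX D a x / densX D x"
    using pos amx unfolding positivity_def densM_AX_def densA_X_def by auto
  show "0 < densAX D a x" "0 < dens D a m x" "0 < densX D x"
    using p 1 2[OF amx(1)] 3 by (auto simp: zero_less_divide_iff)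
qed

lemma alp_lam_pos: "0 < alp D a m x" "0 < lam D a x" "cl \<le> alp D a m x" "alp D a m x \<le> cu" "cl \<le> lam D a x" "lam D a x \<le> cu"
proof -
  show p: "0 < alp D a m x" "0 < lam D a x"
    using dens_pos by (simp_all add: alp_def densM_AX_def lam_def densA_X_def)
  show "cl \<le> alp D a m x" "alp D a m x \<le> cu" "cl \<le> lam D a x" "lam D a x \<le> cu"
    using nb[OF amx] p by auto
qed

lemma dens_eq: "dens D a m x = alp D a m x * densX D x / lam D a x"
  using dens_pos by (simp add: alp_def densM_AX_def lam_def densA_X_def)

text \<open>By \<open>dens_eq\<close> the joint density is \<open>densX D x\<close> times
  \<open>alp / lam\<close>, and this ratio lies between \<open>cl / cu\<close> and
  \<open>cu / cl\<close>.\<close>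

lemma dens_bounds: "cl / cu * densX D x \<le> dens D a m x" "dens D a m x \<le> cu / cl * densX D x"
proof -
  note p = alp_lam_pos dens_pos
  have "cl / cu \<le> alp D a m x / lam D a x" "alp D a m x / lam D a x \<le> cu / cl"
    using p cl cu_pos by (auto intro!: frac_le)
  then have "cl / cu * densX D x \<le> alp D a m x / lam D a x * densX D x" "alp D a m x / lam D a x * densX D x \<le> cu / cl * densX D x"
    using p by (intro mult_right_mono; simp)+
  then show "cl / cu * densX D x \<le> dens D a m x" "dens D a m x \<le> cu / cl * densX D x"
    by (simp_all add: dens_eq)
qed

end

text \<open>\<open>densAX\<close> is a Bochner integral, and a Bochner integral different from zero
  certifies integrability of its integrand.\<close>

lemma alp_integral:
  assumes "a \<in> SS" "x \<in> domX D"
  shows "integrable RM (\<lambda>m. alp D a m x)" "(LINT m|RM. alp D a m x) = 1"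
proof -
  obtain s m x' y where m: "m \<in> domM D" by (rule nonempty)
  have p: "0 < densAX D a x" by (rule dens_pos(1)[OF assms(1) m assms(2)])
  then have "integrable RM (\<lambda>m. dens D a m x)"
    unfolding densAX_def using not_integrable_integral_eq by fastforce
  then show "integrable RM (\<lambda>m. alp D a m x)" "(LINT m|RM. alp D a m x) = 1"
    using p by (simp_all add: alp_def densM_AX_def densAX_def)
qed

lemma finite_measure_of_integrable_bound:
  assumes "integrable N F" "\<And>z. z \<in> space N \<Longrightarrow> c \<le> F z" "0 < (c :: real)"
  shows "finite_measure N"
proof
  have "ennreal c * emeasure N (space N) = (\<integral>\<^sup>+z. ennreal c \<partial>N)" by simp
  also have "\<dots> \<le> (\<integral>\<^sup>+z. ennreal (norm (F z)) \<partial>N)"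
    using assms(2) by (intro nn_integral_mono ennreal_leI) fastforce
  also have "\<dots> < \<infinity>" using assms(1) by (simp add: integrable_iff_bounded)
  finally show "emeasure N (space N) \<noteq> \<infinity>" using assms(3) by (auto simp: ennreal_mult_eq_top_iff)
qed

text \<open>A conditional density of the mediator that is bounded away from zero forces a finite reference measure.\<close>

sublocale FM: finite_measure RM
proof -
  obtain s m x y where a: "s \<in> SS" "m \<in> domM D" "x \<in> domX D" by (rule nonempty)
  show "finite_measure RM"
    using alp_integral[OF a(1,3)] alp_lam_pos(3)[OF a(1) _ a(3)] cl
    by (intro finite_measure_of_integrable_bound[of RM "\<lambda>m. alp D s m x" cl]) auto
qed

text \<open>An upper bound on \<open>lam\<close> is a lower bound on the density of the treatment
  given \<open>X\<close>. The integral of that density over the treatment range is finite, so the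
  range has finite Lebesgue measure.\<close>

sublocale FA: finite_measure RA
proof -
  obtain s m x y where a: "s \<in> SS" "m \<in> domM D" "x \<in> domX D" by (rule nonempty)
  have p: "0 < densX D x" by (rule dens_pos(3)[OF a])
  then have i: "integrable RA (\<lambda>a. densAX D a x)"
    unfolding densX_def refA_def using not_integrable_integral_eq by fastforce
  have "densX D x / cu \<le> densAX D b x" if b: "b \<in> SS" for b
  proof -
    have "densAX D b x = densX D x / lam D b x"
      using dens_pos[OF b a(2,3)] by (simp add: lam_def densA_X_def)
    moreover have "densX D x / cu \<le> densX D x / lam D b x"
      using alp_lam_pos[OF b a(2,3)] p by (intro divide_left_mono) (auto intro: mult_pos_pos order_less_le_trans)
    ultimately show ?thesis by simp
  qed
  then show "finite_measure RA"
    using i p cu_pos by (intro finite_measure_of_integrable_bound[of RA "\<lambda>a. densAX D a x" "densX D x / cu"]) auto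
qed

sublocale SX: sigma_finite_measure RX by (rule setupD)
sublocale MX: pair_sigma_finite RM RX ..

lemma NZ_sigma_finite: "sigma_finite_measure NZ"
  by (rule sigma_finite_pair_measure[OF FM.sigma_finite_measure_axioms SX.sigma_finite_measure_axioms])

sublocale AMX: pair_sigma_finite RA NZ
  by (intro pair_sigma_finite.intro FA.sigma_finite_measure_axioms NZ_sigma_finite)

lemma vol_pos: "0 < measure RA SS"
proof -
  obtain s m x y where a: "s \<in> SS" "m \<in> domM D" "x \<in> domX D" by (rule nonempty)
  have "emeasure lborel SS \<noteq> 0"
    using open_not_negligible[OF setupD(2)] a(1) setupD(2) by (auto simp: negligible_iff_emeasure0 emeasure_completion)
  then have "emeasure RA SS \<noteq> 0"
    using setupD(2) by (subst emeasure_restrict_space) auto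
  then show ?thesis using FA.emeasure_eq_measure[of SS] by (auto simp: zero_less_measure_iff)
qed

lemma dens_meas [measurable]: "(\<lambda>p. dens D (fst p) (fst (snd p)) (snd (snd p))) \<in> borel_measurable (RA \<Otimes>\<^sub>M NZ)"
proof -
  have "(\<lambda>(a, m, x). ennreal (dens D a m x)) \<in> borel_measurable (RA \<Otimes>\<^sub>M NZ)"
    using setupD(8) by (simp add: distributed_def)
  then have "(\<lambda>p. enn2real (ennreal (dens D (fst p) (fst (snd p)) (snd (snd p))))) \<in> borel_measurable (RA \<Otimes>\<^sub>M NZ)"
    by (simp add: split_beta')
  also have "?this \<longleftrightarrow> ?thesis"
    by (intro measurable_cong) (auto simp: space_pair_measure intro!: enn2real_ennreal setupD(7))
  finally show ?thesis .
qed

lemma dens_section: "m \<in> domM D \<Longrightarrow> x \<in> domX D \<Longrightarrow> integrable RA (\<lambda>s. dens D s m x)"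
proof -
  assume mx: "m \<in> domM D" "x \<in> domX D"
  have m: "(\<lambda>s. dens D s m x) \<in> borel_measurable RA"
    using measurable_compose[OF measurable_Pair2'[of "(m, x)" NZ RA] dens_meas] mx by (simp add: space_pair_measure)
  show ?thesis
    by (rule FA.integrable_const_bound[of _ "cu / cl * densX D x"])
      (use m dens_bounds(2)[OF _ mx] in \<open>auto simp: abs_of_pos[OF dens_pos(2)[OF _ mx]] intro!: AE_I2\<close>)
qed

lemma densMX_bounds:
  assumes mx: "m \<in> domM D" "x \<in> domX D"
  shows "cl / cu * measure RA SS * densX D x \<le> densMX D m x" "densMX D m x \<le> cu / cl * measure RA SS * densX D x"
    "0 < densMX D m x"
proof -
  have "(LINT s|RA. cl / cu * densX D x) \<le> densMX D m x" "densMX D m x \<le> (LINT s|RA. cu / cl * densX D x)"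
    unfolding densMX_def refA_def using dens_section[OF mx] dens_bounds[OF _ mx] by (intro integral_mono; simp)+
  then show 1: "cl / cu * measure RA SS * densX D x \<le> densMX D m x" "densMX D m x \<le> cu / cl * measure RA SS * densX D x"
    by (simp_all add: mult_ac)
  obtain s m' x' y where "s \<in> SS" by (rule nonempty)
  then have "0 < cl / cu * measure RA SS * densX D x"
    using vol_pos cl cu_pos dens_pos(3)[OF _ mx] by (intro mult_pos_pos divide_pos_pos)
  then show "0 < densMX D m x" using 1 by linarith
qed

lemma densMX_meas [measurable]: "(\<lambda>p. densMX D (fst p) (snd p)) \<in> borel_measurable NZ"
proof -
  have "(\<lambda>z. LINT s|RA. dens D (fst (s, z)) (fst (snd (s, z))) (snd (snd (s, z)))) \<in> borel_measurable NZ"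
    by (intro FA.borel_measurable_lebesgue_integral) (simp add: split_beta' measurable_pair_swap_iff[of _ NZ])
  then show ?thesis by (simp add: densMX_def refA_def)
qed

lemma Z_law: "distributed PP NZ ZZ (\<lambda>z. ennreal (densMX D (fst z) (snd z)))"
proof -
  have d: "distributed PP NZ ZZ (\<lambda>z. \<integral>\<^sup>+ s. (\<lambda>(a, m, x). ennreal (dens D a m x)) (s, z) \<partial>RA)"
    by (rule PS.distr_marginal2[OF FA.sigma_finite_measure_axioms NZ_sigma_finite setupD(8)])
  have e: "(\<integral>\<^sup>+ s. (\<lambda>(a, m, x). ennreal (dens D a m x)) (s, z) \<partial>RA) = ennreal (densMX D (fst z) (snd z))" if z: "z \<in> space NZ" for z
  proof -
    have mx: "fst z \<in> domM D" "snd z \<in> domX D" using z by (auto simp: space_pair_measure)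
    show ?thesis
      unfolding densMX_def refA_def using nn_integral_eq_integral[OF dens_section[OF mx] AE_I2] setupD(7)[OF _ mx]
      by (simp add: split_beta')
  qed
  have "(\<lambda>z. \<integral>\<^sup>+ s. (\<lambda>(a, m, x). ennreal (dens D a m x)) (s, z) \<partial>RA) \<in> borel_measurable NZ"
    using d unfolding distributed_def by blast
  with d show ?thesis by (subst distributed_cong_density[OF AE_I2[OF e], symmetric]) auto
qed

lemma densA_MX_meas [measurable]: "(\<lambda>p. densA_MX D (fst p) (fst (snd p)) (snd (snd p))) \<in> borel_measurable (RA \<Otimes>\<^sub>M NZ)"
  unfolding densA_MX_def using measurable_compose[OF measurable_snd densMX_meas, of RA] by measurable

text \<open>The law of \<open>ZZ\<close> has the everywhere positive density \<open>densMX\<close>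
  with respect to \<open>NZ\<close>; relative to this law the joint density is divided by
  \<open>densMX\<close>.\<close>

lemma AZ_law: "distributed PP (RA \<Otimes>\<^sub>M distr PP NZ ZZ) (\<lambda>\<omega>. (trt D \<omega>, ZZ \<omega>)) (\<lambda>p. ennreal (densA_MX D (fst p) (fst (snd p)) (snd (snd p))))"
proof -
  let ?q = "\<lambda>z. ennreal (densMX D (fst z) (snd z))" and ?f = "\<lambda>p. ennreal (densA_MX D (fst p) (fst (snd p)) (snd (snd p)))"
  have dz: "distr PP NZ ZZ = density NZ ?q" using Z_law by (simp add: distributed_def)
  have qm: "?q \<in> borel_measurable NZ" by measurable
  have sf: "sigma_finite_measure (density NZ ?q)"
    unfolding dz[symmetric] by (intro prob_space_imp_sigma_finite PS.prob_space_distr) measurable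
  have "RA \<Otimes>\<^sub>M density NZ ?q = density RA (\<lambda>_. 1) \<Otimes>\<^sub>M density NZ ?q" by (simp add: density_1)
  also have "\<dots> = density (RA \<Otimes>\<^sub>M NZ) (\<lambda>(s, z). 1 * ?q z)"
    by (rule pair_measure_density[OF _ qm NZ_sigma_finite sf]) simp
  finally have pd: "RA \<Otimes>\<^sub>M distr PP NZ ZZ = density (RA \<Otimes>\<^sub>M NZ) (\<lambda>p. ?q (snd p))" by (simp add: dz split_beta')
  have fm: "?f \<in> borel_measurable (RA \<Otimes>\<^sub>M NZ)" by measurable
  have "density (RA \<Otimes>\<^sub>M distr PP NZ ZZ) ?f = density (RA \<Otimes>\<^sub>M NZ) (\<lambda>p. ?q (snd p) * ?f p)"
    unfolding pd by (rule density_density_eq) measurable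
  also have "\<dots> = density (RA \<Otimes>\<^sub>M NZ) (\<lambda>(a, m, x). ennreal (dens D a m x))"
  proof (rule density_cong)
    show "AE p in RA \<Otimes>\<^sub>M NZ. ?q (snd p) * ?f p = (\<lambda>(a, m, x). ennreal (dens D a m x)) p"
    proof (intro AE_I2)
      fix p assume "p \<in> space (RA \<Otimes>\<^sub>M NZ)"
      then have s: "fst p \<in> SS" "fst (snd p) \<in> domM D" "snd (snd p) \<in> domX D" by (auto simp: space_pair_measure)
      note q0 = densMX_bounds(3)[OF s(2,3)]
      show "?q (snd p) * ?f p = (\<lambda>(a, m, x). ennreal (dens D a m x)) p"
        using q0 setupD(7)[OF s] by (simp add: split_beta' densA_MX_def ennreal_mult[symmetric])
    qed
    show "(\<lambda>p. ?q (snd p) * ?f p) \<in> borel_measurable (RA \<Otimes>\<^sub>M NZ)"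
      using measurable_compose[OF measurable_snd qm, of RA] fm by measurable
    show "(\<lambda>(a, m, x). ennreal (dens D a m x)) \<in> borel_measurable (RA \<Otimes>\<^sub>M NZ)"
      using setupD(8) by (simp add: distributed_def)
  qed
  also have "\<dots> = distr PP (RA \<Otimes>\<^sub>M NZ) (\<lambda>\<omega>. (trt D \<omega>, ZZ \<omega>))" using setupD(8) by (simp add: distributed_def)
  also have "\<dots> = distr PP (RA \<Otimes>\<^sub>M distr PP NZ ZZ) (\<lambda>\<omega>. (trt D \<omega>, ZZ \<omega>))"
    by (intro distr_cong refl sets_pair_measure_cong) auto
  finally have e: "distr PP (RA \<Otimes>\<^sub>M distr PP NZ ZZ) (\<lambda>\<omega>. (trt D \<omega>, ZZ \<omega>)) = density (RA \<Otimes>\<^sub>M distr PP NZ ZZ) ?f" ..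
  have sets: "sets (RA \<Otimes>\<^sub>M distr PP NZ ZZ) = sets (RA \<Otimes>\<^sub>M NZ)" by (intro sets_pair_measure_cong) auto
  show ?thesis
    unfolding distributed_def
    using e fm by (simp add: measurable_cong_sets[OF sets refl] measurable_cong_sets[OF refl sets])
qed

end

section \<open>Conditional moments of the outcome\<close>

context mediation_model begin

definition "fz s z = densA_MX D s (fst z) (snd z)"
definition "gz s z = gam D (snd z) (fst z) s"
definition "vz s z = varY D (snd z) (fst z) s"

context
  fixes a m x assumes amx: "a \<in> SS" "m \<in> domM D" "x \<in> domX D"
begin

lemma givenAMX_prob: "prob_space (givenAMX D ((a, m), x))"
  and givenAMX_sets: "sets (givenAMX D ((a, m), x)) = sets PP"
  and givenAMX_AE: "AE \<omega> in givenAMX D ((a, m), x). trt D \<omega> = a \<and> med D \<omega> = m \<and> cov D \<omega> = x"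
proof -
  have "((a, m), x) \<in> space ((RA \<Otimes>\<^sub>M RM) \<Otimes>\<^sub>M RX)" using amx by (simp add: space_pair_measure)
  note R = reg_cond_distD(5,6,3)[OF setupD(11) this]
  show "prob_space (givenAMX D ((a, m), x))" "sets (givenAMX D ((a, m), x)) = sets PP" by (rule R)+
  show "AE \<omega> in givenAMX D ((a, m), x). trt D \<omega> = a \<and> med D \<omega> = m \<and> cov D \<omega> = x" using R(3) by simp
qed

lemma givenAMX_meas: "F \<in> borel_measurable PP \<Longrightarrow> F \<in> borel_measurable (givenAMX D ((a, m), x))"
  by (simp add: measurable_cong_sets[OF givenAMX_sets refl])

lemma givenAMX_Y:
  "integrable (givenAMX D ((a, m), x)) (\<lambda>\<omega>. (outc D \<omega>)\<^sup>2)" "integrable (givenAMX D ((a, m), x)) (outc D)"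
  "(LINT \<omega>|givenAMX D ((a, m), x). (outc D \<omega>)\<^sup>2) = varY D x m a + (gam D x m a)\<^sup>2" "0 \<le> varY D x m a"
proof -
  interpret K: prob_space "givenAMX D ((a, m), x)" by (rule givenAMX_prob)
  show 1: "integrable (givenAMX D ((a, m), x)) (\<lambda>\<omega>. (outc D \<omega>)\<^sup>2)"
    using varreg amx unfolding variance_regularity_def by blast
  show 2: "integrable (givenAMX D ((a, m), x)) (outc D)"
    by (rule K.square_integrable_imp_integrable[OF givenAMX_meas[OF outc_meas] 1])
  show "(LINT \<omega>|givenAMX D ((a, m), x). (outc D \<omega>)\<^sup>2) = varY D x m a + (gam D x m a)\<^sup>2"
    using K.variance_eq[OF 2 1] by (simp add: varY_def var_of_def gam_def)
  show "0 \<le> varY D x m a" by (simp add: varY_def var_of_def)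
qed

end

lemma reassoc_meas: "(\<lambda>p. ((fst p, fst (snd p)), snd (snd p))) \<in> measurable (RA \<Otimes>\<^sub>M NZ) ((RA \<Otimes>\<^sub>M RM) \<Otimes>\<^sub>M RX)"
  by measurable

lemma fz_meas: "(\<lambda>p. fz (fst p) (snd p)) \<in> borel_measurable (RA \<Otimes>\<^sub>M NZ)"
  unfolding fz_def by (rule densA_MX_meas)

lemma gz_meas: "(\<lambda>p. gz (fst p) (snd p)) \<in> borel_measurable (RA \<Otimes>\<^sub>M NZ)"
  using measurable_compose[OF reassoc_meas reg_cond_dist_integral_meas[OF setupD(11) outc_meas]]
  by (simp add: gz_def gam_def)

lemma vz_meas: "(\<lambda>p. vz (fst p) (snd p)) \<in> borel_measurable (RA \<Otimes>\<^sub>M NZ)"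
proof -
  have "(\<lambda>\<omega>. (outc D \<omega>)\<^sup>2) \<in> borel_measurable PP" by measurable
  from measurable_compose[OF reassoc_meas reg_cond_dist_integral_meas[OF setupD(11) this]]
  have "(\<lambda>p. LINT \<omega>|givenAMX D ((fst p, fst (snd p)), snd (snd p)). (outc D \<omega>)\<^sup>2) \<in> borel_measurable (RA \<Otimes>\<^sub>M NZ)" .
  then have "(\<lambda>p. (LINT \<omega>|givenAMX D ((fst p, fst (snd p)), snd (snd p)). (outc D \<omega>)\<^sup>2) - (gz (fst p) (snd p))\<^sup>2) \<in> borel_measurable (RA \<Otimes>\<^sub>M NZ)"
    using gz_meas by measurable
  also have "?this \<longleftrightarrow> ?thesis"
    by (intro measurable_cong) (auto simp: space_pair_measure givenAMX_Y(3) vz_def gz_def)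
  finally show ?thesis .
qed

text \<open>\<open>givenAMX\<close> is concentrated on its conditioning value, so \<open>b\<close>
  is constant under it and can be pulled out. The uniform bound \<open>K\<close> on the conditional
  absolute moment turns integrability of \<open>b\<close> into integrability of the product.\<close>

lemma conditional_product:
  fixes b :: "real ^ 'd \<Rightarrow> 'm \<times> 'x \<Rightarrow> real" and \<phi> :: "real \<Rightarrow> real"
  assumes bm: "(\<lambda>p. b (fst p) (snd p)) \<in> borel_measurable (RA \<Otimes>\<^sub>M NZ)" and bi: "integrable PP (\<lambda>\<omega>. b (trt D \<omega>) (ZZ \<omega>))"
    and \<phi>: "\<phi> \<in> borel_measurable borel"
    and i: "\<And>a m x. a \<in> SS \<Longrightarrow> m \<in> domM D \<Longrightarrow> x \<in> domX D \<Longrightarrow> integrable (givenAMX D ((a, m), x)) (\<lambda>\<omega>. \<phi> (outc D \<omega>))"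
    and K: "\<And>a m x. a \<in> SS \<Longrightarrow> m \<in> domM D \<Longrightarrow> x \<in> domX D \<Longrightarrow> (LINT \<omega>|givenAMX D ((a, m), x). \<bar>\<phi> (outc D \<omega>)\<bar>) \<le> K"
  shows "integrable PP (\<lambda>\<omega>. b (trt D \<omega>) (ZZ \<omega>) * \<phi> (outc D \<omega>))"
    and "(LINT \<omega>|PP. b (trt D \<omega>) (ZZ \<omega>) * \<phi> (outc D \<omega>)) =
      (LINT \<omega>|PP. b (trt D \<omega>) (ZZ \<omega>) * (LINT \<omega>'|givenAMX D ((trt D \<omega>, med D \<omega>), cov D \<omega>). \<phi> (outc D \<omega>')))"
proof -
  have bP: "(\<lambda>\<omega>. b (trt D \<omega>) (ZZ \<omega>)) \<in> borel_measurable PP" using bi by simp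
  have phiP: "(\<lambda>\<omega>. \<phi> (outc D \<omega>)) \<in> borel_measurable PP" by (rule measurable_compose[OF outc_meas \<phi>])
  have gm: "(\<lambda>\<omega>. b (trt D \<omega>) (ZZ \<omega>) * \<phi> (outc D \<omega>)) \<in> borel_measurable PP" using bP phiP by measurable
  let ?\<kappa> = "\<lambda>\<omega>. givenAMX D ((trt D \<omega>, med D \<omega>), cov D \<omega>)"
  have AEk: "AE \<omega>' in ?\<kappa> \<omega>. b (trt D \<omega>') (ZZ \<omega>') * \<phi> (outc D \<omega>') = b (trt D \<omega>) (ZZ \<omega>) * \<phi> (outc D \<omega>')"
    if w: "\<omega> \<in> space PP" for \<omega>
    using givenAMX_AE[OF in_dom(1-3)[OF w]] by eventually_elim (simp add: ZZ_def)
  have "(\<integral>\<^sup>+\<omega>. ennreal (norm (b (trt D \<omega>) (ZZ \<omega>) * \<phi> (outc D \<omega>))) \<partial>PP) =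
     (\<integral>\<^sup>+\<omega>. \<integral>\<^sup>+\<omega>'. ennreal (norm (b (trt D \<omega>') (ZZ \<omega>') * \<phi> (outc D \<omega>'))) \<partial>?\<kappa> \<omega> \<partial>PP)"
    by (rule reg_cond_dist_nn_integral[OF setupD(11)]) (use gm in measurable)
  also have "\<dots> \<le> (\<integral>\<^sup>+\<omega>. ennreal \<bar>b (trt D \<omega>) (ZZ \<omega>)\<bar> * ennreal K \<partial>PP)"
  proof (rule nn_integral_mono)
    fix \<omega> assume w: "\<omega> \<in> space PP"
    have "(\<integral>\<^sup>+\<omega>'. ennreal (norm (b (trt D \<omega>') (ZZ \<omega>') * \<phi> (outc D \<omega>'))) \<partial>?\<kappa> \<omega>) =
        (\<integral>\<^sup>+\<omega>'. ennreal \<bar>b (trt D \<omega>) (ZZ \<omega>)\<bar> * ennreal \<bar>\<phi> (outc D \<omega>')\<bar> \<partial>?\<kappa> \<omega>)"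
      by (rule nn_integral_cong_AE, use AEk[OF w] in eventually_elim) (simp only: real_norm_def abs_mult ennreal_mult abs_ge_zero)
    also have "\<dots> = ennreal \<bar>b (trt D \<omega>) (ZZ \<omega>)\<bar> * (\<integral>\<^sup>+\<omega>'. ennreal \<bar>\<phi> (outc D \<omega>')\<bar> \<partial>?\<kappa> \<omega>)"
      using givenAMX_meas[OF in_dom(1-3)[OF w] phiP] by (intro nn_integral_cmult) measurable
    also have "(\<integral>\<^sup>+\<omega>'. ennreal \<bar>\<phi> (outc D \<omega>')\<bar> \<partial>?\<kappa> \<omega>) = ennreal (LINT \<omega>'|?\<kappa> \<omega>. \<bar>\<phi> (outc D \<omega>')\<bar>)"
      using i[OF in_dom(1-3)[OF w]] by (intro nn_integral_eq_integral) auto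
    also have "\<dots> \<le> ennreal K" by (rule ennreal_leI[OF K[OF in_dom(1-3)[OF w]]])
    finally show "(\<integral>\<^sup>+\<omega>'. ennreal (norm (b (trt D \<omega>') (ZZ \<omega>') * \<phi> (outc D \<omega>'))) \<partial>?\<kappa> \<omega>) \<le> ennreal \<bar>b (trt D \<omega>) (ZZ \<omega>)\<bar> * ennreal K"
      by (simp add: mult_left_mono)
  qed
  also have "\<dots> = (\<integral>\<^sup>+\<omega>. ennreal \<bar>b (trt D \<omega>) (ZZ \<omega>)\<bar> \<partial>PP) * ennreal K"
    using bP by (intro nn_integral_multc) measurable
  also have "\<dots> < \<infinity>" using bi by (simp add: integrable_iff_bounded ennreal_mult_less_top)
  finally show int: "integrable PP (\<lambda>\<omega>. b (trt D \<omega>) (ZZ \<omega>) * \<phi> (outc D \<omega>))"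
    using gm by (simp add: integrable_iff_bounded)
  have "(LINT \<omega>|PP. b (trt D \<omega>) (ZZ \<omega>) * \<phi> (outc D \<omega>)) = (LINT \<omega>|PP. LINT \<omega>'|?\<kappa> \<omega>. b (trt D \<omega>') (ZZ \<omega>') * \<phi> (outc D \<omega>'))"
    by (rule reg_cond_dist_integral(2)[OF setupD(11) int])
  also have "\<dots> = (LINT \<omega>|PP. b (trt D \<omega>) (ZZ \<omega>) * (LINT \<omega>'|?\<kappa> \<omega>. \<phi> (outc D \<omega>')))"
  proof (intro Bochner_Integration.integral_cong refl)
    fix \<omega> assume w: "\<omega> \<in> space PP"
    have "(LINT \<omega>'|?\<kappa> \<omega>. b (trt D \<omega>') (ZZ \<omega>') * \<phi> (outc D \<omega>')) = (LINT \<omega>'|?\<kappa> \<omega>. b (trt D \<omega>) (ZZ \<omega>) * \<phi> (outc D \<omega>'))"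
      using givenAMX_meas[OF in_dom(1-3)[OF w] gm] givenAMX_meas[OF in_dom(1-3)[OF w] phiP] AEk[OF w]
      by (intro integral_cong_AE) auto
    then show "(LINT \<omega>'|?\<kappa> \<omega>. b (trt D \<omega>') (ZZ \<omega>') * \<phi> (outc D \<omega>')) = b (trt D \<omega>) (ZZ \<omega>) * (LINT \<omega>'|?\<kappa> \<omega>. \<phi> (outc D \<omega>'))"
      by simp
  qed
  finally show "(LINT \<omega>|PP. b (trt D \<omega>) (ZZ \<omega>) * \<phi> (outc D \<omega>)) =
      (LINT \<omega>|PP. b (trt D \<omega>) (ZZ \<omega>) * (LINT \<omega>'|?\<kappa> \<omega>. \<phi> (outc D \<omega>')))" .
qed

lemma partial_has_derivative:
  assumes "coord_differentiable r S F" "i < r" "s \<in> S"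
  shows "((\<lambda>t. (partial j ^^ i) F (s + t *\<^sub>R axis j 1)) has_real_derivative (partial j ^^ Suc i) F s) (at 0)"
  using assms unfolding coord_differentiable_def by (auto simp: partial_def DERIV_deriv_iff_real_differentiable)

definition "pder i F j s z = (partial j ^^ i) (\<lambda>s. F s z) s" for F :: "real ^ 'd \<Rightarrow> 'm \<times> 'x \<Rightarrow> real"

lemma ex_model_bound: "\<exists>C\<ge>1. \<forall>s\<in>SS. \<forall>z\<in>space NZ. \<bar>vz s z\<bar> \<le> C \<and>
    (\<forall>j. \<bar>pder 1 vz j s z\<bar> \<le> C) \<and> (\<forall>j. \<forall>i\<le>2. \<bar>pder i fz j s z\<bar> \<le> C \<and> \<bar>pder i gz j s z\<bar> \<le> C)"
proof -
  obtain C1 where C1: "\<And>m x j i a. m \<in> domM D \<Longrightarrow> x \<in> domX D \<Longrightarrow> i \<le> 3 \<Longrightarrow> a \<in> SS \<Longrightarrow> \<bar>(partial j ^^ i) (\<lambda>a. densA_MX D a m x) a\<bar> \<le> C1"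
    using smooth unfolding smoothness_def bounded_partials_def by fastforce
  obtain C2 where C2: "\<And>m x j i a. m \<in> domM D \<Longrightarrow> x \<in> domX D \<Longrightarrow> i \<le> 3 \<Longrightarrow> a \<in> SS \<Longrightarrow> \<bar>(partial j ^^ i) (\<lambda>a. gam D x m a) a\<bar> \<le> C2"
    using smooth unfolding smoothness_def bounded_partials_def by fastforce
  obtain C3 where C3: "\<And>m x j i a. m \<in> domM D \<Longrightarrow> x \<in> domX D \<Longrightarrow> i \<le> 2 \<Longrightarrow> a \<in> SS \<Longrightarrow> \<bar>(partial j ^^ i) (\<lambda>a. varY D x m a) a\<bar> \<le> C3"
    using varreg unfolding variance_regularity_def bounded_partials_def by fastforce
  define C where "C = max 1 (max C1 (max C2 C3))"
  have le: "1 \<le> C" "C1 \<le> C" "C2 \<le> C" "C3 \<le> C" by (auto simp: C_def)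
  show ?thesis
  proof (intro exI[of _ C] conjI ballI allI impI)
    fix s z assume s: "s \<in> SS" and z: "z \<in> space NZ"
    have mx: "fst z \<in> domM D" "snd z \<in> domX D" using z by (auto simp: space_pair_measure)
    show "\<bar>vz s z\<bar> \<le> C" using C3[OF mx, of 0 s] s le by (simp add: vz_def)
    show "\<bar>pder 1 vz j s z\<bar> \<le> C" for j using C3[OF mx, of 1 s j] s le by (simp add: pder_def vz_def)
    show "\<bar>pder i fz j s z\<bar> \<le> C" "\<bar>pder i gz j s z\<bar> \<le> C" if "i \<le> 2" for i j
      using C1[OF mx, of i s j] C2[OF mx, of i s j] that s le by (auto simp: pder_def fz_def gz_def)
  qed (rule le)
qed

text \<open>The interpretation of \<open>kernel_model\<close> takes one constant as a parameter, so
  a common bound for densities, means, variances and their derivatives is fixed by choice.\<close>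

definition "CC = (SOME C. C \<ge> 1 \<and> (\<forall>s\<in>SS. \<forall>z\<in>space NZ. \<bar>vz s z\<bar> \<le> C \<and>
    (\<forall>j. \<bar>pder 1 vz j s z\<bar> \<le> C) \<and> (\<forall>j. \<forall>i\<le>2. \<bar>pder i fz j s z\<bar> \<le> C \<and> \<bar>pder i gz j s z\<bar> \<le> C)))"

lemma CC: "1 \<le> CC" "s \<in> SS \<Longrightarrow> z \<in> space NZ \<Longrightarrow> \<bar>vz s z\<bar> \<le> CC" "s \<in> SS \<Longrightarrow> z \<in> space NZ \<Longrightarrow> \<bar>pder 1 vz j s z\<bar> \<le> CC"
  "s \<in> SS \<Longrightarrow> z \<in> space NZ \<Longrightarrow> i \<le> 2 \<Longrightarrow> \<bar>pder i fz j s z\<bar> \<le> CC" "s \<in> SS \<Longrightarrow> z \<in> space NZ \<Longrightarrow> i \<le> 2 \<Longrightarrow> \<bar>pder i gz j s z\<bar> \<le> CC"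
  using someI_ex[OF ex_model_bound[unfolded Bex_def]] unfolding CC_def by blast+

lemma pder_0: "pder 0 F j s z = F s z"
  by (simp add: pder_def)

text \<open>Here the null-event conditioning is converted into integral identities:
  \<open>Y1\<close> and \<open>Y2\<close> are \<open>conditional_product\<close> for the identity
  and for the square of the outcome.\<close>

sublocale KM: kernel_model k PP SS NZ "trt D" ZZ "outc D" fz gz vz "pder 1 fz" "pder 2 fz" "pder 1 gz" "pder 2 gz" CC
proof
  show "open SS" by (rule setupD)
  show "1 \<le> CC" by (rule CC)
  show "ZZ \<in> measurable PP NZ" "outc D \<in> borel_measurable PP" "trt D \<in> measurable PP RA" by measurable
  show "(\<lambda>p. fz (fst p) (snd p)) \<in> borel_measurable (RA \<Otimes>\<^sub>M NZ)" by (rule fz_meas)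
  show "(\<lambda>p. gz (fst p) (snd p)) \<in> borel_measurable (RA \<Otimes>\<^sub>M NZ)" by (rule gz_meas)
  show "(\<lambda>p. vz (fst p) (snd p)) \<in> borel_measurable (RA \<Otimes>\<^sub>M NZ)" by (rule vz_meas)
  show "distributed PP (RA \<Otimes>\<^sub>M distr PP NZ ZZ) (\<lambda>w. (trt D w, ZZ w)) (\<lambda>p. ennreal (fz (fst p) (snd p)))"
    unfolding fz_def by (rule AZ_law)
  fix z assume z: "z \<in> space NZ"
  then have mx: "fst z \<in> domM D" "snd z \<in> domX D" by (auto simp: space_pair_measure)
  \<comment> \<open>\<open>smoothness\<close> quantifies over outcome values too, so its clauses on
    the other functions are reached through some \<open>y\<close>.\<close>
  obtain y where y: "y \<in> domY D" by (rule nonempty)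
  have cd: "coord_continuously_differentiable 3 SS (\<lambda>s. fz s z)" "coord_continuously_differentiable 3 SS (\<lambda>s. gz s z)"
    using smooth mx y unfolding smoothness_def fz_def gz_def by blast+
  then have cont: "continuous_on SS ((partial j ^^ i) (\<lambda>s. fz s z))" "continuous_on SS ((partial j ^^ i) (\<lambda>s. gz s z))" if "i \<le> 3" for i j
    using that unfolding coord_continuously_differentiable_def by blast+
  have vd: "coord_differentiable 2 SS (\<lambda>s. vz s z)"
    using varreg mx unfolding variance_regularity_def vz_def by blast
  have "continuous_on SS (\<lambda>s. vz s z)"
  proof (rule coordinatewise_Lipschitz_continuous[OF setupD(2)])
    fix s j assume s: "s \<in> SS"
    have "(\<lambda>t. (partial j ^^ 0) (\<lambda>s. vz s z) (s + t *\<^sub>R axis j 1)) differentiable at 0"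
      using vd s unfolding coord_differentiable_def by fastforce
    then show "(\<lambda>t. vz (s + t *\<^sub>R axis j 1) z) differentiable at 0" by simp
    show "\<bar>partial j (\<lambda>s. vz s z) s\<bar> \<le> CC" using CC(3)[OF s z, of j] by (simp add: pder_def)
  qed
  then show "continuous_on SS (\<lambda>s. fz s z) \<and> continuous_on SS (\<lambda>s. gz s z) \<and> continuous_on SS (\<lambda>s. vz s z)"
    using cont[of 0] by simp
  show "continuous_on SS (\<lambda>s. pder 1 fz j s z) \<and> continuous_on SS (\<lambda>s. pder 2 fz j s z) \<and>
        continuous_on SS (\<lambda>s. pder 1 gz j s z) \<and> continuous_on SS (\<lambda>s. pder 2 gz j s z)" for j
    unfolding pder_def using cont[of 1 j] cont[of 2 j] by simp
  fix s assume s: "s \<in> SS"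
  show "0 \<le> fz s z"
    using dens_pos(2)[OF s mx] densMX_bounds(3)[OF mx] by (simp add: fz_def densA_MX_def)
  show "0 \<le> vz s z" using givenAMX_Y(4)[OF s mx] by (simp add: vz_def)
  show "\<bar>fz s z\<bar> \<le> CC \<and> \<bar>gz s z\<bar> \<le> CC \<and> \<bar>vz s z\<bar> \<le> CC"
    using CC(4)[OF s z, of 0] CC(5)[OF s z, of 0] CC(2)[OF s z] by (simp add: pder_0)
  show "\<bar>pder 1 fz j s z\<bar> \<le> CC \<and> \<bar>pder 2 fz j s z\<bar> \<le> CC \<and> \<bar>pder 1 gz j s z\<bar> \<le> CC \<and> \<bar>pder 2 gz j s z\<bar> \<le> CC" for j
    using CC(4)[OF s z] CC(5)[OF s z] by simp
  have D: "coord_differentiable 3 SS (\<lambda>s. fz s z)" "coord_differentiable 3 SS (\<lambda>s. gz s z)"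
    using cd unfolding coord_continuously_differentiable_def by blast+
  show "((\<lambda>t. fz (s + t *\<^sub>R axis j 1) z) has_real_derivative pder 1 fz j s z) (at 0) \<and>
        ((\<lambda>t. pder 1 fz j (s + t *\<^sub>R axis j 1) z) has_real_derivative pder 2 fz j s z) (at 0) \<and>
        ((\<lambda>t. gz (s + t *\<^sub>R axis j 1) z) has_real_derivative pder 1 gz j s z) (at 0) \<and>
        ((\<lambda>t. pder 1 gz j (s + t *\<^sub>R axis j 1) z) has_real_derivative pder 2 gz j s z) (at 0)" for j
    using partial_has_derivative[OF D(1) _ s, of 0 j] partial_has_derivative[OF D(1) _ s, of 1 j]
      partial_has_derivative[OF D(2) _ s, of 0 j] partial_has_derivative[OF D(2) _ s, of 1 j]
    by (simp add: pder_def numeral_2_eq_2)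
next
  fix b :: "real ^ 'd \<Rightarrow> 'm \<times> 'x \<Rightarrow> real"
  assume b: "(\<lambda>p. b (fst p) (snd p)) \<in> borel_measurable (RA \<Otimes>\<^sub>M NZ)" "integrable PP (\<lambda>w. b (trt D w) (ZZ w))"
  have v: "varY D x m a \<le> CC" "\<bar>gam D x m a\<bar> \<le> CC" if "a \<in> SS" "m \<in> domM D" "x \<in> domX D" for a m x
    using CC(2)[of a "(m, x)"] CC(5)[of a "(m, x)" 0] that by (auto simp: space_pair_measure vz_def pder_0 gz_def)
  have K2: "(LINT \<omega>|givenAMX D ((a, m), x). \<bar>(outc D \<omega>)\<^sup>2\<bar>) \<le> CC + CC\<^sup>2" if "a \<in> SS" "m \<in> domM D" "x \<in> domX D" for a m x
    using givenAMX_Y(3)[OF that] v[OF that] CC(1) abs_le_square_iff[of "gam D x m a" CC] by simp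
  have K1: "(LINT \<omega>|givenAMX D ((a, m), x). \<bar>outc D \<omega>\<bar>) \<le> 1 + (CC + CC\<^sup>2)" if a: "a \<in> SS" "m \<in> domM D" "x \<in> domX D" for a m x
  proof -
    interpret K: prob_space "givenAMX D ((a, m), x)" by (rule givenAMX_prob[OF a])
    have "\<bar>y\<bar> \<le> 1 + \<bar>y\<^sup>2\<bar>" for y :: real
      using sum_squares_bound[of 1 "\<bar>y\<bar>"] by simp
    then have "(LINT \<omega>|givenAMX D ((a, m), x). \<bar>outc D \<omega>\<bar>) \<le> (LINT \<omega>|givenAMX D ((a, m), x). 1 + \<bar>(outc D \<omega>)\<^sup>2\<bar>)"
      using givenAMX_Y(1,2)[OF a] by (intro integral_mono) auto
    also have "\<dots> = 1 + (LINT \<omega>|givenAMX D ((a, m), x). \<bar>(outc D \<omega>)\<^sup>2\<bar>)"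
      using givenAMX_Y(1)[OF a] by (simp add: K.prob_space)
    finally show ?thesis using K2[OF a] by linarith
  qed
  note C1 = conditional_product[OF b, of "\<lambda>y. y", OF _ givenAMX_Y(2) K1]
  note C2 = conditional_product[OF b, of "\<lambda>y. y\<^sup>2", OF _ givenAMX_Y(1) K2]
  show "has_bochner_integral PP (\<lambda>w. b (trt D w) (ZZ w) * outc D w) (LINT w|PP. b (trt D w) (ZZ w) * gz (trt D w) (ZZ w))"
    unfolding has_bochner_integral_iff
  proof
    show "integrable PP (\<lambda>w. b (trt D w) (ZZ w) * outc D w)" using C1(1) by simp
    show "(LINT w|PP. b (trt D w) (ZZ w) * outc D w) = (LINT w|PP. b (trt D w) (ZZ w) * gz (trt D w) (ZZ w))"
      using C1(2) by (simp add: gz_def gam_def ZZ_def)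
  qed
  show "has_bochner_integral PP (\<lambda>w. b (trt D w) (ZZ w) * (outc D w)\<^sup>2) (LINT w|PP. b (trt D w) (ZZ w) * (vz (trt D w) (ZZ w) + (gz (trt D w) (ZZ w))\<^sup>2))"
    unfolding has_bochner_integral_iff
  proof
    show "integrable PP (\<lambda>w. b (trt D w) (ZZ w) * (outc D w)\<^sup>2)" using C2(1) by simp
    have "(LINT w|PP. b (trt D w) (ZZ w) * (outc D w)\<^sup>2) = (LINT \<omega>|PP. b (trt D \<omega>) (ZZ \<omega>) * (LINT \<omega>'|givenAMX D ((trt D \<omega>, med D \<omega>), cov D \<omega>). (outc D \<omega>')\<^sup>2))"
      using C2(2) by simp
    also have "\<dots> = (LINT w|PP. b (trt D w) (ZZ w) * (vz (trt D w) (ZZ w) + (gz (trt D w) (ZZ w))\<^sup>2))"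
      by (intro Bochner_Integration.integral_cong refl) (simp add: vz_def gz_def ZZ_def givenAMX_Y(3) in_dom)
    finally show "(LINT w|PP. b (trt D w) (ZZ w) * (outc D w)\<^sup>2) = (LINT w|PP. b (trt D w) (ZZ w) * (vz (trt D w) (ZZ w) + (gz (trt D w) (ZZ w))\<^sup>2))" .
  qed
qed

end

context mediation_model begin

section \<open>Nuisance errors\<close>

lemma dens_bounded_int:
  assumes x: "x \<in> domX D"
  shows "integrable (RA \<Otimes>\<^sub>M RM) (\<lambda>(s, m). dens D s m x)"
proof -
  interpret AM: pair_sigma_finite RA RM ..
  interpret AMf: finite_measure "RA \<Otimes>\<^sub>M RM" by (rule finite_measure_pair_measure) (rule FA.finite_measure_axioms FM.finite_measure_axioms)+
  have t: "(\<lambda>p. (fst p, (snd p, x))) \<in> measurable (RA \<Otimes>\<^sub>M RM) (RA \<Otimes>\<^sub>M NZ)"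
    using x by (intro measurable_Pair measurable_const) auto
  have m: "(\<lambda>(s, m). dens D s m x) \<in> borel_measurable (RA \<Otimes>\<^sub>M RM)"
    using measurable_compose[OF t dens_meas] by (simp add: split_beta')
  show ?thesis
  proof (rule AMf.integrable_const_bound[OF _ m])
    show "AE p in RA \<Otimes>\<^sub>M RM. norm (case p of (s, m) \<Rightarrow> dens D s m x) \<le> cu / cl * densX D x"
      using dens_bounds(2)[OF _ _ x] dens_pos(2)[OF _ _ x]
      by (intro AE_I2) (auto simp: space_pair_measure abs_of_pos)
  qed
qed

text \<open>\<open>densX\<close> is defined by integrating out the mediator first; here the
  treatment goes first. For fixed \<open>x\<close> the joint density is bounded on a finite product
  space, which justifies the exchange.\<close>

lemma densMX_integral: "x \<in> domX D \<Longrightarrow> integrable RM (\<lambda>m. densMX D m x)" "x \<in> domX D \<Longrightarrow> (LINT m|RM. densMX D m x) = densX D x"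
proof -
  assume x: "x \<in> domX D"
  interpret AM: pair_sigma_finite RA RM ..
  show "integrable RM (\<lambda>m. densMX D m x)" "(LINT m|RM. densMX D m x) = densX D x"
    using AM.integrable_snd[OF dens_bounded_int[OF x]] AM.Fubini_integral[OF dens_bounded_int[OF x]]
    by (simp_all add: densMX_def densX_def densAX_def refA_def)
qed

lemma densX_nonneg: "x \<in> domX D \<Longrightarrow> 0 \<le> densX D x"
proof -
  assume x: "x \<in> domX D"
  obtain s m x' y where "s \<in> SS" "m \<in> domM D" by (rule nonempty)
  from dens_pos(3)[OF this x] show ?thesis by simp
qed

lemma densAX_meas: "a \<in> SS \<Longrightarrow> densAX D a \<in> borel_measurable RX" and dens_meas_z: "a \<in> SS \<Longrightarrow> (\<lambda>z. dens D a (fst z) (snd z)) \<in> borel_measurable NZ"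
proof -
  assume a: "a \<in> SS"
  show m: "(\<lambda>z. dens D a (fst z) (snd z)) \<in> borel_measurable NZ"
    using measurable_compose[OF measurable_Pair1'[of a RA NZ] dens_meas] a by simp
  have "(\<lambda>x. LINT m|RM. dens D a (fst (m, x)) (snd (m, x))) \<in> borel_measurable RX"
    by (intro FM.borel_measurable_lebesgue_integral) (use measurable_compose[OF measurable_pair_swap' m] in \<open>simp add: split_beta'\<close>)
  then show "densAX D a \<in> borel_measurable RX" by (simp add: densAX_def[abs_def])
qed

lemma densX_meas: "densX D \<in> borel_measurable RX"
proof -
  have "(\<lambda>x. LINT m|RM. densMX D (fst (m, x)) (snd (m, x))) \<in> borel_measurable RX"
    by (intro FM.borel_measurable_lebesgue_integral) (use measurable_compose[OF measurable_pair_swap' densMX_meas] in \<open>simp add: split_beta'\<close>)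
  also have "?this \<longleftrightarrow> ?thesis" by (intro measurable_cong) (simp add: densMX_integral)
  finally show ?thesis .
qed

lemma X_law: "distributed PP RX (cov D) (\<lambda>x. ennreal (densX D x))"
proof -
  have d: "distributed PP RX (cov D) (\<lambda>x. \<integral>\<^sup>+ m. ennreal (densMX D (fst (m, x)) (snd (m, x))) \<partial>RM)"
    using Z_law unfolding ZZ_def[abs_def]
    by (rule PS.distr_marginal2[OF FM.sigma_finite_measure_axioms SX.sigma_finite_measure_axioms])
  have e: "(\<integral>\<^sup>+ m. ennreal (densMX D (fst (m, x)) (snd (m, x))) \<partial>RM) = ennreal (densX D x)" if "x \<in> space RX" for x
  proof -
    have x: "x \<in> domX D" using that by simp
    have "AE m in RM. 0 \<le> densMX D m x" using densMX_bounds(3)[OF _ x] by (intro AE_I2) (simp add: less_imp_le)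
    from nn_integral_eq_integral[OF densMX_integral(1)[OF x] this] show ?thesis by (simp add: densMX_integral(2)[OF x])
  qed
  have "(\<lambda>x. \<integral>\<^sup>+ m. ennreal (densMX D (fst (m, x)) (snd (m, x))) \<partial>RM) \<in> borel_measurable RX"
    using d unfolding distributed_def by blast
  with d densX_meas show ?thesis by (subst distributed_cong_density[OF AE_I2[OF e], symmetric]) auto
qed

lemma X_integral: "u \<in> borel_measurable RX \<Longrightarrow> (LINT x|RX. u x * densX D x) = (LINT \<omega>|PP. u (cov D \<omega>))"
  using distributed_integral[OF X_law, of u] densX_nonneg by (simp add: mult.commute)

lemma Z_integral: "u \<in> borel_measurable NZ \<Longrightarrow> (LINT z|NZ. u z * densMX D (fst z) (snd z)) = (LINT \<omega>|PP. u (ZZ \<omega>))"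
proof -
  have "\<And>z. z \<in> space NZ \<Longrightarrow> 0 \<le> densMX D (fst z) (snd z)"
    using densMX_bounds(3) by (auto simp: space_pair_measure less_imp_le)
  then show "u \<in> borel_measurable NZ \<Longrightarrow> (LINT z|NZ. u z * densMX D (fst z) (snd z)) = (LINT \<omega>|PP. u (ZZ \<omega>))"
    using distributed_integral[OF Z_law, of u] by (simp add: mult.commute)
qed

text \<open>Bayes' rule: integrating against the density of \<open>A\<close> at \<open>a\<close> given \<open>(M, X)\<close> replaces the law of \<open>M\<close>
  given \<open>X\<close> by its law given \<open>A = a\<close> and \<open>X\<close>.\<close>

lemma tilt:
  assumes a: "a \<in> SS" and F: "KM.admZ F B"
  shows "(LINT \<omega>|PP. F (ZZ \<omega>) * fz a (ZZ \<omega>)) = (LINT \<omega>|PP. (LINT m|RM. F (m, cov D \<omega>) * alp D a m (cov D \<omega>)) / lam D a (cov D \<omega>))"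
proof -
  have Fm: "F \<in> borel_measurable NZ" by (rule KM.admZ_meas[OF F])
  note fm = KM.admZ_meas[OF KM.admZ_f[OF a]]
  have Ffm: "(\<lambda>z. F z * fz a z) \<in> borel_measurable NZ" using Fm fm by measurable
  have "integrable PP (\<lambda>\<omega>. F (ZZ \<omega>) * fz a (ZZ \<omega>))"
    by (rule KM.admZ_int(2)[OF KM.admZ_mult[OF F KM.admZ_f[OF a]]])
  then have "integrable NZ (\<lambda>z. densMX D (fst z) (snd z) * (F z * fz a z))"
    using distributed_integrable[OF Z_law Ffm] densMX_bounds(3) by (force simp: space_pair_measure less_imp_le)
  then have int: "integrable NZ (\<lambda>z. F z * dens D a (fst z) (snd z))"
  proof (rule Bochner_Integration.integrable_cong[OF refl, THEN iffD1, rotated])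
    fix z assume "z \<in> space NZ"
    then have "0 < densMX D (fst z) (snd z)" using densMX_bounds(3) by (auto simp: space_pair_measure)
    then show "densMX D (fst z) (snd z) * (F z * fz a z) = F z * dens D a (fst z) (snd z)"
      by (simp add: fz_def densA_MX_def)
  qed
  have "(LINT \<omega>|PP. F (ZZ \<omega>) * fz a (ZZ \<omega>)) = (LINT z|NZ. F z * fz a z * densMX D (fst z) (snd z))"
    by (rule Z_integral[OF Ffm, symmetric])
  also have "\<dots> = (LINT z|NZ. F z * dens D a (fst z) (snd z))"
  proof (intro Bochner_Integration.integral_cong refl)
    fix z assume "z \<in> space NZ"
    then have "0 < densMX D (fst z) (snd z)" using densMX_bounds(3) by (auto simp: space_pair_measure)
    then show "F z * fz a z * densMX D (fst z) (snd z) = F z * dens D a (fst z) (snd z)"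
      by (simp add: fz_def densA_MX_def)
  qed
  also have "\<dots> = (LINT x|RX. LINT m|RM. F (m, x) * dens D a m x)"
    using MX.integral_snd[of "\<lambda>m x. F (m, x) * dens D a m x"] int by (simp add: split_beta')
  also have "\<dots> = (LINT x|RX. (LINT m|RM. F (m, x) * alp D a m x) / lam D a x * densX D x)"
  proof (intro Bochner_Integration.integral_cong refl)
    fix x assume "x \<in> space RX"
    then have x: "x \<in> domX D" by simp
    have "(LINT m|RM. F (m, x) * dens D a m x) = (LINT m|RM. F (m, x) * alp D a m x * (densX D x / lam D a x))"
      by (intro Bochner_Integration.integral_cong refl) (simp add: dens_eq[OF a _ x])
    then show "(LINT m|RM. F (m, x) * dens D a m x) = (LINT m|RM. F (m, x) * alp D a m x) / lam D a x * densX D x" by simp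
  qed
  also have "\<dots> = (LINT \<omega>|PP. (LINT m|RM. F (m, cov D \<omega>) * alp D a m (cov D \<omega>)) / lam D a (cov D \<omega>))"
  proof (rule X_integral)
    have am: "(\<lambda>z. alp D a (fst z) (snd z)) \<in> borel_measurable NZ"
      unfolding alp_def densM_AX_def using dens_meas_z[OF a] measurable_compose[OF measurable_snd densAX_meas[OF a]] by measurable
    have "(\<lambda>x. LINT m|RM. F (m, x) * alp D a (fst (m, x)) (snd (m, x))) \<in> borel_measurable RX"
      by (intro FM.borel_measurable_lebesgue_integral)
        (use measurable_compose[OF measurable_pair_swap' borel_measurable_times[OF Fm am]] in \<open>simp add: split_beta'\<close>)
    moreover have "lam D a \<in> borel_measurable RX"
      unfolding lam_def[abs_def] densA_X_def using densAX_meas[OF a] densX_meas by measurable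
    ultimately show "(\<lambda>x. (LINT m|RM. F (m, x) * alp D a m x) / lam D a x) \<in> borel_measurable RX" by simp
  qed
  finally show ?thesis .
qed

text \<open>Satisfied by the true nuisance functions and, at every sample point, by the cross-fitted
  ones (\<open>hats_ok\<close>). The whole error analysis can therefore be done for fixed functions,
  without randomness from the training data.\<close>

definition nuisance_ok ::
  "real ^ 'd \<Rightarrow> real ^ 'd \<Rightarrow> (real ^ 'd \<Rightarrow> 'm \<Rightarrow> 'x \<Rightarrow> real) \<Rightarrow> (real ^ 'd \<Rightarrow> 'x \<Rightarrow> real) \<Rightarrow> ('x \<Rightarrow> 'm \<Rightarrow> real ^ 'd \<Rightarrow> real) \<Rightarrow> bool" where
  "nuisance_ok a a' al la ga \<longleftrightarrow> a \<in> SS \<and> a' \<in> SS \<and>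
     (\<forall>b\<in>{a, a'}. (\<lambda>z. al b (fst z) (snd z)) \<in> borel_measurable NZ \<and> la b \<in> borel_measurable RX \<and>
       (\<forall>m\<in>domM D. \<forall>x\<in>domX D. cl \<le> \<bar>al b m x\<bar> \<and> \<bar>al b m x\<bar> \<le> cu \<and> cl \<le> \<bar>la b x\<bar> \<and> \<bar>la b x\<bar> \<le> cu)) \<and>
     (\<lambda>z. ga (snd z) (fst z) a) \<in> borel_measurable NZ \<and> (\<forall>m\<in>domM D. \<forall>x\<in>domX D. \<bar>ga x m a\<bar> \<le> cu)"

lemma nuisance_ok_true: "a \<in> SS \<Longrightarrow> a' \<in> SS \<Longrightarrow> nuisance_ok a a' (alp D) (lam D) (gam D)"
proof -
  assume a: "a \<in> SS" "a' \<in> SS"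
  have am: "(\<lambda>z. alp D b (fst z) (snd z)) \<in> borel_measurable NZ" if "b \<in> SS" for b
    unfolding alp_def densM_AX_def using dens_meas_z[OF that] measurable_compose[OF measurable_snd densAX_meas[OF that]] by measurable
  have lm: "lam D b \<in> borel_measurable RX" if "b \<in> SS" for b
    unfolding lam_def[abs_def] densA_X_def using densAX_meas[OF that] densX_meas by measurable
  have gm: "(\<lambda>z. gam D (snd z) (fst z) a) \<in> borel_measurable NZ"
    using KM.admZ_meas[OF KM.admZ_g[OF a(1)]] by (simp add: gz_def[abs_def])
  show ?thesis unfolding nuisance_ok_def using a am lm gm nb by simp
qed

text \<open>The weights that bring the moment function into the form \<open>mom\<close>:
  \<open>W1\<close> multiplies the residual, \<open>W3\<close> the kernel at \<open>a'\<close>, and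
  \<open>HH\<close> is \<open>eta\<close> read as a function of \<open>(m, x)\<close>.\<close>

definition W1 where "W1 al la a a' z = la a (snd z) * (al a' (fst z) (snd z) / al a (fst z) (snd z))"
  for al :: "real ^ 'd \<Rightarrow> 'm \<Rightarrow> 'x \<Rightarrow> real" and la :: "real ^ 'd \<Rightarrow> 'x \<Rightarrow> real" and a a' :: "real ^ 'd"
definition HH where "HH al ga a a' z = eta_of RM al ga a a' (snd z)"
  for al :: "real ^ 'd \<Rightarrow> 'm \<Rightarrow> 'x \<Rightarrow> real" and ga :: "'x \<Rightarrow> 'm \<Rightarrow> real ^ 'd \<Rightarrow> real" and a a' :: "real ^ 'd" and z :: "'m \<times> 'x"
definition W3 where "W3 al la ga a a' z = la a' (snd z) * (ga (snd z) (fst z) a - HH al ga a a' z)"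
  for al :: "real ^ 'd \<Rightarrow> 'm \<Rightarrow> 'x \<Rightarrow> real" and la :: "real ^ 'd \<Rightarrow> 'x \<Rightarrow> real" and ga :: "'x \<Rightarrow> 'm \<Rightarrow> real ^ 'd \<Rightarrow> real" and a a' :: "real ^ 'd"

text \<open>Sum of the bounds for \<open>W1\<close>, for a single nuisance function, for
  \<open>HH\<close> and for \<open>W3\<close>, in this order, so that one constant serves all of
  them.\<close>

definition "bW = cu * (cu / cl) + cu + cu * cu * measure RM (domM D) + cu * (cu + cu * cu * measure RM (domM D))"

lemma bW_le: "cu * (cu / cl) \<le> bW" "cu \<le> bW" "cu * cu * measure RM (domM D) \<le> bW" "cu * (cu + cu * cu * measure RM (domM D)) \<le> bW" "0 \<le> bW"
proof -
  have "0 \<le> cu * (cu / cl)" "0 \<le> cu" "0 \<le> cu * cu * measure RM (domM D)" "0 \<le> cu * (cu + cu * cu * measure RM (domM D))"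
    using cu_pos cl by auto
  then show "cu * (cu / cl) \<le> bW" "cu \<le> bW" "cu * cu * measure RM (domM D) \<le> bW" "cu * (cu + cu * cu * measure RM (domM D)) \<le> bW" "0 \<le> bW"
    unfolding bW_def by linarith+
qed

context
  fixes a a' :: "real ^ 'd" and al la ga
  assumes ok: "nuisance_ok a a' al la ga"
begin

lemma okD: "a \<in> SS" "a' \<in> SS" "(\<lambda>z. al a (fst z) (snd z)) \<in> borel_measurable NZ" "(\<lambda>z. al a' (fst z) (snd z)) \<in> borel_measurable NZ"
  "la a \<in> borel_measurable RX" "la a' \<in> borel_measurable RX" "(\<lambda>z. ga (snd z) (fst z) a) \<in> borel_measurable NZ"
  "b \<in> {a, a'} \<Longrightarrow> m \<in> domM D \<Longrightarrow> x \<in> domX D \<Longrightarrow> cl \<le> \<bar>al b m x\<bar> \<and> \<bar>al b m x\<bar> \<le> cu \<and> cl \<le> \<bar>la b x\<bar> \<and> \<bar>la b x\<bar> \<le> cu"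
  "m \<in> domM D \<Longrightarrow> x \<in> domX D \<Longrightarrow> \<bar>ga x m a\<bar> \<le> cu"
  using ok unfolding nuisance_ok_def by auto

lemma ok_adm:
  "KM.admZ (\<lambda>z. al a (fst z) (snd z)) bW" "KM.admZ (\<lambda>z. al a' (fst z) (snd z)) bW" "KM.admZ (\<lambda>z. la a (snd z)) bW" "KM.admZ (\<lambda>z. la a' (snd z)) bW"
  "KM.admZ (\<lambda>z. ga (snd z) (fst z) a) bW"
proof -
  have le: "\<bar>y\<bar> \<le> bW" if "\<bar>y\<bar> \<le> cu" for y using order_trans[OF that bW_le(2)] .
  have z: "fst z \<in> domM D" "snd z \<in> domX D" if "z \<in> space NZ" for z :: "'m \<times> 'x"
    using that by (auto simp: space_pair_measure)
  show "KM.admZ (\<lambda>z. al a (fst z) (snd z)) bW" "KM.admZ (\<lambda>z. al a' (fst z) (snd z)) bW" "KM.admZ (\<lambda>z. la a (snd z)) bW"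
    "KM.admZ (\<lambda>z. la a' (snd z)) bW" "KM.admZ (\<lambda>z. ga (snd z) (fst z) a) bW"
    unfolding KM.admZ_def using okD(3,4,7) measurable_compose[OF measurable_snd okD(5), of RM] measurable_compose[OF measurable_snd okD(6), of RM]
      okD(8)[OF _ z] okD(9)[OF z] by (simp_all add: le)
qed

lemma eta_int: "x \<in> domX D \<Longrightarrow> integrable RM (\<lambda>m. ga x m a * al a' m x)" "x \<in> domX D \<Longrightarrow> \<bar>eta_of RM al ga a a' x\<bar> \<le> cu * cu * measure RM (domM D)"
proof -
  assume x: "x \<in> domX D"
  have p: "(\<lambda>m. (m, x)) \<in> measurable RM NZ" by (rule measurable_Pair2') (use x in simp)
  have m: "(\<lambda>m. ga x m a * al a' m x) \<in> borel_measurable RM"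
    using measurable_compose[OF p borel_measurable_times[OF okD(7,4)]] by simp
  have b: "\<bar>ga x m a * al a' m x\<bar> \<le> cu * cu" if "m \<in> domM D" for m
    using okD(8)[of a', OF _ that x] okD(9)[OF that x] cu_pos by (auto simp: abs_mult intro!: mult_mono)
  show i: "integrable RM (\<lambda>m. ga x m a * al a' m x)"
    by (rule FM.integrable_const_bound[OF _ m, of "cu * cu"]) (use b in \<open>auto intro!: AE_I2\<close>)
  have "\<bar>eta_of RM al ga a a' x\<bar> \<le> (LINT m|RM. \<bar>ga x m a * al a' m x\<bar>)"
    unfolding eta_of_def by (rule integral_abs_bound)
  also have "\<dots> \<le> (LINT m|RM. cu * cu)" using i b by (intro integral_mono) auto
  finally show "\<bar>eta_of RM al ga a a' x\<bar> \<le> cu * cu * measure RM (domM D)" by (simp add: mult_ac)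
qed

lemma eta_meas: "eta_of RM al ga a a' \<in> borel_measurable RX"
proof -
  have "(\<lambda>x. LINT m|RM. ga (snd (m, x)) (fst (m, x)) a * al a' (fst (m, x)) (snd (m, x))) \<in> borel_measurable RX"
    by (intro FM.borel_measurable_lebesgue_integral)
      (use measurable_compose[OF measurable_pair_swap' borel_measurable_times[OF okD(7,4)]] in \<open>simp add: split_beta'\<close>)
  then show ?thesis by (simp add: eta_of_def[abs_def])
qed

lemma W_adm: "KM.admZ (W1 al la a a') bW" "KM.admZ (W3 al la ga a a') bW" "KM.admZ (HH al ga a a') bW"
proof -
  note mL = measurable_compose[OF measurable_snd okD(5), of RM] measurable_compose[OF measurable_snd okD(6), of RM]
    measurable_compose[OF measurable_snd eta_meas, of RM]
  have b: "\<bar>W1 al la a a' z\<bar> \<le> cu * (cu / cl)" "\<bar>HH al ga a a' z\<bar> \<le> cu * cu * measure RM (domM D)"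
     "\<bar>W3 al la ga a a' z\<bar> \<le> cu * (cu + cu * cu * measure RM (domM D))" if "z \<in> space NZ" for z
  proof -
    have z: "fst z \<in> domM D" "snd z \<in> domX D" using that by (auto simp: space_pair_measure)
    note B = okD(8)[of a, OF _ z] okD(8)[of a', OF _ z] okD(9)[OF z]
    show h: "\<bar>HH al ga a a' z\<bar> \<le> cu * cu * measure RM (domM D)" unfolding HH_def by (rule eta_int(2)[OF z(2)])
    show "\<bar>W1 al la a a' z\<bar> \<le> cu * (cu / cl)"
      unfolding W1_def abs_mult abs_divide using B cl cu_pos by (intro mult_mono frac_le) auto
    have "\<bar>ga (snd z) (fst z) a - HH al ga a a' z\<bar> \<le> cu + cu * cu * measure RM (domM D)" using B h by linarith
    then show "\<bar>W3 al la ga a a' z\<bar> \<le> cu * (cu + cu * cu * measure RM (domM D))"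
      unfolding W3_def abs_mult using B cu_pos by (intro mult_mono) auto
  qed
  show "KM.admZ (W1 al la a a') bW" "KM.admZ (W3 al la ga a a') bW" "KM.admZ (HH al ga a a') bW"
  proof -
    have "W1 al la a a' \<in> borel_measurable NZ" "W3 al la ga a a' \<in> borel_measurable NZ" "HH al ga a a' \<in> borel_measurable NZ"
      unfolding W1_def[abs_def] W3_def[abs_def] HH_def[abs_def] using okD(3,4,7) mL by measurable
    then show "KM.admZ (W1 al la a a') bW" "KM.admZ (W3 al la ga a a') bW" "KM.admZ (HH al ga a a') bW"
      unfolding KM.admZ_def using order_trans[OF b(1) bW_le(1)] order_trans[OF b(3) bW_le(4)] order_trans[OF b(2) bW_le(3)] by blast+
  qed
qed

end

lemma admZ_diff: "KM.admZ u B \<Longrightarrow> KM.admZ u' B' \<Longrightarrow> KM.admZ (\<lambda>z. u z - u' z) (B + B')"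
  unfolding KM.admZ_def by (auto intro: order_trans[OF abs_triangle_ineq4] add_mono)

lemma L2_sum_bound:
  fixes x y z w :: "'w \<Rightarrow> real"
  assumes c: "0 \<le> c" and i: "integrable PP (\<lambda>\<omega>. (x \<omega>)\<^sup>2)" "integrable PP (\<lambda>\<omega>. (y \<omega>)\<^sup>2)" "integrable PP (\<lambda>\<omega>. (z \<omega>)\<^sup>2)"
    and w: "integrable PP (\<lambda>\<omega>. (w \<omega>)\<^sup>2)" and le: "\<And>\<omega>. \<omega> \<in> space PP \<Longrightarrow> \<bar>w \<omega>\<bar> \<le> c * (\<bar>x \<omega>\<bar> + \<bar>y \<omega>\<bar> + \<bar>z \<omega>\<bar>)"
  shows "(LINT \<omega>|PP. (w \<omega>)\<^sup>2) \<le> 3 * c\<^sup>2 * ((LINT \<omega>|PP. (x \<omega>)\<^sup>2) + (LINT \<omega>|PP. (y \<omega>)\<^sup>2) + (LINT \<omega>|PP. (z \<omega>)\<^sup>2))"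
proof -
  have sq3: "(\<bar>p\<bar> + \<bar>q\<bar> + \<bar>r\<bar>)\<^sup>2 \<le> 3 * (p\<^sup>2 + q\<^sup>2 + r\<^sup>2)" for p q r :: real
  proof -
    have "(\<bar>p\<bar> + \<bar>q\<bar> + \<bar>r\<bar>)\<^sup>2 = \<bar>p\<bar>\<^sup>2 + \<bar>q\<bar>\<^sup>2 + \<bar>r\<bar>\<^sup>2 + 2 * \<bar>p\<bar> * \<bar>q\<bar> + 2 * \<bar>p\<bar> * \<bar>r\<bar> + 2 * \<bar>q\<bar> * \<bar>r\<bar>"
      by (simp add: power2_eq_square algebra_simps)
    then show ?thesis
      using sum_squares_bound[of "\<bar>p\<bar>" "\<bar>q\<bar>"] sum_squares_bound[of "\<bar>p\<bar>" "\<bar>r\<bar>"] sum_squares_bound[of "\<bar>q\<bar>" "\<bar>r\<bar>"] by simp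
  qed
  have "(w \<omega>)\<^sup>2 \<le> 3 * c\<^sup>2 * ((x \<omega>)\<^sup>2 + (y \<omega>)\<^sup>2 + (z \<omega>)\<^sup>2)" if "\<omega> \<in> space PP" for \<omega>
  proof -
    have "\<bar>w \<omega>\<bar>\<^sup>2 \<le> (c * (\<bar>x \<omega>\<bar> + \<bar>y \<omega>\<bar> + \<bar>z \<omega>\<bar>))\<^sup>2" using le[OF that] by (intro power_mono) auto
    also have "\<dots> = c\<^sup>2 * (\<bar>x \<omega>\<bar> + \<bar>y \<omega>\<bar> + \<bar>z \<omega>\<bar>)\<^sup>2" by (rule power_mult_distrib)
    also have "\<dots> \<le> c\<^sup>2 * (3 * ((x \<omega>)\<^sup>2 + (y \<omega>)\<^sup>2 + (z \<omega>)\<^sup>2))" by (intro mult_left_mono sq3) auto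
    finally show ?thesis by (simp add: algebra_simps)
  qed
  then have "(LINT \<omega>|PP. (w \<omega>)\<^sup>2) \<le> (LINT \<omega>|PP. 3 * c\<^sup>2 * ((x \<omega>)\<^sup>2 + (y \<omega>)\<^sup>2 + (z \<omega>)\<^sup>2))"
    using i w by (intro integral_mono) auto
  then show ?thesis using i by simp
qed

end

section \<open>Expansion of the moment function in the nuisance errors\<close>

context mediation_model begin

definition "obsv \<omega> = (trt D \<omega>, cov D \<omega>, med D \<omega>, outc D \<omega>)"

text \<open>Mean squared errors as expectations under the data law; \<open>err_eq\<close> identifies
  them with the weighted integrals of the assumptions.\<close>

definition "EA al b = (LINT \<omega>|PP. (al b (fst (ZZ \<omega>)) (snd (ZZ \<omega>)) - alp D b (fst (ZZ \<omega>)) (snd (ZZ \<omega>)))\<^sup>2)"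
  for al :: "real ^ 'd \<Rightarrow> 'm \<Rightarrow> 'x \<Rightarrow> real"
definition "EL la b = (LINT \<omega>|PP. (la b (snd (ZZ \<omega>)) - lam D b (snd (ZZ \<omega>)))\<^sup>2)"
  for la :: "real ^ 'd \<Rightarrow> 'x \<Rightarrow> real"
definition "EG ga b = (LINT \<omega>|PP. (ga (snd (ZZ \<omega>)) (fst (ZZ \<omega>)) b - gz b (ZZ \<omega>))\<^sup>2)"
  for ga :: "'x \<Rightarrow> 'm \<Rightarrow> real ^ 'd \<Rightarrow> real"

lemma E_nonneg: "0 \<le> EA al b" "0 \<le> EL la b" "0 \<le> EG ga b"
  by (simp_all add: EA_def EL_def EG_def)

lemma admZ_mono: "KM.admZ u B \<Longrightarrow> B \<le> B' \<Longrightarrow> KM.admZ u B'"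
  unfolding KM.admZ_def by (blast intro: order_trans)

lemma admZ_add: "KM.admZ u B \<Longrightarrow> KM.admZ u' B' \<Longrightarrow> KM.admZ (\<lambda>z. u z + u' z) (B + B')"
  unfolding KM.admZ_def by (auto intro: order_trans[OF abs_triangle_ineq] add_mono)

lemma abs_triangle3: "\<bar>x + y + z\<bar> \<le> \<bar>x\<bar> + \<bar>y\<bar> + \<bar>z\<bar>" for x y z :: real
  by linarith

lemma E_abs_le_sqrt:
  assumes "KM.admZ u B"
  shows "(LINT \<omega>|PP. \<bar>u (ZZ \<omega>)\<bar>) \<le> sqrt (LINT \<omega>|PP. (u (ZZ \<omega>))\<^sup>2)"
  using Cauchy_Schwarz_integral(2)[OF KM.admZ_int(1)[OF assms] borel_measurable_const[of 1] KM.admZ_sq_int[OF assms]]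
  by (simp add: PS.prob_space)

lemma E_abs_prod_le:
  assumes u: "KM.admZ u B" "KM.admZ u' B'"
  shows "(LINT \<omega>|PP. \<bar>u (ZZ \<omega>)\<bar> * \<bar>u' (ZZ \<omega>)\<bar>) \<le> sqrt (LINT \<omega>|PP. (u (ZZ \<omega>))\<^sup>2) * sqrt (LINT \<omega>|PP. (u' (ZZ \<omega>))\<^sup>2)"
  using Cauchy_Schwarz_integral(2)[OF KM.admZ_int(1)[OF u(1)] KM.admZ_int(1)[OF u(2)] KM.admZ_sq_int[OF u(1)] KM.admZ_sq_int[OF u(2)]]
  by (simp add: abs_mult)

context
  fixes a a' :: "real ^ 'd" and al la ga
  assumes ok: "nuisance_ok a a' al la ga"
begin

lemma aS: "a \<in> SS" "a' \<in> SS" by (rule okD[OF ok])+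

lemma ok0: "nuisance_ok a a' (alp D) (lam D) (gam D)" by (rule nuisance_ok_true[OF aS])

text \<open>The hybrid of true \<open>alp\<close>, \<open>lam\<close> and estimated
  \<open>ga\<close>: its \<open>eta\<close> is the intermediate value in
  \<open>bias_identity\<close>.\<close>

lemma ok1: "nuisance_ok a a' (alp D) (lam D) ga" using ok ok0 unfolding nuisance_ok_def by blast

definition "dA b z = al b (fst z) (snd z) - alp D b (fst z) (snd z)"
definition "dL b z = la b (snd z) - lam D b (snd z)"
definition "dG z = ga (snd z) (fst z) a - gz a z"
definition "dH z = HH al ga a a' z - HH (alp D) (gam D) a a' z"
definition "d1 z = W1 al la a a' z - W1 (alp D) (lam D) a a' z"
text \<open>Replacing the true regression by \<open>ga\<close> shifts the residual by
  \<open>- dG\<close>; this is the shift with its weight. Being a function of \<open>(M, X)\<close>,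
  it takes the place of \<open>u2\<close> in \<open>mom\<close>.\<close>

definition "e1 z = - W1 al la a a' z * dG z"
definition "d3 z = W3 al la ga a a' z - W3 (alp D) (lam D) (gam D) a a' z"

text \<open>\<open>2 * bW\<close> bounds the differences, \<open>bW * (2 * bW)\<close> bounds
  \<open>e1\<close>.\<close>

definition "bD = 2 * bW + bW * (2 * bW)"

lemma bD: "2 * bW \<le> bD" "bW * (2 * bW) \<le> bD" using bW_le(5) by (simp_all add: bD_def)

lemma d_adm: "KM.admZ (dA a) bD" "KM.admZ (dA a') bD" "KM.admZ (dL a) bD" "KM.admZ (dL a') bD" "KM.admZ dG bD" "KM.admZ dH bD"
  "KM.admZ d1 bD" "KM.admZ e1 bD" "KM.admZ d3 bD"
proof -
  note A = ok_adm[OF ok] and A0 = ok_adm[OF ok0] and W = W_adm[OF ok] and W0 = W_adm[OF ok0]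
  have le: "bW + bW \<le> bD" using bD(1) by simp
  have g: "KM.admZ dG (bW + bW)" using admZ_diff[OF A(5) A0(5)] by (simp add: dG_def[abs_def] gz_def)
  have e: "KM.admZ (\<lambda>z. W1 al la a a' z * dG z) bD" using KM.admZ_mult[OF W(1) g] bD(2) by (auto intro: admZ_mono)
  show "KM.admZ (dA a) bD" "KM.admZ (dA a') bD" "KM.admZ (dL a) bD" "KM.admZ (dL a') bD" "KM.admZ dG bD" "KM.admZ dH bD"
    "KM.admZ d1 bD" "KM.admZ d3 bD"
    using admZ_mono[OF admZ_diff[OF A(1) A0(1)] le] admZ_mono[OF admZ_diff[OF A(2) A0(2)] le] admZ_mono[OF admZ_diff[OF A(3) A0(3)] le]
      admZ_mono[OF admZ_diff[OF A(4) A0(4)] le] admZ_mono[OF g le] admZ_mono[OF admZ_diff[OF W(3) W0(3)] le]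
      admZ_mono[OF admZ_diff[OF W(1) W0(1)] le] admZ_mono[OF admZ_diff[OF W(2) W0(2)] le]
    by (simp_all add: dA_def[abs_def] dL_def[abs_def] dH_def[abs_def] d1_def[abs_def] d3_def[abs_def])
  show "KM.admZ e1 bD" using e by (auto simp: KM.admZ_def e1_def[abs_def])
qed

lemma E_d: "EA al b = (LINT \<omega>|PP. (dA b (ZZ \<omega>))\<^sup>2)" "EL la b = (LINT \<omega>|PP. (dL b (ZZ \<omega>))\<^sup>2)" "EG ga a = (LINT \<omega>|PP. (dG (ZZ \<omega>))\<^sup>2)"
  by (simp_all add: EA_def EL_def EG_def dA_def dL_def dG_def)

text \<open>With \<open>Y - ga = (Y - gz) - dG\<close> the outcome enters through the true residual
  only, whose conditional mean and variance are known.\<close>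

lemma moment_diff:
  "moment RM k h a a' al la ga psi (obsv \<omega>) - moment RM k h a a' (alp D) (lam D) (gam D) psi (obsv \<omega>) =
     KM.mom h a a' d1 e1 d3 dH \<omega>"
proof -
  have "moment RM k h a a' al la ga psi (obsv \<omega>) - moment RM k h a a' (alp D) (lam D) (gam D) psi (obsv \<omega>) =
    Kh k h (trt D \<omega> - a) * (W1 al la a a' (ZZ \<omega>) * (outc D \<omega> - ga (cov D \<omega>) (med D \<omega>) a) - W1 (alp D) (lam D) a a' (ZZ \<omega>) * (outc D \<omega> - gz a (ZZ \<omega>)))
    + Kh k h (trt D \<omega> - a') * d3 (ZZ \<omega>) + dH (ZZ \<omega>)"
    by (simp add: moment_def obsv_def W1_def d3_def W3_def dH_def HH_def ZZ_def gz_def algebra_simps)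
  also have "W1 al la a a' (ZZ \<omega>) * (outc D \<omega> - ga (cov D \<omega>) (med D \<omega>) a) - W1 (alp D) (lam D) a a' (ZZ \<omega>) * (outc D \<omega> - gz a (ZZ \<omega>))
      = d1 (ZZ \<omega>) * (outc D \<omega> - gz a (ZZ \<omega>)) + e1 (ZZ \<omega>)"
    by (simp add: d1_def e1_def dG_def ZZ_def algebra_simps)
  finally show ?thesis by (simp add: KM.mom_def)
qed

context
  fixes z assumes z: "z \<in> space NZ"
begin

lemma mz: "fst z \<in> domM D" "snd z \<in> domX D" using z by (auto simp: space_pair_measure)

lemma hb: "cl \<le> \<bar>al a (fst z) (snd z)\<bar>" "\<bar>al a (fst z) (snd z)\<bar> \<le> cu" "\<bar>al a' (fst z) (snd z)\<bar> \<le> cu"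
  "\<bar>la a (snd z)\<bar> \<le> cu" "\<bar>la a' (snd z)\<bar> \<le> cu" "\<bar>ga (snd z) (fst z) a\<bar> \<le> cu"
  using okD(8)[OF ok _ mz, of a] okD(8)[OF ok _ mz, of a'] okD(9)[OF ok mz] by auto

lemma tb: "cl \<le> alp D a (fst z) (snd z)" "alp D a (fst z) (snd z) \<le> cu" "cl \<le> alp D a' (fst z) (snd z)" "alp D a' (fst z) (snd z) \<le> cu"
  "lam D a (snd z) \<le> cu" "0 < lam D a (snd z)" "cl \<le> lam D a' (snd z)" "\<bar>gam D (snd z) (fst z) a\<bar> \<le> cu"
  using alp_lam_pos[OF aS(1) mz] alp_lam_pos[OF aS(2) mz] nb[OF aS(1) mz] by auto

lemma d1_bound: "\<bar>d1 z\<bar> \<le> (cu / cl + cu * cu / (cl * cl)) * (\<bar>dL a z\<bar> + \<bar>dA a' z\<bar> + \<bar>dA a z\<bar>)"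
proof -
  define p q r p0 q0 r0 where "p = la a (snd z)" and "q = al a' (fst z) (snd z)" and "r = al a (fst z) (snd z)"
    and "p0 = lam D a (snd z)" and "q0 = alp D a' (fst z) (snd z)" and "r0 = alp D a (fst z) (snd z)"
  note defs = p_def q_def r_def p0_def q0_def r0_def
  have b: "cl \<le> \<bar>r\<bar>" "\<bar>q\<bar> \<le> cu" "\<bar>p0\<bar> \<le> cu" "\<bar>q0\<bar> \<le> cu" "cl \<le> \<bar>r0\<bar>" "r \<noteq> 0" "r0 \<noteq> 0"
    using hb tb cl unfolding defs by auto
  \<comment> \<open>Telescopes \<open>p * q / r - p0 * q0 / r0\<close> through its three factors;
    each error occurs once, with a bounded coefficient.\<close>
  have e: "d1 z = (p - p0) * (q / r) + (p0 / r) * (q - q0) + (p0 * q0 / (r * r0)) * (r0 - r)"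
    using b by (simp add: d1_def W1_def defs[symmetric] divide_simps) (simp add: algebra_simps)
  have c: "\<bar>q / r\<bar> \<le> cu / cl" "\<bar>p0 / r\<bar> \<le> cu / cl" "\<bar>p0 * q0 / (r * r0)\<bar> \<le> cu * cu / (cl * cl)"
    unfolding abs_divide abs_mult using b cl cu_pos by (auto intro!: frac_le mult_mono)
  have "\<bar>d1 z\<bar> \<le> \<bar>p - p0\<bar> * \<bar>q / r\<bar> + \<bar>p0 / r\<bar> * \<bar>q - q0\<bar> + \<bar>p0 * q0 / (r * r0)\<bar> * \<bar>r0 - r\<bar>"
    unfolding e abs_mult[symmetric] by (rule abs_triangle3)
  also have "\<dots> \<le> \<bar>p - p0\<bar> * (cu / cl) + (cu / cl) * \<bar>q - q0\<bar> + (cu * cu / (cl * cl)) * \<bar>r0 - r\<bar>"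
    using c by (intro add_mono mult_left_mono mult_right_mono) auto
  also have "\<dots> \<le> \<bar>p - p0\<bar> * (cu / cl + cu * cu / (cl * cl)) + (cu / cl + cu * cu / (cl * cl)) * \<bar>q - q0\<bar> + (cu / cl + cu * cu / (cl * cl)) * \<bar>r0 - r\<bar>"
    using cl cu_pos by (intro add_mono mult_left_mono mult_right_mono) auto
  also have "\<dots> = (cu / cl + cu * cu / (cl * cl)) * (\<bar>dL a z\<bar> + \<bar>dA a' z\<bar> + \<bar>dA a z\<bar>)"
    by (simp add: dL_def dA_def defs distrib_left distrib_right abs_minus_commute mult.commute)
  finally show ?thesis .
qed

text \<open>The zero summands fit the three-term shape of \<open>L2_sum_bound\<close>.\<close>

lemma e1_bound: "\<bar>e1 z\<bar> \<le> (cu * cu / cl) * (\<bar>dG z\<bar> + \<bar>0\<bar> + \<bar>0\<bar>)"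
proof -
  have "\<bar>W1 al la a a' z\<bar> \<le> cu * (cu / cl)"
    unfolding W1_def abs_mult abs_divide using hb cl cu_pos by (intro mult_mono frac_le) auto
  then have "\<bar>W1 al la a a' z\<bar> * \<bar>dG z\<bar> \<le> (cu * cu / cl) * \<bar>dG z\<bar>" by (intro mult_right_mono) auto
  then show ?thesis by (simp add: e1_def abs_mult)
qed

text \<open>Telescoping: the error of \<open>la\<close> meets the true bracket
  \<open>gam - eta\<close>, the errors of \<open>ga\<close> and of \<open>eta\<close> meet the
  estimated \<open>la\<close>.\<close>

lemma d3_bound: "\<bar>d3 z\<bar> \<le> (2 * cu + cu * cu * measure RM (domM D)) * (\<bar>dL a' z\<bar> + \<bar>dG z\<bar> + \<bar>dH z\<bar>)"
proof -
  let ?c = "2 * cu + cu * cu * measure RM (domM D)"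
  let ?y = "gz a z - HH (alp D) (gam D) a a' z"
  have y: "\<bar>?y\<bar> \<le> cu + cu * cu * measure RM (domM D)"
    using eta_int(2)[OF ok0 mz(2)] tb(8) by (simp add: HH_def gz_def)
  have e: "d3 z = dL a' z * ?y + la a' (snd z) * dG z - la a' (snd z) * dH z"
    by (simp add: d3_def W3_def dL_def dG_def dH_def gz_def algebra_simps)
  have "\<bar>d3 z\<bar> \<le> \<bar>dL a' z\<bar> * \<bar>?y\<bar> + \<bar>la a' (snd z)\<bar> * \<bar>dG z\<bar> + \<bar>la a' (snd z)\<bar> * \<bar>dH z\<bar>"
    unfolding e abs_mult[symmetric] by linarith
  also have "\<dots> \<le> \<bar>dL a' z\<bar> * ?c + ?c * \<bar>dG z\<bar> + ?c * \<bar>dH z\<bar>"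
    using y hb(5) cu_pos by (intro add_mono mult_left_mono mult_right_mono) (auto intro: order_trans)
  finally show ?thesis by (simp add: algebra_simps)
qed

end

text \<open>\<open>dH\<close> is an integral over the mediator of a function \<open>F\<close> that
  is linear in \<open>dA a'\<close> and \<open>dG\<close>. Cauchy-Schwarz on the finite measure
  \<open>RM\<close> bounds its square by the integral of \<open>F^2\<close> against
  \<open>dm\<close>, and reading \<open>tilt\<close> backwards turns that integral into an
  expectation under the data law.\<close>

lemma dH_sq: "(LINT \<omega>|PP. (dH (ZZ \<omega>))\<^sup>2) \<le> 2 * cu\<^sup>2 * measure RM (domM D) * (cu / cl) * CC * (EG ga a + EA al a')"
proof -
  define F where "F z = ga (snd z) (fst z) a * dA a' z + dG z * alp D a' (fst z) (snd z)" for z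
  let ?\<mu> = "measure RM (domM D)"
  have Fadm: "KM.admZ F (bW * bD + bD * bW)"
    unfolding F_def[abs_def] by (intro admZ_add KM.admZ_mult ok_adm(5)[OF ok] d_adm(2) d_adm(5) ok_adm(2)[OF ok0])
  have Fsec: "(\<lambda>m. F (m, x)) \<in> borel_measurable RM" if "x \<in> domX D" for x
    using measurable_compose[OF measurable_Pair2'[of x RX RM] KM.admZ_meas[OF Fadm]] that by simp
  have FI: "integrable RM (\<lambda>m. (F (m, x))\<^sup>2)" if x: "x \<in> domX D" for x
  proof (rule FM.integrable_const_bound[of _ "(bW * bD + bD * bW)\<^sup>2"])
    show "(\<lambda>m. (F (m, x))\<^sup>2) \<in> borel_measurable RM" using Fsec[OF x] by measurable
    show "AE m in RM. norm ((F (m, x))\<^sup>2) \<le> (bW * bD + bD * bW)\<^sup>2"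
      using KM.admZ_bd[OF KM.admZ_sq[OF Fadm]] x by (intro AE_I2) (auto simp: space_pair_measure)
  qed
  have dHe: "dH z = (LINT m|RM. F (m, snd z))" if "z \<in> space NZ" for z
  proof -
    have x: "snd z \<in> domX D" using that by (auto simp: space_pair_measure)
    have "dH z = (LINT m|RM. ga (snd z) m a * al a' m (snd z) - gam D (snd z) m a * alp D a' m (snd z))"
      using eta_int(1)[OF ok x] eta_int(1)[OF ok0 x] by (simp add: dH_def HH_def eta_of_def)
    then show ?thesis by (simp add: F_def dA_def dG_def gz_def algebra_simps)
  qed
  have sq: "(dH z)\<^sup>2 \<le> ?\<mu> * (LINT m|RM. (F (m, snd z))\<^sup>2)" if z: "z \<in> space NZ" for z
  proof -
    have x: "snd z \<in> domX D" using z by (auto simp: space_pair_measure)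
    have "\<bar>LINT m|RM. F (m, snd z) * 1\<bar> \<le> sqrt (LINT m|RM. (F (m, snd z))\<^sup>2) * sqrt (LINT m|RM. 1\<^sup>2)"
      by (rule Cauchy_Schwarz_integral(3)[OF Fsec[OF x] _ FI[OF x]]) simp_all
    then have "\<bar>dH z\<bar>\<^sup>2 \<le> (sqrt (LINT m|RM. (F (m, snd z))\<^sup>2) * sqrt ?\<mu>)\<^sup>2"
      unfolding dHe[OF z] by (intro power_mono) simp_all
    then show ?thesis by (simp add: power_mult_distrib mult.commute)
  qed
  \<comment> \<open>Compensates the change of law: tilting \<open>Q\<close> at \<open>a\<close>
    multiplies by \<open>alp D a\<close> and divides by \<open>lam D a\<close>, which leaves exactly
    \<open>F^2\<close>.\<close>
  define Q where "Q z = lam D a (snd z) * (F z)\<^sup>2 / alp D a (fst z) (snd z)" for z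
  have Qb: "0 \<le> Q z" "Q z \<le> cu / cl * (F z)\<^sup>2" if z: "z \<in> space NZ" for z
  proof -
    have c: "lam D a (snd z) / alp D a (fst z) (snd z) \<le> cu / cl" using tb[OF z] cl cu_pos by (intro frac_le) auto
    show "0 \<le> Q z" using tb[OF z] cl by (simp add: Q_def)
    show "Q z \<le> cu / cl * (F z)\<^sup>2" using mult_right_mono[OF c, of "(F z)\<^sup>2"] by (simp add: Q_def)
  qed
  have Qadm: "KM.admZ Q (cu / cl * (bW * bD + bD * bW)\<^sup>2)"
    unfolding KM.admZ_def
  proof (intro conjI ballI)
    have "Q = (\<lambda>z. lam D a (snd z) * (F z)\<^sup>2 / alp D a (fst z) (snd z))" by (simp add: Q_def[abs_def])
    then show "Q \<in> borel_measurable NZ"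
      using KM.admZ_meas[OF ok_adm(3)[OF ok0]] KM.admZ_meas[OF ok_adm(1)[OF ok0]] KM.admZ_meas[OF Fadm] by simp
    fix z assume z: "z \<in> space NZ"
    have "cu / cl * (F z)\<^sup>2 \<le> cu / cl * (bW * bD + bD * bW)\<^sup>2"
      using KM.admZ_bd[OF KM.admZ_sq[OF Fadm] z] cl cu_pos by (intro mult_left_mono) auto
    then show "\<bar>Q z\<bar> \<le> cu / cl * (bW * bD + bD * bW)\<^sup>2" using Qb[OF z] by simp
  qed
  have IQ: "(LINT m|RM. Q (m, x) * alp D a m x) / lam D a x = (LINT m|RM. (F (m, x))\<^sup>2)" if x: "x \<in> domX D" for x
  proof -
    obtain s m x' y where "m \<in> domM D" by (rule nonempty)
    then have l: "0 < lam D a x" using alp_lam_pos(2)[OF aS(1) _ x] by simp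
    have "(LINT m|RM. Q (m, x) * alp D a m x) = (LINT m|RM. lam D a x * (F (m, x))\<^sup>2)"
    proof (intro Bochner_Integration.integral_cong refl)
      fix m assume "m \<in> space RM"
      then have "0 < alp D a m x" using alp_lam_pos(1)[OF aS(1) _ x] by simp
      then show "Q (m, x) * alp D a m x = lam D a x * (F (m, x))\<^sup>2" by (simp add: Q_def)
    qed
    then show ?thesis using l by simp
  qed
  have tiltQ: "(LINT \<omega>|PP. Q (ZZ \<omega>) * fz a (ZZ \<omega>)) = (LINT \<omega>|PP. LINT m|RM. (F (m, cov D \<omega>))\<^sup>2)"
    unfolding tilt[OF aS(1) Qadm] by (intro Bochner_Integration.integral_cong refl IQ in_dom)
  have Fxm: "(\<lambda>\<omega>. LINT m|RM. (F (m, cov D \<omega>))\<^sup>2) \<in> borel_measurable PP"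
  proof -
    have "(\<lambda>x. LINT m|RM. (F (m, x))\<^sup>2) \<in> borel_measurable RX"
      by (intro FM.borel_measurable_lebesgue_integral)
        (use measurable_compose[OF measurable_pair_swap' KM.admZ_meas[OF KM.admZ_sq[OF Fadm]]] in \<open>simp add: split_beta'\<close>)
    from measurable_compose[OF cov_meas this] show ?thesis .
  qed
  have Fxi: "integrable PP (\<lambda>\<omega>. LINT m|RM. (F (m, cov D \<omega>))\<^sup>2)"
  proof (rule PS.integrable_const_bound[of _ "(bW * bD + bD * bW)\<^sup>2 * ?\<mu>", OF _ Fxm])
    have "(LINT m|RM. (F (m, x))\<^sup>2) \<le> (LINT m|RM. (bW * bD + bD * bW)\<^sup>2)" if x: "x \<in> domX D" for x
      using KM.admZ_bd[OF KM.admZ_sq[OF Fadm]] x by (intro integral_mono FI) (auto simp: space_pair_measure)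
    then show "AE \<omega> in PP. norm (LINT m|RM. (F (m, cov D \<omega>))\<^sup>2) \<le> (bW * bD + bD * bW)\<^sup>2 * ?\<mu>"
      using in_dom(3) by (intro AE_I2) (simp add: mult_ac)
  qed
  have "(LINT \<omega>|PP. (dH (ZZ \<omega>))\<^sup>2) \<le> (LINT \<omega>|PP. ?\<mu> * (LINT m|RM. (F (m, cov D \<omega>))\<^sup>2))"
    using sq[OF KM.Z_in] KM.admZ_sq_int[OF d_adm(6)] Fxi by (intro integral_mono) (auto simp: ZZ_def)
  also have "\<dots> = ?\<mu> * (LINT \<omega>|PP. Q (ZZ \<omega>) * fz a (ZZ \<omega>))" by (simp add: tiltQ)
  also have "\<dots> \<le> ?\<mu> * (LINT \<omega>|PP. 2 * cu\<^sup>2 * (cu / cl) * CC * ((dG (ZZ \<omega>))\<^sup>2 + (dA a' (ZZ \<omega>))\<^sup>2))"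
  proof (intro mult_left_mono integral_mono)
    show "integrable PP (\<lambda>\<omega>. Q (ZZ \<omega>) * fz a (ZZ \<omega>))" by (rule KM.admZ_int(2)[OF KM.admZ_mult[OF Qadm KM.admZ_f[OF aS(1)]]])
    show "integrable PP (\<lambda>\<omega>. 2 * cu\<^sup>2 * (cu / cl) * CC * ((dG (ZZ \<omega>))\<^sup>2 + (dA a' (ZZ \<omega>))\<^sup>2))"
      using KM.admZ_sq_int[OF d_adm(5)] KM.admZ_sq_int[OF d_adm(2)] by simp
    fix \<omega> assume w: "\<omega> \<in> space PP"
    note z = KM.Z_in[OF w]
    let ?z = "ZZ \<omega>"
    have "\<bar>F ?z\<bar> \<le> \<bar>ga (snd ?z) (fst ?z) a\<bar> * \<bar>dA a' ?z\<bar> + \<bar>dG ?z\<bar> * \<bar>alp D a' (fst ?z) (snd ?z)\<bar>"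
      unfolding F_def abs_mult[symmetric] by linarith
    also have "\<dots> \<le> cu * \<bar>dA a' ?z\<bar> + \<bar>dG ?z\<bar> * cu"
      using hb[OF z] tb[OF z] cl by (intro add_mono mult_left_mono mult_right_mono) auto
    finally have "\<bar>F ?z\<bar>\<^sup>2 \<le> (cu * (\<bar>dA a' ?z\<bar> + \<bar>dG ?z\<bar>))\<^sup>2" by (intro power_mono) (auto simp: algebra_simps)
    also have "\<dots> = cu\<^sup>2 * (\<bar>dA a' ?z\<bar> + \<bar>dG ?z\<bar>)\<^sup>2" by (rule power_mult_distrib)
    also have "\<dots> \<le> cu\<^sup>2 * (2 * ((dG ?z)\<^sup>2 + (dA a' ?z)\<^sup>2))"
      using sum_squares_bound[of "\<bar>dA a' ?z\<bar>" "\<bar>dG ?z\<bar>"] by (intro mult_left_mono) (auto simp: power2_sum)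
    finally have F2: "(F ?z)\<^sup>2 \<le> cu\<^sup>2 * (2 * ((dG ?z)\<^sup>2 + (dA a' ?z)\<^sup>2))" by simp
    have "Q ?z * fz a ?z \<le> (cu / cl * (F ?z)\<^sup>2) * CC"
      using Qb[OF z] KM.admZ_bd[OF KM.admZ_f[OF aS(1)] z] KM.f_nonneg[OF aS(1) z] cl cu_pos by (intro mult_mono) auto
    also have "\<dots> \<le> (cu / cl * (cu\<^sup>2 * (2 * ((dG ?z)\<^sup>2 + (dA a' ?z)\<^sup>2)))) * CC"
      using F2 cl cu_pos CC(1) by (intro mult_right_mono mult_left_mono) auto
    finally show "Q ?z * fz a ?z \<le> 2 * cu\<^sup>2 * (cu / cl) * CC * ((dG ?z)\<^sup>2 + (dA a' ?z)\<^sup>2)" by (simp add: algebra_simps)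
  qed simp
  also have "\<dots> = 2 * cu\<^sup>2 * ?\<mu> * (cu / cl) * CC * (EG ga a + EA al a')"
    using KM.admZ_sq_int[OF d_adm(5)] KM.admZ_sq_int[OF d_adm(2)] by (simp add: E_d mult_ac)
  finally show ?thesis .
qed

definition "tot = EA al a + EA al a' + EL la a + EL la a' + EG ga a"

lemma tot_nonneg: "0 \<le> tot" and tot_ge: "EA al a \<le> tot" "EA al a' \<le> tot" "EL la a \<le> tot" "EL la a' \<le> tot" "EG ga a \<le> tot"
  using E_nonneg(1)[of al a] E_nonneg(1)[of al a'] E_nonneg(2)[of la a] E_nonneg(2)[of la a'] E_nonneg(3)[of ga a] by (simp_all add: tot_def)

text \<open>\<open>kH\<close> is twice the constant of \<open>dH_sq\<close>, since two errors are
  each at most \<open>tot\<close>. \<open>kD\<close> adds up the constants for \<open>d1\<close>,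
  \<open>e1\<close>, \<open>d3\<close> and \<open>dH\<close>; in the third summand,
  \<open>2 + kH\<close> stands for the errors of \<open>la\<close>, \<open>ga\<close> and
  \<open>eta\<close>.\<close>

definition "kH = 4 * cu\<^sup>2 * measure RM (domM D) * (cu / cl) * CC"
definition "kD = 3 * (cu / cl + cu * cu / (cl * cl))\<^sup>2 * 3 + 3 * (cu * cu / cl)\<^sup>2 + 3 * (2 * cu + cu * cu * measure RM (domM D))\<^sup>2 * (2 + kH) + kH"

lemma kH_nonneg: "0 \<le> kH"
  using cu_pos cl CC(1) by (simp add: kH_def)

lemma sq_bounds:
  "(LINT \<omega>|PP. (d1 (ZZ \<omega>))\<^sup>2) \<le> kD * tot" "(LINT \<omega>|PP. (e1 (ZZ \<omega>))\<^sup>2) \<le> kD * tot"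
  "(LINT \<omega>|PP. (d3 (ZZ \<omega>))\<^sup>2) \<le> kD * tot" "(LINT \<omega>|PP. (dH (ZZ \<omega>))\<^sup>2) \<le> kD * tot" "0 \<le> kD"
proof -
  note i = KM.admZ_sq_int[OF d_adm(1)] KM.admZ_sq_int[OF d_adm(2)] KM.admZ_sq_int[OF d_adm(3)] KM.admZ_sq_int[OF d_adm(4)]
    KM.admZ_sq_int[OF d_adm(5)] KM.admZ_sq_int[OF d_adm(6)] KM.admZ_sq_int[OF d_adm(7)] KM.admZ_sq_int[OF d_adm(8)] KM.admZ_sq_int[OF d_adm(9)]
  let ?c1 = "cu / cl + cu * cu / (cl * cl)" and ?c2 = "cu * cu / cl" and ?c3 = "2 * cu + cu * cu * measure RM (domM D)"
  have c: "0 \<le> ?c1" "0 \<le> ?c2" "0 \<le> ?c3" using cu_pos cl by auto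
  have parts: "0 \<le> 3 * ?c1\<^sup>2 * 3" "0 \<le> 3 * ?c2\<^sup>2" "0 \<le> 3 * ?c3\<^sup>2 * (2 + kH)" "0 \<le> kH" using kH_nonneg by simp_all
  show "0 \<le> kD" unfolding kD_def using parts by linarith
  have le: "3 * ?c1\<^sup>2 * 3 \<le> kD" "3 * ?c2\<^sup>2 \<le> kD" "3 * ?c3\<^sup>2 * (2 + kH) \<le> kD" "kH \<le> kD" unfolding kD_def using parts by linarith+
  note T = tot_ge tot_nonneg
  have "(LINT \<omega>|PP. (d1 (ZZ \<omega>))\<^sup>2) \<le> 3 * ?c1\<^sup>2 * (EL la a + EA al a' + EA al a)"
    unfolding E_d using d1_bound[OF KM.Z_in] by (intro L2_sum_bound c i)
  also have "\<dots> \<le> 3 * ?c1\<^sup>2 * (3 * tot)" using T by (intro mult_left_mono) auto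
  also have "\<dots> \<le> kD * tot" using mult_right_mono[OF le(1) T(6)] by simp
  finally show "(LINT \<omega>|PP. (d1 (ZZ \<omega>))\<^sup>2) \<le> kD * tot" .
  have "(LINT \<omega>|PP. (e1 (ZZ \<omega>))\<^sup>2) \<le> 3 * ?c2\<^sup>2 * ((LINT \<omega>|PP. (dG (ZZ \<omega>))\<^sup>2) + (LINT \<omega>|PP. 0\<^sup>2) + (LINT \<omega>|PP. 0\<^sup>2))"
    using e1_bound[OF KM.Z_in] by (intro L2_sum_bound c i) simp_all
  also have "\<dots> = 3 * ?c2\<^sup>2 * EG ga a" by (simp add: E_d)
  also have "\<dots> \<le> 3 * ?c2\<^sup>2 * tot" using T by (intro mult_left_mono) auto
  also have "\<dots> \<le> kD * tot" by (rule mult_right_mono[OF le(2) T(6)])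
  finally show "(LINT \<omega>|PP. (e1 (ZZ \<omega>))\<^sup>2) \<le> kD * tot" .
  have H: "(LINT \<omega>|PP. (dH (ZZ \<omega>))\<^sup>2) \<le> kH * tot"
  proof -
    have "(LINT \<omega>|PP. (dH (ZZ \<omega>))\<^sup>2) \<le> 2 * cu\<^sup>2 * measure RM (domM D) * (cu / cl) * CC * (2 * tot)"
      using cu_pos cl CC(1) T by (intro order_trans[OF dH_sq] mult_left_mono mult_nonneg_nonneg) auto
    then show ?thesis by (simp add: kH_def)
  qed
  also have "\<dots> \<le> kD * tot" by (rule mult_right_mono[OF le(4) T(6)])
  finally show "(LINT \<omega>|PP. (dH (ZZ \<omega>))\<^sup>2) \<le> kD * tot" .
  have "(LINT \<omega>|PP. (d3 (ZZ \<omega>))\<^sup>2) \<le> 3 * ?c3\<^sup>2 * (EL la a' + EG ga a + (LINT \<omega>|PP. (dH (ZZ \<omega>))\<^sup>2))"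
    unfolding E_d using d3_bound[OF KM.Z_in] by (intro L2_sum_bound c i)
  also have "\<dots> \<le> 3 * ?c3\<^sup>2 * ((2 + kH) * tot)"
  proof (intro mult_left_mono)
    show "EL la a' + EG ga a + (LINT \<omega>|PP. (dH (ZZ \<omega>))\<^sup>2) \<le> (2 + kH) * tot"
      using T H by (simp add: distrib_right)
  qed simp
  also have "\<dots> \<le> kD * tot" using mult_right_mono[OF le(3) T(6)] by simp
  finally show "(LINT \<omega>|PP. (d3 (ZZ \<omega>))\<^sup>2) \<le> kD * tot" .
qed

text \<open>\<open>mom_sq_bound\<close> with all four weights controlled by
  \<open>sq_bounds\<close>: 99 is three times 33, and 8 belongs to the term without a
  kernel.\<close>

lemma moment_diff_second:
  assumes h: "0 < h" "h \<le> 1"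
  shows "integrable PP (\<lambda>\<omega>. (KM.mom h a a' d1 e1 d3 dH \<omega>)\<^sup>2)"
    and "h ^ CARD('d) * (LINT \<omega>|PP. (KM.mom h a a' d1 e1 d3 dH \<omega>)\<^sup>2) \<le>
      (99 * CC ^ 3 * (LINT u|lborel. (k u)\<^sup>2) ^ CARD('d) + 8) * kD * tot"
proof -
  note A = d_adm(7) d_adm(8) d_adm(9) d_adm(6)
  show "integrable PP (\<lambda>\<omega>. (KM.mom h a a' d1 e1 d3 dH \<omega>)\<^sup>2)" by (rule KM.mom_sq_int[OF aS A h(1)])
  let ?K = "33 * CC ^ 3 * (LINT u|lborel. (k u)\<^sup>2) ^ CARD('d)"
  have K: "0 \<le> ?K" using CC(1) by (intro mult_nonneg_nonneg zero_le_power) auto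
  note sb = sq_bounds
  have "h ^ CARD('d) * (LINT \<omega>|PP. (KM.mom h a a' d1 e1 d3 dH \<omega>)\<^sup>2) \<le>
     ?K * ((LINT \<omega>|PP. (d1 (ZZ \<omega>))\<^sup>2) + (LINT \<omega>|PP. (e1 (ZZ \<omega>))\<^sup>2) + (LINT \<omega>|PP. (d3 (ZZ \<omega>))\<^sup>2)) + 8 * h ^ CARD('d) * (LINT \<omega>|PP. (dH (ZZ \<omega>))\<^sup>2)"
    by (rule KM.mom_sq_bound[OF aS A h(1)])
  also have "\<dots> \<le> ?K * (kD * tot + kD * tot + kD * tot) + 8 * 1 * (kD * tot)"
    using h sb K tot_nonneg order_trans[OF zero_le_one CC(1)] by (intro add_mono mult_left_mono mult_mono power_le_one mult_nonneg_nonneg) auto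
  also have "\<dots> = (99 * CC ^ 3 * (LINT u|lborel. (k u)\<^sup>2) ^ CARD('d) + 8) * kD * tot"
    by (simp add: algebra_simps)
  finally show "h ^ CARD('d) * (LINT \<omega>|PP. (KM.mom h a a' d1 e1 d3 dH \<omega>)\<^sup>2) \<le>
      (99 * CC ^ 3 * (LINT u|lborel. (k u)\<^sup>2) ^ CARD('d) + 8) * kD * tot" .
qed

text \<open>The first-order terms of the expansion of the moment function in the nuisance functions cancel;
  only products of two errors remain.\<close>

lemma bias_identity:
  "(LINT \<omega>|PP. e1 (ZZ \<omega>) * fz a (ZZ \<omega>) + d3 (ZZ \<omega>) * fz a' (ZZ \<omega>) + dH (ZZ \<omega>)) =
    - (LINT \<omega>|PP. dG (ZZ \<omega>) * d1 (ZZ \<omega>) * fz a (ZZ \<omega>))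
    - (LINT \<omega>|PP. dL a' (ZZ \<omega>) * (ga (snd (ZZ \<omega>)) (fst (ZZ \<omega>)) a / alp D a' (fst (ZZ \<omega>)) (snd (ZZ \<omega>)) * dA a' (ZZ \<omega>)) * fz a' (ZZ \<omega>))"
proof -
  let ?W = "W1 (alp D) (lam D) a a'"
  \<comment> \<open>The first digit tells whether \<open>alp\<close> is estimated, the second
    whether \<open>gam\<close> is; 0 stands for the true function.\<close>
  let ?h11 = "HH al ga a a'" and ?h01 = "HH (alp D) ga a a'" and ?h00 = "HH (alp D) (gam D) a a'"
  \<comment> \<open>The ratio that remains when the estimated \<open>la a'\<close> meets the
    division by the true \<open>lam D a'\<close> produced by \<open>tilt\<close>.\<close>
  define R where "R z = la a' (snd z) / lam D a' (snd z)" for z :: "'m \<times> 'x"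
  define Q where "Q z = dL a' z * (ga (snd z) (fst z) a / alp D a' (fst z) (snd z) * dA a' z)" for z
  have inv_adm: "KM.admZ (\<lambda>z. 1 / lam D a' (snd z)) (1 / cl)" "KM.admZ (\<lambda>z. 1 / alp D a' (fst z) (snd z)) (1 / cl)"
    using KM.admZ_meas[OF ok_adm(4)[OF ok0]] KM.admZ_meas[OF ok_adm(2)[OF ok0]] tb(3,7) cl
    unfolding KM.admZ_def by (auto simp: abs_of_pos[OF less_le_trans[OF cl]] intro!: frac_le)
  have Radm: "KM.admZ R (bW * (1 / cl))"
    using KM.admZ_mult[OF ok_adm(4)[OF ok] inv_adm(1)] by (simp add: R_def[abs_def])
  have Qadm: "KM.admZ Q (bD * (bW * (1 / cl) * bD))"
    using KM.admZ_mult[OF d_adm(4) KM.admZ_mult[OF KM.admZ_mult[OF ok_adm(5)[OF ok] inv_adm(2)] d_adm(2)]] by (simp add: Q_def[abs_def])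
  note hadm = W_adm(3)[OF ok] W_adm(3)[OF ok1] W_adm(3)[OF ok0]
  note Wadm = W_adm(1)[OF ok0]
  have int: "integrable PP (\<lambda>\<omega>. u (ZZ \<omega>))" if "KM.admZ u B" for u B by (rule KM.admZ_int(2)[OF that])
  note fa = KM.admZ_f[OF aS(1)] and fa' = KM.admZ_f[OF aS(2)]
  have lpos: "0 < lam D a' x" "0 < lam D a x" if "x \<in> domX D" for x
  proof -
    obtain s m x' y where "m \<in> domM D" by (rule nonempty)
    then show "0 < lam D a' x" "0 < lam D a x" using alp_lam_pos(2)[OF aS(2) _ that] alp_lam_pos(2)[OF aS(1) _ that] by auto
  qed
  have dX: "snd (ZZ \<omega>) \<in> domX D" if "\<omega> \<in> space PP" for \<omega> using in_dom(3)[OF that] by (simp add: ZZ_def)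
  have i11: "(LINT m|RM. ga x m a * al a' m x) = ?h11 (m', x)" and i01: "(LINT m|RM. ga x m a * alp D a' m x) = ?h01 (m', x)"
    and i00: "(LINT m|RM. gam D x m a * alp D a' m x) = ?h00 (m', x)" for m' x
    by (simp_all add: HH_def eta_of_def)
  \<comment> \<open>Tilting at \<open>a\<close> cancels the factors \<open>lam D a\<close> and
    \<open>alp D a\<close> of the true weight and leaves the integral of \<open>dG\<close> against
    \<open>alp D a'\<close>, a difference of two values of \<open>eta\<close>.\<close>
  have ii: "(LINT \<omega>|PP. dG (ZZ \<omega>) * ?W (ZZ \<omega>) * fz a (ZZ \<omega>)) = (LINT \<omega>|PP. ?h01 (ZZ \<omega>) - ?h00 (ZZ \<omega>))"
  proof -
    have "(LINT m|RM. dG (m, x) * ?W (m, x) * alp D a m x) / lam D a x = ?h01 (m', x) - ?h00 (m', x)" if x: "x \<in> domX D" for x m'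
    proof -
      have "(LINT m|RM. dG (m, x) * ?W (m, x) * alp D a m x) = (LINT m|RM. lam D a x * (ga x m a * alp D a' m x - gam D x m a * alp D a' m x))"
      proof (intro Bochner_Integration.integral_cong refl)
        fix m assume "m \<in> space RM"
        then have "0 < alp D a m x" using alp_lam_pos(1)[OF aS(1) _ x] by simp
        then show "dG (m, x) * ?W (m, x) * alp D a m x = lam D a x * (ga x m a * alp D a' m x - gam D x m a * alp D a' m x)"
          by (simp add: dG_def W1_def gz_def field_simps)
      qed
      also have "\<dots> = lam D a x * (?h01 (m', x) - ?h00 (m', x))"
        using eta_int(1)[OF ok1 x] eta_int(1)[OF ok0 x] i01[of x m'] i00[of x m'] by simp
      finally show ?thesis using lpos(2)[OF x] by simp
    qed
    from this[OF in_dom(3)] show ?thesis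
      unfolding tilt[OF aS(1) KM.admZ_mult[OF d_adm(5) Wadm]] by (intro Bochner_Integration.integral_cong refl) (simp add: ZZ_def)
  qed
  \<comment> \<open>Under tilting at \<open>a'\<close> the true part of \<open>d3\<close> is centred
    and vanishes; the estimated part leaves \<open>R\<close> times the gap in \<open>eta\<close>
    caused by the error of \<open>alp\<close>.\<close>
  have iii: "(LINT \<omega>|PP. d3 (ZZ \<omega>) * fz a' (ZZ \<omega>)) = (LINT \<omega>|PP. R (ZZ \<omega>) * (?h01 (ZZ \<omega>) - ?h11 (ZZ \<omega>)))"
  proof -
    have "(LINT m|RM. d3 (m, x) * alp D a' m x) / lam D a' x = R (m', x) * (?h01 (m', x) - ?h11 (m', x))" if x: "x \<in> domX D" for x m'
    proof -
      have "(LINT m|RM. d3 (m, x) * alp D a' m x) = (LINT m|RM. la a' x * (ga x m a * alp D a' m x - ?h11 (m', x) * alp D a' m x)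
          - lam D a' x * (gam D x m a * alp D a' m x - ?h00 (m', x) * alp D a' m x))"
        by (intro Bochner_Integration.integral_cong refl) (simp add: d3_def W3_def HH_def algebra_simps)
      also have "\<dots> = la a' x * (?h01 (m', x) - ?h11 (m', x))"
        using eta_int(1)[OF ok1 x] eta_int(1)[OF ok0 x] alp_integral[OF aS(2) x] i01[of x m'] i00[of x m'] by simp
      finally show ?thesis by (simp add: R_def)
    qed
    from this[OF in_dom(3)] show ?thesis
      unfolding tilt[OF aS(2) d_adm(9)] by (intro Bochner_Integration.integral_cong refl) (simp add: ZZ_def)
  qed
  \<comment> \<open>The product error \<open>Q\<close> equals \<open>R - 1\<close> times the same
    gap, with the sign reversed.\<close>
  have v: "(LINT \<omega>|PP. Q (ZZ \<omega>) * fz a' (ZZ \<omega>)) = (LINT \<omega>|PP. (R (ZZ \<omega>) - 1) * (?h11 (ZZ \<omega>) - ?h01 (ZZ \<omega>)))"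
  proof -
    have "(LINT m|RM. Q (m, x) * alp D a' m x) / lam D a' x = (R (m', x) - 1) * (?h11 (m', x) - ?h01 (m', x))" if x: "x \<in> domX D" for x m'
    proof -
      have "(LINT m|RM. Q (m, x) * alp D a' m x) = (LINT m|RM. (la a' x - lam D a' x) * (ga x m a * al a' m x - ga x m a * alp D a' m x))"
      proof (intro Bochner_Integration.integral_cong refl)
        fix m assume "m \<in> space RM"
        then have "0 < alp D a' m x" using alp_lam_pos(1)[OF aS(2) _ x] by simp
        then show "Q (m, x) * alp D a' m x = (la a' x - lam D a' x) * (ga x m a * al a' m x - ga x m a * alp D a' m x)"
          by (simp add: Q_def dL_def dA_def field_simps)
      qed
      also have "\<dots> = (la a' x - lam D a' x) * (?h11 (m', x) - ?h01 (m', x))"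
        using eta_int(1)[OF ok1 x] eta_int(1)[OF ok x] i01[of x m'] i11[of x m'] by simp
      finally show ?thesis using lpos(1)[OF x] by (simp add: R_def field_simps)
    qed
    from this[OF in_dom(3)] show ?thesis
      unfolding tilt[OF aS(2) Qadm] by (intro Bochner_Integration.integral_cong refl) (simp add: ZZ_def)
  qed
  have i_d: "integrable PP (\<lambda>\<omega>. e1 (ZZ \<omega>) * fz a (ZZ \<omega>))" "integrable PP (\<lambda>\<omega>. d3 (ZZ \<omega>) * fz a' (ZZ \<omega>))" "integrable PP (\<lambda>\<omega>. dH (ZZ \<omega>))"
    "integrable PP (\<lambda>\<omega>. dG (ZZ \<omega>) * d1 (ZZ \<omega>) * fz a (ZZ \<omega>))" "integrable PP (\<lambda>\<omega>. dG (ZZ \<omega>) * ?W (ZZ \<omega>) * fz a (ZZ \<omega>))"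
    by (rule int[OF KM.admZ_mult[OF d_adm(8) fa]] int[OF KM.admZ_mult[OF d_adm(9) fa']] int[OF d_adm(6)]
      int[OF KM.admZ_mult[OF KM.admZ_mult[OF d_adm(5) d_adm(7)] fa]] int[OF KM.admZ_mult[OF KM.admZ_mult[OF d_adm(5) Wadm] fa]])+
  have i_h: "integrable PP (\<lambda>\<omega>. ?h01 (ZZ \<omega>) - ?h00 (ZZ \<omega>))" "integrable PP (\<lambda>\<omega>. R (ZZ \<omega>) * (?h01 (ZZ \<omega>) - ?h11 (ZZ \<omega>)))"
    "integrable PP (\<lambda>\<omega>. ?h01 (ZZ \<omega>) - ?h11 (ZZ \<omega>))"
    by (rule int[OF admZ_diff[OF hadm(2,3)]] int[OF KM.admZ_mult[OF Radm admZ_diff[OF hadm(2,1)]]] int[OF admZ_diff[OF hadm(2,1)]])+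
  have e1e: "e1 z * fz a z = - (dG z * d1 z * fz a z) - dG z * ?W z * fz a z" for z
    by (simp add: e1_def d1_def algebra_simps)
  have "(LINT \<omega>|PP. e1 (ZZ \<omega>) * fz a (ZZ \<omega>)) = - (LINT \<omega>|PP. dG (ZZ \<omega>) * d1 (ZZ \<omega>) * fz a (ZZ \<omega>)) - (LINT \<omega>|PP. dG (ZZ \<omega>) * ?W (ZZ \<omega>) * fz a (ZZ \<omega>))"
    unfolding e1e using i_d(4,5) by (subst Bochner_Integration.integral_diff) auto
  then have s1: "(LINT \<omega>|PP. e1 (ZZ \<omega>) * fz a (ZZ \<omega>)) = - (LINT \<omega>|PP. dG (ZZ \<omega>) * d1 (ZZ \<omega>) * fz a (ZZ \<omega>)) - (LINT \<omega>|PP. ?h01 (ZZ \<omega>) - ?h00 (ZZ \<omega>))"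
    unfolding ii .
  have "(LINT \<omega>|PP. dH (ZZ \<omega>)) = (LINT \<omega>|PP. (?h01 (ZZ \<omega>) - ?h00 (ZZ \<omega>)) - (?h01 (ZZ \<omega>) - ?h11 (ZZ \<omega>)))"
    by (simp add: dH_def)
  also have "\<dots> = (LINT \<omega>|PP. ?h01 (ZZ \<omega>) - ?h00 (ZZ \<omega>)) - (LINT \<omega>|PP. ?h01 (ZZ \<omega>) - ?h11 (ZZ \<omega>))"
    by (rule Bochner_Integration.integral_diff[OF i_h(1,3)])
  finally have s3: "(LINT \<omega>|PP. dH (ZZ \<omega>)) = (LINT \<omega>|PP. ?h01 (ZZ \<omega>) - ?h00 (ZZ \<omega>)) - (LINT \<omega>|PP. ?h01 (ZZ \<omega>) - ?h11 (ZZ \<omega>))" .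
  have "(LINT \<omega>|PP. Q (ZZ \<omega>) * fz a' (ZZ \<omega>)) = (LINT \<omega>|PP. (?h01 (ZZ \<omega>) - ?h11 (ZZ \<omega>)) - R (ZZ \<omega>) * (?h01 (ZZ \<omega>) - ?h11 (ZZ \<omega>)))"
    unfolding v by (simp add: algebra_simps)
  also have "\<dots> = (LINT \<omega>|PP. ?h01 (ZZ \<omega>) - ?h11 (ZZ \<omega>)) - (LINT \<omega>|PP. R (ZZ \<omega>) * (?h01 (ZZ \<omega>) - ?h11 (ZZ \<omega>)))"
    by (rule Bochner_Integration.integral_diff[OF i_h(3,2)])
  finally have s4: "(LINT \<omega>|PP. Q (ZZ \<omega>) * fz a' (ZZ \<omega>)) = (LINT \<omega>|PP. ?h01 (ZZ \<omega>) - ?h11 (ZZ \<omega>)) - (LINT \<omega>|PP. R (ZZ \<omega>) * (?h01 (ZZ \<omega>) - ?h11 (ZZ \<omega>)))" .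
  have "(LINT \<omega>|PP. e1 (ZZ \<omega>) * fz a (ZZ \<omega>) + d3 (ZZ \<omega>) * fz a' (ZZ \<omega>) + dH (ZZ \<omega>)) =
      (LINT \<omega>|PP. e1 (ZZ \<omega>) * fz a (ZZ \<omega>)) + (LINT \<omega>|PP. d3 (ZZ \<omega>) * fz a' (ZZ \<omega>)) + (LINT \<omega>|PP. dH (ZZ \<omega>))"
    using i_d(1-3) by simp
  \<comment> \<open>The terms \<open>h01 - h00\<close> cancel; what is left of the second and third
    summand is \<open>(R - 1) * (h01 - h11)\<close>, that is, minus the \<open>Q\<close>
    term.\<close>
  also have "\<dots> = - (LINT \<omega>|PP. dG (ZZ \<omega>) * d1 (ZZ \<omega>) * fz a (ZZ \<omega>)) - (LINT \<omega>|PP. Q (ZZ \<omega>) * fz a' (ZZ \<omega>))"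
    unfolding s1 iii s3 s4 by (simp only: diff_conv_add_uminus minus_add_distrib minus_minus add_ac)
  finally show ?thesis by (simp only: Q_def)
qed

text \<open>The mean splits into a smoothing error and the value at bandwidth zero. The former is
  bounded through absolute means of \<open>d1\<close>, \<open>e1\<close>, \<open>d3\<close>, each at
  most \<open>sqrt (kD * tot)\<close>, whence 15 as three times 5. The latter is a sum of products
  of errors by \<open>bias_identity\<close>, bounded by Cauchy-Schwarz.\<close>

lemma moment_diff_first:
  assumes \<delta>: "0 < \<delta>" "cube \<delta> a \<subseteq> SS" "cube \<delta> a' \<subseteq> SS" and h: "0 < h"
  shows "integrable PP (KM.mom h a a' d1 e1 d3 dH)"
    and "\<bar>LINT \<omega>|PP. KM.mom h a a' d1 e1 d3 dH \<omega>\<bar> \<le>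
      15 * CC\<^sup>2 * smooth_const \<delta> TYPE('d) * sqrt kD * (h\<^sup>2 * sqrt tot) +
      CC * (cu / cl + cu * cu / (cl * cl)) * (sqrt (EL la a) * sqrt (EG ga a) + sqrt (EA al a') * sqrt (EG ga a) + sqrt (EA al a) * sqrt (EG ga a)) +
      CC * (cu / cl) * (sqrt (EL la a') * sqrt (EA al a'))"
proof -
  note A = d_adm(7) d_adm(8) d_adm(9) d_adm(6)
  show "integrable PP (KM.mom h a a' d1 e1 d3 dH)" by (rule KM.mom_int[OF aS A h])
  let ?S = "5 * CC\<^sup>2 * smooth_const \<delta> TYPE('d) * h\<^sup>2"
  have S0: "0 \<le> ?S" using smooth_const_nonneg[OF \<delta>(1), where 'd = 'd] by simp
  let ?bias = "LINT \<omega>|PP. e1 (ZZ \<omega>) * fz a (ZZ \<omega>) + d3 (ZZ \<omega>) * fz a' (ZZ \<omega>) + dH (ZZ \<omega>)"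
  have sm: "(LINT \<omega>|PP. \<bar>d1 (ZZ \<omega>)\<bar>) \<le> sqrt (kD * tot)" "(LINT \<omega>|PP. \<bar>e1 (ZZ \<omega>)\<bar>) \<le> sqrt (kD * tot)" "(LINT \<omega>|PP. \<bar>d3 (ZZ \<omega>)\<bar>) \<le> sqrt (kD * tot)"
    using order_trans[OF E_abs_le_sqrt[OF d_adm(7)] real_sqrt_le_mono[OF sq_bounds(1)]]
      order_trans[OF E_abs_le_sqrt[OF d_adm(8)] real_sqrt_le_mono[OF sq_bounds(2)]]
      order_trans[OF E_abs_le_sqrt[OF d_adm(9)] real_sqrt_le_mono[OF sq_bounds(3)]] by auto
  have "\<bar>(LINT \<omega>|PP. KM.mom h a a' d1 e1 d3 dH \<omega>) - ?bias\<bar> \<le>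
      ?S * ((LINT \<omega>|PP. \<bar>d1 (ZZ \<omega>)\<bar>) + (LINT \<omega>|PP. \<bar>e1 (ZZ \<omega>)\<bar>) + (LINT \<omega>|PP. \<bar>d3 (ZZ \<omega>)\<bar>))"
    by (rule KM.mom_expectation_bound[OF \<delta>(1,2) aS(1) \<delta>(3) aS(2) A h])
  also have "\<dots> \<le> ?S * (3 * sqrt (kD * tot))"
    using sm by (intro mult_left_mono S0) linarith
  also have "\<dots> = 15 * CC\<^sup>2 * smooth_const \<delta> TYPE('d) * sqrt kD * (h\<^sup>2 * sqrt tot)"
    by (simp add: real_sqrt_mult)
  finally have main: "\<bar>(LINT \<omega>|PP. KM.mom h a a' d1 e1 d3 dH \<omega>) - ?bias\<bar> \<le> 15 * CC\<^sup>2 * smooth_const \<delta> TYPE('d) * sqrt kD * (h\<^sup>2 * sqrt tot)" .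
  let ?c1 = "cu / cl + cu * cu / (cl * cl)"
  have c1: "0 \<le> ?c1" using cl cu_pos by simp
  have ai: "integrable PP (\<lambda>\<omega>. \<bar>u (ZZ \<omega>)\<bar> * \<bar>w (ZZ \<omega>)\<bar>)" if "KM.admZ u B" "KM.admZ w B'" for u w B B'
    by (rule KM.admZ_int(2)[OF KM.admZ_mult[OF KM.admZ_abs[OF that(1)] KM.admZ_abs[OF that(2)]]])
  have b1: "\<bar>LINT \<omega>|PP. dG (ZZ \<omega>) * d1 (ZZ \<omega>) * fz a (ZZ \<omega>)\<bar> \<le>
      CC * ?c1 * (sqrt (EL la a) * sqrt (EG ga a) + sqrt (EA al a') * sqrt (EG ga a) + sqrt (EA al a) * sqrt (EG ga a))"
  proof -
    let ?g = "\<lambda>\<omega>. CC * ?c1 * (\<bar>dL a (ZZ \<omega>)\<bar> * \<bar>dG (ZZ \<omega>)\<bar> + \<bar>dA a' (ZZ \<omega>)\<bar> * \<bar>dG (ZZ \<omega>)\<bar> + \<bar>dA a (ZZ \<omega>)\<bar> * \<bar>dG (ZZ \<omega>)\<bar>)"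
    note isx = ai[OF d_adm(3) d_adm(5)] ai[OF d_adm(2) d_adm(5)] ai[OF d_adm(1) d_adm(5)]
    have "\<bar>LINT \<omega>|PP. dG (ZZ \<omega>) * d1 (ZZ \<omega>) * fz a (ZZ \<omega>)\<bar> \<le> (LINT \<omega>|PP. \<bar>dG (ZZ \<omega>) * d1 (ZZ \<omega>) * fz a (ZZ \<omega>)\<bar>)"
      by (rule integral_abs_bound)
    also have "\<dots> \<le> (LINT \<omega>|PP. ?g \<omega>)"
    proof (rule integral_mono)
      show "integrable PP (\<lambda>\<omega>. \<bar>dG (ZZ \<omega>) * d1 (ZZ \<omega>) * fz a (ZZ \<omega>)\<bar>)"
        by (intro integrable_abs KM.admZ_int(2)[OF KM.admZ_mult[OF KM.admZ_mult[OF d_adm(5) d_adm(7)] KM.admZ_f[OF aS(1)]]])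
      show "integrable PP ?g" using isx by simp
      fix \<omega> assume w: "\<omega> \<in> space PP"
      note z = KM.Z_in[OF w]
      have "\<bar>dG (ZZ \<omega>)\<bar> * \<bar>d1 (ZZ \<omega>)\<bar> * \<bar>fz a (ZZ \<omega>)\<bar> \<le> \<bar>dG (ZZ \<omega>)\<bar> * (?c1 * (\<bar>dL a (ZZ \<omega>)\<bar> + \<bar>dA a' (ZZ \<omega>)\<bar> + \<bar>dA a (ZZ \<omega>)\<bar>)) * CC"
        using d1_bound[OF z] KM.admZ_bd[OF KM.admZ_f[OF aS(1)] z] c1 by (intro mult_mono mult_left_mono mult_nonneg_nonneg) auto
      also have "\<dots> = ?g \<omega>" by (simp add: algebra_simps)
      finally show "\<bar>dG (ZZ \<omega>) * d1 (ZZ \<omega>) * fz a (ZZ \<omega>)\<bar> \<le> ?g \<omega>" by (simp only: abs_mult)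
    qed
    also have "\<dots> = CC * ?c1 * ((LINT \<omega>|PP. \<bar>dL a (ZZ \<omega>)\<bar> * \<bar>dG (ZZ \<omega>)\<bar>) + (LINT \<omega>|PP. \<bar>dA a' (ZZ \<omega>)\<bar> * \<bar>dG (ZZ \<omega>)\<bar>) + (LINT \<omega>|PP. \<bar>dA a (ZZ \<omega>)\<bar> * \<bar>dG (ZZ \<omega>)\<bar>))"
      using isx by simp
    also have "\<dots> \<le> CC * ?c1 * (sqrt (EL la a) * sqrt (EG ga a) + sqrt (EA al a') * sqrt (EG ga a) + sqrt (EA al a) * sqrt (EG ga a))"
      unfolding E_d using c1 CC(1)
      by (intro mult_left_mono add_mono E_abs_prod_le[OF d_adm(3) d_adm(5)] E_abs_prod_le[OF d_adm(2) d_adm(5)] E_abs_prod_le[OF d_adm(1) d_adm(5)] mult_nonneg_nonneg) auto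
    finally show ?thesis .
  qed
  let ?Q = "\<lambda>\<omega>. dL a' (ZZ \<omega>) * (ga (snd (ZZ \<omega>)) (fst (ZZ \<omega>)) a / alp D a' (fst (ZZ \<omega>)) (snd (ZZ \<omega>)) * dA a' (ZZ \<omega>)) * fz a' (ZZ \<omega>)"
  have b2: "\<bar>LINT \<omega>|PP. ?Q \<omega>\<bar> \<le> CC * (cu / cl) * (sqrt (EL la a') * sqrt (EA al a'))"
  proof -
    note isx = ai[OF d_adm(4) d_adm(2)]
    have Qb: "\<bar>?Q \<omega>\<bar> \<le> CC * (cu / cl) * (\<bar>dL a' (ZZ \<omega>)\<bar> * \<bar>dA a' (ZZ \<omega>)\<bar>)" if w: "\<omega> \<in> space PP" for \<omega>
    proof -
      note z = KM.Z_in[OF w]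
      have q: "\<bar>ga (snd (ZZ \<omega>)) (fst (ZZ \<omega>)) a / alp D a' (fst (ZZ \<omega>)) (snd (ZZ \<omega>))\<bar> \<le> cu / cl"
        unfolding abs_divide using hb(6)[OF z] tb(3)[OF z] cl cu_pos by (intro frac_le) auto
      have "\<bar>dL a' (ZZ \<omega>)\<bar> * (\<bar>ga (snd (ZZ \<omega>)) (fst (ZZ \<omega>)) a / alp D a' (fst (ZZ \<omega>)) (snd (ZZ \<omega>))\<bar> * \<bar>dA a' (ZZ \<omega>)\<bar>) * \<bar>fz a' (ZZ \<omega>)\<bar>
          \<le> \<bar>dL a' (ZZ \<omega>)\<bar> * ((cu / cl) * \<bar>dA a' (ZZ \<omega>)\<bar>) * CC"
        using q KM.admZ_bd[OF KM.admZ_f[OF aS(2)] z] cl cu_pos by (intro mult_mono mult_left_mono mult_right_mono mult_nonneg_nonneg) auto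
      also have "\<dots> = CC * (cu / cl) * (\<bar>dL a' (ZZ \<omega>)\<bar> * \<bar>dA a' (ZZ \<omega>)\<bar>)" by (simp only: mult_ac)
      finally show ?thesis by (simp only: abs_mult)
    qed
    have "\<bar>LINT \<omega>|PP. ?Q \<omega>\<bar> \<le> (LINT \<omega>|PP. CC * (cu / cl) * (\<bar>dL a' (ZZ \<omega>)\<bar> * \<bar>dA a' (ZZ \<omega>)\<bar>))"
    proof (cases "integrable PP ?Q")
      case True
      then show ?thesis by (intro order_trans[OF integral_abs_bound] integral_mono integrable_abs integrable_mult_right isx Qb)
    next
      \<comment> \<open>A function that is not integrable has Bochner integral 0, and the bound is
        nonnegative.\<close>
      case False
      then show ?thesis using CC(1) cl cu_pos by (simp add: not_integrable_integral_eq)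
    qed
    also have "\<dots> = CC * (cu / cl) * (LINT \<omega>|PP. \<bar>dL a' (ZZ \<omega>)\<bar> * \<bar>dA a' (ZZ \<omega>)\<bar>)" by simp
    also have "\<dots> \<le> CC * (cu / cl) * (sqrt (EL la a') * sqrt (EA al a'))"
      unfolding E_d using CC(1) cl cu_pos by (intro mult_left_mono E_abs_prod_le[OF d_adm(4) d_adm(2)]) auto
    finally show ?thesis .
  qed
  show "\<bar>LINT \<omega>|PP. KM.mom h a a' d1 e1 d3 dH \<omega>\<bar> \<le>
      15 * CC\<^sup>2 * smooth_const \<delta> TYPE('d) * sqrt kD * (h\<^sup>2 * sqrt tot) +
      CC * ?c1 * (sqrt (EL la a) * sqrt (EG ga a) + sqrt (EA al a') * sqrt (EG ga a) + sqrt (EA al a) * sqrt (EG ga a)) +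
      CC * (cu / cl) * (sqrt (EL la a') * sqrt (EA al a'))"
    using main b1 b2 unfolding bias_identity by linarith
qed

end

end

context mediation_model begin

section \<open>Identification, bias and variance formulas\<close>

lemma gam_bd: "a \<in> SS \<Longrightarrow> m \<in> domM D \<Longrightarrow> x \<in> domX D \<Longrightarrow> \<bar>gam D x m a\<bar> \<le> cu"
  using nb by blast

lemma gam_section: "a \<in> SS \<Longrightarrow> x \<in> domX D \<Longrightarrow> (\<lambda>m. gam D x m a) \<in> borel_measurable RM"
  using measurable_compose[OF measurable_Pair2'[of x RX RM] KM.admZ_meas[OF KM.admZ_g[of a]]] by (simp add: gz_def)

text \<open>Under \<open>givenAX\<close> the mediator has density \<open>alp\<close>, and the
  covariate may be replaced by its conditioning value \<open>x\<close>.\<close>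

lemma gam_given_treatment:
  assumes a: "a \<in> SS" "a' \<in> SS" and x: "x \<in> domX D" and \<phi>: "\<phi> \<in> borel_measurable borel"
  shows "(LINT \<omega>|givenAX D (a', x). \<phi> (gam D (cov D \<omega>) (med D \<omega>) a)) = (LINT m|RM. \<phi> (gam D x m a) * alp D a' m x)"
    and "(LINT \<omega>|givenAX D (a', x). \<phi> (gam D x (med D \<omega>) a)) = (LINT m|RM. \<phi> (gam D x m a) * alp D a' m x)"
proof -
  have sp: "(a', x) \<in> space (RA \<Otimes>\<^sub>M RX)" using a x by (simp add: space_pair_measure)
  note R = reg_cond_distD(3,6)[OF setupD(10) sp]
  have [measurable_cong]: "sets (givenAX D (a', x)) = sets PP" by (rule R(2))
  have gm: "(\<lambda>m. \<phi> (gam D x m a)) \<in> borel_measurable RM" using measurable_compose[OF gam_section[OF a(1) x] \<phi>] .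
  have 1: "(\<lambda>\<omega>. \<phi> (gam D (cov D \<omega>) (med D \<omega>) a)) \<in> borel_measurable (givenAX D (a', x))"
    using measurable_compose[OF measurable_compose[OF ZZ_meas KM.admZ_meas[OF KM.admZ_g[OF a(1)]]] \<phi>]
    by (simp add: gz_def ZZ_def measurable_cong_sets[OF R(2) refl])
  have 2: "(\<lambda>\<omega>. \<phi> (gam D x (med D \<omega>) a)) \<in> borel_measurable (givenAX D (a', x))"
    using measurable_compose[OF med_meas gm] by (simp add: measurable_cong_sets[OF R(2) refl])
  show e: "(LINT \<omega>|givenAX D (a', x). \<phi> (gam D x (med D \<omega>) a)) = (LINT m|RM. \<phi> (gam D x m a) * alp D a' m x)"
    using distributed_integral[OF setupD(13)[OF a(2) x] gm] alp_lam_pos(1)[OF a(2) _ x]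
    by (simp add: alp_def less_imp_le mult.commute)
  have "(LINT \<omega>|givenAX D (a', x). \<phi> (gam D (cov D \<omega>) (med D \<omega>) a)) = (LINT \<omega>|givenAX D (a', x). \<phi> (gam D x (med D \<omega>) a))"
    by (rule integral_cong_AE[OF 1 2]) (use R(1) in eventually_elim, simp)
  then show "(LINT \<omega>|givenAX D (a', x). \<phi> (gam D (cov D \<omega>) (med D \<omega>) a)) = (LINT m|RM. \<phi> (gam D x m a) * alp D a' m x)"
    using e by simp
qed

text \<open>Conditioning on \<open>(M^(a'), X)\<close> reduces the nested outcome to
  \<open>Y^(a,m)\<close>. Its law there agrees with its law given
  \<open>(A, M, X) = (a, m, x)\<close>, where it is the observed outcome with mean
  \<open>gam\<close>. The remaining average over \<open>M^(a')\<close> given \<open>X\<close> is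
  then moved to the observed mediator given \<open>A = a'\<close> and \<open>X\<close>, which
  produces \<open>eta\<close>.\<close>

lemma identification:
  assumes cons: "consistency D" and se: "sequential_exchangeability D" and a: "a \<in> SS" "a' \<in> SS"
  shows "(LINT \<omega>|PP. HH (alp D) (gam D) a a' (ZZ \<omega>)) = psi0 D a a'"
proof -
  have pm [measurable]: "pot_med D a' \<in> measurable PP RM" by (rule setupD(14)[OF a(2)])
  define Fo where "Fo \<omega> = pot_outc D a (pot_med D a' \<omega>) \<omega>" for \<omega>
  have Fm: "Fo \<in> borel_measurable PP"
    using measurable_compose[OF _ setupD(15)[OF a(1)], of "\<lambda>\<omega>. (pot_med D a' \<omega>, \<omega>)" PP] by (simp add: Fo_def[abs_def])
  have pom: "pot_outc D a m \<in> borel_measurable PP" if "m \<in> domM D" for m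
    using measurable_compose[OF measurable_Pair1'[of m RM PP] setupD(15)[OF a(1)]] that by simp
  note R = setupD(12)[OF a(2)]
  \<comment> \<open>Both conditional laws equal the law of \<open>Y^(a,m)\<close> given
    \<open>X = x\<close>. Independence at every value of the condition, not only almost every one,
    is what makes this available on the null event \<open>A = a, M = m\<close>.\<close>
  have law: "distr (givenPM D a' (m, x)) borel (pot_outc D a m) = distr (givenAMX D ((a, m), x)) borel (pot_outc D a m)"
    if m: "m \<in> domM D" and x: "x \<in> domX D" for m x
  proof -
    have c1: "cond_indep PP borel (pot_outc D a m) (refA D \<Otimes>\<^sub>M RM) (\<lambda>\<omega>. (trt D \<omega>, med D \<omega>)) RX (cov D) (givenAMX D) (givenX D)"
      and c2: "cond_indep PP borel (pot_outc D a m) RM (pot_med D a') RX (cov D) (givenPM D a') (givenX D)"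
      using se a m unfolding sequential_exchangeability_def by blast+
    have "distr (givenAMX D ((a, m), x)) borel (pot_outc D a m) = distr (givenX D x) borel (pot_outc D a m)"
      using c1 a m x unfolding cond_indep_def by (simp add: space_pair_measure refA_def)
    moreover have "distr (givenPM D a' (m, x)) borel (pot_outc D a m) = distr (givenX D x) borel (pot_outc D a m)"
      using c2 m x unfolding cond_indep_def by simp
    ultimately show ?thesis by simp
  qed
  \<comment> \<open>On \<open>M^(a') = m\<close> the nested outcome is \<open>Y^(a,m)\<close>, and
    on \<open>A = a, M = m\<close> consistency makes \<open>Y^(a,m)\<close> the observed outcome;
    \<open>law\<close> connects the two conditional laws.\<close>
  have nn: "(\<integral>\<^sup>+\<omega>. ennreal (\<phi> (Fo \<omega>)) \<partial>givenPM D a' (m, x)) = (\<integral>\<^sup>+\<omega>. ennreal (\<phi> (outc D \<omega>)) \<partial>givenAMX D ((a, m), x))"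
    and ll: "(LINT \<omega>|givenPM D a' (m, x). Fo \<omega>) = gam D x m a"
    if \<phi>: "\<phi> \<in> borel_measurable borel" and m: "m \<in> domM D" and x: "x \<in> domX D" for \<phi> :: "real \<Rightarrow> real" and m x
  proof -
    have sp: "(m, x) \<in> space NZ" using m x by (simp add: space_pair_measure)
    note RP = reg_cond_distD(3,6)[OF R sp]
    have AE1: "AE \<omega> in givenPM D a' (m, x). Fo \<omega> = pot_outc D a m \<omega>"
      using RP(1) by eventually_elim (simp add: Fo_def)
    have spaceK: "space (givenAMX D ((a, m), x)) = space PP" by (rule sets_eq_imp_space_eq[OF givenAMX_sets[OF a(1) m x]])
    have AE2: "AE \<omega> in givenAMX D ((a, m), x). pot_outc D a m \<omega> = outc D \<omega>"
      using givenAMX_AE[OF a(1) m x] AE_space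
      by eventually_elim (use cons a m spaceK in \<open>auto simp: consistency_def\<close>)
    have m1: "pot_outc D a m \<in> borel_measurable (givenPM D a' (m, x))" "Fo \<in> borel_measurable (givenPM D a' (m, x))"
      using pom[OF m] Fm by (simp_all add: measurable_cong_sets[OF RP(2) refl])
    have m2: "pot_outc D a m \<in> borel_measurable (givenAMX D ((a, m), x))" "outc D \<in> borel_measurable (givenAMX D ((a, m), x))"
      using givenAMX_meas[OF a(1) m x pom[OF m]] givenAMX_meas[OF a(1) m x outc_meas] by auto
    have "(\<integral>\<^sup>+\<omega>. ennreal (\<phi> (Fo \<omega>)) \<partial>givenPM D a' (m, x)) = (\<integral>\<^sup>+\<omega>. ennreal (\<phi> (pot_outc D a m \<omega>)) \<partial>givenPM D a' (m, x))"
      by (rule nn_integral_cong_AE) (use AE1 in eventually_elim, simp)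
    also have "\<dots> = (\<integral>\<^sup>+y. ennreal (\<phi> y) \<partial>distr (givenPM D a' (m, x)) borel (pot_outc D a m))"
      using m1(1) \<phi> by (subst nn_integral_distr) auto
    also have "\<dots> = (\<integral>\<^sup>+\<omega>. ennreal (\<phi> (pot_outc D a m \<omega>)) \<partial>givenAMX D ((a, m), x))"
      unfolding law[OF m x] using m2(1) \<phi> by (subst nn_integral_distr) auto
    also have "\<dots> = (\<integral>\<^sup>+\<omega>. ennreal (\<phi> (outc D \<omega>)) \<partial>givenAMX D ((a, m), x))"
      by (rule nn_integral_cong_AE) (use AE2 in eventually_elim, simp)
    finally show "(\<integral>\<^sup>+\<omega>. ennreal (\<phi> (Fo \<omega>)) \<partial>givenPM D a' (m, x)) = (\<integral>\<^sup>+\<omega>. ennreal (\<phi> (outc D \<omega>)) \<partial>givenAMX D ((a, m), x))" .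
    have "(LINT \<omega>|givenPM D a' (m, x). Fo \<omega>) = (LINT \<omega>|givenPM D a' (m, x). pot_outc D a m \<omega>)"
      by (rule integral_cong_AE[OF m1(2,1) AE1])
    also have "\<dots> = (LINT y|distr (givenPM D a' (m, x)) borel (pot_outc D a m). y)"
      using m1(1) by (subst integral_distr) auto
    also have "\<dots> = (LINT \<omega>|givenAMX D ((a, m), x). pot_outc D a m \<omega>)"
      unfolding law[OF m x] using m2(1) by (subst integral_distr) auto
    also have "\<dots> = (LINT \<omega>|givenAMX D ((a, m), x). outc D \<omega>)"
      by (rule integral_cong_AE[OF m2 AE2])
    finally show "(LINT \<omega>|givenPM D a' (m, x). Fo \<omega>) = gam D x m a" by (simp add: gam_def)
  qed
  have pin: "pot_med D a' \<omega> \<in> domM D" if "\<omega> \<in> space PP" for \<omega> using measurable_space[OF pm that] by simp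
  \<comment> \<open>Integrability of the nested outcome is derived: its conditional absolute moment
    is transferred to \<open>givenAMX\<close>, where variance and mean of the observed outcome are
    bounded.\<close>
  have Fint: "integrable PP Fo"
  proof (rule integrableI_bounded[OF Fm])
    have "(\<integral>\<^sup>+\<omega>. ennreal (norm (Fo \<omega>)) \<partial>PP) = (\<integral>\<^sup>+\<omega>. \<integral>\<^sup>+\<omega>'. ennreal (norm (Fo \<omega>')) \<partial>givenPM D a' (pot_med D a' \<omega>, cov D \<omega>) \<partial>PP)"
      by (rule reg_cond_dist_nn_integral[OF R]) (use Fm in measurable)
    also have "\<dots> \<le> (\<integral>\<^sup>+\<omega>. ennreal (1 + (CC + CC\<^sup>2)) \<partial>PP)"
    proof (rule nn_integral_mono)
      fix \<omega> assume w: "\<omega> \<in> space PP"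
      let ?m = "pot_med D a' \<omega>" and ?x = "cov D \<omega>"
      note mx = pin[OF w] in_dom(3)[OF w]
      interpret K: prob_space "givenAMX D ((a, ?m), ?x)" by (rule givenAMX_prob[OF a(1) mx])
      note Y = givenAMX_Y[OF a(1) mx]
      have z: "(?m, ?x) \<in> space NZ" using mx by (simp add: space_pair_measure)
      have "(\<integral>\<^sup>+\<omega>'. ennreal (norm (Fo \<omega>')) \<partial>givenPM D a' (?m, ?x)) = (\<integral>\<^sup>+\<omega>'. ennreal \<bar>outc D \<omega>'\<bar> \<partial>givenAMX D ((a, ?m), ?x))"
        using nn[of abs, OF _ mx] by simp
      also have "\<dots> \<le> (\<integral>\<^sup>+\<omega>'. ennreal (1 + (outc D \<omega>')\<^sup>2) \<partial>givenAMX D ((a, ?m), ?x))"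
      proof (intro nn_integral_mono ennreal_leI)
        fix \<omega>' show "\<bar>outc D \<omega>'\<bar> \<le> 1 + (outc D \<omega>')\<^sup>2"
          using sum_squares_bound[of 1 "\<bar>outc D \<omega>'\<bar>"] by simp
      qed
      also have "\<dots> = ennreal (LINT \<omega>'|givenAMX D ((a, ?m), ?x). 1 + (outc D \<omega>')\<^sup>2)"
        using Y(1) by (intro nn_integral_eq_integral) auto
      also have "(LINT \<omega>'|givenAMX D ((a, ?m), ?x). 1 + (outc D \<omega>')\<^sup>2) = 1 + (varY D ?x ?m a + (gam D ?x ?m a)\<^sup>2)"
        using Y(1,3) by (simp add: K.prob_space)
      also have "\<dots> \<le> 1 + (CC + CC\<^sup>2)"
        using CC(2)[OF a(1) z] CC(5)[OF a(1) z, of 0] CC(1) abs_le_square_iff[of "gam D ?x ?m a" CC]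
        by (intro add_mono) (auto simp: vz_def gz_def pder_0)
      finally show "(\<integral>\<^sup>+\<omega>'. ennreal (norm (Fo \<omega>')) \<partial>givenPM D a' (?m, ?x)) \<le> ennreal (1 + (CC + CC\<^sup>2))"
        by (simp add: ennreal_leI)
    qed
    also have "\<dots> < \<infinity>" by (simp add: PS.emeasure_space_1)
    finally show "(\<integral>\<^sup>+\<omega>. ennreal (norm (Fo \<omega>)) \<partial>PP) < \<infinity>" .
  qed
  define G where "G \<omega> = gam D (cov D \<omega>) (pot_med D a' \<omega>) a" for \<omega>
  have Gm: "G \<in> borel_measurable PP"
    using measurable_compose[OF _ KM.admZ_meas[OF KM.admZ_g[OF a(1)]], of "\<lambda>\<omega>. (pot_med D a' \<omega>, cov D \<omega>)" PP]
    by (simp add: G_def[abs_def] gz_def)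
  have Gi: "integrable PP G"
    by (rule PS.integrable_const_bound[of _ cu, OF _ Gm]) (use gam_bd[OF a(1) pin in_dom(3)] in \<open>auto simp: G_def intro!: AE_I2\<close>)
  have "psi0 D a a' = integral\<^sup>L PP Fo" by (simp add: psi0_def Fo_def[abs_def])
  also have "\<dots> = (LINT \<omega>|PP. LINT \<omega>'|givenPM D a' (pot_med D a' \<omega>, cov D \<omega>). Fo \<omega>')"
    by (rule reg_cond_dist_integral(2)[OF R Fint])
  also have "\<dots> = integral\<^sup>L PP G"
    using pin in_dom(3) by (intro Bochner_Integration.integral_cong refl) (simp add: G_def ll[of "\<lambda>y. y"])
  also have "\<dots> = (LINT \<omega>|PP. LINT \<omega>'|givenX D (cov D \<omega>). G \<omega>')"
    by (rule reg_cond_dist_integral(2)[OF setupD(9) Gi])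
  also have "\<dots> = (LINT \<omega>|PP. HH (alp D) (gam D) a a' (ZZ \<omega>))"
  proof (intro Bochner_Integration.integral_cong refl)
    fix \<omega> assume w: "\<omega> \<in> space PP"
    let ?x = "cov D \<omega>"
    have x: "?x \<in> domX D" by (rule in_dom(3)[OF w])
    have spX: "?x \<in> space RX" and spA: "(a', ?x) \<in> space (RA \<Otimes>\<^sub>M RX)" using x a by (simp_all add: space_pair_measure)
    note RX = reg_cond_distD(3,6)[OF setupD(9) spX] and RAX = reg_cond_distD(3,6)[OF setupD(10) spA]
    have spaceAX: "space (givenAX D (a', ?x)) = space PP" by (rule sets_eq_imp_space_eq[OF RAX(2)])
    have pmX: "pot_med D a' \<in> measurable (givenX D ?x) RM" "pot_med D a' \<in> measurable (givenAX D (a', ?x)) RM"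
      "med D \<in> measurable (givenAX D (a', ?x)) RM"
      using pm med_meas by (simp_all add: measurable_cong_sets[OF RX(2) refl] measurable_cong_sets[OF RAX(2) refl])
    note gs = gam_section[OF a(1) x]
    have ci: "cond_indep PP RM (pot_med D a') (refA D) (trt D) RX (cov D) (givenAX D) (givenX D)"
    proof -
      obtain s m x' y where "m \<in> domM D" by (rule nonempty)
      then show ?thesis using se a unfolding sequential_exchangeability_def by blast
    qed
    \<comment> \<open>Given \<open>X\<close> alone and given \<open>A = a', X\<close> the mediator
      \<open>M^(a')\<close> has the same law; under the second condition consistency replaces it by
      the observed mediator.\<close>
    then have lawM: "distr (givenAX D (a', ?x)) RM (pot_med D a') = distr (givenX D ?x) RM (pot_med D a')"
      using a x unfolding cond_indep_def by (simp add: refA_def)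
    have "(LINT \<omega>'|givenX D ?x. G \<omega>') = (LINT \<omega>'|givenX D ?x. gam D ?x (pot_med D a' \<omega>') a)"
    proof (rule integral_cong_AE)
      show "G \<in> borel_measurable (givenX D ?x)" using Gm by (simp add: measurable_cong_sets[OF RX(2) refl])
      show "(\<lambda>\<omega>'. gam D ?x (pot_med D a' \<omega>') a) \<in> borel_measurable (givenX D ?x)" by (rule measurable_compose[OF pmX(1) gs])
      show "AE \<omega>' in givenX D ?x. G \<omega>' = gam D ?x (pot_med D a' \<omega>') a" using RX(1) by eventually_elim (simp add: G_def)
    qed
    also have "\<dots> = (LINT m|distr (givenX D ?x) RM (pot_med D a'). gam D ?x m a)" using pmX(1) gs by (subst integral_distr) auto
    also have "\<dots> = (LINT \<omega>'|givenAX D (a', ?x). gam D ?x (pot_med D a' \<omega>') a)"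
      unfolding lawM[symmetric] using pmX(2) gs by (subst integral_distr) auto
    also have "\<dots> = (LINT \<omega>'|givenAX D (a', ?x). gam D ?x (med D \<omega>') a)"
    proof (rule integral_cong_AE[OF measurable_compose[OF pmX(2) gs] measurable_compose[OF pmX(3) gs]])
      show "AE \<omega>' in givenAX D (a', ?x). gam D ?x (pot_med D a' \<omega>') a = gam D ?x (med D \<omega>') a"
        using RAX(1) AE_space by eventually_elim (use cons a spaceAX in \<open>auto simp: consistency_def\<close>)
    qed
    also have "\<dots> = (LINT m|RM. gam D ?x m a * alp D a' m ?x)"
      using gam_given_treatment(2)[OF a x, of "\<lambda>y. y"] by simp
    finally show "(LINT \<omega>'|givenX D ?x. G \<omega>') = HH (alp D) (gam D) a a' (ZZ \<omega>)"
      by (simp add: HH_def eta_of_def ZZ_def)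
  qed
  finally show ?thesis ..
qed

section \<open>Mean, variance and bias of the true moment function\<close>

context
  fixes a a' :: "real ^ 'd" assumes a: "a \<in> SS" "a' \<in> SS"
begin

abbreviation "w1 \<equiv> W1 (alp D) (lam D) a a'"
abbreviation "w3 \<equiv> W3 (alp D) (lam D) (gam D) a a'"
abbreviation "hh \<equiv> HH (alp D) (gam D) a a'"

lemmas w_adm = W_adm[OF nuisance_ok_true[OF a]]

lemma alp_int_x: "x \<in> domX D \<Longrightarrow> integrable RM (\<lambda>m. gam D x m a * alp D a' m x)" "x \<in> domX D \<Longrightarrow> integrable RM (\<lambda>m. alp D a' m x)"
  "x \<in> domX D \<Longrightarrow> (LINT m|RM. alp D a' m x) = 1"
  using eta_int(1)[OF nuisance_ok_true[OF a]] alp_integral[OF a(2)] by auto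

lemma lam'_pos: "x \<in> domX D \<Longrightarrow> 0 < lam D a' x"
proof -
  assume x: "x \<in> domX D"
  obtain s m x' y where "m \<in> domM D" by (rule nonempty)
  from alp_lam_pos(2)[OF a(2) this x] show "0 < lam D a' x" .
qed

text \<open>Tilting at \<open>a'\<close> integrates \<open>gam - eta\<close> against
  \<open>alp D a'\<close>, and \<open>eta\<close> is the mean of \<open>gam\<close> under this
  density.\<close>

lemma w3_mean_zero: "(LINT \<omega>|PP. w3 (ZZ \<omega>) * fz a' (ZZ \<omega>)) = 0"
proof -
  have "(LINT m|RM. w3 (m, x) * alp D a' m x) = 0" if x: "x \<in> domX D" for x
  proof -
    have "(LINT m|RM. w3 (m, x) * alp D a' m x) = (LINT m|RM. lam D a' x * (gam D x m a * alp D a' m x - eta_of RM (alp D) (gam D) a a' x * alp D a' m x))"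
      by (intro Bochner_Integration.integral_cong refl) (simp add: W3_def HH_def algebra_simps)
    also have "\<dots> = 0" using alp_int_x[OF x] by (simp add: eta_of_def)
    finally show ?thesis .
  qed
  from this[OF in_dom(3)] have "(LINT \<omega>|PP. w3 (ZZ \<omega>) * fz a' (ZZ \<omega>)) = (LINT \<omega>|PP. 0)"
    unfolding tilt[OF a(2) w_adm(2)] by (intro Bochner_Integration.integral_cong refl) simp
  then show ?thesis by simp
qed

lemma moment_true:
  "moment RM k h a a' (alp D) (lam D) (gam D) psi (obsv \<omega>) = KM.mom h a a' w1 (\<lambda>_. 0) w3 (\<lambda>z. hh z - psi) \<omega>"
  by (simp add: moment_def obsv_def KM.mom_def W1_def W3_def HH_def ZZ_def gz_def algebra_simps)

lemma hh_diff_adm: "KM.admZ (\<lambda>z. hh z - psi) (bW + \<bar>psi\<bar>)"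
  using w_adm(3) by (auto simp: KM.admZ_def intro: order_trans[OF abs_triangle_ineq4])

text \<open>The second summand arises by tilting: \<open>w3^2\<close> averages to
  \<open>lam^2\<close> at \<open>a'\<close> times a conditional variance, and the division by
  \<open>lam\<close> in \<open>tilt\<close> leaves one factor. The centring in \<open>w3\<close> is
  the right one because the mean of \<open>gam\<close> under \<open>givenAX\<close> is
  \<open>eta\<close>.\<close>

lemma V_asym_eq:
  "V_asym D k a a' = (LINT u|lborel. (k u)\<^sup>2) ^ CARD('d) *
     (LINT \<omega>|PP. (w1 (ZZ \<omega>))\<^sup>2 * (vz a (ZZ \<omega>) * fz a (ZZ \<omega>)) + (w3 (ZZ \<omega>))\<^sup>2 * fz a' (ZZ \<omega>))"
proof -
  let ?v1 = "\<lambda>\<omega>. (w1 (ZZ \<omega>))\<^sup>2 * (vz a (ZZ \<omega>) * fz a (ZZ \<omega>))"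
  let ?v2 = "\<lambda>x. lam D a' x * var_of (givenAX D (a', x)) (\<lambda>\<omega>'. gam D (cov D \<omega>') (med D \<omega>') a)"
  have I: "(LINT m|RM. (w3 (m, x))\<^sup>2 * alp D a' m x) / lam D a' x = ?v2 x" if x: "x \<in> domX D" for x
  proof -
    let ?e = "eta_of RM (alp D) (gam D) a a' x"
    have "(LINT \<omega>'|givenAX D (a', x). gam D (cov D \<omega>') (med D \<omega>') a) = ?e"
      using gam_given_treatment(1)[OF a x, of "\<lambda>y. y"] by (simp add: eta_of_def)
    then have "var_of (givenAX D (a', x)) (\<lambda>\<omega>'. gam D (cov D \<omega>') (med D \<omega>') a) = (LINT m|RM. (gam D x m a - ?e)\<^sup>2 * alp D a' m x)"
      using gam_given_treatment(1)[OF a x, of "\<lambda>y. (y - ?e)\<^sup>2"] by (simp add: var_of_def)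
    moreover have "(LINT m|RM. (w3 (m, x))\<^sup>2 * alp D a' m x) = (LINT m|RM. (lam D a' x)\<^sup>2 * ((gam D x m a - ?e)\<^sup>2 * alp D a' m x))"
      by (intro Bochner_Integration.integral_cong refl) (simp add: W3_def HH_def power_mult_distrib)
    ultimately show ?thesis using lam'_pos[OF x] by (simp add: power2_eq_square)
  qed
  have t: "(LINT \<omega>|PP. (w3 (ZZ \<omega>))\<^sup>2 * fz a' (ZZ \<omega>)) = (LINT \<omega>|PP. ?v2 (cov D \<omega>))"
    unfolding tilt[OF a(2) KM.admZ_sq[OF w_adm(2)]] by (intro Bochner_Integration.integral_cong refl I in_dom)
  have i1: "integrable PP ?v1"
    by (rule KM.admZ_int(2)[OF KM.admZ_mult[OF KM.admZ_sq[OF w_adm(1)] KM.admZ_mult[OF KM.admZ_v[OF a(1)] KM.admZ_f[OF a(1)]]]])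
  have i3: "integrable PP (\<lambda>\<omega>. (w3 (ZZ \<omega>))\<^sup>2 * fz a' (ZZ \<omega>))"
    by (rule KM.admZ_int(2)[OF KM.admZ_mult[OF KM.admZ_sq[OF w_adm(2)] KM.admZ_f[OF a(2)]]])
  \<comment> \<open>Measurability of the conditional variance in \<open>x\<close> is obtained
    through its density formula \<open>I\<close>.\<close>
  have i2: "integrable PP (\<lambda>\<omega>. ?v2 (cov D \<omega>))"
  proof -
    have bdx: "\<bar>?v2 x\<bar> \<le> bW\<^sup>2 * (1 / cl)" if x: "x \<in> domX D" for x
    proof -
      have le: "(w3 (m, x))\<^sup>2 * alp D a' m x \<le> bW\<^sup>2 * alp D a' m x" if m: "m \<in> domM D" for m
        using KM.admZ_bd[OF KM.admZ_sq[OF w_adm(2)], of "(m, x)"] alp_lam_pos(1)[OF a(2) m x] m x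
        by (intro mult_right_mono) (auto simp: space_pair_measure)
      have ps: "0 \<le> (w3 (m, x))\<^sup>2 * alp D a' m x" if m: "m \<in> domM D" for m
        using alp_lam_pos(1)[OF a(2) m x] by simp
      have "(LINT m|RM. (w3 (m, x))\<^sup>2 * alp D a' m x) \<le> (LINT m|RM. bW\<^sup>2 * alp D a' m x)"
        by (rule integral_mono_AE') (use le order_trans[OF ps le] alp_int_x(2)[OF x] in \<open>auto intro!: AE_I2\<close>)
      also have "\<dots> = bW\<^sup>2" using alp_int_x[OF x] by simp
      finally have 1: "(LINT m|RM. (w3 (m, x))\<^sup>2 * alp D a' m x) \<le> bW\<^sup>2" .
      have 2: "0 \<le> (LINT m|RM. (w3 (m, x))\<^sup>2 * alp D a' m x)" using ps by (intro integral_nonneg_AE AE_I2) auto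
      obtain s m x' y where m: "m \<in> domM D" by (rule nonempty)
      have "\<bar>?v2 x\<bar> = (LINT m|RM. (w3 (m, x))\<^sup>2 * alp D a' m x) * (1 / lam D a' x)"
        unfolding I[OF x, symmetric] using 2 lam'_pos[OF x] by simp
      also have "\<dots> \<le> bW\<^sup>2 * (1 / cl)"
        using 1 alp_lam_pos(5)[OF a(2) m x] lam'_pos[OF x] cl by (intro mult_mono frac_le) auto
      finally show ?thesis .
    qed
    have m: "(\<lambda>\<omega>. (LINT m|RM. (w3 (m, cov D \<omega>))\<^sup>2 * alp D a' m (cov D \<omega>)) / lam D a' (cov D \<omega>)) \<in> borel_measurable PP"
    proof -
      have Fm: "(\<lambda>z. (w3 z)\<^sup>2 * alp D a' (fst z) (snd z)) \<in> borel_measurable NZ"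
        using KM.admZ_meas[OF w_adm(2)] KM.admZ_meas[OF ok_adm(2)[OF nuisance_ok_true[OF a]]] by measurable
      have "(\<lambda>x. LINT m|RM. (w3 (m, x))\<^sup>2 * alp D a' (fst (m, x)) (snd (m, x))) \<in> borel_measurable RX"
        by (intro FM.borel_measurable_lebesgue_integral) (use measurable_compose[OF measurable_pair_swap' Fm] in \<open>simp add: split_beta'\<close>)
      from measurable_compose[OF cov_meas this] measurable_compose[OF cov_meas okD(6)[OF nuisance_ok_true[OF a]]]
      show ?thesis by simp
    qed
    have "(\<lambda>\<omega>. ?v2 (cov D \<omega>)) \<in> borel_measurable PP"
      using m by (subst measurable_cong[OF I[OF in_dom(3), symmetric]])
    then show ?thesis
      by (intro PS.integrable_const_bound[of _ "bW\<^sup>2 * (1 / cl)"]) (use bdx in_dom(3) in \<open>auto intro!: AE_I2\<close>)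
  qed
  have "V_asym D k a a' = (LINT u|lborel. (k u)\<^sup>2) ^ CARD('d) * (LINT \<omega>|PP. ?v1 \<omega> + ?v2 (cov D \<omega>))"
    unfolding V_asym_def Let_def
    by (intro arg_cong2[where f = "(*)"] refl Bochner_Integration.integral_cong)
      (simp add: W1_def ZZ_def vz_def fz_def power_mult_distrib power_divide mult_ac)
  also have "(LINT \<omega>|PP. ?v1 \<omega> + ?v2 (cov D \<omega>)) = (LINT \<omega>|PP. ?v1 \<omega>) + (LINT \<omega>|PP. ?v2 (cov D \<omega>))"
    by (rule Bochner_Integration.integral_add[OF i1 i2])
  also have "\<dots> = (LINT \<omega>|PP. ?v1 \<omega> + (w3 (ZZ \<omega>))\<^sup>2 * fz a' (ZZ \<omega>))"
    unfolding t[symmetric] by (rule Bochner_Integration.integral_add[OF i1 i3, symmetric])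
  finally show ?thesis .
qed

lemma V_asym_nonneg: "0 \<le> V_asym D k a a'"
proof -
  have "0 \<le> (w1 (ZZ \<omega>))\<^sup>2 * (vz a (ZZ \<omega>) * fz a (ZZ \<omega>)) + (w3 (ZZ \<omega>))\<^sup>2 * fz a' (ZZ \<omega>)" if "\<omega> \<in> space PP" for \<omega>
    using KM.f_nonneg[OF a(1) KM.Z_in[OF that]] KM.f_nonneg[OF a(2) KM.Z_in[OF that]] KM.v_nonneg[OF a(1) KM.Z_in[OF that]] by simp
  then have "0 \<le> (LINT \<omega>|PP. (w1 (ZZ \<omega>))\<^sup>2 * (vz a (ZZ \<omega>) * fz a (ZZ \<omega>)) + (w3 (ZZ \<omega>))\<^sup>2 * fz a' (ZZ \<omega>))"
    by (intro integral_nonneg_AE AE_I2) auto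
  moreover have "0 \<le> (LINT u|lborel. (k u)\<^sup>2)" by (intro integral_nonneg_AE AE_I2) auto
  ultimately show ?thesis unfolding V_asym_eq by simp
qed

lemma B_main_eq:
  "B_main D k a a' = (LINT u|lborel. u\<^sup>2 * k u) * (LINT \<omega>|PP. w1 (ZZ \<omega>) * ((\<Sum>j\<in>UNIV. pder 1 gz j a (ZZ \<omega>) * pder 1 fz j a (ZZ \<omega>))
        + 1 / 2 * (\<Sum>j\<in>UNIV. pder 2 gz j a (ZZ \<omega>)) * fz a (ZZ \<omega>)) + w3 (ZZ \<omega>) * (1 / 2) * (\<Sum>j\<in>UNIV. pder 2 fz j a' (ZZ \<omega>)))"
  unfolding B_main_def Let_def
  by (intro arg_cong2[where f = "(*)"] refl Bochner_Integration.integral_cong)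
    (simp add: W1_def W3_def HH_def ZZ_def gz_def fz_def pder_def eta_def mult_ac)

end

end

section \<open>The cross-fitted estimator\<close>

locale crossfit_model = mediation_model k D cl cu for k and D :: "('w, 'd::finite, 'm, 'x) mediation" and cl cu +
  fixes E :: "('s, 'd, 'm, 'x) crossfit" and h :: "nat \<Rightarrow> real" and Ch :: real and a a' :: "real ^ 'd"
  assumes iid: "iid_sample D E" and cf: "crossfit_setup D E" and cons: "consistency D" and se: "sequential_exchangeability D"
    and bw: "bandwidth_conditions CARD('d) h Ch" and nc: "nuisance_consistency D E" and pr: "product_rates D E h"
    and hats: "\<And>n l \<omega> b m x. l \<in> {1..nfolds E} \<Longrightarrow> \<omega> \<in> space (smp E) \<Longrightarrow> b \<in> domA D \<Longrightarrow> m \<in> domM D \<Longrightarrow> x \<in> domX D \<Longrightarrow>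
       cl \<le> \<bar>alp_hat E n l \<omega> b m x\<bar> \<and> \<bar>alp_hat E n l \<omega> b m x\<bar> \<le> cu \<and>
       cl \<le> \<bar>lam_hat E n l \<omega> b x\<bar> \<and> \<bar>lam_hat E n l \<omega> b x\<bar> \<le> cu \<and> \<bar>gam_hat E n l \<omega> x m b\<bar> \<le> cu"
    and a_in: "a \<in> domA D" and a'_in: "a' \<in> domA D"
begin

section \<open>The sample and the true moment function\<close>

abbreviation "OS \<equiv> obs_space D"
abbreviation "SM \<equiv> smp E"

sublocale SP: prob_space SM using iid by (simp add: iid_sample_def)

lemma OS_eq: "OS = RA \<Otimes>\<^sub>M RX \<Otimes>\<^sub>M RM \<Otimes>\<^sub>M borel" by (simp add: obs_space_def refA_def)

lemma obs_indep: "SP.indep_vars (\<lambda>_. OS) (obs E) {1..}" using iid by (simp add: iid_sample_def)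

lemma obs_meas: "1 \<le> i \<Longrightarrow> obs E i \<in> measurable SM OS"
  using obs_indep by (auto simp: SP.indep_vars_def)

lemma obsv_meas: "obsv \<in> measurable PP OS"
  unfolding OS_eq obsv_def[abs_def] by measurable

lemma transfer_obs:
  fixes g :: "(real ^ 'd) \<times> 'x \<times> 'm \<times> real \<Rightarrow> real"
  assumes i: "1 \<le> i" and g: "g \<in> borel_measurable OS"
  shows "(LINT \<omega>|SM. g (obs E i \<omega>)) = (LINT \<omega>|PP. g (obsv \<omega>))"
    and "integrable SM (\<lambda>\<omega>. g (obs E i \<omega>)) \<longleftrightarrow> integrable PP (\<lambda>\<omega>. g (obsv \<omega>))"
proof -
  have d: "distr SM OS (obs E i) = distr PP OS obsv"
    using iid i by (simp add: iid_sample_def obsv_def[abs_def])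
  show "(LINT \<omega>|SM. g (obs E i \<omega>)) = (LINT \<omega>|PP. g (obsv \<omega>))"
    using integral_distr[OF obs_meas[OF i] g] integral_distr[OF obsv_meas g] d by simp
  show "integrable SM (\<lambda>\<omega>. g (obs E i \<omega>)) \<longleftrightarrow> integrable PP (\<lambda>\<omega>. g (obsv \<omega>))"
    using integrable_distr_eq[OF obs_meas[OF i] g] integrable_distr_eq[OF obsv_meas g] d by simp
qed

text \<open>Joint measurability in training data and observation is what Fubini requires for the
  independent pair of training data and fold. The delicate term is \<open>eta_of\<close>, an
  integral over the mediator that depends on both.\<close>

lemma moment_joint_meas:
  fixes al :: "'t \<Rightarrow> real ^ 'd \<Rightarrow> 'm \<Rightarrow> 'x \<Rightarrow> real"
  assumes al: "\<And>b. b \<in> {a, a'} \<Longrightarrow> (\<lambda>(t, m, x). al t b m x) \<in> borel_measurable (MT \<Otimes>\<^sub>M RM \<Otimes>\<^sub>M RX)"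
    and la: "\<And>b. b \<in> {a, a'} \<Longrightarrow> (\<lambda>(t, x). la t b x) \<in> borel_measurable (MT \<Otimes>\<^sub>M RX)"
    and ga: "(\<lambda>(t, m, x). ga t x m a) \<in> borel_measurable (MT \<Otimes>\<^sub>M RM \<Otimes>\<^sub>M RX)"
  shows "(\<lambda>p. moment RM k b a a' (al (fst p)) (la (fst p)) (ga (fst p)) psi (snd p)) \<in> borel_measurable (MT \<Otimes>\<^sub>M OS)"
proof -
  have tmx: "(\<lambda>p. (fst p, fst (snd (snd (snd p))), fst (snd (snd p)))) \<in> measurable (MT \<Otimes>\<^sub>M OS) (MT \<Otimes>\<^sub>M RM \<Otimes>\<^sub>M RX)"
    and tx: "(\<lambda>p. (fst p, fst (snd (snd p)))) \<in> measurable (MT \<Otimes>\<^sub>M OS) (MT \<Otimes>\<^sub>M RX)"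
    and Y: "(\<lambda>p. snd (snd (snd (snd p)))) \<in> borel_measurable (MT \<Otimes>\<^sub>M OS)"
    and A0: "(\<lambda>p. fst (snd p)) \<in> measurable (MT \<Otimes>\<^sub>M OS) RA"
    unfolding OS_eq by measurable
  have A: "(\<lambda>p. fst (snd p)) \<in> borel_measurable (MT \<Otimes>\<^sub>M OS)"
    by (rule measurable_compose[OF A0]) (auto intro: measurable_restrict_space1)
  have Km: "(\<lambda>p. Kh k b (fst (snd p) - c)) \<in> borel_measurable (MT \<Otimes>\<^sub>M OS)" for c
  proof -
    have "(\<lambda>p. (1 / b) *\<^sub>R (fst (snd p) - c)) \<in> borel_measurable (MT \<Otimes>\<^sub>M OS)" using A by measurable
    from measurable_compose[OF this kprod_meas] show ?thesis unfolding Kh_eq_kprod by measurable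
  qed
  have alm: "(\<lambda>p. al (fst p) c (fst (snd (snd (snd p)))) (fst (snd (snd p)))) \<in> borel_measurable (MT \<Otimes>\<^sub>M OS)" if "c \<in> {a, a'}" for c
    using measurable_compose[OF tmx al[OF that]] by simp
  have lam: "(\<lambda>p. la (fst p) c (fst (snd (snd p)))) \<in> borel_measurable (MT \<Otimes>\<^sub>M OS)" if "c \<in> {a, a'}" for c
    using measurable_compose[OF tx la[OF that]] by simp
  have gam: "(\<lambda>p. ga (fst p) (fst (snd (snd p))) (fst (snd (snd (snd p)))) a) \<in> borel_measurable (MT \<Otimes>\<^sub>M OS)"
    using measurable_compose[OF tmx ga] by simp
  have sw: "(\<lambda>p. (fst (fst p), snd p, snd (fst p))) \<in> measurable ((MT \<Otimes>\<^sub>M RX) \<Otimes>\<^sub>M RM) (MT \<Otimes>\<^sub>M RM \<Otimes>\<^sub>M RX)"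
    by measurable
  have "(\<lambda>p. ga (fst (fst p)) (snd (fst p)) (snd p) a * al (fst (fst p)) a' (snd p) (snd (fst p))) \<in> borel_measurable ((MT \<Otimes>\<^sub>M RX) \<Otimes>\<^sub>M RM)"
    using measurable_compose[OF sw ga] measurable_compose[OF sw al[of a']] by simp
  then have "(\<lambda>q. LINT m|RM. ga (fst q) (snd q) m a * al (fst q) a' m (snd q)) \<in> borel_measurable (MT \<Otimes>\<^sub>M RX)"
    by (intro FM.borel_measurable_lebesgue_integral) (simp add: split_beta')
  from measurable_compose[OF tx this]
  have eta: "(\<lambda>p. eta_of RM (al (fst p)) (ga (fst p)) a a' (fst (snd (snd p)))) \<in> borel_measurable (MT \<Otimes>\<^sub>M OS)"
    by (simp add: eta_of_def)
  have "(\<lambda>p. Kh k b (fst (snd p) - a) * la (fst p) a (fst (snd (snd p)))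
      * (al (fst p) a' (fst (snd (snd (snd p)))) (fst (snd (snd p))) / al (fst p) a (fst (snd (snd (snd p)))) (fst (snd (snd p))))
      * (snd (snd (snd (snd p))) - ga (fst p) (fst (snd (snd p))) (fst (snd (snd (snd p)))) a)
     + Kh k b (fst (snd p) - a') * la (fst p) a' (fst (snd (snd p)))
      * (ga (fst p) (fst (snd (snd p))) (fst (snd (snd (snd p)))) a - eta_of RM (al (fst p)) (ga (fst p)) a a' (fst (snd (snd p))))
     + eta_of RM (al (fst p)) (ga (fst p)) a a' (fst (snd (snd p))) - psi) \<in> borel_measurable (MT \<Otimes>\<^sub>M OS)"
    using Km alm[of a] alm[of a'] lam[of a] lam[of a'] gam eta Y by measurable
  then show ?thesis by (simp add: moment_def split_beta')
qed

definition "mt b = moment RM k b a a' (alp D) (lam D) (gam D) (psi0 D a a')"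

lemma ok_true: "nuisance_ok a a' (alp D) (lam D) (gam D)" by (rule nuisance_ok_true[OF a_in a'_in])

lemma mt_meas: "mt b \<in> borel_measurable OS"
proof -
  \<comment> \<open>The true nuisance functions are treated as estimators computed from trivial
    data, points of a one-element space.\<close>
  let ?U = "count_space (UNIV :: unit set)"
  note O = okD[OF ok_true]
  have sw: "(\<lambda>p. (fst (snd p), snd (snd p))) \<in> measurable (?U \<Otimes>\<^sub>M RM \<Otimes>\<^sub>M RX) NZ" by measurable
  have "(\<lambda>p. moment RM k b a a' (alp D) (lam D) (gam D) (psi0 D a a') (snd p)) \<in> borel_measurable (?U \<Otimes>\<^sub>M OS)"
  proof (rule moment_joint_meas[where al = "\<lambda>_. alp D" and la = "\<lambda>_. lam D" and ga = "\<lambda>_. gam D"])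
    show "(\<lambda>(t, m, x). alp D c m x) \<in> borel_measurable (?U \<Otimes>\<^sub>M RM \<Otimes>\<^sub>M RX)" if "c \<in> {a, a'}" for c
      using that measurable_compose[OF sw O(3)] measurable_compose[OF sw O(4)] by (auto simp: split_beta')
    show "(\<lambda>(t, x). lam D c x) \<in> borel_measurable (?U \<Otimes>\<^sub>M RX)" if "c \<in> {a, a'}" for c
      using that measurable_compose[OF measurable_snd O(5)] measurable_compose[OF measurable_snd O(6)] by (auto simp: split_beta')
    show "(\<lambda>(t, m, x). gam D x m a) \<in> borel_measurable (?U \<Otimes>\<^sub>M RM \<Otimes>\<^sub>M RX)"
      using measurable_compose[OF sw O(7)] by (simp add: split_beta')
  qed
  from measurable_compose[OF measurable_Pair1'[of "()" ?U OS] this] show ?thesis by (simp add: mt_def)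
qed

lemma mt_obsv: "mt b (obsv \<omega>) = KM.mom b a a' (W1 (alp D) (lam D) a a') (\<lambda>_. 0) (W3 (alp D) (lam D) (gam D) a a') (\<lambda>z. HH (alp D) (gam D) a a' z - psi0 D a a') \<omega>"
  unfolding mt_def by (rule moment_true[OF a_in a'_in])

definition "bT = bW + \<bar>psi0 D a a'\<bar>"

lemma true_adm: "KM.admZ (W1 (alp D) (lam D) a a') bT" "KM.admZ (\<lambda>_. 0) bT" "KM.admZ (W3 (alp D) (lam D) (gam D) a a') bT"
  "KM.admZ (\<lambda>z. HH (alp D) (gam D) a a' z - psi0 D a a') bT"
proof -
  have le: "bW \<le> bT" "0 \<le> bT" using bW_le(5) by (simp_all add: bT_def)
  show "KM.admZ (W1 (alp D) (lam D) a a') bT" "KM.admZ (\<lambda>_. 0) bT" "KM.admZ (W3 (alp D) (lam D) (gam D) a a') bT"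
    "KM.admZ (\<lambda>z. HH (alp D) (gam D) a a' z - psi0 D a a') bT"
    using admZ_mono[OF W_adm(1)[OF ok_true] le(1)] admZ_mono[OF W_adm(2)[OF ok_true] le(1)] KM.admZ_zero[OF le(2)]
      hh_diff_adm[OF a_in a'_in] by (simp_all add: bT_def)
qed

text \<open>The mean of the true moment function at bandwidth zero: the kernel term at
  \<open>a'\<close> is centred by \<open>w3_mean_zero\<close>, and \<open>eta\<close> has mean
  \<open>psi0\<close> by \<open>identification\<close>.\<close>

lemma true_main_zero: "(LINT \<omega>|PP. W3 (alp D) (lam D) (gam D) a a' (ZZ \<omega>) * fz a' (ZZ \<omega>) + (HH (alp D) (gam D) a a' (ZZ \<omega>) - psi0 D a a')) = 0"
  using w3_mean_zero[OF a_in a'_in] identification[OF cons se a_in a'_in] KM.admZ_int(2)[OF true_adm(4)]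
    KM.admZ_int(2)[OF KM.admZ_mult[OF true_adm(3) KM.admZ_f[OF a'_in]]] KM.admZ_int(2)[OF W_adm(3)[OF ok_true]]
  by (simp add: PS.prob_space)

lemma bwD: "0 < h n" "h \<longlonglongrightarrow> 0" "filterlim (\<lambda>n. real n * h n ^ CARD('d)) at_top sequentially" "(\<lambda>n. real n * h n ^ (CARD('d) + 4)) \<longlonglongrightarrow> Ch"
  using bw by (auto simp: bandwidth_conditions_def)

lemma h_le_1: "\<forall>\<^sub>F n in sequentially. h n \<le> 1"
  using order_tendstoD(2)[OF bwD(2), of 1] by (auto elim: eventually_mono)

lemma mt_moments:
  assumes b: "0 < b"
  shows "integrable PP (\<lambda>\<omega>. mt b (obsv \<omega>))" "integrable PP (\<lambda>\<omega>. (mt b (obsv \<omega>))\<^sup>2)"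
  unfolding mt_obsv using KM.mom_int[OF a_in a'_in true_adm b] KM.mom_sq_int[OF a_in a'_in true_adm b] by simp_all

text \<open>By \<open>true_main_zero\<close> the mean consists of smoothing error alone, hence is of
  order \<open>b^2\<close>; the second moment is of order \<open>b^(-d)\<close>. Both hold uniformly
  for bandwidths up to 1.\<close>

lemma mt_moment_bounds: "\<exists>K. 0 \<le> K \<and> (\<forall>b. 0 < b \<and> b \<le> 1 \<longrightarrow> \<bar>LINT \<omega>|PP. mt b (obsv \<omega>)\<bar> \<le> K * b\<^sup>2 \<and>
   b ^ CARD('d) * (LINT \<omega>|PP. (mt b (obsv \<omega>))\<^sup>2) \<le> K)"
proof -
  obtain \<delta>1 where d1: "0 < \<delta>1" "cube \<delta>1 a \<subseteq> SS" using open_contains_cube[OF setupD(2) a_in] .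
  obtain \<delta>2 where d2: "0 < \<delta>2" "cube \<delta>2 a' \<subseteq> SS" using open_contains_cube[OF setupD(2) a'_in] .
  define \<delta> where "\<delta> = min \<delta>1 \<delta>2"
  have d: "0 < \<delta>" "cube \<delta> a \<subseteq> SS" "cube \<delta> a' \<subseteq> SS" using d1 d2 by (fastforce simp: \<delta>_def cube_def)+
  let ?w1 = "W1 (alp D) (lam D) a a'" and ?w3 = "W3 (alp D) (lam D) (gam D) a a'" and ?w4 = "\<lambda>z. HH (alp D) (gam D) a a' z - psi0 D a a'"
  let ?s = "5 * CC\<^sup>2 * smooth_const \<delta> TYPE('d) * ((LINT \<omega>|PP. \<bar>?w1 (ZZ \<omega>)\<bar>) + (LINT \<omega>|PP. \<bar>?w3 (ZZ \<omega>)\<bar>))"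
  let ?t = "33 * CC ^ 3 * (LINT u|lborel. (k u)\<^sup>2) ^ CARD('d) * ((LINT \<omega>|PP. (?w1 (ZZ \<omega>))\<^sup>2) + (LINT \<omega>|PP. (?w3 (ZZ \<omega>))\<^sup>2)) + 8 * (LINT \<omega>|PP. (?w4 (ZZ \<omega>))\<^sup>2)"
  show ?thesis
  proof (intro exI[of _ "\<bar>?s\<bar> + \<bar>?t\<bar>"] conjI allI impI)
    fix b :: real assume "0 < b \<and> b \<le> 1"
    then have b: "0 < b" "b \<le> 1" by auto
    have "\<bar>LINT \<omega>|PP. mt b (obsv \<omega>)\<bar> \<le> ?s * b\<^sup>2"
      using KM.mom_expectation_bound[OF d(1,2) a_in d(3) a'_in true_adm b(1)] true_main_zero unfolding mt_obsv
      by (simp add: mult_ac)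
    also have "\<dots> \<le> (\<bar>?s\<bar> + \<bar>?t\<bar>) * b\<^sup>2" by (intro mult_right_mono) auto
    finally show "\<bar>LINT \<omega>|PP. mt b (obsv \<omega>)\<bar> \<le> (\<bar>?s\<bar> + \<bar>?t\<bar>) * b\<^sup>2" .
    have "b ^ CARD('d) * (LINT \<omega>|PP. (mt b (obsv \<omega>))\<^sup>2) \<le>
        33 * CC ^ 3 * (LINT u|lborel. (k u)\<^sup>2) ^ CARD('d) * ((LINT \<omega>|PP. (?w1 (ZZ \<omega>))\<^sup>2) + (LINT \<omega>|PP. (?w3 (ZZ \<omega>))\<^sup>2)) + 8 * b ^ CARD('d) * (LINT \<omega>|PP. (?w4 (ZZ \<omega>))\<^sup>2)"
      using KM.mom_sq_bound[OF a_in a'_in true_adm b(1)] unfolding mt_obsv by simp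
    also have "\<dots> \<le> ?t"
      using b by (intro add_left_mono mult_right_mono) (auto intro: power_le_one)
    finally show "b ^ CARD('d) * (LINT \<omega>|PP. (mt b (obsv \<omega>))\<^sup>2) \<le> \<bar>?s\<bar> + \<bar>?t\<bar>" by linarith
  qed simp
qed

lemma sum_second_moment:
  fixes g :: "(real ^ 'd) \<times> 'x \<times> 'm \<times> real \<Rightarrow> real"
  assumes I: "finite I" "I \<subseteq> {1..}" and g: "g \<in> borel_measurable OS" and sq: "integrable PP (\<lambda>\<omega>. (g (obsv \<omega>))\<^sup>2)"
  shows "(\<integral>\<^sup>+\<omega>. ennreal ((\<Sum>i\<in>I. g (obs E i \<omega>))\<^sup>2) \<partial>SM) \<le>
    ennreal (real (card I) * (LINT \<omega>|PP. (g (obsv \<omega>))\<^sup>2) + (real (card I))\<^sup>2 * (LINT \<omega>|PP. g (obsv \<omega>))\<^sup>2)"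
proof (rule SP.iid_sum_second_moment[OF I(1)])
  have g2: "(\<lambda>o'. (g o')\<^sup>2) \<in> borel_measurable OS" using g by measurable
  show "SP.indep_vars (\<lambda>_. borel) (\<lambda>i \<omega>. g (obs E i \<omega>)) I"
    by (rule SP.indep_vars_compose2[OF SP.indep_vars_subset[OF obs_indep I(2)]]) (rule g)
  fix i assume "i \<in> I"
  then have i: "1 \<le> i" using I by auto
  show "integrable SM (\<lambda>\<omega>. (g (obs E i \<omega>))\<^sup>2)" using transfer_obs(2)[OF i g2] sq by simp
  show "(LINT \<omega>|SM. g (obs E i \<omega>)) = (LINT \<omega>|PP. g (obsv \<omega>))" by (rule transfer_obs(1)[OF i g])
  show "(LINT \<omega>|SM. (g (obs E i \<omega>))\<^sup>2) = (LINT \<omega>|PP. (g (obsv \<omega>))\<^sup>2)" by (rule transfer_obs(1)[OF i g2])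
qed

section \<open>Folds, training data and the fold remainder\<close>

lemma cfD: "1 \<le> nfolds E" "(\<Union>l\<in>{1..nfolds E}. folds E n l) = {1..n}" "disjoint_family_on (folds E n) {1..nfolds E}"
  "l \<in> {1..nfolds E} \<Longrightarrow> (\<lambda>n. real (card (folds E n l)) / real n) \<longlonglongrightarrow> 1 / real (nfolds E)"
  "l \<in> {1..nfolds E} \<Longrightarrow> b \<in> SS \<Longrightarrow> (\<lambda>(d, m, x). est_alp E n l d b m x) \<in> borel_measurable (PiM (train_idx E n l) (\<lambda>_. OS) \<Otimes>\<^sub>M RM \<Otimes>\<^sub>M RX)"
  "l \<in> {1..nfolds E} \<Longrightarrow> b \<in> SS \<Longrightarrow> (\<lambda>(d, x). est_lam E n l d b x) \<in> borel_measurable (PiM (train_idx E n l) (\<lambda>_. OS) \<Otimes>\<^sub>M RX)"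
  "l \<in> {1..nfolds E} \<Longrightarrow> b \<in> SS \<Longrightarrow> (\<lambda>(d, m, x). est_gam E n l d x m b) \<in> borel_measurable (PiM (train_idx E n l) (\<lambda>_. OS) \<Otimes>\<^sub>M RM \<Otimes>\<^sub>M RX)"
  using cf unfolding crossfit_setup_def by blast+

definition nl :: "nat \<Rightarrow> nat \<Rightarrow> real" where "nl n l = real (card (folds E n l))"

lemma folds_sub: "l \<in> {1..nfolds E} \<Longrightarrow> folds E n l \<subseteq> {1..n}" "l \<in> {1..nfolds E} \<Longrightarrow> finite (folds E n l)" "l \<in> {1..nfolds E} \<Longrightarrow> nl n l \<le> real n"
proof -
  assume l: "l \<in> {1..nfolds E}"
  show s: "folds E n l \<subseteq> {1..n}" using cfD(2)[of n] l by blast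
  then show "finite (folds E n l)" by (rule finite_subset) simp
  show "nl n l \<le> real n" using card_mono[OF _ s] by (simp add: nl_def)
qed

lemma nl_ratio: "l \<in> {1..nfolds E} \<Longrightarrow> (\<lambda>n. real n / nl n l) \<longlonglongrightarrow> real (nfolds E)"
  using tendsto_inverse[OF cfD(4)[of l]] cfD(1) by (simp add: nl_def inverse_eq_divide)

lemma nl_pos: "l \<in> {1..nfolds E} \<Longrightarrow> \<forall>\<^sub>F n in sequentially. 0 < nl n l"
proof -
  assume l: "l \<in> {1..nfolds E}"
  have "0 < 1 / real (nfolds E)" using cfD(1) by simp
  from order_tendstoD(1)[OF cfD(4)[OF l] this] show ?thesis
    by eventually_elim (auto simp: nl_def zero_less_divide_iff)
qed

definition "tr n l = PiM (train_idx E n l) (\<lambda>_. OS)"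
definition "fsp n l = PiM (folds E n l) (\<lambda>_. OS)"
definition "fold_obs n l \<omega> = restrict (\<lambda>i. obs E i \<omega>) (folds E n l)"

lemma train_fold_indep: "l \<in> {1..nfolds E} \<Longrightarrow> SP.indep_var (tr n l) (train E n l) (fsp n l) (fold_obs n l)"
  unfolding tr_def fsp_def train_def[abs_def] fold_obs_def[abs_def]
  by (rule SP.indep_var_restrict[OF obs_indep]) (use folds_sub(1)[of l n] in \<open>auto simp: train_idx_def\<close>)

text \<open>The training data enter as a free argument \<open>t\<close>, so that independence of
  training data and fold can be used before the sample is inserted.\<close>

definition "mh n l t = moment RM k (h n) a a' (est_alp E n l t) (est_lam E n l t) (est_gam E n l t)"

lemma mh_meas: "l \<in> {1..nfolds E} \<Longrightarrow> (\<lambda>p. mh n l (fst p) psi (snd p)) \<in> borel_measurable (tr n l \<Otimes>\<^sub>M OS)"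
  unfolding mh_def tr_def using cfD(5,6,7) a_in a'_in by (intro moment_joint_meas) auto

text \<open>The normalised fold average of estimated minus true moment function, as a function of
  the pair of training and fold data: the format of \<open>tendsto_prob_conditional\<close>.\<close>

definition "FF n l p = sqrt (real n * h n ^ CARD('d)) / nl n l * (\<Sum>i\<in>folds E n l. mh n l (fst p) (psi0 D a a') (snd p i) - mt (h n) (snd p i))"

lemma FF_meas: "l \<in> {1..nfolds E} \<Longrightarrow> FF n l \<in> borel_measurable (tr n l \<Otimes>\<^sub>M fsp n l)"
proof -
  assume l: "l \<in> {1..nfolds E}"
  have c: "(\<lambda>p. (fst p, snd p i)) \<in> measurable (tr n l \<Otimes>\<^sub>M fsp n l) (tr n l \<Otimes>\<^sub>M OS)" "(\<lambda>p. snd p i) \<in> measurable (tr n l \<Otimes>\<^sub>M fsp n l) OS"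
    if "i \<in> folds E n l" for i
  proof -
    show 1: "(\<lambda>p. snd p i) \<in> measurable (tr n l \<Otimes>\<^sub>M fsp n l) OS"
      unfolding fsp_def by (rule measurable_compose[OF measurable_snd measurable_component_singleton[OF that]])
    show "(\<lambda>p. (fst p, snd p i)) \<in> measurable (tr n l \<Otimes>\<^sub>M fsp n l) (tr n l \<Otimes>\<^sub>M OS)"
      by (intro measurable_Pair measurable_fst 1)
  qed
  have "(\<lambda>p. mh n l (fst p) (psi0 D a a') (snd p i) - mt (h n) (snd p i)) \<in> borel_measurable (tr n l \<Otimes>\<^sub>M fsp n l)" if "i \<in> folds E n l" for i
    using measurable_compose[OF c(1)[OF that] mh_meas[OF l]] measurable_compose[OF c(2)[OF that] mt_meas] by simp
  then show ?thesis unfolding FF_def[abs_def] by measurable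
qed

lemma hats_ok:
  assumes l: "l \<in> {1..nfolds E}" and w: "\<omega> \<in> space SM"
  shows "nuisance_ok a a' (alp_hat E n l \<omega>) (lam_hat E n l \<omega>) (gam_hat E n l \<omega>)"
proof -
  have t: "train E n l \<omega> \<in> space (PiM (train_idx E n l) (\<lambda>_. OS))"
    using measurable_space[OF SP.indep_var_rv1[OF train_fold_indep[OF l]] w] by (simp add: tr_def)
  have s: "(\<lambda>z. (train E n l \<omega>, fst z, snd z)) \<in> measurable NZ (PiM (train_idx E n l) (\<lambda>_. OS) \<Otimes>\<^sub>M RM \<Otimes>\<^sub>M RX)"
    "(\<lambda>x. (train E n l \<omega>, x)) \<in> measurable RX (PiM (train_idx E n l) (\<lambda>_. OS) \<Otimes>\<^sub>M RX)"
    using t by (auto intro!: measurable_Pair measurable_const)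
  have "(\<lambda>z. alp_hat E n l \<omega> b (fst z) (snd z)) \<in> borel_measurable NZ" "lam_hat E n l \<omega> b \<in> borel_measurable RX" if "b \<in> SS" for b
    using measurable_compose[OF s(1) cfD(5)[OF l that]] measurable_compose[OF s(2) cfD(6)[OF l that]]
    by (simp_all add: alp_hat_def lam_hat_def)
  moreover have "(\<lambda>z. gam_hat E n l \<omega> (snd z) (fst z) a) \<in> borel_measurable NZ"
    using measurable_compose[OF s(1) cfD(7)[OF l a_in]] by (simp add: gam_hat_def)
  ultimately show ?thesis
    unfolding nuisance_ok_def using hats[OF l w] a_in a'_in by simp
qed

lemma err_eq:
  assumes l: "l \<in> {1..nfolds E}" and w: "\<omega> \<in> space SM"
  shows "b \<in> {a, a'} \<Longrightarrow> err_alp D E n l \<omega> b = EA (alp_hat E n l \<omega>) b" "b \<in> {a, a'} \<Longrightarrow> err_lam D E n l \<omega> b = EL (lam_hat E n l \<omega>) b"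
    "err_gam D E n l \<omega> a = EG (gam_hat E n l \<omega>) a"
proof -
  note O = okD[OF hats_ok[OF l w, of n]] and O0 = okD[OF ok_true]
  show "err_alp D E n l \<omega> b = EA (alp_hat E n l \<omega>) b" if b: "b \<in> {a, a'}"
  proof -
    have "(\<lambda>z. (alp_hat E n l \<omega> b (fst z) (snd z) - alp D b (fst z) (snd z))\<^sup>2) \<in> borel_measurable NZ"
      using b O(3,4) O0(3,4) by auto
    from Z_integral[OF this] show ?thesis by (simp add: err_alp_def EA_def split_beta')
  qed
  show "err_lam D E n l \<omega> b = EL (lam_hat E n l \<omega>) b" if b: "b \<in> {a, a'}"
  proof -
    have "(\<lambda>x. (lam_hat E n l \<omega> b x - lam D b x)\<^sup>2) \<in> borel_measurable RX"
      using b O(5,6) O0(5,6) by auto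
    from X_integral[OF this] show ?thesis by (simp add: err_lam_def EL_def ZZ_def)
  qed
  have "(\<lambda>z. (gam_hat E n l \<omega> (snd z) (fst z) a - gam D (snd z) (fst z) a)\<^sup>2) \<in> borel_measurable NZ"
    using O(7) O0(7) by auto
  from Z_integral[OF this] show "err_gam D E n l \<omega> a = EG (gam_hat E n l \<omega>) a"
    by (simp add: err_gam_def EG_def gz_def split_beta')
qed

definition "toth n l \<omega> = err_alp D E n l \<omega> a + err_alp D E n l \<omega> a' + err_lam D E n l \<omega> a + err_lam D E n l \<omega> a' + err_gam D E n l \<omega> a"
definition "sn n = sqrt (real n * h n ^ CARD('d))"
text \<open>The error products that bound the conditional mean in \<open>moment_diff_first\<close>,
  scaled by \<open>sn\<close>: \<open>prod1\<close> contains those with the error of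
  \<open>gam\<close>, \<open>prod2\<close> is the product of the errors of \<open>lam\<close> and
  \<open>alp\<close> at \<open>a'\<close>.\<close>

definition "prod1 n l \<omega> = sn n * sqrt (err_lam D E n l \<omega> a) * sqrt (err_gam D E n l \<omega> a)
   + sn n * sqrt (err_alp D E n l \<omega> a') * sqrt (err_gam D E n l \<omega> a) + sn n * sqrt (err_alp D E n l \<omega> a) * sqrt (err_gam D E n l \<omega> a)"
definition "prod2 n l \<omega> = sn n * sqrt (err_lam D E n l \<omega> a') * sqrt (err_alp D E n l \<omega> a')"

lemma rates:
  assumes l: "l \<in> {1..nfolds E}"
  shows "tendsto_prob SM (\<lambda>n \<omega>. toth n l \<omega>) 0" "tendsto_prob SM (\<lambda>n \<omega>. prod1 n l \<omega>) 0" "tendsto_prob SM (\<lambda>n \<omega>. prod2 n l \<omega>) 0"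
proof -
  have e: "tendsto_prob SM (\<lambda>n \<omega>. err_lam D E n l \<omega> b) 0" "tendsto_prob SM (\<lambda>n \<omega>. err_alp D E n l \<omega> b) 0" "tendsto_prob SM (\<lambda>n \<omega>. err_gam D E n l \<omega> b) 0"
    if "b \<in> SS" for b using nc l that unfolding nuisance_consistency_def by blast+
  show "tendsto_prob SM (\<lambda>n \<omega>. toth n l \<omega>) 0"
    unfolding toth_def by (intro SP.tendsto_prob_add e a_in a'_in)
  have p: "tendsto_prob SM (\<lambda>n \<omega>. sn n * sqrt (err_alp D E n l \<omega> b') * sqrt (err_gam D E n l \<omega> b)) 0"
    "tendsto_prob SM (\<lambda>n \<omega>. sn n * sqrt (err_lam D E n l \<omega> b') * sqrt (err_gam D E n l \<omega> b)) 0"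
    "tendsto_prob SM (\<lambda>n \<omega>. sn n * sqrt (err_lam D E n l \<omega> b') * sqrt (err_alp D E n l \<omega> b)) 0" if "b \<in> SS" "b' \<in> SS" for b b'
    using pr l that unfolding product_rates_def sn_def by blast+
  show "tendsto_prob SM (\<lambda>n \<omega>. prod1 n l \<omega>) 0" "tendsto_prob SM (\<lambda>n \<omega>. prod2 n l \<omega>) 0"
    unfolding prod1_def prod2_def by (intro SP.tendsto_prob_add p a_in a'_in)+
qed

text \<open>The last identity is how the limit \<open>Ch\<close> enters: it keeps
  \<open>sn n * (h n)^2\<close>, the scaled order of the smoothing bias, bounded.\<close>

lemma sn_sq: "(sn n)\<^sup>2 = real n * h n ^ CARD('d)" "0 \<le> sn n" "sn n * (h n)\<^sup>2 = sqrt (real n * h n ^ (CARD('d) + 4))"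
proof -
  have h0: "0 \<le> h n" using bwD(1)[of n] by simp
  show "(sn n)\<^sup>2 = real n * h n ^ CARD('d)" "0 \<le> sn n" using h0 by (simp_all add: sn_def)
  have "h n ^ (CARD('d) + 4) = h n ^ CARD('d) * ((h n)\<^sup>2)\<^sup>2"
    by (simp only: power_add power_mult[symmetric]) simp
  then have "sqrt (h n ^ (CARD('d) + 4)) = sqrt (h n ^ CARD('d)) * (h n)\<^sup>2" by (simp only: real_sqrt_mult real_sqrt_abs abs_power2)
  then show "sn n * (h n)\<^sup>2 = sqrt (real n * h n ^ (CARD('d) + 4))" by (simp add: sn_def real_sqrt_mult)
qed

text \<open>For fixed training data the fold sum consists of i.i.d. terms with mean \<open>m\<close>
  and second moment \<open>s\<close>. After scaling, its second moment is at most a variance part,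
  controlled by \<open>moment_diff_second\<close>, plus \<open>(sn n * m)^2\<close>, controlled by
  \<open>moment_diff_first\<close>.\<close>

lemma fold_remainder_bound:
  assumes l: "l \<in> {1..nfolds E}"
  shows "\<exists>K. \<forall>n. 0 < nl n l \<and> h n \<le> 1 \<longrightarrow> (\<forall>\<omega>\<in>space SM. (\<integral>\<^sup>+\<omega>'. ennreal ((FF n l (train E n l \<omega>, fold_obs n l \<omega>'))\<^sup>2) \<partial>SM) \<le>
     ennreal (K * ((real n / nl n l) * toth n l \<omega> + (real n * h n ^ (CARD('d) + 4)) * toth n l \<omega> + (prod1 n l \<omega>)\<^sup>2 + (prod2 n l \<omega>)\<^sup>2)))"
proof -
  obtain \<delta>1 where d1: "0 < \<delta>1" "cube \<delta>1 a \<subseteq> SS" using open_contains_cube[OF setupD(2) a_in] .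
  obtain \<delta>2 where d2: "0 < \<delta>2" "cube \<delta>2 a' \<subseteq> SS" using open_contains_cube[OF setupD(2) a'_in] .
  define \<delta> where "\<delta> = min \<delta>1 \<delta>2"
  have d: "0 < \<delta>" "cube \<delta> a \<subseteq> SS" "cube \<delta> a' \<subseteq> SS" using d1 d2 by (fastforce simp: \<delta>_def cube_def)+
  define K1 where "K1 = (99 * CC ^ 3 * (LINT u|lborel. (k u)\<^sup>2) ^ CARD('d) + 8) * kD"
  define K2 where "K2 = 15 * CC\<^sup>2 * smooth_const \<delta> TYPE('d) * sqrt kD"
  define K3 where "K3 = CC * (cu / cl + cu * cu / (cl * cl))"
  define K4 where "K4 = CC * (cu / cl)"
  \<comment> \<open>\<open>K1\<close> is the constant of the second moment, \<open>K2\<close> to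
    \<open>K4\<close> are those of the three parts of the mean; the factor 3 comes from squaring a
    sum of three terms.\<close>
  define K where "K = \<bar>K1\<bar> + 3 * K2\<^sup>2 + 3 * K3\<^sup>2 + 3 * K4\<^sup>2"
  have Kle: "K1 \<le> K" "3 * K2\<^sup>2 \<le> K" "3 * K3\<^sup>2 \<le> K" "3 * K4\<^sup>2 \<le> K"
  proof -
    have "0 \<le> K2\<^sup>2" "0 \<le> K3\<^sup>2" "0 \<le> K4\<^sup>2" by simp_all
    then show "K1 \<le> K" "3 * K2\<^sup>2 \<le> K" "3 * K3\<^sup>2 \<le> K" "3 * K4\<^sup>2 \<le> K" unfolding K_def by linarith+
  qed
  show ?thesis
  proof (intro exI[of _ K] allI impI ballI)
    fix n \<omega> assume "0 < nl n l \<and> h n \<le> 1" and w: "\<omega> \<in> space SM"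
    then have nl0: "0 < nl n l" and h1: "h n \<le> 1" by auto
    note h0 = bwD(1)[of n]
    let ?al = "alp_hat E n l \<omega>" and ?la = "lam_hat E n l \<omega>" and ?ga = "gam_hat E n l \<omega>"
    note ok = hats_ok[OF l w, of n]
    note er = err_eq(1,2)[OF l w, of _ n] err_eq(3)[OF l w, of n]
    have tote: "toth n l \<omega> = tot a a' ?al ?la ?ga" unfolding toth_def tot_def[OF ok] using er by simp
    have tot0: "0 \<le> toth n l \<omega>" unfolding tote by (rule tot_nonneg[OF ok])
    define g where "g o' = mh n l (train E n l \<omega>) (psi0 D a a') o' - mt (h n) o'" for o'
    let ?mom = "KM.mom (h n) a a' (d1 a a' ?al ?la) (e1 a a' ?al ?la ?ga) (d3 a a' ?al ?la ?ga) (dH a a' ?al ?ga)"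
    have gobs: "g (obsv \<omega>') = ?mom \<omega>'" for \<omega>'
      unfolding g_def mh_def mt_def alp_hat_def[symmetric] lam_hat_def[symmetric] gam_hat_def[symmetric]
      by (rule moment_diff[OF ok])
    have t: "train E n l \<omega> \<in> space (tr n l)" by (rule measurable_space[OF SP.indep_var_rv1[OF train_fold_indep[OF l]] w])
    have gm: "g \<in> borel_measurable OS"
      unfolding g_def using measurable_compose[OF measurable_Pair1'[OF t] mh_meas[OF l]] mt_meas by simp
    define s m where "s = (LINT \<omega>'|PP. (g (obsv \<omega>'))\<^sup>2)" and "m = (LINT \<omega>'|PP. g (obsv \<omega>'))"
    have sq: "integrable PP (\<lambda>\<omega>'. (g (obsv \<omega>'))\<^sup>2)" unfolding gobs by (rule moment_diff_second(1)[OF ok h0 h1])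
    have s: "h n ^ CARD('d) * s \<le> K1 * toth n l \<omega>"
      unfolding s_def gobs tote K1_def by (rule moment_diff_second(2)[OF ok h0 h1])
    have s0: "0 \<le> s" by (simp add: s_def)
    define p1 p2 where "p1 = sqrt (EL ?la a) * sqrt (EG ?ga a) + sqrt (EA ?al a') * sqrt (EG ?ga a) + sqrt (EA ?al a) * sqrt (EG ?ga a)"
      and "p2 = sqrt (EL ?la a') * sqrt (EA ?al a')"
    have P: "prod1 n l \<omega> = sn n * p1" "prod2 n l \<omega> = sn n * p2"
      unfolding prod1_def prod2_def p1_def p2_def using er by (simp_all add: algebra_simps)
    have m: "\<bar>m\<bar> \<le> K2 * ((h n)\<^sup>2 * sqrt (toth n l \<omega>)) + K3 * p1 + K4 * p2"
      unfolding m_def gobs tote K2_def K3_def K4_def p1_def p2_def by (rule moment_diff_first(2)[OF ok d h0])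
    have "\<bar>sn n * m\<bar> = sn n * \<bar>m\<bar>" using sn_sq(2) by (simp add: abs_mult)
    also have "\<dots> \<le> sn n * (K2 * ((h n)\<^sup>2 * sqrt (toth n l \<omega>)) + K3 * p1 + K4 * p2)" using sn_sq(2) by (intro mult_left_mono m)
    also have "\<dots> = K2 * (sn n * (h n)\<^sup>2 * sqrt (toth n l \<omega>)) + K3 * prod1 n l \<omega> + K4 * prod2 n l \<omega>"
      unfolding P by (simp add: algebra_simps)
    finally have "\<bar>sn n * m\<bar>\<^sup>2 \<le> (K2 * (sn n * (h n)\<^sup>2 * sqrt (toth n l \<omega>)) + K3 * prod1 n l \<omega> + K4 * prod2 n l \<omega>)\<^sup>2"
      by (intro power_mono) auto
    also have "\<dots> \<le> 3 * ((K2 * (sn n * (h n)\<^sup>2 * sqrt (toth n l \<omega>)))\<^sup>2 + (K3 * prod1 n l \<omega>)\<^sup>2 + (K4 * prod2 n l \<omega>)\<^sup>2)"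
    proof -
      have "(x + y + z)\<^sup>2 \<le> 3 * (x\<^sup>2 + y\<^sup>2 + z\<^sup>2)" for x y z :: real
      proof -
        have "(x + y + z)\<^sup>2 = x\<^sup>2 + y\<^sup>2 + z\<^sup>2 + 2 * x * y + 2 * x * z + 2 * y * z" by (simp add: power2_eq_square algebra_simps)
        then show ?thesis using sum_squares_bound[of x y] sum_squares_bound[of x z] sum_squares_bound[of y z] by simp
      qed
      then show ?thesis .
    qed
    also have "(K2 * (sn n * (h n)\<^sup>2 * sqrt (toth n l \<omega>)))\<^sup>2 = K2\<^sup>2 * (real n * h n ^ (CARD('d) + 4) * toth n l \<omega>)"
      unfolding sn_sq(3) using tot0 h0 by (simp add: power_mult_distrib)
    finally have m2: "(sn n * m)\<^sup>2 \<le> 3 * K2\<^sup>2 * (real n * h n ^ (CARD('d) + 4) * toth n l \<omega>) + 3 * K3\<^sup>2 * (prod1 n l \<omega>)\<^sup>2 + 3 * K4\<^sup>2 * (prod2 n l \<omega>)\<^sup>2"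
      by (simp add: power_mult_distrib algebra_simps)
    have FFe: "FF n l (train E n l \<omega>, fold_obs n l \<omega>') = sn n / nl n l * (\<Sum>i\<in>folds E n l. g (obs E i \<omega>'))" for \<omega>'
      unfolding FF_def sn_def g_def by (simp add: fold_obs_def)
    have "(\<integral>\<^sup>+\<omega>'. ennreal ((FF n l (train E n l \<omega>, fold_obs n l \<omega>'))\<^sup>2) \<partial>SM) =
       (\<integral>\<^sup>+\<omega>'. ennreal ((sn n / nl n l)\<^sup>2) * ennreal ((\<Sum>i\<in>folds E n l. g (obs E i \<omega>'))\<^sup>2) \<partial>SM)"
      unfolding FFe power_mult_distrib by (simp add: ennreal_mult)
    also have "\<dots> = ennreal ((sn n / nl n l)\<^sup>2) * (\<integral>\<^sup>+\<omega>'. ennreal ((\<Sum>i\<in>folds E n l. g (obs E i \<omega>'))\<^sup>2) \<partial>SM)"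
    proof (rule nn_integral_cmult)
      have "(\<lambda>\<omega>'. g (obs E i \<omega>')) \<in> borel_measurable SM" if "i \<in> folds E n l" for i
        using measurable_compose[OF obs_meas gm, of i] folds_sub(1)[OF l, of n] that by auto
      then show "(\<lambda>\<omega>'. ennreal ((\<Sum>i\<in>folds E n l. g (obs E i \<omega>'))\<^sup>2)) \<in> borel_measurable SM" by measurable
    qed
    also have "\<dots> \<le> ennreal ((sn n / nl n l)\<^sup>2) * ennreal (nl n l * s + (nl n l)\<^sup>2 * m\<^sup>2)"
      unfolding s_def m_def nl_def using folds_sub[OF l, of n] by (intro mult_left_mono sum_second_moment gm sq) auto
    also have "\<dots> = ennreal ((sn n / nl n l)\<^sup>2 * (nl n l * s + (nl n l)\<^sup>2 * m\<^sup>2))"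
      using s0 nl0 by (simp add: ennreal_mult)
    \<comment> \<open>The fold size cancels in the squared mean and remains as the ratio
      \<open>n / nl n l\<close> in the variance part.\<close>
    also have "(sn n / nl n l)\<^sup>2 * (nl n l * s + (nl n l)\<^sup>2 * m\<^sup>2) = real n / nl n l * (h n ^ CARD('d) * s) + (sn n * m)\<^sup>2"
      using nl0 by (simp add: power_divide power_mult_distrib sn_sq(1) field_simps power2_eq_square[of "nl n l"])
    also have "ennreal \<dots> \<le> ennreal (K * ((real n / nl n l) * toth n l \<omega> + (real n * h n ^ (CARD('d) + 4)) * toth n l \<omega> + (prod1 n l \<omega>)\<^sup>2 + (prod2 n l \<omega>)\<^sup>2))"
    proof (rule ennreal_leI)
      have "real n / nl n l * (h n ^ CARD('d) * s) \<le> real n / nl n l * (K1 * toth n l \<omega>)" using s nl0 by (intro mult_left_mono) auto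
      also have "\<dots> \<le> real n / nl n l * (K * toth n l \<omega>)" using nl0 tot0 Kle by (intro mult_left_mono mult_right_mono) auto
      finally have 1: "real n / nl n l * (h n ^ CARD('d) * s) \<le> K * (real n / nl n l * toth n l \<omega>)" by (simp add: mult_ac)
      have "3 * K2\<^sup>2 * (real n * h n ^ (CARD('d) + 4) * toth n l \<omega>) \<le> K * (real n * h n ^ (CARD('d) + 4) * toth n l \<omega>)"
        using tot0 h0 by (intro mult_right_mono Kle) auto
      moreover have "3 * K3\<^sup>2 * (prod1 n l \<omega>)\<^sup>2 \<le> K * (prod1 n l \<omega>)\<^sup>2" "3 * K4\<^sup>2 * (prod2 n l \<omega>)\<^sup>2 \<le> K * (prod2 n l \<omega>)\<^sup>2"
        by (intro mult_right_mono Kle; simp)+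
      ultimately show "real n / nl n l * (h n ^ CARD('d) * s) + (sn n * m)\<^sup>2 \<le>
          K * ((real n / nl n l) * toth n l \<omega> + (real n * h n ^ (CARD('d) + 4)) * toth n l \<omega> + (prod1 n l \<omega>)\<^sup>2 + (prod2 n l \<omega>)\<^sup>2)"
        using 1 m2 by (simp only: distrib_left)
    qed
    finally show "(\<integral>\<^sup>+\<omega>'. ennreal ((FF n l (train E n l \<omega>, fold_obs n l \<omega>'))\<^sup>2) \<partial>SM) \<le>
      ennreal (K * ((real n / nl n l) * toth n l \<omega> + (real n * h n ^ (CARD('d) + 4)) * toth n l \<omega> + (prod1 n l \<omega>)\<^sup>2 + (prod2 n l \<omega>)\<^sup>2))" .
  qed
qed

lemma fold_remainder:
  assumes l: "l \<in> {1..nfolds E}"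
  shows "tendsto_prob SM (\<lambda>n \<omega>. FF n l (train E n l \<omega>, fold_obs n l \<omega>)) 0"
proof -
  obtain K where K: "\<And>n \<omega>. 0 < nl n l \<Longrightarrow> h n \<le> 1 \<Longrightarrow> \<omega> \<in> space SM \<Longrightarrow> (\<integral>\<^sup>+\<omega>'. ennreal ((FF n l (train E n l \<omega>, fold_obs n l \<omega>'))\<^sup>2) \<partial>SM) \<le>
     ennreal (K * ((real n / nl n l) * toth n l \<omega> + (real n * h n ^ (CARD('d) + 4)) * toth n l \<omega> + (prod1 n l \<omega>)\<^sup>2 + (prod2 n l \<omega>)\<^sup>2))"
    using fold_remainder_bound[OF l] by blast
  \<comment> \<open>Convergent deterministic factors are eventually bounded; this is applied to
    \<open>n / nl n l\<close> and to \<open>n h^(d+4)\<close>.\<close>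
  have bd: "\<forall>\<^sub>F n in sequentially. \<bar>c n\<bar> \<le> \<bar>c0\<bar> + 1" if "c \<longlonglongrightarrow> c0" for c :: "nat \<Rightarrow> real" and c0
    using order_tendstoD(2)[OF tendsto_rabs[OF that], of "\<bar>c0\<bar> + 1"] by (auto elim: eventually_mono)
  note R = rates[OF l]
  show ?thesis
  proof (rule SP.tendsto_prob_conditional[OF train_fold_indep[OF l] FF_meas[OF l]])
    show "tendsto_prob SM (\<lambda>n \<omega>. K * ((real n / nl n l) * toth n l \<omega> + (real n * h n ^ (CARD('d) + 4)) * toth n l \<omega> + (prod1 n l \<omega>)\<^sup>2 + (prod2 n l \<omega>)\<^sup>2)) 0"
      by (intro SP.tendsto_prob_cmult[of _ "\<lambda>_. K" "\<bar>K\<bar>"] SP.tendsto_prob_add SP.tendsto_prob_square R(2,3)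
          SP.tendsto_prob_cmult[OF R(1) bd[OF nl_ratio[OF l]]] SP.tendsto_prob_cmult[OF R(1) bd[OF bwD(4)]]) simp
    show "\<forall>\<^sub>F n in sequentially. \<forall>\<omega>\<in>space SM. (\<integral>\<^sup>+\<omega>'. ennreal ((FF n l (train E n l \<omega>, fold_obs n l \<omega>'))\<^sup>2) \<partial>SM) \<le>
        ennreal (K * ((real n / nl n l) * toth n l \<omega> + (real n * h n ^ (CARD('d) + 4)) * toth n l \<omega> + (prod1 n l \<omega>)\<^sup>2 + (prod2 n l \<omega>)\<^sup>2))"
      using nl_pos[OF l] h_le_1 by eventually_elim (use K in auto)
  qed
qed

end

section \<open>Linearisation of the estimator\<close>

context crossfit_model
begin

lemma moment_shift: "moment RM k b a a' al la ga psi p = moment RM k b a a' al la ga psi' p + (psi' - psi)"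
  by (simp add: moment_def split_beta')

text \<open>\<open>psi\<close> enters the moment function with coefficient -1, so on a nonempty fold
  the defining equation is linear with exactly one root. The \<open>psi\<close> on the right is
  arbitrary: \<open>psi0\<close> exhibits the estimation error, 0 serves for measurability.\<close>

lemma psi_fold_eq:
  assumes "0 < nl n l"
  shows "psi_fold D E k h a a' n l \<omega> = psi + (\<Sum>i\<in>folds E n l. mh n l (train E n l \<omega>) psi (obs E i \<omega>)) / nl n l"
proof -
  define S where "S = (\<Sum>i\<in>folds E n l. mh n l (train E n l \<omega>) psi (obs E i \<omega>))"
  have "(\<Sum>i\<in>folds E n l. moment RM k (h n) a a' (alp_hat E n l \<omega>) (lam_hat E n l \<omega>) (gam_hat E n l \<omega>) p (obs E i \<omega>)) = S + nl n l * (psi - p)" for p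
    unfolding S_def mh_def alp_hat_def lam_hat_def gam_hat_def moment_shift[of _ _ _ _ p _ psi] by (simp add: sum.distrib nl_def)
  then have "psi_fold D E k h a a' n l \<omega> = (THE p. 1 / nl n l * (S + nl n l * (psi - p)) = 0)"
    unfolding psi_fold_def nl_def by simp
  also have "\<dots> = psi + S / nl n l"
    using assms by (intro the_equality) (auto simp: field_simps)
  finally show ?thesis by (simp add: S_def)
qed

lemma mh_obs_meas:
  assumes l: "l \<in> {1..nfolds E}" and i: "i \<in> folds E n l"
  shows "(\<lambda>\<omega>. mh n l (train E n l \<omega>) psi (obs E i \<omega>)) \<in> borel_measurable SM"
proof -
  have "(\<lambda>\<omega>. (train E n l \<omega>, obs E i \<omega>)) \<in> measurable SM (tr n l \<Otimes>\<^sub>M OS)"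
    using folds_sub(1)[OF l, of n] i by (intro measurable_Pair SP.indep_var_rv1[OF train_fold_indep[OF l]] obs_meas) auto
  from measurable_compose[OF this mh_meas[OF l]] show ?thesis by simp
qed

text \<open>For an empty fold the defining equation holds for every value, and the estimator is a constant.\<close>

lemma psi_fold_meas:
  assumes l: "l \<in> {1..nfolds E}"
  shows "psi_fold D E k h a a' n l \<in> borel_measurable SM"
proof (cases "0 < nl n l")
  case True
  show ?thesis unfolding psi_fold_eq[OF True, of _ 0, abs_def] using mh_obs_meas[OF l] by measurable
next
  case False
  then have "folds E n l = {}" using folds_sub(2)[OF l, of n] by (simp add: nl_def)
  then show ?thesis by (simp add: psi_fold_def[abs_def])
qed

lemma psi_MR_meas: "psi_MR D E k h a a' n \<in> borel_measurable SM"
  unfolding psi_MR_def[abs_def] using psi_fold_meas by measurable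

lemma mt_obs_meas: "1 \<le> i \<Longrightarrow> (\<lambda>\<omega>. mt b (obs E i \<omega>)) \<in> borel_measurable SM"
  by (rule measurable_compose[OF obs_meas mt_meas])

lemma sn_div: "sqrt (h n ^ CARD('d) / real n) = sn n / real n"
proof (cases "n = 0")
  case False
  then have "(sn n / real n)\<^sup>2 = h n ^ CARD('d) / real n" by (simp add: power_divide sn_sq(1) power2_eq_square[of "real n"])
  moreover have "0 \<le> sn n / real n" using sn_sq(2) by simp
  ultimately show ?thesis by (metis real_sqrt_unique)
qed simp

definition "fold_sum n l \<omega> = (\<Sum>i\<in>folds E n l. mt (h n) (obs E i \<omega>))"

lemma fold_sum_meas: "l \<in> {1..nfolds E} \<Longrightarrow> fold_sum n l \<in> borel_measurable SM"
  unfolding fold_sum_def[abs_def] using folds_sub(1)[of l n] by (intro borel_measurable_sum mt_obs_meas) auto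

text \<open>The estimator weights folds equally while the linear term weights observations equally.
  As folds have only asymptotically equal sizes, the mismatch appears as the second summand.\<close>

lemma fold_decomposition:
  assumes "\<And>l. l \<in> {1..nfolds E} \<Longrightarrow> 0 < nl n l"
  shows "sn n * (psi_MR D E k h a a' n \<omega> - psi0 D a a') - sn n / real n * (\<Sum>i\<in>{1..n}. mt (h n) (obs E i \<omega>)) =
    (\<Sum>l\<in>{1..nfolds E}. 1 / real (nfolds E) * FF n l (train E n l \<omega>, fold_obs n l \<omega>)
      + sn n / real n * (real n / nl n l / real (nfolds E) - 1) * fold_sum n l \<omega>)"
proof -
  let ?L = "real (nfolds E)"
  have L: "0 < ?L" using cfD(1) by simp
  have n0: "0 < real n" using assms[of 1] cfD(1) folds_sub(3)[of 1 n] by fastforce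
  have F: "sn n * (psi_fold D E k h a a' n l \<omega> - psi0 D a a') = FF n l (train E n l \<omega>, fold_obs n l \<omega>) + sn n / nl n l * fold_sum n l \<omega>"
    if l: "l \<in> {1..nfolds E}" for l
    unfolding psi_fold_eq[OF assms[OF l], of _ "psi0 D a a'"] FF_def fold_sum_def sn_def
    by (simp add: fold_obs_def sum_subtractf right_diff_distrib)
  have "(\<Sum>i\<in>{1..n}. mt (h n) (obs E i \<omega>)) = (\<Sum>l\<in>{1..nfolds E}. fold_sum n l \<omega>)"
    unfolding fold_sum_def cfD(2)[symmetric, of n] using folds_sub(2) cfD(3)[of n]
    by (intro sum.UNION_disjoint) (auto simp: disjoint_family_on_def)
  moreover have "psi_MR D E k h a a' n \<omega> - psi0 D a a' = (\<Sum>l\<in>{1..nfolds E}. 1 / ?L * (psi_fold D E k h a a' n l \<omega> - psi0 D a a'))"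
    using L by (simp add: psi_MR_def sum_subtractf sum_distrib_left[symmetric] sum_divide_distrib[symmetric] right_diff_distrib diff_divide_distrib)
  ultimately have "sn n * (psi_MR D E k h a a' n \<omega> - psi0 D a a') - sn n / real n * (\<Sum>i\<in>{1..n}. mt (h n) (obs E i \<omega>)) =
    (\<Sum>l\<in>{1..nfolds E}. 1 / ?L * (sn n * (psi_fold D E k h a a' n l \<omega> - psi0 D a a')) - sn n / real n * fold_sum n l \<omega>)"
    by (simp add: sum_subtractf sum_distrib_left mult_ac)
  also have "\<dots> = (\<Sum>l\<in>{1..nfolds E}. 1 / ?L * FF n l (train E n l \<omega>, fold_obs n l \<omega>)
      + sn n / real n * (real n / nl n l / ?L - 1) * fold_sum n l \<omega>)"
  proof (rule sum.cong[OF refl])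
    fix l assume l: "l \<in> {1..nfolds E}"
    show "1 / ?L * (sn n * (psi_fold D E k h a a' n l \<omega> - psi0 D a a')) - sn n / real n * fold_sum n l \<omega> =
       1 / ?L * FF n l (train E n l \<omega>, fold_obs n l \<omega>) + sn n / real n * (real n / nl n l / ?L - 1) * fold_sum n l \<omega>"
      unfolding F[OF l] using assms[OF l] L n0 by (simp add: field_simps)
  qed
  finally show ?thesis .
qed

text \<open>By \<open>mt_moment_bounds\<close> the scaled fold sum is bounded in mean square by
  \<open>K + K^2 * (n h^(d+4))\<close>, which converges; the squared imbalance
  \<open>(\<rho> n)^2\<close> of the fold sizes sends the product to zero.\<close>

lemma fold_gap:
  assumes l: "l \<in> {1..nfolds E}"
  shows "tendsto_prob SM (\<lambda>n \<omega>. sn n / real n * (real n / nl n l / real (nfolds E) - 1) * fold_sum n l \<omega>) 0"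
proof -
  obtain K where K: "0 \<le> K" "\<And>b. 0 < b \<Longrightarrow> b \<le> 1 \<Longrightarrow> \<bar>LINT \<omega>|PP. mt b (obsv \<omega>)\<bar> \<le> K * b\<^sup>2"
    "\<And>b. 0 < b \<Longrightarrow> b \<le> 1 \<Longrightarrow> b ^ CARD('d) * (LINT \<omega>|PP. (mt b (obsv \<omega>))\<^sup>2) \<le> K" using mt_moment_bounds by blast
  define \<rho> where "\<rho> n = real n / nl n l / real (nfolds E) - 1" for n
  define b where "b n = (\<rho> n)\<^sup>2 * (K + K\<^sup>2 * (real n * h n ^ (CARD('d) + 4)))" for n
  have "(\<lambda>n. real n / nl n l / real (nfolds E) - 1) \<longlonglongrightarrow> real (nfolds E) / real (nfolds E) - 1"
    by (intro tendsto_intros nl_ratio[OF l]) (use cfD(1) in simp)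
  then have \<rho>0: "\<rho> \<longlonglongrightarrow> 0" using cfD(1) by (simp add: \<rho>_def[abs_def])
  have "b \<longlonglongrightarrow> 0\<^sup>2 * (K + K\<^sup>2 * Ch)"
    unfolding b_def[abs_def] by (intro tendsto_intros \<rho>0 bwD(4))
  then have b0: "b \<longlonglongrightarrow> 0" by simp
  show ?thesis
  proof (rule SP.tendsto_prob_L2[OF _ _ b0])
    show "(\<lambda>\<omega>. sn n / real n * (real n / nl n l / real (nfolds E) - 1) * fold_sum n l \<omega>) \<in> borel_measurable SM" for n
      using fold_sum_meas[OF l, of n] by measurable
    show "\<forall>\<^sub>F n in sequentially. 0 \<le> b n \<and>
        (\<integral>\<^sup>+\<omega>. ennreal ((sn n / real n * (real n / nl n l / real (nfolds E) - 1) * fold_sum n l \<omega>)\<^sup>2) \<partial>SM) \<le> ennreal (b n)"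
      using h_le_1 eventually_gt_at_top[of 0]
    proof eventually_elim
      case (elim n)
      note h0 = bwD(1)[of n] and h1 = elim(1)
      have n0: "0 < real n" using elim(2) by simp
      let ?s = "LINT \<omega>|PP. (mt (h n) (obsv \<omega>))\<^sup>2" and ?m = "LINT \<omega>|PP. mt (h n) (obsv \<omega>)"
      have s0: "0 \<le> ?s" by simp
      have nn: "nl n l \<le> real n" "0 \<le> nl n l" using folds_sub(3)[OF l] by (simp_all add: nl_def)
      have m2: "?m\<^sup>2 \<le> K\<^sup>2 * h n ^ 4"
      proof -
        have "\<bar>?m\<bar>\<^sup>2 \<le> (K * (h n)\<^sup>2)\<^sup>2" by (intro power_mono K(2)[OF h0 h1]) simp
        also have "\<dots> = K\<^sup>2 * h n ^ 4" by (simp add: power_mult_distrib power_mult[symmetric])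
        finally show ?thesis by simp
      qed
      have "(\<integral>\<^sup>+\<omega>. ennreal ((sn n / real n * \<rho> n * fold_sum n l \<omega>)\<^sup>2) \<partial>SM) =
          (\<integral>\<^sup>+\<omega>. ennreal ((sn n / real n * \<rho> n)\<^sup>2) * ennreal ((fold_sum n l \<omega>)\<^sup>2) \<partial>SM)"
        unfolding power_mult_distrib[of "sn n / real n * \<rho> n"] by (simp add: ennreal_mult)
      also have "\<dots> = ennreal ((sn n / real n * \<rho> n)\<^sup>2) * (\<integral>\<^sup>+\<omega>. ennreal ((fold_sum n l \<omega>)\<^sup>2) \<partial>SM)"
        by (rule nn_integral_cmult) (use fold_sum_meas[OF l, of n] in measurable)
      also have "\<dots> \<le> ennreal ((sn n / real n * \<rho> n)\<^sup>2) * ennreal (nl n l * ?s + (nl n l)\<^sup>2 * ?m\<^sup>2)"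
        unfolding fold_sum_def nl_def using folds_sub[OF l, of n]
        by (intro mult_left_mono sum_second_moment mt_meas mt_moments(2)[OF h0]) auto
      also have "\<dots> \<le> ennreal ((sn n / real n * \<rho> n)\<^sup>2) * ennreal (real n * ?s + (real n)\<^sup>2 * (K\<^sup>2 * h n ^ 4))"
        using s0 nn m2 by (intro mult_left_mono ennreal_leI add_mono mult_right_mono mult_mono power_mono) auto
      also have "\<dots> = ennreal ((sn n / real n * \<rho> n)\<^sup>2 * (real n * ?s + (real n)\<^sup>2 * (K\<^sup>2 * h n ^ 4)))"
        using s0 h0 by (simp add: ennreal_mult)
      also have "(sn n / real n * \<rho> n)\<^sup>2 * (real n * ?s + (real n)\<^sup>2 * (K\<^sup>2 * h n ^ 4)) =
          (\<rho> n)\<^sup>2 * (h n ^ CARD('d) * ?s + K\<^sup>2 * (real n * h n ^ (CARD('d) + 4)))"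
        using n0 by (simp add: power_mult_distrib power_divide sn_sq(1) power_add field_simps power2_eq_square[of "real n"])
      also have "ennreal \<dots> \<le> ennreal (b n)"
        unfolding b_def by (intro ennreal_leI mult_left_mono add_right_mono K(3)[OF h0 h1]) auto
      finally have "(\<integral>\<^sup>+\<omega>. ennreal ((sn n / real n * \<rho> n * fold_sum n l \<omega>)\<^sup>2) \<partial>SM) \<le> ennreal (b n)" .
      moreover have "0 \<le> b n" unfolding b_def using K(1) h0 by simp
      ultimately show ?case unfolding \<rho>_def by simp
    qed
  qed
qed

lemma linearization:
  "tendsto_prob SM (\<lambda>n \<omega>. sn n * (psi_MR D E k h a a' n \<omega> - psi0 D a a') - sn n / real n * (\<Sum>i\<in>{1..n}. mt (h n) (obs E i \<omega>))) 0"
proof (rule SP.tendsto_prob_boundI)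
  let ?W = "\<lambda>n \<omega>. \<Sum>l\<in>{1..nfolds E}. 1 / real (nfolds E) * FF n l (train E n l \<omega>, fold_obs n l \<omega>)
      + sn n / real n * (real n / nl n l / real (nfolds E) - 1) * fold_sum n l \<omega>"
  show "(\<lambda>\<omega>. sn n * (psi_MR D E k h a a' n \<omega> - psi0 D a a') - sn n / real n * (\<Sum>i\<in>{1..n}. mt (h n) (obs E i \<omega>))) \<in> borel_measurable SM" for n
  proof -
    have "(\<lambda>\<omega>. \<Sum>i\<in>{1..n}. mt (h n) (obs E i \<omega>)) \<in> borel_measurable SM" by (intro borel_measurable_sum mt_obs_meas) simp
    then show ?thesis using psi_MR_meas[of n] by measurable
  qed
  show "tendsto_prob SM ?W 0"
    by (intro SP.tendsto_prob_sum SP.tendsto_prob_add fold_gap SP.tendsto_prob_cmult[OF fold_remainder, of _ "\<lambda>_. 1 / real (nfolds E)" "1 / real (nfolds E)"]) auto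
  \<comment> \<open>\<open>fold_decomposition\<close> requires all folds to be nonempty, which holds
    for large \<open>n\<close>.\<close>
  have "\<forall>\<^sub>F n in sequentially. \<forall>l\<in>{1..nfolds E}. 0 < nl n l"
    by (rule eventually_ball_finite) (use nl_pos in auto)
  then show "\<forall>\<^sub>F n in sequentially. \<forall>\<omega>\<in>space SM.
      \<bar>sn n * (psi_MR D E k h a a' n \<omega> - psi0 D a a') - sn n / real n * (\<Sum>i\<in>{1..n}. mt (h n) (obs E i \<omega>))\<bar> \<le> 1 * \<bar>?W n \<omega>\<bar>"
  proof eventually_elim
    case (elim n)
    then show ?case by (intro ballI, subst fold_decomposition) auto
  qed
qed simp

text \<open>The conditional third-moment bound under \<open>givenAMX\<close> is integrated against
  functions of treatment, mediator and covariates; this is the hypothesis \<open>Y3\<close> of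
  \<open>mom_third\<close>.\<close>

lemma mt_third:
  assumes tm: "third_moments D" and kp: "kernel_products k"
  shows "\<exists>K. \<forall>b. 0 < b \<and> b \<le> 1 \<longrightarrow> integrable PP (\<lambda>\<omega>. \<bar>mt b (obsv \<omega>)\<bar> ^ 3) \<and> b ^ (2 * CARD('d)) * (LINT \<omega>|PP. \<bar>mt b (obsv \<omega>)\<bar> ^ 3) \<le> K"
proof -
  obtain C0 where C0': "\<forall>b\<in>SS. \<forall>b'\<in>SS. \<forall>m\<in>domM D. \<forall>x\<in>domX D.
      (\<integral>\<^sup>+\<omega>. ennreal (\<bar>outc D \<omega> - gam D (cov D \<omega>) (med D \<omega>) b\<bar> ^ 3) \<partial>givenAMX D ((b', m), x)) \<le> ennreal C0"
    using tm unfolding third_moments_def ..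
  note C0 = C0'[rule_format]
  \<comment> \<open>The kernel condition for the powers 3 and 0 and the shift 0.\<close>
  have "integrable lborel (\<lambda>u. k u ^ 3 * k (u + 0) ^ 0) \<and> integrable lborel (\<lambda>u. u\<^sup>2 * k u ^ 3 * k (u + 0) ^ 0)"
    using kp[unfolded kernel_products_def, THEN spec, THEN bspec, of 3, THEN bspec, of 0 0] by simp
  then have "integrable lborel (\<lambda>u. k u ^ 3)" by simp
  from integrable_abs[OF this] have k3: "integrable lborel (\<lambda>u. \<bar>k u\<bar> ^ 3)" by (simp add: power_abs)
  let ?Q = "\<lambda>\<omega>. ennreal (\<bar>outc D \<omega> - gz a (ZZ \<omega>)\<bar> ^ 3)"
  have gm: "(\<lambda>\<omega>. gz a (ZZ \<omega>)) \<in> borel_measurable PP"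
    using measurable_compose[OF KM.Z_meas okD(7)[OF ok_true]] by (simp add: gz_def ZZ_def)
  have Qm: "?Q \<in> borel_measurable PP" using gm KM.Y_meas by measurable
  show ?thesis unfolding mt_obsv
  \<comment> \<open>\<open>third_moments\<close> provides some real bound; \<open>mom_third\<close>
    asks for a nonnegative one, hence the maximum with 0.\<close>
  proof (rule KM.mom_third[OF a_in a'_in true_adm(1,3,4) k3, where ?C3.0 = "max 0 C0"])
    fix b :: "real ^ 'd \<Rightarrow> 'm \<times> 'x \<Rightarrow> real"
    assume bm: "(\<lambda>p. b (fst p) (snd p)) \<in> borel_measurable (RA \<Otimes>\<^sub>M NZ)"
    let ?b = "\<lambda>\<omega>. ennreal (b (trt D \<omega>) (ZZ \<omega>))"
    have "(\<lambda>\<omega>. (trt D \<omega>, ZZ \<omega>)) \<in> measurable PP (RA \<Otimes>\<^sub>M NZ)" by (intro measurable_Pair KM.A_meas KM.Z_meas)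
    from measurable_compose[OF this bm] have bm': "?b \<in> borel_measurable PP" by simp
    have inner: "(\<integral>\<^sup>+\<omega>'. ?b \<omega>' * ?Q \<omega>' \<partial>givenAMX D ((trt D \<omega>, med D \<omega>), cov D \<omega>)) \<le> ennreal (max 0 C0) * ?b \<omega>" if w: "\<omega> \<in> space PP" for \<omega>
    proof -
      have amx: "trt D \<omega> \<in> SS" "med D \<omega> \<in> domM D" "cov D \<omega> \<in> domX D"
        using KM.A_in[OF w] KM.Z_in[OF w] by (simp_all only: ZZ_def space_pair_measure domM_def domX_def mem_Times_iff fst_conv snd_conv)
      let ?G = "givenAMX D ((trt D \<omega>, med D \<omega>), cov D \<omega>)"
      have "(\<integral>\<^sup>+\<omega>'. ?b \<omega>' * ?Q \<omega>' \<partial>?G) = (\<integral>\<^sup>+\<omega>'. ?b \<omega> * ?Q \<omega>' \<partial>?G)"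
        by (rule nn_integral_cong_AE) (use givenAMX_AE[OF amx] in eventually_elim, simp add: ZZ_def)
      moreover have "(\<integral>\<^sup>+\<omega>'. ?b \<omega> * ?Q \<omega>' \<partial>?G) = ?b \<omega> * (\<integral>\<^sup>+\<omega>'. ?Q \<omega>' \<partial>?G)"
        by (rule nn_integral_cmult) (simp add: measurable_cong_sets[OF givenAMX_sets[OF amx] refl] Qm)
      moreover have "(\<integral>\<^sup>+\<omega>'. ?Q \<omega>' \<partial>?G) \<le> ennreal (max 0 C0)"
      proof (rule order_trans)
        show "(\<integral>\<^sup>+\<omega>'. ?Q \<omega>' \<partial>?G) \<le> ennreal C0" using C0[OF a_in amx] by (simp add: gz_def ZZ_def)
        show "ennreal C0 \<le> ennreal (max 0 C0)" by (rule ennreal_leI) simp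
      qed
      ultimately show ?thesis by (simp only: mult.commute[of _ "?b \<omega>"] mult_left_mono zero_le)
    qed
    have "(\<integral>\<^sup>+\<omega>. ?b \<omega> * ?Q \<omega> \<partial>PP) = (\<integral>\<^sup>+\<omega>. \<integral>\<^sup>+\<omega>'. ?b \<omega>' * ?Q \<omega>' \<partial>givenAMX D ((trt D \<omega>, med D \<omega>), cov D \<omega>) \<partial>PP)"
      by (rule reg_cond_dist_nn_integral[OF setupD(11)]) (rule borel_measurable_times_ennreal[OF bm' Qm])
    moreover have "(\<integral>\<^sup>+\<omega>. \<integral>\<^sup>+\<omega>'. ?b \<omega>' * ?Q \<omega>' \<partial>givenAMX D ((trt D \<omega>, med D \<omega>), cov D \<omega>) \<partial>PP) \<le> (\<integral>\<^sup>+\<omega>. ennreal (max 0 C0) * ?b \<omega> \<partial>PP)"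
      by (rule nn_integral_mono) (rule inner)
    moreover have "(\<integral>\<^sup>+\<omega>. ennreal (max 0 C0) * ?b \<omega> \<partial>PP) = ennreal (max 0 C0) * (\<integral>\<^sup>+\<omega>. ?b \<omega> \<partial>PP)" by (rule nn_integral_cmult[OF bm'])
    ultimately show "(\<integral>\<^sup>+\<omega>. ?b \<omega> * ?Q \<omega> \<partial>PP) \<le> ennreal (max 0 C0) * (\<integral>\<^sup>+\<omega>. ?b \<omega> \<partial>PP)" by (simp only:)
  qed simp
qed

end

section \<open>Asymptotic normality\<close>

context crossfit_model
begin

lemma sn_at_top: "filterlim sn at_top sequentially"
  unfolding sn_def[abs_def] by (rule filterlim_compose[OF sqrt_at_top bwD(3)])

definition "mu n = (LINT \<omega>|PP. mt (h n) (obsv \<omega>))"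
definition "cm n i \<omega> = sn n / real n * (mt (h n) (obs E i \<omega>) - mu n)"

text \<open>For \<open>n > 0\<close> the scaling \<open>n * (sn n / n)^2\<close> is
  \<open>h^d\<close>, so this is \<open>mom_sq_tendsto\<close> up to the squared mean, which tends
  to zero.\<close>

lemma variance_limit: "(\<lambda>n. real n * ((sn n / real n)\<^sup>2 * ((LINT \<omega>|PP. (mt (h n) (obsv \<omega>))\<^sup>2) - (mu n)\<^sup>2))) \<longlonglongrightarrow> V_asym D k a a'"
proof -
  obtain K where K: "0 \<le> K" "\<And>b. 0 < b \<Longrightarrow> b \<le> 1 \<Longrightarrow> \<bar>LINT \<omega>|PP. mt b (obsv \<omega>)\<bar> \<le> K * b\<^sup>2"
    using mt_moment_bounds by blast
  have 1: "(\<lambda>n. h n ^ CARD('d) * (LINT \<omega>|PP. (mt (h n) (obsv \<omega>))\<^sup>2)) \<longlonglongrightarrow> V_asym D k a a'"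
    unfolding mt_obsv V_asym_eq[OF a_in a'_in] by (rule KM.mom_sq_tendsto[OF a_in a'_in true_adm(1,3,4) bwD(2,1)])
  have mu0: "mu \<longlonglongrightarrow> 0"
  proof (rule Lim_null_comparison)
    show "\<forall>\<^sub>F n in sequentially. norm (mu n) \<le> K * (h n)\<^sup>2"
      using h_le_1 by eventually_elim (use K(2) bwD(1) in \<open>simp add: mu_def\<close>)
    have "(\<lambda>n. K * (h n)\<^sup>2) \<longlonglongrightarrow> K * 0\<^sup>2" by (intro tendsto_intros bwD(2))
    then show "(\<lambda>n. K * (h n)\<^sup>2) \<longlonglongrightarrow> 0" by simp
  qed
  have "(\<lambda>n. h n ^ CARD('d) * (LINT \<omega>|PP. (mt (h n) (obsv \<omega>))\<^sup>2) - h n ^ CARD('d) * (mu n)\<^sup>2) \<longlonglongrightarrow> V_asym D k a a' - 0 ^ CARD('d) * 0\<^sup>2"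
    by (intro tendsto_diff[OF 1] tendsto_intros bwD(2) mu0)
  then have L: "(\<lambda>n. h n ^ CARD('d) * (LINT \<omega>|PP. (mt (h n) (obsv \<omega>))\<^sup>2) - h n ^ CARD('d) * (mu n)\<^sup>2) \<longlonglongrightarrow> V_asym D k a a'" by simp
  show ?thesis
  proof (rule Lim_transform_eventually[OF L])
    show "\<forall>\<^sub>F n in sequentially. h n ^ CARD('d) * (LINT \<omega>|PP. (mt (h n) (obsv \<omega>))\<^sup>2) - h n ^ CARD('d) * (mu n)\<^sup>2 =
        real n * ((sn n / real n)\<^sup>2 * ((LINT \<omega>|PP. (mt (h n) (obsv \<omega>))\<^sup>2) - (mu n)\<^sup>2))"
      using eventually_gt_at_top[of 0]
      by eventually_elim (simp add: power_divide sn_sq(1) power2_eq_square[of "real _"] right_diff_distrib)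
  qed
qed

text \<open>As \<open>sn n * (h n)^2\<close> converges, it suffices that
  \<open>mu n / (h n)^2\<close> tends to \<open>B_main\<close> and \<open>R (h n)\<close> to zero.
  This is why the conclusion holds for every remainder \<open>R\<close> of order
  \<open>h\<close>.\<close>

lemma bias_limit:
  assumes R: "R \<in> O[at_right 0](\<lambda>b. b)"
  shows "(\<lambda>n. sn n * (mu n - (h n)\<^sup>2 * (B_main D k a a' + R (h n)))) \<longlonglongrightarrow> 0"
proof -
  have "(\<lambda>n. ((LINT \<omega>|PP. mt (h n) (obsv \<omega>)) - (LINT \<omega>|PP. W3 (alp D) (lam D) (gam D) a a' (ZZ \<omega>) * fz a' (ZZ \<omega>) + (HH (alp D) (gam D) a a' (ZZ \<omega>) - psi0 D a a'))) / (h n)\<^sup>2)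
      \<longlonglongrightarrow> B_main D k a a'"
    unfolding mt_obsv B_main_eq[OF a_in a'_in]
    by (rule KM.mom_expectation_tendsto[OF a_in a'_in true_adm(1,3,4) bwD(2,1)])
  then have 1: "(\<lambda>n. mu n / (h n)\<^sup>2) \<longlonglongrightarrow> B_main D k a a'" unfolding true_main_zero by (simp add: mu_def)
  have hr: "filterlim h (at_right 0) sequentially"
    using bwD(1,2) by (simp add: filterlim_at less_imp_neq[THEN not_sym])
  obtain c where c: "\<forall>\<^sub>F b in at_right 0. norm (R b) \<le> c * norm b" using landau_o.bigE[OF R] by blast
  have 2: "(\<lambda>n. R (h n)) \<longlonglongrightarrow> 0"
  proof (rule Lim_null_comparison)
    show "\<forall>\<^sub>F n in sequentially. norm (R (h n)) \<le> c * \<bar>h n\<bar>"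
      using filterlim_iff[THEN iffD1, OF hr, rule_format, OF c] by simp
    have "(\<lambda>n. c * \<bar>h n\<bar>) \<longlonglongrightarrow> c * \<bar>0\<bar>" by (intro tendsto_intros bwD(2))
    then show "(\<lambda>n. c * \<bar>h n\<bar>) \<longlonglongrightarrow> 0" by simp
  qed
  have "(\<lambda>n. sqrt (real n * h n ^ (CARD('d) + 4)) * (mu n / (h n)\<^sup>2 - (B_main D k a a' + R (h n)))) \<longlonglongrightarrow> sqrt Ch * (B_main D k a a' - (B_main D k a a' + 0))"
    by (intro tendsto_intros 1 2 bwD(4))
  moreover have "sqrt (real n * h n ^ (CARD('d) + 4)) * (mu n / (h n)\<^sup>2 - (B_main D k a a' + R (h n))) =
      sn n * (mu n - (h n)\<^sup>2 * (B_main D k a a' + R (h n)))" for n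
    unfolding sn_sq(3)[symmetric] using bwD(1)[of n] by (simp add: field_simps)
  ultimately show ?thesis by simp
qed

text \<open>Lyapunov's condition: the third moments of a row sum to at most a multiple of
  \<open>1 / sn n\<close>, which vanishes because \<open>n h^d\<close> diverges.\<close>

lemma central_limit:
  assumes tm: "third_moments D" and kp: "kernel_products k"
  shows "(\<lambda>n. char (distr SM borel (\<lambda>\<omega>. \<Sum>i\<in>{1..n}. cm n i \<omega>)) t) \<longlonglongrightarrow> of_real (exp (- (t\<^sup>2 * V_asym D k a a' / 2)))"
proof -
  obtain K where K: "0 \<le> K" "\<And>b. 0 < b \<Longrightarrow> b \<le> 1 \<Longrightarrow> \<bar>LINT \<omega>|PP. mt b (obsv \<omega>)\<bar> \<le> K * b\<^sup>2"
    using mt_moment_bounds by blast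
  obtain K3 where K3: "\<And>b. 0 < b \<Longrightarrow> b \<le> 1 \<Longrightarrow> integrable PP (\<lambda>\<omega>. \<bar>mt b (obsv \<omega>)\<bar> ^ 3)"
    "\<And>b. 0 < b \<Longrightarrow> b \<le> 1 \<Longrightarrow> b ^ (2 * CARD('d)) * (LINT \<omega>|PP. \<bar>mt b (obsv \<omega>)\<bar> ^ 3) \<le> K3"
    using mt_third[OF tm kp] by blast
  define s where "s n = (sn n / real n)\<^sup>2 * ((LINT \<omega>|PP. (mt (h n) (obsv \<omega>))\<^sup>2) - (mu n)\<^sup>2)" for n
  \<comment> \<open>The factor 4 comes from the inequality \<open>cube\<close> below,
    \<open>K3\<close> bounds the scaled third moment of \<open>mt\<close>, and \<open>K ^ 3\<close>
    accounts for the centring, by \<open>\<bar>mu n\<bar> \<le> K * (h n)^2 \<le> K\<close>.\<close>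
  define r where "r n = (sn n / real n) ^ 3 * (4 * ((K3 + K ^ 3) / h n ^ (2 * CARD('d))))" for n
  have mm: "(\<lambda>o'. sn n / real n * (mt (h n) o' - mu n)) \<in> borel_measurable OS" for n using mt_meas by measurable
  have i1: "integrable SM (\<lambda>\<omega>. mt (h n) (obs E i \<omega>))" "(LINT \<omega>|SM. mt (h n) (obs E i \<omega>)) = mu n" if "1 \<le> i" for n i
    using transfer_obs[OF that mt_meas] mt_moments(1)[OF bwD(1)] by (simp_all add: mu_def)
  have i2: "integrable SM (\<lambda>\<omega>. (mt (h n) (obs E i \<omega>))\<^sup>2)" "(LINT \<omega>|SM. (mt (h n) (obs E i \<omega>))\<^sup>2) = (LINT \<omega>|PP. (mt (h n) (obsv \<omega>))\<^sup>2)" if "1 \<le> i" for n i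
  proof -
    have "(\<lambda>o'. (mt (h n) o')\<^sup>2) \<in> borel_measurable OS" using mt_meas by measurable
    from transfer_obs[OF that this] show "integrable SM (\<lambda>\<omega>. (mt (h n) (obs E i \<omega>))\<^sup>2)" "(LINT \<omega>|SM. (mt (h n) (obs E i \<omega>))\<^sup>2) = (LINT \<omega>|PP. (mt (h n) (obsv \<omega>))\<^sup>2)"
      using mt_moments(2)[OF bwD(1)] by simp_all
  qed
  have cmsq: "(cm n i \<omega>)\<^sup>2 = (sn n / real n)\<^sup>2 * ((mt (h n) (obs E i \<omega>))\<^sup>2 - 2 * mu n * mt (h n) (obs E i \<omega>) + (mu n)\<^sup>2)" for n i \<omega>
    unfolding cm_def power_mult_distrib by (simp add: power2_diff algebra_simps)
  have s_eq: "integrable SM (\<lambda>\<omega>. (cm n i \<omega>)\<^sup>2)" "(LINT \<omega>|SM. (cm n i \<omega>)\<^sup>2) = s n" if i: "1 \<le> i" for n i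
    unfolding cmsq using i1[OF i, of n] i2[OF i, of n] by (simp_all add: s_def SP.prob_space power2_eq_square[of "mu n"])
  show ?thesis
  proof (rule SP.triangular_array_char_tendsto[where s = s and r = r])
    show "SP.indep_vars (\<lambda>_. borel) (cm n) {1..n}" for n
      unfolding cm_def[abs_def]
      by (rule SP.indep_vars_compose2[OF SP.indep_vars_subset[OF obs_indep]]) (use mm[of n] in \<open>auto simp del: times_divide_eq_left\<close>)
    fix n i :: nat assume "i \<in> {1..n}"
    then have i: "1 \<le> i" by simp
    show "integrable SM (\<lambda>\<omega>. (cm n i \<omega>)\<^sup>2)" "(LINT \<omega>|SM. (cm n i \<omega>)\<^sup>2) = s n" by (rule s_eq[OF i])+
    show "(LINT \<omega>|SM. cm n i \<omega>) = 0" unfolding cm_def using i1[OF i, of n] by (simp add: SP.prob_space)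
  next
    show "(\<lambda>n. real n * s n) \<longlonglongrightarrow> V_asym D k a a'" unfolding s_def by (rule variance_limit)
    show "0 \<le> s n" for n using s_eq(2)[of 1 n] by (metis integral_nonneg_AE AE_I2 zero_le_power2 order_refl)
    have "(\<lambda>n. 4 * (K3 + K ^ 3) * inverse (sn n)) \<longlonglongrightarrow> 4 * (K3 + K ^ 3) * 0"
      by (intro tendsto_intros tendsto_inverse_0_at_top[OF sn_at_top])
    then have L: "(\<lambda>n. 4 * (K3 + K ^ 3) * inverse (sn n)) \<longlonglongrightarrow> 0" by simp
    show "(\<lambda>n. real n * r n) \<longlonglongrightarrow> 0"
    proof (rule Lim_transform_eventually[OF L])
      show "\<forall>\<^sub>F n in sequentially. 4 * (K3 + K ^ 3) * inverse (sn n) = real n * r n"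
        using eventually_gt_at_top[of 0]
      proof eventually_elim
        case (elim n)
        then have n0: "0 < real n" by simp
        have sn0: "0 < sn n" using n0 bwD(1)[of n] by (simp add: sn_def)
        have "(sn n) ^ 4 = (real n)\<^sup>2 * h n ^ (2 * CARD('d))"
          using arg_cong[OF sn_sq(1)[of n], of "\<lambda>x. x\<^sup>2"] by (simp add: power_mult_distrib power_mult[symmetric] mult.commute)
        then have "real n * ((sn n / real n) ^ 3 / h n ^ (2 * CARD('d))) = inverse (sn n)"
          using n0 sn0 bwD(1)[of n] by (simp add: power_divide field_simps eval_nat_numeral)
        moreover have "real n * r n = 4 * (K3 + K ^ 3) * (real n * ((sn n / real n) ^ 3 / h n ^ (2 * CARD('d))))"
          by (simp add: r_def)
        ultimately show ?case by (simp only:)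
      qed
    qed
    show "\<forall>\<^sub>F n in sequentially. \<forall>i\<in>{1..n}. integrable SM (\<lambda>\<omega>. \<bar>cm n i \<omega>\<bar> ^ 3) \<and> (LINT \<omega>|SM. \<bar>cm n i \<omega>\<bar> ^ 3) \<le> r n"
      using h_le_1
    proof eventually_elim
      case (elim n)
      note h0 = bwD(1)[of n]
      show ?case
      proof
        fix i assume "i \<in> {1..n}"
        then have i: "1 \<le> i" by simp
        have m3: "(\<lambda>o'. \<bar>mt (h n) o'\<bar> ^ 3) \<in> borel_measurable OS" using mt_meas by measurable
        have I3: "integrable SM (\<lambda>\<omega>. \<bar>mt (h n) (obs E i \<omega>)\<bar> ^ 3)" "(LINT \<omega>|SM. \<bar>mt (h n) (obs E i \<omega>)\<bar> ^ 3) = (LINT \<omega>|PP. \<bar>mt (h n) (obsv \<omega>)\<bar> ^ 3)"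
          using transfer_obs[OF i m3] K3(1)[OF h0 elim] by simp_all
        have cube: "\<bar>x - y\<bar> ^ 3 \<le> 4 * (\<bar>x\<bar> ^ 3 + \<bar>y\<bar> ^ 3)" for x y :: real
        proof -
          have "\<bar>x - y\<bar> ^ 3 \<le> (\<bar>x\<bar> + \<bar>y\<bar>) ^ 3" by (intro power_mono) auto
          \<comment> \<open>This identity gives \<open>(u + v) ^ 3 \<le> 4 * (u ^ 3 + v ^ 3)\<close>
            for nonnegative \<open>u\<close> and \<open>v\<close>.\<close>
          moreover have "4 * (u ^ 3 + v ^ 3) - (u + v) ^ 3 = 3 * ((u + v) * (u - v)\<^sup>2)" for u v :: real
            by (simp add: power2_eq_square power3_eq_cube algebra_simps)
          moreover have "0 \<le> 3 * ((\<bar>x\<bar> + \<bar>y\<bar>) * (\<bar>x\<bar> - \<bar>y\<bar>)\<^sup>2)" by simp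
          ultimately show ?thesis by (metis (no_types, lifting) diff_ge_0_iff_ge order_trans)
        qed
        have c3: "\<bar>cm n i \<omega>\<bar> ^ 3 \<le> (sn n / real n) ^ 3 * (4 * (\<bar>mt (h n) (obs E i \<omega>)\<bar> ^ 3 + \<bar>mu n\<bar> ^ 3))" for \<omega>
        proof -
          have "\<bar>cm n i \<omega>\<bar> ^ 3 = (sn n / real n) ^ 3 * \<bar>mt (h n) (obs E i \<omega>) - mu n\<bar> ^ 3"
            using sn_sq(2)[of n] by (simp add: cm_def abs_mult power_mult_distrib power_divide)
          also have "\<dots> \<le> (sn n / real n) ^ 3 * (4 * (\<bar>mt (h n) (obs E i \<omega>)\<bar> ^ 3 + \<bar>mu n\<bar> ^ 3))"
            using sn_sq(2)[of n] by (intro mult_left_mono cube) simp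
          finally show ?thesis .
        qed
        have bi: "integrable SM (\<lambda>\<omega>. (sn n / real n) ^ 3 * (4 * (\<bar>mt (h n) (obs E i \<omega>)\<bar> ^ 3 + \<bar>mu n\<bar> ^ 3)))"
          using I3(1) by simp
        have ci: "integrable SM (\<lambda>\<omega>. \<bar>cm n i \<omega>\<bar> ^ 3)"
        proof (rule Bochner_Integration.integrable_bound[OF bi])
          show "(\<lambda>\<omega>. \<bar>cm n i \<omega>\<bar> ^ 3) \<in> borel_measurable SM" unfolding cm_def using mt_obs_meas[OF i] by measurable
          show "AE \<omega> in SM. norm (\<bar>cm n i \<omega>\<bar> ^ 3) \<le> norm ((sn n / real n) ^ 3 * (4 * (\<bar>mt (h n) (obs E i \<omega>)\<bar> ^ 3 + \<bar>mu n\<bar> ^ 3)))"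
          proof (rule AE_I2)
            fix \<omega>
            have "norm (\<bar>cm n i \<omega>\<bar> ^ 3) = \<bar>cm n i \<omega>\<bar> ^ 3" by simp
            then show "norm (\<bar>cm n i \<omega>\<bar> ^ 3) \<le> norm ((sn n / real n) ^ 3 * (4 * (\<bar>mt (h n) (obs E i \<omega>)\<bar> ^ 3 + \<bar>mu n\<bar> ^ 3)))"
              using c3[of \<omega>] by (simp only: real_norm_def) (rule order_trans[OF _ abs_ge_self])
          qed
        qed
        have "(LINT \<omega>|SM. \<bar>cm n i \<omega>\<bar> ^ 3) \<le> (LINT \<omega>|SM. (sn n / real n) ^ 3 * (4 * (\<bar>mt (h n) (obs E i \<omega>)\<bar> ^ 3 + \<bar>mu n\<bar> ^ 3)))"
          by (rule integral_mono[OF ci bi c3])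
        also have "\<dots> = (sn n / real n) ^ 3 * (4 * ((LINT \<omega>|PP. \<bar>mt (h n) (obsv \<omega>)\<bar> ^ 3) + \<bar>mu n\<bar> ^ 3))"
          using I3 by (simp add: SP.prob_space)
        also have "\<dots> \<le> r n" unfolding r_def
        proof (intro mult_left_mono)
          have hp: "0 < h n ^ (2 * CARD('d))" "h n ^ (2 * CARD('d)) \<le> 1" using h0 elim by (auto intro: power_le_one)
          have "\<bar>mu n\<bar> \<le> K * (h n)\<^sup>2" unfolding mu_def by (rule K(2)[OF h0 elim])
          also have "\<dots> \<le> K * 1" using h0 elim K(1) by (intro mult_left_mono power_le_one) auto
          finally have "\<bar>mu n\<bar> ^ 3 \<le> K ^ 3" by (intro power_mono) auto
          then have "h n ^ (2 * CARD('d)) * \<bar>mu n\<bar> ^ 3 \<le> 1 * K ^ 3" using hp by (intro mult_mono) auto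
          then have "h n ^ (2 * CARD('d)) * ((LINT \<omega>|PP. \<bar>mt (h n) (obsv \<omega>)\<bar> ^ 3) + \<bar>mu n\<bar> ^ 3) \<le> K3 + K ^ 3"
            using K3(2)[OF h0 elim] by (simp add: distrib_left)
          then show "(LINT \<omega>|PP. \<bar>mt (h n) (obsv \<omega>)\<bar> ^ 3) + \<bar>mu n\<bar> ^ 3 \<le> (K3 + K ^ 3) / h n ^ (2 * CARD('d))"
            using hp(1) by (simp add: pos_le_divide_eq mult.commute)
        qed (use sn_sq(2)[of n] in auto)
        finally show "integrable SM (\<lambda>\<omega>. \<bar>cm n i \<omega>\<bar> ^ 3) \<and> (LINT \<omega>|SM. \<bar>cm n i \<omega>\<bar> ^ 3) \<le> r n" using ci by blast
      qed
    qed
  qed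
qed

text \<open>The scaled error and the centred row sum differ by the linearisation remainder and a
  deterministic bias term, which both vanish. Slutsky and Levy continuity then carry the limit over;
  working with characteristic functions includes the degenerate case of zero variance.\<close>

lemma asymptotic_normality:
  assumes tm: "third_moments D" and kp: "kernel_products k" and R: "R \<in> O[at_right 0](\<lambda>b. b)"
  shows "tendsto_dist SM (\<lambda>n \<omega>. sn n * (psi_MR D E k h a a' n \<omega> - psi0 D a a' - (h n)\<^sup>2 * (B_main D k a a' + R (h n)))) (normal_law 0 (V_asym D k a a'))"
proof -
  let ?Z = "\<lambda>n \<omega>. sn n * (psi_MR D E k h a a' n \<omega> - psi0 D a a' - (h n)\<^sup>2 * (B_main D k a a' + R (h n)))"
  let ?W = "\<lambda>n \<omega>. \<Sum>i\<in>{1..n}. cm n i \<omega>"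
  have Zm: "?Z n \<in> borel_measurable SM" for n using psi_MR_meas[of n] by measurable
  have Wm: "?W n \<in> borel_measurable SM" for n
  proof (rule borel_measurable_sum)
    fix i assume "i \<in> {1..n}"
    then show "cm n i \<in> borel_measurable SM" unfolding cm_def[abs_def] using mt_obs_meas[of i "h n"] by simp
  qed
  have det: "tendsto_prob SM (\<lambda>n \<omega>. c n) 0" if "c \<longlonglongrightarrow> 0" for c :: "nat \<Rightarrow> real"
  proof (rule SP.tendsto_prob_L2[where b = "\<lambda>n. (c n)\<^sup>2"])
    show "(\<lambda>n. (c n)\<^sup>2) \<longlonglongrightarrow> 0" using tendsto_power[OF that, of 2] by simp
  qed (auto simp: SP.emeasure_space_1)
  have "?Z n \<omega> - ?W n \<omega> = (sn n * (psi_MR D E k h a a' n \<omega> - psi0 D a a') - sn n / real n * (\<Sum>i\<in>{1..n}. mt (h n) (obs E i \<omega>)))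
      + sn n * (mu n - (h n)\<^sup>2 * (B_main D k a a' + R (h n)))" for n \<omega>
  \<comment> \<open>Summing the constant \<open>mu n\<close> uses
    \<open>n * (sn n / n) = sn n\<close> for positive \<open>n\<close>; at \<open>n = 0\<close> both
    sides vanish because \<open>sn 0 = 0\<close>.\<close>
  proof (cases "n = 0")
    case True
    then have "sn n = 0" by (simp add: sn_def)
    then show ?thesis using True by simp
  next
    case False
    then have "?W n \<omega> = sn n / real n * (\<Sum>i\<in>{1..n}. mt (h n) (obs E i \<omega>)) - sn n * mu n"
      unfolding cm_def sum_distrib_left[symmetric] by (simp add: sum_subtractf right_diff_distrib)
    then show ?thesis by (simp add: algebra_simps)
  qed
  then have d: "tendsto_prob SM (\<lambda>n \<omega>. ?Z n \<omega> - ?W n \<omega>) 0"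
    using SP.tendsto_prob_add[OF linearization det[OF bias_limit[OF R]]] by simp
  have "weak_conv_m (\<lambda>n. distr SM borel (?Z n)) (normal_law 0 (V_asym D k a a'))"
  proof (rule levy_continuity)
    show "real_distribution (distr SM borel (?Z n))" for n by (rule SP.real_distribution_distr[OF Zm])
    show "real_distribution (normal_law 0 (V_asym D k a a'))" by (rule char_normal_law(1)[OF V_asym_nonneg[OF a_in a'_in]])
    show "(\<lambda>n. char (distr SM borel (?Z n)) t) \<longlonglongrightarrow> char (normal_law 0 (V_asym D k a a')) t" for t
      unfolding char_normal_law(2)[OF V_asym_nonneg[OF a_in a'_in]]
      by (rule SP.char_Slutsky[OF Zm Wm d central_limit[OF tm kp]])
  qed
  then show ?thesis using Zm by (simp add: tendsto_dist_def)
qed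

end

theorem theorem1:
  fixes D :: "('w, 'd::finite, 'm, 'x) mediation"
    and E :: "('s, 'd, 'm, 'x) crossfit"
    and k :: "real \<Rightarrow> real" and h :: "nat \<Rightarrow> real" and C_h :: real
  assumes "mediation_setup D" and "iid_sample D E" and "crossfit_setup D E"
    and "consistency D" and "sequential_exchangeability D" and "positivity D"
    and "kernel_conditions k" and "bandwidth_conditions CARD('d) h C_h"
    and "smoothness D" and "nuisance_bounds D E" and "variance_regularity D"
    and "nuisance_consistency D E"
    and "product_rates D E h"
  shows "(\<forall>a\<in>domA D. \<forall>a'\<in>domA D.
           tendsto_prob (smp E) (\<lambda>n \<omega>.
             sqrt (real n * h n ^ CARD('d)) * (psi_MR D E k h a a' n \<omega> - psi0 D a a')
             - sqrt (h n ^ CARD('d) / real n) *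
                 (\<Sum>i\<in>{1..n}. moment (refM D) k (h n) a a'
                    (alp D) (lam D) (gam D) (psi0 D a a') (obs E i \<omega>))) 0) \<and>
         (third_moments D \<and> kernel_products k \<longrightarrow>
           (\<forall>a\<in>domA D. \<forall>a'\<in>domA D. \<forall>R :: real \<Rightarrow> real. R \<in> O[at_right 0](\<lambda>b. b) \<longrightarrow>
             tendsto_dist (smp E) (\<lambda>n \<omega>.
               sqrt (real n * h n ^ CARD('d)) *
                 (psi_MR D E k h a a' n \<omega> - psi0 D a a' - (h n)\<^sup>2 * (B_main D k a a' + R (h n))))
               (normal_law 0 (V_asym D k a a'))))"
proof -
  obtain c C where c: "0 < c"
    and nb: "\<forall>a\<in>domA D. \<forall>m\<in>domM D. \<forall>x\<in>domX D. c \<le> \<bar>alp D a m x\<bar> \<and> \<bar>alp D a m x\<bar> \<le> C \<and>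
          c \<le> \<bar>lam D a x\<bar> \<and> \<bar>lam D a x\<bar> \<le> C \<and> \<bar>gam D x m a\<bar> \<le> C"
    and hats: "\<forall>n. \<forall>l\<in>{1..nfolds E}. \<forall>\<omega>\<in>space (smp E). \<forall>a\<in>domA D. \<forall>m\<in>domM D. \<forall>x\<in>domX D.
          c \<le> \<bar>alp_hat E n l \<omega> a m x\<bar> \<and> \<bar>alp_hat E n l \<omega> a m x\<bar> \<le> C \<and>
          c \<le> \<bar>lam_hat E n l \<omega> a x\<bar> \<and> \<bar>lam_hat E n l \<omega> a x\<bar> \<le> C \<and> \<bar>gam_hat E n l \<omega> x m a\<bar> \<le> C"
    using \<open>nuisance_bounds D E\<close> unfolding nuisance_bounds_def by (elim exE conjE) (rule that)
  \<comment> \<open>The same constants bound the true and the estimated nuisance functions, so all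
    later bounds are uniform over samples and folds.\<close>
  interpret mediation_model k D c C
    by (intro mediation_model.intro kernel.intro mediation_model_axioms.intro assms c nb[rule_format])
  have model: "crossfit_model k D c C E h C_h a a'" if "a \<in> domA D" "a' \<in> domA D" for a a'
    by (intro crossfit_model.intro crossfit_model_axioms.intro mediation_model_axioms assms that hats[rule_format])
  show ?thesis
  proof (intro conjI ballI impI allI)
    fix a a' assume a: "a \<in> domA D" "a' \<in> domA D"
    interpret crossfit_model k D c C E h C_h a a' by (rule model[OF a])
    show "tendsto_prob (smp E) (\<lambda>n \<omega>.
             sqrt (real n * h n ^ CARD('d)) * (psi_MR D E k h a a' n \<omega> - psi0 D a a')
             - sqrt (h n ^ CARD('d) / real n) *
                 (\<Sum>i\<in>{1..n}. moment (refM D) k (h n) a a'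
                    (alp D) (lam D) (gam D) (psi0 D a a') (obs E i \<omega>))) 0"
      using linearization unfolding sn_div mt_def sn_def .
  next
    fix a a' and R :: "real \<Rightarrow> real"
    assume tk: "third_moments D \<and> kernel_products k" and a: "a \<in> domA D" "a' \<in> domA D" and R: "R \<in> O[at_right 0](\<lambda>b. b)"
    interpret crossfit_model k D c C E h C_h a a' by (rule model[OF a])
    show "tendsto_dist (smp E) (\<lambda>n \<omega>.
               sqrt (real n * h n ^ CARD('d)) *
                 (psi_MR D E k h a a' n \<omega> - psi0 D a a' - (h n)\<^sup>2 * (B_main D k a a' + R (h n))))
               (normal_law 0 (V_asym D k a a'))"
      using asymptotic_normality[OF conjunct1[OF tk] conjunct2[OF tk] R] unfolding sn_def .
  qed
qed

end
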